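(* Let $(\mathbb{T}_n)$ be a refining sequence of partitions of $[0,1]$. Suppose that $x\in C[0,1]$ satisfies $x(0)=0$ and admits a continuous quadratic variation $\langle x\rangle$ along $(\mathbb{T}_n)$, that $A\in\mathit{CBV}[0,1]$, and that $b\in C([0,1]\times\mathbb{R})$ satisfies both a local Lipschitz condition and a linear growth condition. Suppose moreover that there is an open interval $I\supset[0,1]$ such that $\sigma(t,\xi)$ is defined for $(t,\xi)\in I\times\mathbb{R}$, belongs to $C^2(I\times\mathbb{R})$, and has bounded first derivatives in $t$ and $\xi$. Then: (i) the flow $\phi(\tau,\xi,t)$, i.e. the function with $\phi(\tau,\xi,0)=\xi$ and $\phi_t(\tau,\xi,t)=\sigma(\tau,\phi(\tau,\xi,t))$, is well-defined for all $\tau\in I$ and $\xi,t\in\mathbb{R}$; (ii) $\phi$ and $\phi_t$ are twice continuously differentiable; (iii) for every $z_0\in\mathbb{R}$ the Stieltjes integral equation $$B(t)=z_0+\int_0^t\frac{b(s,\phi(s,B(s),x(s)))}{\phi_\xi(s,B(s),x(s))}\,dA(s)-\int_0^t\frac{\phi_\tau(s,B(s),x(s))}{\phi_\xi(s,B(s),x(s))}\,ds-\frac12\int_0^t\frac{\phi_{tt}(s,B(s),x(s))}{\phi_\xi(s,B(s),x(s))}\,d\langle x\rangle_s,\quad 0\le t\le1,$$ admits a unique continuous solution $B$; (iv) $z(t):=\phi(t,B(t),x(t))$ is the unique solution of the Itô differential equation $dz(t)=\sigma(t,z(t))\,dx(t)+b(t,z(t))\,dA(t)$ with initial condition $z(0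)=z_0$.
   Context: A refining sequence of partitions is an increasing sequence $\mathbb{T}_1\subset\mathbb{T}_2\subset\cdots$ of finite sets $\{t_0,\dots,t_n\}$, $0=t_0<\dots<t_n=1$, with mesh tending to zero. For $s\in\mathbb{T}_n$, $s'$ is the successor of $s$ in $\mathbb{T}_n$ ($s'=1$ if $s=1$). $\langle x\rangle_t:=\lim_n\sum_{s\in\mathbb{T}_n,s\le t}(x(s')-x(s))^2$; $x$ has continuous quadratic variation if this limit exists for all $t$ and is continuous in $t$. $\mathit{CBV}[0,1]$: continuous functions of bounded variation on $[0,1]$. A function $f$ on $[0,1]\times\mathbb{R}$ satisfies a local Lipschitz condition if for each $p>0$ there is $L_p\ge0$ with $|f(t,\xi)-f(t,\zeta)|\le L_p|\xi-\zeta|$ for $\xi,\zeta\in[-p,p]$, $t\in[0,1]$; it satisfies a linear growth condition if $|f(t,\xi)|\le c(1+|\xi|)$ for some $c\ge0$ and all $t,\xi$. Subscripts $\phi_t,\phi_\tau,\phi_\xi,\phi_{tt}$ denote partial derivatives of $\phi(\tau,\xi,t)$. A function $\eta$ on $[0,1]$ is an admissible integrand for $x$ if there exist $n\in\mathbb{N}$, a continuous $\mathbf{A}:[0,1]\to\mathbb{R}^n$ with components in $\mathit{CBV}[0,1]$, an open $U\subset\mathbb{R}^n\times\mathbb{R}$ with $(\mathbf{A}(t),x(t))\in U$ for all $t$, and a $C^1$ function $f:U\to\mathbb{R}$ such that for every $\mathbf a$ in the projection of $U$ onto $\mathbb{R}^n$ the map $\xi\mapsto f(\mathbf a,\xi)$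 is $C^2$ on its domain, and $\eta(t)=\partial_\xi f(\mathbf{A}(t),x(t))$; for such $\eta$ the Föllmer integral $\int_0^t\eta\,dx:=\lim_n\sum_{s\in\mathbb{T}_n,s\le t}\eta(s)(x(s')-x(s))$ exists. A solution of $dz=\sigma(t,z)\,dx+b(t,z)\,dA$, $z(0)=z_0$, is a $z\in C[0,1]$ such that $t\mapsto\sigma(t,z(t))$ is an admissible integrand for $x$ and $z(t)=z_0+\int_0^t\sigma(s,z(s))\,dx(s)+\int_0^tb(s,z(s))\,dA(s)$ for all $t\in[0,1]$. Integrals against $dA$, $ds$, $d\langle x\rangle_s$ are Riemann--Stieltjes integrals. *)

theory Defs
  imports "HOL-Analysis.Analysis"
begin

definition is_partition01 :: "real set \<Rightarrow> bool" where
  "is_partition01 P \<longleftrightarrow> finite P \<and> 0 \<in> P \<and> 1 \<in> P \<and> P \<subseteq> {0..1}"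

definition succ_pt :: "real set \<Rightarrow> real \<Rightarrow> real" where
  "succ_pt P s = (if s = 1 then 1 else Min {u \<in> P. s < u})"

definition mesh :: "real set \<Rightarrow> real" where
  "mesh P = Max ((\<lambda>s. succ_pt P s - s) ` P)"

definition refining_sequence :: "(nat \<Rightarrow> real set) \<Rightarrow> bool" where
  "refining_sequence T \<longleftrightarrow>
     (\<forall>n. is_partition01 (T n)) \<and> (\<forall>n. T n \<subseteq> T (Suc n)) \<and>
     (\<lambda>n. mesh (T n)) \<longlonglongrightarrow> 0"

definition qv_sum :: "real set \<Rightarrow> (real \<Rightarrow> real) \<Rightarrow> real \<Rightarrow> real" where
  "qv_sum P x t = (\<Sum>s\<in>{s\<in>P. s \<le> t}. (x (succ_pt P s) - x s)^2)"

definition quadvar :: "(nat \<Rightarrow> real set) \<Rightarrow> (real \<Rightarrow> real) \<Rightarrow> real \<Rightarrow> real" where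
  "quadvar T x t = lim (\<lambda>n. qv_sum (T n) x t)"

definition has_cont_quadvar :: "(nat \<Rightarrow> real set) \<Rightarrow> (real \<Rightarrow> real) \<Rightarrow> bool" where
  "has_cont_quadvar T x \<longleftrightarrow>
     (\<forall>t\<in>{0..1}. convergent (\<lambda>n. qv_sum (T n) x t)) \<and> continuous_on {0..1} (quadvar T x)"

definition bounded_variation_on :: "(real \<Rightarrow> real) \<Rightarrow> real \<Rightarrow> real \<Rightarrow> bool" where
  "bounded_variation_on f a b \<longleftrightarrow>
     (\<exists>M. \<forall>(p::nat \<Rightarrow> real) n. p 0 = a \<and> p n = b \<and> (\<forall>i<n. p i \<le> p (Suc i)) \<longrightarrow>
          (\<Sum>i<n. \<bar>f (p (Suc i)) - f (p i)\<bar>) \<le> M)"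

definition CBV01 :: "(real \<Rightarrow> real) \<Rightarrow> bool" where
  "CBV01 f \<longleftrightarrow> continuous_on {0..1} f \<and> bounded_variation_on f 0 1"

definition RS_sum :: "(real \<Rightarrow> real) \<Rightarrow> (real \<Rightarrow> real) \<Rightarrow> (nat \<Rightarrow> real) \<Rightarrow> (nat \<Rightarrow> real) \<Rightarrow> nat \<Rightarrow> real" where
  "RS_sum f g p \<xi> n = (\<Sum>i<n. f (\<xi> i) * (g (p (Suc i)) - g (p i)))"

definition tagged_div_fine :: "real \<Rightarrow> real \<Rightarrow> real \<Rightarrow> (nat \<Rightarrow> real) \<Rightarrow> (nat \<Rightarrow> real) \<Rightarrow> nat \<Rightarrow> bool" where
  "tagged_div_fine a b d p \<xi> n \<longleftrightarrow>
     p 0 = a \<and> p n = b \<and>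
     (\<forall>i<n. p i < p (Suc i) \<and> p i \<le> \<xi> i \<and> \<xi> i \<le> p (Suc i) \<and> p (Suc i) - p i < d)"

definition has_RS_integral :: "(real \<Rightarrow> real) \<Rightarrow> (real \<Rightarrow> real) \<Rightarrow> real \<Rightarrow> real \<Rightarrow> real \<Rightarrow> bool" where
  "has_RS_integral f g a b I \<longleftrightarrow>
     (\<forall>e>0. \<exists>d>0. \<forall>p \<xi> n. tagged_div_fine a b d p \<xi> n \<longrightarrow> \<bar>RS_sum f g p \<xi> n - I\<bar> < e)"

definition C1_on :: "'a::euclidean_space set \<Rightarrow> ('a \<Rightarrow> real) \<Rightarrow> bool" where
  "C1_on S f \<longleftrightarrow>
     (\<exists>Df :: 'a \<Rightarrow> ('a \<Rightarrow>\<^sub>L real).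
        (\<forall>p\<in>S. (f has_derivative blinfun_apply (Df p)) (at p)) \<and> continuous_on S Df)"

definition C2_on :: "'a::euclidean_space set \<Rightarrow> ('a \<Rightarrow> real) \<Rightarrow> bool" where
  "C2_on S f \<longleftrightarrow>
     (\<exists>(Df :: 'a \<Rightarrow> ('a \<Rightarrow>\<^sub>L real)) (D2f :: 'a \<Rightarrow> ('a \<Rightarrow>\<^sub>L ('a \<Rightarrow>\<^sub>L real))).
        (\<forall>p\<in>S. (f has_derivative blinfun_apply (Df p)) (at p) \<and>
                 (Df has_derivative blinfun_apply (D2f p)) (at p)) \<and>
        continuous_on S D2f)"

definition foellmer_sum :: "real set \<Rightarrow> (real \<Rightarrow> real) \<Rightarrow> (real \<Rightarrow> real) \<Rightarrow> real \<Rightarrow> real" where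
  "foellmer_sum P \<eta> x t = (\<Sum>s\<in>{s\<in>P. s \<le> t}. \<eta> s * (x (succ_pt P s) - x s))"

definition admissible_integrand ::
    "'n::finite itself \<Rightarrow> (real \<Rightarrow> real) \<Rightarrow> (real \<Rightarrow> real) \<Rightarrow> bool" where
  "admissible_integrand _ x \<eta> \<longleftrightarrow>
     (\<exists>(A :: real \<Rightarrow> real^'n) (U :: ((real^'n) \<times> real) set) (f :: (real^'n) \<times> real \<Rightarrow> real).
        continuous_on {0..1} A \<and> (\<forall>i. CBV01 (\<lambda>t. A t $ i)) \<and>
        open U \<and> (\<forall>t\<in>{0..1}. (A t, x t) \<in> U) \<and>
        C1_on U f \<and>
        (\<forall>a\<in>fst ` U. C2_on {\<xi>. (a, \<xi>) \<in> U} (\<lambda>\<xi>. f (a, \<xi>))) \<and>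
        (\<forall>t\<in>{0..1}. \<eta> t = deriv (\<lambda>\<xi>. f (A t, \<xi>)) (x t)))"

definition is_solution ::
    "'n::finite itself \<Rightarrow> (nat \<Rightarrow> real set) \<Rightarrow> (real \<Rightarrow> real) \<Rightarrow> (real \<Rightarrow> real) \<Rightarrow>
     (real \<Rightarrow> real \<Rightarrow> real) \<Rightarrow> (real \<Rightarrow> real \<Rightarrow> real) \<Rightarrow> real \<Rightarrow> (real \<Rightarrow> real) \<Rightarrow> bool" where
  "is_solution N T x A \<sigma> b z0 z \<longleftrightarrow>
     continuous_on {0..1} z \<and>
     admissible_integrand N x (\<lambda>t. \<sigma> t (z t)) \<and>
     (\<forall>t\<in>{0..1}. \<exists>I J.
        (\<lambda>n. foellmer_sum (T n) (\<lambda>s. \<sigma> s (z s)) x t) \<longlonglongrightarrow> I \<and>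
        has_RS_integral (\<lambda>s. b s (z s)) A 0 t J \<and>
        z t = z0 + I + J)"

definition B_equation ::
    "(nat \<Rightarrow> real set) \<Rightarrow> (real \<Rightarrow> real) \<Rightarrow> (real \<Rightarrow> real) \<Rightarrow> (real \<Rightarrow> real \<Rightarrow> real) \<Rightarrow>
     (real \<Rightarrow> real \<Rightarrow> real \<Rightarrow> real) \<Rightarrow> real \<Rightarrow> (real \<Rightarrow> real) \<Rightarrow> bool" where
  "B_equation T x A b \<phi> z0 B \<longleftrightarrow>
     continuous_on {0..1} B \<and>
     (\<forall>t\<in>{0..1}. \<exists>I1 I2 I3.
        has_RS_integral
          (\<lambda>s. b s (\<phi> s (B s) (x s)) / deriv (\<lambda>\<xi>. \<phi> s \<xi> (x s)) (B s)) A 0 t I1 \<and>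
        has_RS_integral
          (\<lambda>s. deriv (\<lambda>\<tau>. \<phi> \<tau> (B s) (x s)) s / deriv (\<lambda>\<xi>. \<phi> s \<xi> (x s)) (B s)) (\<lambda>s. s) 0 t I2 \<and>
        has_RS_integral
          (\<lambda>s. deriv (deriv (\<phi> s (B s))) (x s) / deriv (\<lambda>\<xi>. \<phi> s \<xi> (x s)) (B s))
          (quadvar T x) 0 t I3 \<and>
        B t = z0 + I1 - I2 - I3 / 2)"

end

theory Submission
  imports Defs
begin

text \<open>The flow turns \<open>dz = \<sigma>(t, z) dx + b(t, z) dA\<close> into an equation without \<open>dx\<close>: by Ito's formula
  \<open>z(t) = \<phi>(t, B(t), x(t))\<close> solves it whenever \<open>B\<close> solves the Stieltjes equation, whose coefficients are locally
  Lipschitz and of linear growth because \<open>\<phi>\<^sub>\<xi>\<close> and \<open>1 / \<phi>\<^sub>\<xi>\<close> are bounded for bounded \<open>t\<close>.  All integrators of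
  bounded variation are Lipschitz with respect to a common increasing continuous clock \<open>m\<close>, which makes the
  Stieltjes equation an ordinary Picard iteration with weight \<open>exp (- \<lambda> m)\<close>.

  Conversely let \<open>z\<close> be a solution, \<open>\<sigma>(t, z(t)) = \<partial>\<^sub>\<xi> f(\<^bold>A(t), x(t))\<close>, put \<open>B(t) = \<phi>(t, z(t), -x(t))\<close>
  and let \<open>D\<close> be the difference of the two sides of the Stieltjes equation for \<open>B\<close>.  On intervals where \<open>B\<close> is
  Lipschitz with respect to \<open>m\<close>, Ito's formula shows that \<open>D\<close> is constant.  Nothing bounds \<open>\<partial>\<^sub>\<xi>\<^sub>\<xi> f\<close> uniformly in
  \<open>\<^bold>a\<close>, so this regularity of \<open>B\<close> is not available at once.  Let \<open>E\<close> be the closed set of points around which \<open>D\<close>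
  is not constant.  If \<open>E\<close> were nonempty, Baire's theorem would give a portion of \<open>E\<close> on which \<open>\<partial>\<^sub>\<xi> f(\<^bold>A(t), \<cdot>)\<close> is
  Lipschitz uniformly in \<open>t\<close>.  There \<open>f(\<^bold>A, x)\<close> and then \<open>B\<close> have increments of order \<open>(\<Delta>x)\<^sup>2 + \<Delta>m\<close>; summing over
  the partitions makes \<open>B\<close> Lipschitz on this portion, hence \<open>D\<close> constant, a contradiction.\<close>

section \<open>Functions of class C1 and C2\<close>

text \<open>The increments of order \<open>(\<Delta>x)^2 + \<Delta>m\<close> rest on an
  interpolation inequality. Given \<open>u\<close>, let \<open>d\<close> be the next point of
  \<open>E\<close> and \<open>l = m d - m u\<close>. On [u, d] the defect \<open>D\<close> is
  constant, so \<open>B\<close> is Lipschitz there, and the difference between f at the parameters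
  of time \<open>d\<close> and the flow line through \<open>z u\<close> varies only by O(l) over the
  levels that \<open>x\<close> visits. Its slope is Lipschitz because \<open>d\<close> lies in the
  portion. So the slope at \<open>x u\<close> is O(sqrt l): by Landau's inequality if
  \<open>x\<close> moves by more than sqrt l, and otherwise by comparison with the slope at
  \<open>x d\<close>, which is O(l). Times \<Delta>x this error is at most of order
  \<open>l + (\<Delta>x)^2\<close>, exactly what sums along the partitions absorb. The bound O(l)
  itself uses no second derivative: the difference of f along the path and \<open>z\<close> has
  increments o(\<Delta>x) beyond a Lipschitz part, and cutting the path at levels of
  \<open>x\<close> removes the o(\<Delta>x).

  The clock has to dominate the parameter curve, which comes with the competing solution. Hence
  every such solution gets its own clock; flow and Stieltjes equation do not refer to it.\<close>

lemma C1_onI: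
  fixes f :: "'a::euclidean_space \<Rightarrow> real"
  assumes d: "\<And>p. p \<in> S \<Longrightarrow> (f has_derivative f' p) (at p)"
    and c: "\<And>i. i \<in> Basis \<Longrightarrow> continuous_on S (\<lambda>p. f' p i)"
  shows "C1_on S f"
proof -
  have bl: "bounded_linear (f' p)" if "p \<in> S" for p
    using d[OF that] by (rule has_derivative_bounded_linear)
  have "continuous_on S (\<lambda>p. Blinfun (f' p))"
  proof (rule continuous_on_blinfun_componentwise)
    fix i :: 'a assume "i \<in> Basis"
    then show "continuous_on S (\<lambda>p. blinfun_apply (Blinfun (f' p)) i)"
      using c by (subst continuous_on_cong[OF refl]) (auto simp: bounded_linear_Blinfun_apply bl)
  qed
  moreover have "\<forall>p\<in>S. (f has_derivative blinfun_apply (Blinfun (f' p))) (at p)"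
    using d bl by (simp add: bounded_linear_Blinfun_apply)
  ultimately show ?thesis
    unfolding C1_on_def by (intro exI conjI)
qed

lemma C1_onE:
  assumes "C1_on S f"
  obtains Df where "\<And>p. p \<in> S \<Longrightarrow> (f has_derivative blinfun_apply (Df p)) (at p)"
    "continuous_on S Df"
  using assms unfolding C1_on_def by auto

lemma C1_on_imp_continuous_on:
  assumes "C1_on S f" shows "continuous_on S f"
  using assms has_derivative_continuous continuous_at_imp_continuous_on
  unfolding C1_on_def by metis

lemma C1_on_cong:
  assumes "open S" "\<And>p. p \<in> S \<Longrightarrow> f p = g p" "C1_on S f"
  shows "C1_on S g"
proof -
  obtain Df where D: "\<And>p. p \<in> S \<Longrightarrow> (f has_derivative blinfun_apply (Df p)) (at p)"
    "continuous_on S Df" using C1_onE[OF assms(3)] by metis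
  have "(g has_derivative blinfun_apply (Df p)) (at p)" if "p \<in> S" for p
    using D(1)[OF that] assms(1,2) that by (auto intro: has_derivative_transform_within_open)
  with D(2) show ?thesis unfolding C1_on_def by auto
qed

lemma C1_on_add:
  assumes "C1_on S f" "C1_on S g" shows "C1_on S (\<lambda>p. f p + g p)"
proof -
  obtain F where F: "\<And>p. p \<in> S \<Longrightarrow> (f has_derivative blinfun_apply (F p)) (at p)" "continuous_on S F"
    using C1_onE[OF assms(1)] by metis
  obtain G where G: "\<And>p. p \<in> S \<Longrightarrow> (g has_derivative blinfun_apply (G p)) (at p)" "continuous_on S G"
    using C1_onE[OF assms(2)] by metis
  show ?thesis
    by (rule C1_onI[where f'="\<lambda>p v. F p v + G p v"])
      (auto intro!: has_derivative_add F G continuous_intros)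
qed

lemma C1_on_mult:
  assumes "C1_on S f" "C1_on S g" shows "C1_on S (\<lambda>p. f p * g p)"
proof -
  obtain F where F: "\<And>p. p \<in> S \<Longrightarrow> (f has_derivative blinfun_apply (F p)) (at p)" "continuous_on S F"
    using C1_onE[OF assms(1)] by metis
  obtain G where G: "\<And>p. p \<in> S \<Longrightarrow> (g has_derivative blinfun_apply (G p)) (at p)" "continuous_on S G"
    using C1_onE[OF assms(2)] by metis
  show ?thesis
    by (rule C1_onI[where f'="\<lambda>p v. f p * G p v + F p v * g p"])
      (auto intro!: has_derivative_mult F G continuous_intros assms[THEN C1_on_imp_continuous_on])
qed

lemma C1_on_const: "C1_on S (\<lambda>_. c)"
  by (rule C1_onI[where f'="\<lambda>_ _. 0"]) auto

lemma C1_on_bounded_linear: "bounded_linear f \<Longrightarrow> C1_on S f"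
  by (rule C1_onI[where f'="\<lambda>_. f"]) (auto intro: bounded_linear_imp_has_derivative)

lemma C1_on_compose:
  fixes h :: "'a::euclidean_space \<Rightarrow> 'b::euclidean_space"
  assumes g: "C1_on V g" and sub: "\<And>p. p \<in> S \<Longrightarrow> h p \<in> V"
    and h: "\<And>p. p \<in> S \<Longrightarrow> (h has_derivative h' p) (at p)"
    and c: "\<And>v. v \<in> Basis \<Longrightarrow> continuous_on S (\<lambda>p. h' p v)"
  shows "C1_on S (\<lambda>p. g (h p))"
proof -
  obtain G where G: "\<And>p. p \<in> V \<Longrightarrow> (g has_derivative blinfun_apply (G p)) (at p)" "continuous_on V G"
    using C1_onE[OF g] by metis
  have ch: "continuous_on S h"
    using h has_derivative_continuous continuous_at_imp_continuous_on by metis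
  have cG: "continuous_on S (\<lambda>p. G (h p))"
    using continuous_on_compose2[OF G(2) ch] sub by blast
  show ?thesis
    by (rule C1_onI[where f'="\<lambda>p v. G (h p) (h' p v)"])
      (auto intro!: has_derivative_compose[OF h G(1)] sub continuous_intros cG c)
qed

lemma C1_on_exp:
  assumes "C1_on S f" shows "C1_on S (\<lambda>p. exp (f p))"
proof -
  obtain F where F: "\<And>p. p \<in> S \<Longrightarrow> (f has_derivative blinfun_apply (F p)) (at p)" "continuous_on S F"
    using C1_onE[OF assms(1)] by metis
  show ?thesis
    by (rule C1_onI[where f'="\<lambda>p v. exp (f p) * F p v"])
      (auto intro!: derivative_eq_intros F continuous_intros assms[THEN C1_on_imp_continuous_on])
qed

lemma C1_on_compose_pair:
  assumes g: "C1_on V g" and sub: "\<And>p. p \<in> S \<Longrightarrow> (h p, k p) \<in> V"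
    and h: "C1_on S h" and k: "C1_on S k"
  shows "C1_on S (\<lambda>p. g (h p, k p))"
proof -
  obtain F where F: "\<And>p. p \<in> S \<Longrightarrow> (h has_derivative blinfun_apply (F p)) (at p)" "continuous_on S F"
    using C1_onE[OF h] by metis
  obtain G where G: "\<And>p. p \<in> S \<Longrightarrow> (k has_derivative blinfun_apply (G p)) (at p)" "continuous_on S G"
    using C1_onE[OF k] by metis
  show ?thesis
    by (rule C1_on_compose[OF g, where h'="\<lambda>p v. (F p v, G p v)"])
      (auto intro!: has_derivative_Pair F G continuous_intros sub)
qed

text \<open>In the dual basis \<open>Df p\<close> is the sum of the scalars \<open>f' p i\<close>
  times the fixed functionals \<open>blinfun_inner_right i\<close>, so the derivative of this
  operator-valued map is assembled from those of the scalar partial derivatives. Regularity proofs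
  can thus stay with real-valued functions.\<close>

lemma C2_onI:
  fixes f :: "'a::euclidean_space \<Rightarrow> real"
  assumes d: "\<And>p. p \<in> S \<Longrightarrow> (f has_derivative f' p) (at p)"
    and c: "\<And>i. i \<in> Basis \<Longrightarrow> C1_on S (\<lambda>p. f' p i)"
  shows "C2_on S f"
proof -
  have "\<exists>G. (\<forall>p\<in>S. ((\<lambda>p. f' p i) has_derivative blinfun_apply (G p)) (at p)) \<and> continuous_on S G"
    if "i \<in> Basis" for i using c[OF that] unfolding C1_on_def by auto
  then obtain G where G: "\<And>i p. i \<in> Basis \<Longrightarrow> p \<in> S \<Longrightarrow>
      ((\<lambda>p. f' p i) has_derivative blinfun_apply (G i p)) (at p)"
    "\<And>i. i \<in> Basis \<Longrightarrow> continuous_on S (G i)"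
    by metis
  define Df where "Df = (\<lambda>p. \<Sum>i\<in>Basis. f' p i *\<^sub>R blinfun_inner_right i)"
  define D2 where "D2 = (\<lambda>p. \<Sum>i\<in>Basis. blinfun_scaleR_left (blinfun_inner_right i :: 'a \<Rightarrow>\<^sub>L real) o\<^sub>L G i p)"
  have 1: "blinfun_apply (Df p) = f' p" if "p \<in> S" for p
  proof
    fix v
    have l: "linear (f' p)" using d[OF that] has_derivative_linear by blast
    have "f' p v = f' p (\<Sum>i\<in>Basis. (i \<bullet> v) *\<^sub>R i)"
      by (subst euclidean_representation[of v, symmetric]) (simp add: inner_commute)
    also have "\<dots> = (\<Sum>i\<in>Basis. (i \<bullet> v) * f' p i)"
      by (simp add: linear_sum[OF l] linear_scale[OF l])
    finally show "blinfun_apply (Df p) v = f' p v"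
      by (simp add: Df_def blinfun.bilinear_simps mult.commute)
  qed
  have "(Df has_derivative blinfun_apply (D2 p)) (at p)" if "p \<in> S" for p
  proof -
    have "(Df has_derivative (\<lambda>v. \<Sum>i\<in>Basis. G i p v *\<^sub>R blinfun_inner_right i)) (at p)"
      unfolding Df_def using G(1) that
      by (intro has_derivative_sum has_derivative_scaleR_left) auto
    moreover have "blinfun_apply (D2 p) = (\<lambda>v. \<Sum>i\<in>Basis. G i p v *\<^sub>R blinfun_inner_right i)"
      by (simp add: D2_def fun_eq_iff blinfun.bilinear_simps)
    ultimately show ?thesis by simp
  qed
  moreover have "continuous_on S D2"
    unfolding D2_def by (intro continuous_intros G(2))
  moreover have "(f has_derivative blinfun_apply (Df p)) (at p)" if "p \<in> S" for p
    using 1 d that by simp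
  ultimately show ?thesis
    unfolding C2_on_def by auto
qed

lemma C2_onE:
  assumes "C2_on S f"
  obtains Df where "\<And>p. p \<in> S \<Longrightarrow> (f has_derivative blinfun_apply (Df p)) (at p)"
    "\<And>v. C1_on S (\<lambda>p. Df p v)"
proof -
  obtain Df D2 where D: "\<And>p. p \<in> S \<Longrightarrow> (f has_derivative blinfun_apply (Df p)) (at p)"
     "\<And>p. p \<in> S \<Longrightarrow> (Df has_derivative blinfun_apply (D2 p)) (at p)" "continuous_on S D2"
    using assms unfolding C2_on_def by auto
  have "C1_on S (\<lambda>p. Df p v)" for v
    by (rule C1_onI[where f'="\<lambda>p w. D2 p w v"])
      (auto intro!: bounded_linear.has_derivative[OF bounded_linear_apply_blinfun] D continuous_intros)
  with D(1) that show ?thesis by auto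
qed

lemma C2_on_imp_C1_on: "C2_on S f \<Longrightarrow> C1_on S f"
  by (erule C2_onE, rule C1_onI) (assumption, rule C1_on_imp_continuous_on)

lemma has_derivative_slice:
  assumes "(f has_derivative f') (at (a, b))"
  shows "((\<lambda>s. f (s, b)) has_derivative (\<lambda>v. f' (v, 0))) (at a)"
    and "((\<lambda>s. f (a, s)) has_derivative (\<lambda>v. f' (0, v))) (at b)"
proof -
  have 1: "((\<lambda>s. (s, b)) has_derivative (\<lambda>v. (v, 0))) (at a)"
    and 2: "((\<lambda>s. (a, s)) has_derivative (\<lambda>v. (0, v))) (at b)"
    by (intro derivative_intros)+
  show "((\<lambda>s. f (s, b)) has_derivative (\<lambda>v. f' (v, 0))) (at a)"
    by (rule has_derivative_compose[OF 1 assms])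
  show "((\<lambda>s. f (a, s)) has_derivative (\<lambda>v. f' (0, v))) (at b)"
    by (rule has_derivative_compose[OF 2 assms])
qed

lemma has_real_derivative_slice:
  fixes f :: "real \<times> real \<Rightarrow> real"
  assumes "(f has_derivative f') (at (a, b))"
  shows "((\<lambda>s. f (s, b)) has_real_derivative f' (1, 0)) (at a)"
    and "((\<lambda>s. f (a, s)) has_real_derivative f' (0, 1)) (at b)"
proof -
  have l: "linear f'" using assms has_derivative_linear by blast
  have 1: "(\<lambda>v. f' (v, 0)) = (\<lambda>v. f' (1, 0) * v)"
  proof
    fix v show "f' (v, 0) = f' (1, 0) * v"
      using linear_scale[OF l, of v "(1, 0)"] by (simp add: mult.commute)
  qed
  have 2: "(\<lambda>v. f' (0, v)) = (\<lambda>v. f' (0, 1) * v)"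
  proof
    fix v show "f' (0, v) = f' (0, 1) * v"
      using linear_scale[OF l, of v "(0, 1)"] by (simp add: mult.commute)
  qed
  show "((\<lambda>s. f (s, b)) has_real_derivative f' (1, 0)) (at a)"
    using has_derivative_slice(1)[OF assms] unfolding has_field_derivative_def 1 .
  show "((\<lambda>s. f (a, s)) has_real_derivative f' (0, 1)) (at b)"
    using has_derivative_slice(2)[OF assms] unfolding has_field_derivative_def 2 .
qed

section \<open>Ordinary differential equations\<close>

text \<open>The antiderivative vanishing at 0 in a form that puts the upper limit into the integrand,
  so that it covers negative \<open>t\<close> and depends on parameters and on \<open>t\<close> in the same way.\<close>

definition antideriv :: "(real \<Rightarrow> real) \<Rightarrow> real \<Rightarrow> real" where
  "antideriv f t = t * integral {0..1} (\<lambda>\<theta>. f (t * \<theta>))"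

lemma antideriv_0 [simp]: "antideriv f 0 = 0"
  by (simp add: antideriv_def)

lemma antideriv_unique:
  assumes F: "\<And>t. (F has_real_derivative f t) (at t)"
  shows "antideriv f t = F t - F 0"
proof -
  have "((\<lambda>\<theta>. f (t * \<theta>) * t) has_integral F (t * 1) - F (t * 0)) {0..1}"
  proof (rule fundamental_theorem_of_calculus)
    fix \<theta> :: real
    have "((\<lambda>\<theta>. F (t * \<theta>)) has_real_derivative f (t * \<theta>) * t) (at \<theta>)"
      by (rule DERIV_chain'[OF _ F]) (auto intro!: derivative_eq_intros)
    then show "((\<lambda>\<theta>. F (t * \<theta>)) has_vector_derivative f (t * \<theta>) * t) (at \<theta> within {0..1})"
      by (simp add: has_real_derivative_iff_has_vector_derivative has_vector_derivative_at_within)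
  qed simp
  from integral_unique[OF this] show ?thesis
    by (simp add: antideriv_def mult.commute[of t])
qed

lemma has_real_derivative_antideriv:
  assumes "continuous_on UNIV f"
  shows "(antideriv f has_real_derivative f t) (at t)"
proof -
  \<comment> \<open>With the end points minus and plus infinity the antiderivative lives on the
    whole line, so \<open>t\<close> of either sign is covered.\<close>
  have "\<exists>F. \<forall>x::real. -\<infinity> < ereal x \<longrightarrow> ereal x < \<infinity> \<longrightarrow> (F has_vector_derivative f x) (at x)"
    by (rule einterval_antiderivative) (use assms in \<open>auto simp: continuous_on_eq_continuous_at\<close>)
  then obtain F where F: "\<And>x. (F has_real_derivative f x) (at x)"
    by (auto simp: has_real_derivative_iff_has_vector_derivative)
  have "antideriv f = (\<lambda>t. F t - F 0)"
    using antideriv_unique[OF F] by blast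
  then show ?thesis
    using F by (auto intro!: derivative_eq_intros)
qed

lemma continuous_on_antideriv:
  fixes f :: "'a::metric_space \<Rightarrow> real \<Rightarrow> real"
  assumes "continuous_on (U \<times> UNIV) (\<lambda>(p, s). f p s)"
  shows "continuous_on (U \<times> UNIV) (\<lambda>(p, t). antideriv (f p) t)"
proof -
  have "continuous_on ((U \<times> (UNIV::real set)) \<times> {0..1::real})
      (\<lambda>z. case (fst (fst z), snd (fst z) * snd z) of (p, s) \<Rightarrow> f p s)"
    by (rule continuous_on_compose2[OF assms]) (auto intro!: continuous_intros)
  then have "continuous_on ((U \<times> (UNIV::real set)) \<times> {0..1::real}) (\<lambda>(q, \<theta>). f (fst q) (snd q * \<theta>))"
    by (simp add: case_prod_unfold)
  then have "continuous_on (U \<times> UNIV) (\<lambda>q. integral (cbox 0 1) (\<lambda>\<theta>. f (fst q) (snd q * \<theta>)))"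
    by (intro integral_continuous_on_param) (simp add: cbox_interval)
  then show ?thesis
    by (auto simp: antideriv_def case_prod_unfold cbox_interval intro!: continuous_intros)
qed

lemma C1_on_integral_param:
  fixes f :: "'a::euclidean_space \<Rightarrow> real \<Rightarrow> real"
  assumes U: "open U" "convex U"
    and d: "\<And>p \<theta>. p \<in> U \<Longrightarrow> \<theta> \<in> {0..1} \<Longrightarrow> ((\<lambda>p. f p \<theta>) has_derivative blinfun_apply (D p \<theta>)) (at p)"
    and c: "continuous_on (U \<times> {0..1}) (\<lambda>(p, \<theta>). f p \<theta>)"
    and cD: "continuous_on (U \<times> {0..1}) (\<lambda>(p, \<theta>). D p \<theta>)"
  shows "C1_on U (\<lambda>p. integral {0..1} (f p))"
proof -
  have ci: "continuous_on {0..1} (f p)" if "p \<in> U" for p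
  proof -
    have "continuous_on {0..1} (\<lambda>\<theta>. case (p, \<theta>) of (p, \<theta>) \<Rightarrow> f p \<theta>)"
      by (rule continuous_on_compose2[OF c]) (use that in \<open>auto intro!: continuous_intros\<close>)
    then show ?thesis by simp
  qed
  have "((\<lambda>p. integral (cbox 0 1) (f p)) has_derivative blinfun_apply (integral (cbox 0 1) (D p))) (at p within U)"
    if p: "p \<in> U" for p
  proof (rule leibniz_rule[OF _ _ _ p U(2)])
    show "((\<lambda>p. f p \<theta>) has_derivative blinfun_apply (D q \<theta>)) (at q within U)"
      if "q \<in> U" "\<theta> \<in> cbox 0 1" for q \<theta>
      using d that by (simp add: cbox_interval has_derivative_at_withinI)
    show "f q integrable_on cbox 0 1" if "q \<in> U" for q
      using ci[OF that] by (simp add: cbox_interval integrable_continuous_real)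
    show "continuous_on (U \<times> cbox 0 1) (\<lambda>(p, \<theta>). D p \<theta>)"
      using cD by (simp only: cbox_interval)
  qed
  then have 1: "\<forall>p\<in>U. ((\<lambda>p. integral {0..1} (f p)) has_derivative blinfun_apply (integral {0..1} (D p))) (at p)"
    using U by (simp add: at_within_open[of _ U] cbox_interval)
  have "continuous_on U (\<lambda>p. integral (cbox 0 1) (D p))"
    using cD by (intro integral_continuous_on_param) (simp only: cbox_interval)
  then have 2: "continuous_on U (\<lambda>p. integral {0..1} (D p))"
    by (simp only: cbox_interval)
  show ?thesis
    unfolding C1_on_def using 1 2 by (intro exI[of _ "\<lambda>p. integral {0..1} (D p)"] conjI)
qed

text \<open>Parameter and upper limit enter the integrand only through the linear map
  \<open>L \<theta>\<close>, so one differentiation under the integral over the fixed interval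
  [0, 1] yields the derivatives in both. The factor in front of the integral comes back through the
  product rule.\<close>

lemma C1_on_antideriv:
  fixes f :: "real \<times> real \<Rightarrow> real \<Rightarrow> real"
  assumes U: "open U" "convex U"
    and f: "C1_on (U \<times> UNIV) (\<lambda>p. f (fst p) (snd p))"
  shows "C1_on (U \<times> UNIV) (\<lambda>p. antideriv (f (fst p)) (snd p))"
proof -
  obtain D where D: "\<And>p. p \<in> U \<times> UNIV \<Longrightarrow>
      ((\<lambda>p. f (fst p) (snd p)) has_derivative blinfun_apply (D p)) (at p)"
    "continuous_on (U \<times> UNIV) D"
    by (rule C1_onE[OF f], rule that)
  define L :: "real \<Rightarrow> ((real \<times> real) \<times> real) \<Rightarrow>\<^sub>L ((real \<times> real) \<times> real)"
    where "L = (\<lambda>\<theta>. Blinfun (\<lambda>v. (fst v, 0)) + \<theta> *\<^sub>R Blinfun (\<lambda>v. (0, snd v)))"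
  have "bounded_linear (\<lambda>v :: (real \<times> real) \<times> real. (fst v, 0 :: real))"
    "bounded_linear (\<lambda>v :: (real \<times> real) \<times> real. (0 :: real \<times> real, snd v))"
    by (intro bounded_linear_intros)+
  then have L: "blinfun_apply (L \<theta>) = (\<lambda>v. (fst v, snd v * \<theta>))" for \<theta>
    by (auto simp: L_def blinfun.bilinear_simps bounded_linear_Blinfun_apply)
  have cf: "continuous_on (U \<times> UNIV) (\<lambda>p. f (fst p) (snd p))"
    by (rule C1_on_imp_continuous_on[OF f])
  have "C1_on (U \<times> UNIV) (\<lambda>p. integral {0..1} (\<lambda>\<theta>. f (fst p) (snd p * \<theta>)))"
  proof (rule C1_on_integral_param)
    show "open (U \<times> (UNIV::real set))" "convex (U \<times> (UNIV::real set))"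
      using U by (auto intro: open_Times convex_Times)
    fix p :: "(real \<times> real) \<times> real" and \<theta> :: real assume p: "p \<in> U \<times> UNIV" "\<theta> \<in> {0..1}"
    have "((\<lambda>p. (fst p, snd p * \<theta>)) has_derivative (\<lambda>v. (fst v, snd v * \<theta>))) (at p)"
      by (intro bounded_linear_imp_has_derivative bounded_linear_intros)
    from has_derivative_compose[OF this D(1)]
    show "((\<lambda>p. f (fst p) (snd p * \<theta>)) has_derivative
        blinfun_apply (D (fst p, snd p * \<theta>) o\<^sub>L L \<theta>)) (at p)"
      using p by (simp add: L o_def blinfun_compose.rep_eq mem_Times_iff)
  next
    show "continuous_on ((U \<times> UNIV) \<times> {0..1}) (\<lambda>(p, \<theta>). f (fst p) (snd p * \<theta>))"
    proof -
      have "continuous_on ((U \<times> UNIV) \<times> {0..1})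
          (\<lambda>z. (\<lambda>p. f (fst p) (snd p)) (fst (fst z), snd (fst z) * snd z))"
        by (rule continuous_on_compose2[OF cf]) (auto intro!: continuous_intros)
      then show ?thesis by (simp add: case_prod_unfold)
    qed
    have "continuous_on ((U \<times> UNIV) \<times> {0..1}) (\<lambda>(p, \<theta>). D (fst p, snd p * \<theta>))"
    proof -
      have "continuous_on ((U \<times> UNIV) \<times> {0..1}) (\<lambda>z. D (fst (fst z), snd (fst z) * snd z))"
        by (rule continuous_on_compose2[OF D(2)]) (auto intro!: continuous_intros)
      then show ?thesis by (simp add: case_prod_unfold)
    qed
    moreover have "continuous_on ((U \<times> UNIV) \<times> {0..1}) (\<lambda>(p, \<theta>). L \<theta>)"
      unfolding L_def case_prod_unfold by (intro continuous_intros)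
    ultimately show "continuous_on ((U \<times> UNIV) \<times> {0..1}) (\<lambda>(p, \<theta>). D (fst p, snd p * \<theta>) o\<^sub>L L \<theta>)"
      by (auto simp: case_prod_unfold intro!: continuous_intros)
  qed
  from C1_on_mult[OF C1_on_bounded_linear[OF bounded_linear_snd] this]
  show ?thesis by (simp add: antideriv_def)
qed

text \<open>Both \<open>F + G\<close> and \<open>G - F\<close> are nondecreasing and vanish at 0.
  For negative \<open>t\<close> the value of \<open>G\<close> is nonpositive, hence the absolute
  value on the right.\<close>

lemma deriv_dominated:
  fixes F G :: "real \<Rightarrow> real"
  assumes F: "\<And>t. (F has_real_derivative f t) (at t)" and G: "\<And>t. (G has_real_derivative g t) (at t)"
    and le: "\<And>t. \<bar>f t\<bar> \<le> g t" and 0: "F 0 = 0" "G 0 = 0"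
  shows "\<bar>F t\<bar> \<le> \<bar>G t\<bar>"
proof -
  have p: "F s + G s \<le> F u + G u" if "s \<le> u" for s u
  proof (rule DERIV_nonneg_imp_nondecreasing[OF that])
    fix x
    show "\<exists>y. ((\<lambda>t. F t + G t) has_real_derivative y) (at x) \<and> 0 \<le> y"
      by (intro exI[of _ "f x + g x"] conjI DERIV_add F G) (use le[of x] in linarith)
  qed
  have m: "G s - F s \<le> G u - F u" if "s \<le> u" for s u
  proof (rule DERIV_nonneg_imp_nondecreasing[OF that])
    fix x
    show "\<exists>y. ((\<lambda>t. G t - F t) has_real_derivative y) (at x) \<and> 0 \<le> y"
      by (intro exI[of _ "g x - f x"] conjI DERIV_diff F G) (use le[of x] in linarith)
  qed
  show ?thesis
    using p[of 0 t] m[of 0 t] p[of t 0] m[of t 0] 0 by linarith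
qed

text \<open>The integrating factors \<open>exp (- (K * t))\<close> for positive and
  \<open>exp (K * t)\<close> for negative times make the product with \<open>r\<close> monotone; the
  two-sided bound on \<open>r'\<close> serves both directions.\<close>

lemma gronwall_deriv:
  fixes r :: "real \<Rightarrow> real"
  assumes r: "\<And>t. (r has_real_derivative r' t) (at t)" and le: "\<And>t. \<bar>r' t\<bar> \<le> K * r t"
  shows "r t \<le> r 0 * exp (K * \<bar>t\<bar>)"
proof (cases "0 \<le> t")
  case True
  have "r t * exp (- (K * t)) \<le> r 0 * exp (- (K * 0))"
    using True
  proof (rule DERIV_nonpos_imp_nonincreasing)
    fix s
    have "((\<lambda>s. r s * exp (- (K * s))) has_real_derivative (r' s - K * r s) * exp (- (K * s))) (at s)"
      by (auto intro!: derivative_eq_intros r simp: algebra_simps)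
    moreover have "(r' s - K * r s) * exp (- (K * s)) \<le> 0"
      using le[of s] by (intro mult_nonpos_nonneg) auto
    ultimately show "\<exists>y. ((\<lambda>s. r s * exp (- (K * s))) has_real_derivative y) (at s) \<and> y \<le> 0"
      by blast
  qed
  then show ?thesis using True by (simp add: exp_minus field_simps)
next
  case False
  have "r t * exp (K * t) \<le> r 0 * exp (K * 0)"
  proof (rule DERIV_nonneg_imp_nondecreasing[of t 0 "\<lambda>t. r t * exp (K * t)"])
    show "t \<le> 0" using False by simp
    fix s
    have "((\<lambda>s. r s * exp (K * s)) has_real_derivative (r' s + K * r s) * exp (K * s)) (at s)"
      by (auto intro!: derivative_eq_intros r simp: algebra_simps)
    moreover have "(r' s + K * r s) * exp (K * s) \<ge> 0"
      using le[of s] by (intro mult_nonneg_nonneg) auto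
    ultimately show "\<exists>y. ((\<lambda>s. r s * exp (K * s)) has_real_derivative y) (at s) \<and> 0 \<le> y"
      by blast
  qed
  then show ?thesis using False by (simp add: exp_minus field_simps)
qed

text \<open>Banach's fixed point theorem for the norm \<open>sup \<bar>y\<bar> / W\<close>.\<close>

lemma weighted_contraction_exists:
  fixes W :: "'a::metric_space \<Rightarrow> real"
  assumes W: "continuous_on S W" "\<And>t. t \<in> S \<Longrightarrow> 0 < W t"
    and y0: "continuous_on S y0" "\<And>t. t \<in> S \<Longrightarrow> \<bar>\<Phi> y0 t - y0 t\<bar> \<le> C0 * W t"
    and cont: "\<And>y. continuous_on S y \<Longrightarrow> continuous_on S (\<Phi> y)"
    and contr: "\<And>y z C. continuous_on S y \<Longrightarrow> continuous_on S z \<Longrightarrow> (\<And>t. t \<in> S \<Longrightarrow> \<bar>y t - z t\<bar> \<le> C * W t)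
      \<Longrightarrow> (\<And>t. t \<in> S \<Longrightarrow> \<bar>\<Phi> y t - \<Phi> z t\<bar> \<le> C / 2 * W t)"
  shows "\<exists>y. continuous_on S y \<and> (\<forall>t\<in>S. \<Phi> y t = y t)"
proof -
  define Y where "Y = (\<lambda>n. (\<Phi> ^^ n) y0)"
  have cY: "continuous_on S (Y n)" for n
    by (induction n) (auto simp: Y_def y0 cont)
  have st: "\<bar>Y (Suc n) t - Y n t\<bar> \<le> C0 * (1/2) ^ n * W t" if "t \<in> S" for n t
    using that
  proof (induction n arbitrary: t)
    case 0 then show ?case using y0 by (simp add: Y_def)
  next
    case (Suc n)
    show ?case using contr[OF cY cY Suc.IH Suc.prems] by (simp add: Y_def)
  qed
  \<comment> \<open>Uniform convergence is available only after division by the weight: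
    \<open>S\<close> may be the whole line, on which the iterates themselves can be
    unbounded.\<close>
  define R where "R = (\<lambda>n t. Y n t / W t)"
  have stR: "\<bar>R (Suc n) t - R n t\<bar> \<le> C0 * (1/2) ^ n" if "t \<in> S" for n t
  proof -
    have "R (Suc n) t - R n t = (Y (Suc n) t - Y n t) / W t" by (simp add: R_def diff_divide_distrib)
    then have "\<bar>R (Suc n) t - R n t\<bar> = \<bar>Y (Suc n) t - Y n t\<bar> / W t" using W(2)[OF that] by (simp add: abs_divide)
    also have "\<dots> \<le> C0 * (1/2) ^ n" using st[OF that, of n] W(2)[OF that] by (simp only: pos_divide_le_eq)
    finally show ?thesis .
  qed
  define D where "D = (\<lambda>n t. R (Suc n) t - R n t)"
  have ul: "uniform_limit S (\<lambda>n t. \<Sum>i<n. D i t) (\<lambda>t. suminf (\<lambda>i. D i t)) sequentially"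
  proof (rule Weierstrass_m_test[where M="\<lambda>n. C0 * (1/2) ^ n"])
    show "norm (D n t) \<le> C0 * (1/2) ^ n" if "t \<in> S" for n t
      using stR[OF that] by (simp add: D_def)
    show "summable (\<lambda>n. C0 * (1/2 :: real) ^ n)"
      by (intro summable_mult summable_geometric) simp
  qed
  have RD: "R n t = R 0 t + (\<Sum>i<n. D i t)" for n t
    using sum_lessThan_telescope[of "\<lambda>n. R n t" n] by (simp add: D_def)
  define r where "r = (\<lambda>t. R 0 t + suminf (\<lambda>i. D i t))"
  have ulR: "uniform_limit S R r sequentially"
  proof (rule uniform_limitI)
    fix e :: real assume "e > 0"
    from uniform_limitD[OF ul this] show "\<forall>\<^sub>F n in sequentially. \<forall>t\<in>S. dist (R n t) (r t) < e"
      by (rule eventually_mono) (subst RD, simp add: r_def dist_real_def)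
  qed
  have "continuous_on S (R n)" for n
    unfolding R_def using W by (intro continuous_intros cY) (auto dest: W(2))
  then have cr: "continuous_on S r"
    using uniform_limit_theorem[OF _ ulR] by auto
  define y where "y = (\<lambda>t. r t * W t)"
  have cy: "continuous_on S y" unfolding y_def by (intro continuous_intros cr W)
  have "\<Phi> y t = y t" if t: "t \<in> S" for t
  proof -
    have "\<bar>\<Phi> y t - y t\<bar> \<le> e" if e: "e > 0" for e
    proof -
      define d where "d = e / (2 * W t)"
      have d: "d > 0" using e W(2)[OF t] by (simp add: d_def)
      have "\<forall>\<^sub>F n in sequentially. \<forall>t\<in>S. dist (R n t) (r t) < d"
        using uniform_limitD[OF ulR d] .
      then obtain N where N: "\<And>n t. n \<ge> N \<Longrightarrow> t \<in> S \<Longrightarrow> \<bar>R n t - r t\<bar> < d"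
        unfolding eventually_sequentially dist_real_def by blast
      have cl: "\<bar>Y n u - y u\<bar> \<le> d * W u" if "n \<ge> N" "u \<in> S" for n u
      proof -
        have "Y n u - y u = (R n u - r u) * W u" using W(2)[OF that(2)] by (simp add: R_def y_def field_simps)
        then show ?thesis using N[OF that] W(2)[OF that(2)] by (simp add: abs_mult)
      qed
      have "\<bar>\<Phi> (Y N) t - \<Phi> y t\<bar> \<le> d / 2 * W t"
        by (rule contr[OF cY cy _ t]) (use cl in auto)
      moreover have "\<Phi> (Y N) t = Y (Suc N) t" by (simp add: Y_def)
      moreover have "\<bar>Y (Suc N) t - y t\<bar> \<le> d * W t" using cl t by simp
      moreover have "d * W t = e / 2" "d / 2 * W t = e / 4" using W(2)[OF t] by (simp_all add: d_def)
      ultimately show ?thesis using e by linarith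
    qed
    from this[of "\<bar>\<Phi> y t - y t\<bar> / 2"] show ?thesis
      by (cases "\<Phi> y t = y t") simp_all
  qed
  with cy show ?thesis by blast
qed

lemma ode_exists:
  fixes f :: "real \<Rightarrow> real"
  assumes lip: "\<And>x y. \<bar>f x - f y\<bar> \<le> M * \<bar>x - y\<bar>"
  shows "\<exists>y. y 0 = \<xi> \<and> (\<forall>t. (y has_real_derivative f (y t)) (at t))"
proof -
  define K where "K = \<bar>M\<bar> + 1"
  have K: "K > 0" "\<bar>f x - f y\<bar> \<le> K * \<bar>x - y\<bar>" for x y
    using order_trans[OF lip[of x y] mult_right_mono[of M K "\<bar>x - y\<bar>"]] by (auto simp: K_def)
  have cf: "continuous_on UNIV f"
    using K by (intro lipschitz_on_continuous_on[of K] lipschitz_onI) (auto simp: dist_real_def)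
  have cfy: "continuous_on UNIV (\<lambda>t. f (y t))" if "continuous_on UNIV y" for y :: "real \<Rightarrow> real"
    using continuous_on_compose2[OF cf that] by auto
  define \<Phi> where "\<Phi> = (\<lambda>y t. \<xi> + antideriv (\<lambda>s. f (y s)) t)"
  have d\<Phi>: "(\<Phi> y has_real_derivative f (y t)) (at t)" if "continuous_on UNIV y" for y t
    unfolding \<Phi>_def by (auto intro!: derivative_eq_intros has_real_derivative_antideriv cfy that)
  \<comment> \<open>\<open>W\<close> is even and its integral from 0 is
    \<open>sinh (2 * K * t) / (2 * K)\<close>, in absolute value at most
    \<open>W t / (2 * K)\<close>. A Lipschitz constant \<open>K\<close> therefore gives contraction
    by 1/2 on the whole line at once, in both time directions.\<close>
  define W where "W = (\<lambda>t. cosh (2 * K * t))"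
  have sc: "\<bar>sinh u\<bar> \<le> cosh u" for u :: real
    using sinh_plus_cosh[of u] cosh_minus_sinh[of u] exp_gt_zero[of u] exp_gt_zero[of "-u"] by linarith
  have ex: "\<exists>y. continuous_on UNIV y \<and> (\<forall>t\<in>UNIV. \<Phi> y t = y t)"
  proof (rule weighted_contraction_exists[where W=W and ?y0.0="\<lambda>_. \<xi>" and ?C0.0="\<bar>f \<xi>\<bar> / (2 * K)"])
    show "continuous_on UNIV W" "\<And>t. 0 < W t" unfolding W_def by (auto intro!: continuous_intros)
    show "continuous_on UNIV (\<Phi> y)" if "continuous_on UNIV y" for y
      using d\<Phi>[OF that] by (meson DERIV_isCont continuous_at_imp_continuous_on)
    have gen: "\<bar>F t\<bar> \<le> c / (2 * K) * W t"
      if F: "\<And>t. (F has_real_derivative g t) (at t)" "F 0 = 0" "\<And>t. \<bar>g t\<bar> \<le> c * W t" for F g c t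
    proof -
      have c: "c \<ge> 0" using that(3)[of 0] by (simp add: W_def)
      have "\<bar>F t\<bar> \<le> \<bar>c / (2 * K) * sinh (2 * K * t)\<bar>"
        by (rule deriv_dominated[OF F(1), where g="\<lambda>t. c * W t"])
          (use F K in \<open>auto simp: W_def intro!: derivative_eq_intros\<close>)
      also have "\<dots> \<le> c / (2 * K) * W t"
        using mult_left_mono[OF sc[of "2 * K * t"], of "c / (2 * K)"] c K by (simp add: W_def abs_mult)
      finally show ?thesis .
    qed
    show "\<bar>\<Phi> (\<lambda>_. \<xi>) t - \<xi>\<bar> \<le> \<bar>f \<xi>\<bar> / (2 * K) * W t" for t
    proof (rule gen)
      show "((\<lambda>t. \<Phi> (\<lambda>_. \<xi>) t - \<xi>) has_real_derivative f \<xi>) (at t)" for t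
        by (auto intro!: derivative_eq_intros d\<Phi>)
      show "\<bar>f \<xi>\<bar> \<le> \<bar>f \<xi>\<bar> * W t" for t
        using mult_left_mono[OF cosh_real_ge_1[of "2*K*t"], of "\<bar>f \<xi>\<bar>"] by (simp add: W_def)
    qed (simp add: \<Phi>_def)
    show "\<bar>\<Phi> y t - \<Phi> z t\<bar> \<le> C / 2 * W t"
      if c: "continuous_on UNIV y" "continuous_on UNIV z" "\<And>t. t \<in> UNIV \<Longrightarrow> \<bar>y t - z t\<bar> \<le> C * W t" for y z C t
    proof -
      have "\<bar>\<Phi> y t - \<Phi> z t\<bar> \<le> (K * C) / (2 * K) * W t"
      proof (rule gen)
        show "((\<lambda>t. \<Phi> y t - \<Phi> z t) has_real_derivative f (y t) - f (z t)) (at t)" for t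
          by (intro derivative_intros d\<Phi> c)
        show "\<bar>f (y t) - f (z t)\<bar> \<le> K * C * W t" for t
          using order_trans[OF K(2)[of "y t" "z t"] mult_left_mono[OF c(3)[OF UNIV_I]]] K(1) by (simp add: mult.assoc)
      qed (simp add: \<Phi>_def)
      then show ?thesis using K by simp
    qed
  qed auto
  then obtain y where y: "continuous_on UNIV y" "\<Phi> y = y" by auto
  then show ?thesis
    using d\<Phi>[OF y(1)] y(2) by (intro exI[of _ y]) (auto simp: \<Phi>_def dest: fun_cong[where x=0])
qed

text \<open>Gronwall is applied to the squared distance, which is differentiable where the distance
  itself is not.\<close>

lemma ode_unique:
  fixes f :: "real \<Rightarrow> real"
  assumes lip: "\<And>x y. \<bar>f x - f y\<bar> \<le> M * \<bar>x - y\<bar>"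
    and y: "\<And>t. (y has_real_derivative f (y t)) (at t)" and z: "\<And>t. (z has_real_derivative f (z t)) (at t)"
    and 0: "y 0 = z 0"
  shows "y = z"
proof
  fix t
  have "(y t - z t)\<^sup>2 \<le> (y 0 - z 0)\<^sup>2 * exp (2 * M * \<bar>t\<bar>)"
  proof (rule gronwall_deriv)
    show "((\<lambda>t. (y t - z t)\<^sup>2) has_real_derivative 2 * (y t - z t) * (f (y t) - f (z t))) (at t)" for t
      by (auto intro!: derivative_eq_intros y z)
    show "\<bar>2 * (y t - z t) * (f (y t) - f (z t))\<bar> \<le> 2 * M * (y t - z t)\<^sup>2" for t
    proof -
      define d where "d = y t - z t"
      have "\<bar>2 * d * (f (y t) - f (z t))\<bar> = 2 * \<bar>d\<bar> * \<bar>f (y t) - f (z t)\<bar>"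
        by (simp add: abs_mult)
      also have "\<dots> \<le> 2 * \<bar>d\<bar> * (M * \<bar>d\<bar>)"
        unfolding d_def by (intro mult_left_mono lip) simp
      also have "\<dots> = 2 * M * (\<bar>d\<bar> * \<bar>d\<bar>)" by simp
      also have "\<bar>d\<bar> * \<bar>d\<bar> = d\<^sup>2" by (simp add: power2_eq_square)
      finally show ?thesis unfolding d_def .
    qed
  qed
  then show "y t = z t" using 0 by simp
qed

section \<open>The flow\<close>

text \<open>Since \<open>g\<close> vanishes at \<open>p\<close>, the increment of the product is
  \<open>A q * g q\<close>, and replacing \<open>A q\<close> by \<open>A p\<close> costs o(1) times
  O(norm (q - p)). Continuity of \<open>A\<close> suffices; this is what turns an exact difference
  formula with continuous coefficients into a derivative.\<close>

lemma has_derivative_continuous_mult: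
  fixes A g :: "'a::real_normed_vector \<Rightarrow> real"
  assumes A: "isCont A p" and g: "(g has_derivative g') (at p)" and 0: "g p = 0"
  shows "((\<lambda>q. A q * g q) has_derivative (\<lambda>v. A p * g' v)) (at p)"
proof -
  have bl: "bounded_linear g'" using g by (rule has_derivative_bounded_linear)
  then obtain K where K: "\<And>v. norm (g' v) \<le> norm v * K"
    using bounded_linear.bounded by blast
  have t: "((\<lambda>y. norm (g y - g p - g' (y - p)) / norm (y - p)) \<longlongrightarrow> 0) (at p)"
    using g by (simp add: has_derivative_iff_norm)
  have tA: "(A \<longlongrightarrow> A p) (at p)" using A by (simp add: isCont_def)
  have "((\<lambda>y. \<bar>A y\<bar> * (norm (g y - g p - g' (y - p)) / norm (y - p)) + \<bar>A y - A p\<bar> * K) \<longlongrightarrow>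
      \<bar>A p\<bar> * 0 + \<bar>A p - A p\<bar> * K) (at p)"
    by (intro tendsto_intros t tA)
  then have lim: "((\<lambda>y. \<bar>A y\<bar> * (norm (g y - g p - g' (y - p)) / norm (y - p)) + \<bar>A y - A p\<bar> * K) \<longlongrightarrow> 0) (at p)"
    by simp
  have "((\<lambda>y. norm (A y * g y - A p * g p - A p * g' (y - p)) / norm (y - p)) \<longlongrightarrow> 0) (at p)"
  proof (rule Lim_null_comparison[OF _ lim], rule always_eventually, rule allI)
    fix y
    show "norm (norm (A y * g y - A p * g p - A p * g' (y - p)) / norm (y - p))
        \<le> \<bar>A y\<bar> * (norm (g y - g p - g' (y - p)) / norm (y - p)) + \<bar>A y - A p\<bar> * K"
    proof (cases "y = p")
      case False
      have "A y * g y - A p * g p - A p * g' (y - p)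
          = A y * (g y - g p - g' (y - p)) + (A y - A p) * g' (y - p)"
        using 0 by (simp add: algebra_simps)
      then have "norm (A y * g y - A p * g p - A p * g' (y - p))
          \<le> \<bar>A y\<bar> * norm (g y - g p - g' (y - p)) + \<bar>A y - A p\<bar> * (norm (y - p) * K)"
        using abs_triangle_ineq[of "A y * (g y - g p - g' (y - p))" "(A y - A p) * g' (y - p)"]
          mult_left_mono[OF K[of "y - p"], of "\<bar>A y - A p\<bar>"]
        by (simp add: abs_mult)
      then show ?thesis using False by (simp add: field_simps)
    qed (use 0 linear_0[OF bounded_linear.linear[OF bl]] in simp)
  qed
  then show ?thesis
    using bl by (simp add: has_derivative_iff_norm bounded_linear_mult_right bounded_linear_compose[OF bounded_linear_mult_right, unfolded comp_def])
qed

locale flow_field =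
  fixes \<sigma> :: "real \<Rightarrow> real \<Rightarrow> real" and I :: "real set" and M :: real
  assumes I: "open I" "is_interval I"
    and C2: "C2_on (I \<times> UNIV) (\<lambda>p. \<sigma> (fst p) (snd p))"
    and M: "0 \<le> M"
      "\<And>\<tau> y. \<tau> \<in> I \<Longrightarrow> \<bar>deriv (\<lambda>s. \<sigma> s y) \<tau>\<bar> \<le> M" "\<And>\<tau> y. \<tau> \<in> I \<Longrightarrow> \<bar>deriv (\<sigma> \<tau>) y\<bar> \<le> M"
begin

definition "s1 \<tau> y = deriv (\<lambda>s. \<sigma> s y) \<tau>"
definition "s2 \<tau> y = deriv (\<sigma> \<tau>) y"

lemma open_strip: "open (I \<times> (UNIV :: 'b::topological_space set))"
  using I by (simp add: open_Times)

lemma convex_interval: "convex I"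
  using I by (simp add: is_interval_convex)

lemma segment_I: "\<tau> \<in> I \<Longrightarrow> \<tau>0 \<in> I \<Longrightarrow> 0 \<le> \<theta> \<Longrightarrow> \<theta> \<le> 1 \<Longrightarrow> \<tau>0 + \<theta> * (\<tau> - \<tau>0) \<in> I"
  using convexD_alt[OF convex_interval, of \<tau>0 \<tau> \<theta>] by (simp add: algebra_simps)

lemma sigma_derivative:
  shows "p \<in> I \<times> UNIV \<Longrightarrow> ((\<lambda>p. \<sigma> (fst p) (snd p)) has_derivative
           (\<lambda>v. s1 (fst p) (snd p) * fst v + s2 (fst p) (snd p) * snd v)) (at p)"
    and "C1_on (I \<times> UNIV) (\<lambda>p. s1 (fst p) (snd p))" "C1_on (I \<times> UNIV) (\<lambda>p. s2 (fst p) (snd p))"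
proof -
  obtain D where D: "\<And>p. p \<in> I \<times> UNIV \<Longrightarrow> ((\<lambda>p. \<sigma> (fst p) (snd p)) has_derivative blinfun_apply (D p)) (at p)"
    "\<And>v. C1_on (I \<times> UNIV) (\<lambda>p. D p v)" by (rule C2_onE[OF C2], rule that)
  have s: "s1 (fst p) (snd p) = D p (1, 0)" "s2 (fst p) (snd p) = D p (0, 1)" if "p \<in> I \<times> UNIV" for p
  proof -
    have *: "((\<lambda>p. \<sigma> (fst p) (snd p)) has_derivative blinfun_apply (D p)) (at (fst p, snd p))"
      using D(1)[OF that] by simp
    show "s1 (fst p) (snd p) = D p (1, 0)" "s2 (fst p) (snd p) = D p (0, 1)"
      using has_real_derivative_slice[OF *, THEN DERIV_imp_deriv] by (simp_all add: s1_def s2_def)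
  qed
  show "((\<lambda>p. \<sigma> (fst p) (snd p)) has_derivative
      (\<lambda>v. s1 (fst p) (snd p) * fst v + s2 (fst p) (snd p) * snd v)) (at p)" if p: "p \<in> I \<times> UNIV"
  proof -
    have "blinfun_apply (D p) = (\<lambda>v. s1 (fst p) (snd p) * fst v + s2 (fst p) (snd p) * snd v)"
    proof
      fix v :: "real \<times> real"
      have "v = fst v *\<^sub>R (1, 0) + snd v *\<^sub>R (0, 1)" by (simp add: prod_eq_iff)
      then have "D p v = fst v *\<^sub>R D p (1, 0) + snd v *\<^sub>R D p (0, 1)"
        by (metis blinfun.add_right blinfun.scaleR_right)
      then show "D p v = s1 (fst p) (snd p) * fst v + s2 (fst p) (snd p) * snd v"
        by (simp add: s[OF p] mult.commute)
    qed
    then show ?thesis using D(1)[OF p] by simp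
  qed
  show "C1_on (I \<times> UNIV) (\<lambda>p. s1 (fst p) (snd p))" "C1_on (I \<times> UNIV) (\<lambda>p. s2 (fst p) (snd p))"
    using s by (auto intro: C1_on_cong[OF open_strip _ D(2)])
qed

lemma C1_sigma: "C1_on (I \<times> UNIV) (\<lambda>p. \<sigma> (fst p) (snd p))"
  by (rule C2_on_imp_C1_on[OF C2])

lemma continuous_on_field:
  assumes "continuous_on S f" "continuous_on S g" "\<And>p. p \<in> S \<Longrightarrow> f p \<in> I"
  shows "continuous_on S (\<lambda>p. \<sigma> (f p) (g p))" "continuous_on S (\<lambda>p. s1 (f p) (g p))"
    "continuous_on S (\<lambda>p. s2 (f p) (g p))"
proof -
  have "continuous_on S (\<lambda>p. (f p, g p))" using assms by (intro continuous_intros)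
  from continuous_on_compose2[OF C1_on_imp_continuous_on[OF C1_sigma] this]
    continuous_on_compose2[OF C1_on_imp_continuous_on[OF sigma_derivative(2)] this]
    continuous_on_compose2[OF C1_on_imp_continuous_on[OF sigma_derivative(3)] this] assms(3)
  show "continuous_on S (\<lambda>p. \<sigma> (f p) (g p))" "continuous_on S (\<lambda>p. s1 (f p) (g p))"
    "continuous_on S (\<lambda>p. s2 (f p) (g p))" by (auto simp: image_subset_iff)
qed

text \<open>Hadamard's averages of the partial derivatives over the segment from (\<tau>0, y0) to
  (\<tau>, y). Unlike the intermediate points of a mean value theorem they depend continuously on
  the end points.\<close>

definition "k1 \<tau>0 y0 \<tau> y = integral {0..1} (\<lambda>\<theta>. s1 (\<tau>0 + \<theta> * (\<tau> - \<tau>0)) (y0 + \<theta> * (y - y0)))"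
definition "k2 \<tau>0 y0 \<tau> y = integral {0..1} (\<lambda>\<theta>. s2 (\<tau>0 + \<theta> * (\<tau> - \<tau>0)) (y0 + \<theta> * (y - y0)))"

lemma sigma_diff:
  assumes t: "\<tau> \<in> I" "\<tau>0 \<in> I"
  shows "\<sigma> \<tau> y - \<sigma> \<tau>0 y0 = (\<tau> - \<tau>0) * k1 \<tau>0 y0 \<tau> y + (y - y0) * k2 \<tau>0 y0 \<tau> y"
    and "\<bar>k1 \<tau>0 y0 \<tau> y\<bar> \<le> M" "\<bar>k2 \<tau>0 y0 \<tau> y\<bar> \<le> M"
proof -
  let ?a = "\<lambda>\<theta>. \<tau>0 + \<theta> * (\<tau> - \<tau>0)" and ?b = "\<lambda>\<theta>. y0 + \<theta> * (y - y0)"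
  have c: "continuous_on {0..1} (\<lambda>\<theta>. s1 (?a \<theta>) (?b \<theta>))" "continuous_on {0..1} (\<lambda>\<theta>. s2 (?a \<theta>) (?b \<theta>))"
    using segment_I[OF t] by (auto intro!: continuous_on_field continuous_intros)
  then have i: "((\<lambda>\<theta>. s1 (?a \<theta>) (?b \<theta>)) has_integral k1 \<tau>0 y0 \<tau> y) {0..1}"
    "((\<lambda>\<theta>. s2 (?a \<theta>) (?b \<theta>)) has_integral k2 \<tau>0 y0 \<tau> y) {0..1}"
    unfolding k1_def k2_def by (auto intro: integrable_integral integrable_continuous_real)
  show "\<bar>k1 \<tau>0 y0 \<tau> y\<bar> \<le> M" "\<bar>k2 \<tau>0 y0 \<tau> y\<bar> \<le> M"
    using has_integral_bound_real[OF M(1) finite.emptyI i(1)] has_integral_bound_real[OF M(1) finite.emptyI i(2)] segment_I[OF t] M(2,3)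
    by (auto simp: s1_def s2_def)
  have "((\<lambda>\<theta>. s1 (?a \<theta>) (?b \<theta>) * (\<tau> - \<tau>0) + s2 (?a \<theta>) (?b \<theta>) * (y - y0)) has_integral
      \<sigma> (?a 1) (?b 1) - \<sigma> (?a 0) (?b 0)) {0..1}"
  proof (rule fundamental_theorem_of_calculus)
    fix \<theta> :: real assume "\<theta> \<in> {0..1}"
    then have "(?a \<theta>, ?b \<theta>) \<in> I \<times> UNIV" using segment_I[OF t] by auto
    moreover have "((\<lambda>\<theta>. (?a \<theta>, ?b \<theta>)) has_derivative (\<lambda>h. (h * (\<tau> - \<tau>0), h * (y - y0)))) (at \<theta>)"
      by (auto intro!: derivative_eq_intros)
    ultimately have "((\<lambda>\<theta>. \<sigma> (?a \<theta>) (?b \<theta>)) has_derivative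
        (\<lambda>h. s1 (?a \<theta>) (?b \<theta>) * (h * (\<tau> - \<tau>0)) + s2 (?a \<theta>) (?b \<theta>) * (h * (y - y0)))) (at \<theta>)"
      using has_derivative_compose[OF _ sigma_derivative(1)] by fastforce
    then show "((\<lambda>\<theta>. \<sigma> (?a \<theta>) (?b \<theta>)) has_vector_derivative
        s1 (?a \<theta>) (?b \<theta>) * (\<tau> - \<tau>0) + s2 (?a \<theta>) (?b \<theta>) * (y - y0)) (at \<theta> within {0..1})"
      by (auto simp: has_vector_derivative_def algebra_simps intro: has_derivative_at_withinI)
  qed simp
  moreover have "((\<lambda>\<theta>. s1 (?a \<theta>) (?b \<theta>) * (\<tau> - \<tau>0) + s2 (?a \<theta>) (?b \<theta>) * (y - y0)) has_integral
      k1 \<tau>0 y0 \<tau> y * (\<tau> - \<tau>0) + k2 \<tau>0 y0 \<tau> y * (y - y0)) {0..1}"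
    by (intro has_integral_add has_integral_mult_left i)
  ultimately have "\<sigma> (?a 1) (?b 1) - \<sigma> (?a 0) (?b 0) = k1 \<tau>0 y0 \<tau> y * (\<tau> - \<tau>0) + k2 \<tau>0 y0 \<tau> y * (y - y0)"
    by (rule has_integral_unique)
  then show "\<sigma> \<tau> y - \<sigma> \<tau>0 y0 = (\<tau> - \<tau>0) * k1 \<tau>0 y0 \<tau> y + (y - y0) * k2 \<tau>0 y0 \<tau> y"
    by (simp add: mult.commute)
qed

lemma sigma_lipschitz: "\<tau> \<in> I \<Longrightarrow> \<bar>\<sigma> \<tau> x - \<sigma> \<tau> y\<bar> \<le> M * \<bar>x - y\<bar>"
  using sigma_diff(1)[of \<tau> \<tau> x y] mult_right_mono[OF sigma_diff(3)[of \<tau> \<tau> y x] abs_ge_zero[of "x - y"]]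
  by (simp add: abs_mult mult.commute)

section \<open>Existence, group property and continuity of the flow\<close>

definition "fl \<tau> \<xi> = (SOME y. y 0 = \<xi> \<and> (\<forall>t. (y has_real_derivative \<sigma> \<tau> (y t)) (at t)))"

lemma fl:
  assumes "\<tau> \<in> I"
  shows fl_0: "fl \<tau> \<xi> 0 = \<xi>" and fl_deriv: "(fl \<tau> \<xi> has_real_derivative \<sigma> \<tau> (fl \<tau> \<xi> t)) (at t)"
  using someI_ex[OF ode_exists[of "\<sigma> \<tau>" M \<xi>]] sigma_lipschitz[OF assms] unfolding fl_def by auto

lemma fl_unique:
  assumes "\<tau> \<in> I" "y 0 = \<xi>" "\<And>t. (y has_real_derivative \<sigma> \<tau> (y t)) (at t)"
  shows "y = fl \<tau> \<xi>"
  using assms fl sigma_lipschitz by (intro ode_unique[of "\<sigma> \<tau>" M]) auto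

lemma fl_shift:
  assumes "\<tau> \<in> I" shows "fl \<tau> (fl \<tau> \<xi> s) t = fl \<tau> \<xi> (s + t)"
proof -
  have "((\<lambda>t. fl \<tau> \<xi> (s + t)) has_real_derivative \<sigma> \<tau> (fl \<tau> \<xi> (s + t))) (at t)" for t
  proof -
    have "((\<lambda>t. s + t) has_real_derivative 1) (at t)"
      by (auto intro!: derivative_eq_intros)
    from DERIV_chain'[OF this fl_deriv[OF assms, of \<xi> "s + t"]] show ?thesis
      by (simp add: mult.commute)
  qed
  then show ?thesis
    using fl_unique[OF assms, of "\<lambda>t. fl \<tau> \<xi> (s + t)"] by (metis add.right_neutral)
qed

lemma fl_inverse: "\<tau> \<in> I \<Longrightarrow> fl \<tau> (fl \<tau> \<xi> t) (- t) = \<xi>" "\<tau> \<in> I \<Longrightarrow> fl \<tau> (fl \<tau> \<xi> (- t)) t = \<xi>"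
  by (simp_all add: fl_shift fl_0)

text \<open>The squared parameter difference is carried along as a constant part of the squared
  distance; this closes the Gronwall inequality although the two vector fields differ. The factor 3
  collects \<open>M * (2 * |d| * |\<tau> - \<tau>0|) \<le> M * (d^2 + (\<tau> - \<tau>0)^2)\<close>
  and the Lipschitz term \<open>2 * M * d^2\<close>.\<close>

lemma fl_gronwall:
  assumes "\<tau> \<in> I" "\<tau>0 \<in> I"
  shows "(fl \<tau> \<xi> t - fl \<tau>0 \<xi>0 t)\<^sup>2 \<le> ((\<xi> - \<xi>0)\<^sup>2 + (\<tau> - \<tau>0)\<^sup>2) * exp (3 * M * \<bar>t\<bar>)"
proof -
  let ?d = "\<lambda>t. fl \<tau> \<xi> t - fl \<tau>0 \<xi>0 t" and ?s = "\<lambda>t. \<sigma> \<tau> (fl \<tau> \<xi> t) - \<sigma> \<tau>0 (fl \<tau>0 \<xi>0 t)"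
  have "(?d t)\<^sup>2 + (\<tau> - \<tau>0)\<^sup>2 \<le> ((?d 0)\<^sup>2 + (\<tau> - \<tau>0)\<^sup>2) * exp (3 * M * \<bar>t\<bar>)"
  proof (rule gronwall_deriv)
    show "((\<lambda>t. (?d t)\<^sup>2 + (\<tau> - \<tau>0)\<^sup>2) has_real_derivative 2 * ?d t * ?s t) (at t)" for t
      by (auto intro!: derivative_eq_intros fl_deriv assms)
    show "\<bar>2 * ?d t * ?s t\<bar> \<le> 3 * M * ((?d t)\<^sup>2 + (\<tau> - \<tau>0)\<^sup>2)" for t
    proof -
      have "\<bar>?s t\<bar> \<le> M * \<bar>\<tau> - \<tau>0\<bar> + M * \<bar>?d t\<bar>"
        unfolding sigma_diff(1)[OF assms]
        by (rule order_trans[OF abs_triangle_ineq])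
          (unfold abs_mult mult.commute[of M], intro add_mono mult_left_mono sigma_diff(2,3)[OF assms] abs_ge_zero)
      then have "2 * \<bar>?d t\<bar> * \<bar>?s t\<bar> \<le> 2 * \<bar>?d t\<bar> * (M * \<bar>\<tau> - \<tau>0\<bar> + M * \<bar>?d t\<bar>)"
        by (intro mult_left_mono) auto
      also have "\<dots> = M * (2 * \<bar>?d t\<bar> * \<bar>\<tau> - \<tau>0\<bar>) + 2 * M * (?d t)\<^sup>2"
        by (simp add: algebra_simps power2_eq_square flip: abs_mult_self_eq[of "?d t"])
      also have "\<dots> \<le> M * (\<bar>?d t\<bar>\<^sup>2 + \<bar>\<tau> - \<tau>0\<bar>\<^sup>2) + 2 * M * (?d t)\<^sup>2"
        by (intro add_right_mono mult_left_mono sum_squares_bound M)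
      also have "\<dots> \<le> 3 * M * ((?d t)\<^sup>2 + (\<tau> - \<tau>0)\<^sup>2)"
        using M(1) by (simp add: algebra_simps)
      finally show ?thesis by (simp only: abs_mult abs_numeral)
    qed
  qed
  then show ?thesis using assms by (simp add: fl_0 add.commute) (smt (verit) zero_le_power2)
qed

lemma continuous_on_fl: "continuous_on ((I \<times> UNIV) \<times> UNIV) (\<lambda>(p, t). fl (fst p) (snd p) t)"
  unfolding continuous_on_def
proof
  fix q0 assume q0: "q0 \<in> (I \<times> (UNIV :: real set)) \<times> (UNIV :: real set)"
  obtain \<tau>0 \<xi>0 t0 where q: "q0 = ((\<tau>0, \<xi>0), t0)" by (metis prod.exhaust)
  have t0: "\<tau>0 \<in> I" using q0 q by simp
  let ?F = "at q0 within (I \<times> UNIV) \<times> (UNIV :: real set)"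
  let ?b = "\<lambda>q :: (real \<times> real) \<times> real. sqrt (((snd (fst q) - \<xi>0)\<^sup>2 + (fst (fst q) - \<tau>0)\<^sup>2) * exp (3 * M * \<bar>snd q\<bar>))"
  have "(?b \<longlongrightarrow> sqrt (((\<xi>0 - \<xi>0)\<^sup>2 + (\<tau>0 - \<tau>0)\<^sup>2) * exp (3 * M * \<bar>t0\<bar>))) ?F"
    unfolding q by (auto intro!: tendsto_eq_intros)
  then have b: "(?b \<longlongrightarrow> 0) ?F" by simp
  have "\<forall>\<^sub>F q in ?F. norm (fl (fst (fst q)) (snd (fst q)) (snd q) - fl \<tau>0 \<xi>0 (snd q)) \<le> ?b q"
    unfolding eventually_at_filter
    by (rule always_eventually) (use fl_gronwall[OF _ t0] in \<open>auto intro!: real_le_rsqrt\<close>)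
  from Lim_null_comparison[OF this b]
  have 1: "((\<lambda>q. fl (fst (fst q)) (snd (fst q)) (snd q) - fl \<tau>0 \<xi>0 (snd q)) \<longlongrightarrow> 0) ?F" .
  have "(snd \<longlongrightarrow> t0) ?F" unfolding q by (auto intro!: tendsto_eq_intros)
  then have 2: "((\<lambda>q. fl \<tau>0 \<xi>0 (snd q)) \<longlongrightarrow> fl \<tau>0 \<xi>0 t0) ?F"
    using DERIV_isCont[OF fl_deriv[OF t0]] by (rule isCont_tendsto_compose[rotated])
  show "((\<lambda>(p, t). fl (fst p) (snd p) t) \<longlongrightarrow> (case q0 of (p, t) \<Rightarrow> fl (fst p) (snd p) t)) ?F"
    using tendsto_add[OF 1 2] by (simp add: case_prod_unfold q)
qed

lemma continuous_on_flI:
  assumes "continuous_on S f" "continuous_on S g" "continuous_on S h" "\<And>p. p \<in> S \<Longrightarrow> f p \<in> I"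
  shows "continuous_on S (\<lambda>p. fl (f p) (g p) (h p))"
proof -
  have "continuous_on S (\<lambda>p. case ((f p, g p), h p) of (p, t) \<Rightarrow> fl (fst p) (snd p) t)"
    by (rule continuous_on_compose2[OF continuous_on_fl]) (use assms in \<open>auto intro!: continuous_intros\<close>)
  then show ?thesis by simp
qed

section \<open>Derivatives of the flow in parameter, initial value and time\<close>

text \<open>Variation of constants: \<open>\<phi>\<^sub>\<xi>\<close> is \<open>la\<close> and \<open>\<phi>\<^sub>\<tau>\<close> is \<open>la * qa\<close>.\<close>

definition "la \<tau> \<xi> t = exp (antideriv (\<lambda>s. s2 \<tau> (fl \<tau> \<xi> s)) t)"
definition "qa \<tau> \<xi> t = antideriv (\<lambda>s. s1 \<tau> (fl \<tau> \<xi> s) / la \<tau> \<xi> s) t"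

text \<open>With the averaged derivatives \<open>K\<close> and \<open>N\<close> the difference of
  two flow lines solves the linear equation \<open>d' = K d + (\<tau> - \<tau>0) N\<close> exactly,
  not only to first order; the right-hand side is its solution by variation of constants.\<close>

lemma fl_diff:
  fixes \<xi> \<xi>0 :: real
  assumes t: "\<tau> \<in> I" "\<tau>0 \<in> I"
  defines "K \<equiv> \<lambda>s. k2 \<tau>0 (fl \<tau>0 \<xi>0 s) \<tau> (fl \<tau> \<xi> s)" and "N \<equiv> \<lambda>s. k1 \<tau>0 (fl \<tau>0 \<xi>0 s) \<tau> (fl \<tau> \<xi> s)"
  assumes c: "continuous_on UNIV K" "continuous_on UNIV N"
  shows "fl \<tau> \<xi> t - fl \<tau>0 \<xi>0 t
    = exp (antideriv K t) * ((\<xi> - \<xi>0) + (\<tau> - \<tau>0) * antideriv (\<lambda>s. N s / exp (antideriv K s)) t)"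
proof -
  let ?E = "\<lambda>t. exp (antideriv K t)" and ?d = "\<lambda>t. fl \<tau> \<xi> t - fl \<tau>0 \<xi>0 t"
  have dK: "(antideriv K has_real_derivative K t) (at t)" for t
    by (rule has_real_derivative_antideriv[OF c(1)])
  have "continuous_on UNIV (antideriv K)"
    using dK by (meson DERIV_isCont continuous_at_imp_continuous_on)
  then have "continuous_on UNIV (\<lambda>s. N s / ?E s)" using c by (intro continuous_intros) auto
  note dN = has_real_derivative_antideriv[OF this]
  let ?h = "\<lambda>t. ?d t / ?E t - (\<tau> - \<tau>0) * antideriv (\<lambda>s. N s / ?E s) t"
  have "(?h has_real_derivative 0) (at t)" for t
  proof -
    have "(?h has_real_derivative ((\<sigma> \<tau> (fl \<tau> \<xi> t) - \<sigma> \<tau>0 (fl \<tau>0 \<xi>0 t)) * ?E t - ?d t * (?E t * K t)) / (?E t * ?E t)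
        - (\<tau> - \<tau>0) * (N t / ?E t)) (at t)"
      by (auto intro!: derivative_eq_intros dN dK fl_deriv t)
    moreover have "((\<sigma> \<tau> (fl \<tau> \<xi> t) - \<sigma> \<tau>0 (fl \<tau>0 \<xi>0 t)) * ?E t - ?d t * (?E t * K t)) / (?E t * ?E t)
        - (\<tau> - \<tau>0) * (N t / ?E t) = 0"
      unfolding sigma_diff(1)[OF t] K_def N_def by (simp add: field_simps)
    ultimately show ?thesis by simp
  qed
  then have "?h t = ?h 0" by (intro DERIV_isconst_all) auto
  then have "?d t / ?E t = (\<xi> - \<xi>0) + (\<tau> - \<tau>0) * antideriv (\<lambda>s. N s / ?E s) t"
    using t by (simp add: fl_0)
  then show ?thesis by (simp add: field_simps)
qed

lemma continuous_on_k:
  assumes t0: "\<tau>0 \<in> I"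
  shows "continuous_on ((I \<times> UNIV) \<times> UNIV) (\<lambda>(p, s). k1 \<tau>0 (fl \<tau>0 \<xi>0 s) (fst p) (fl (fst p) (snd p) s))"
    and "continuous_on ((I \<times> UNIV) \<times> UNIV) (\<lambda>(p, s). k2 \<tau>0 (fl \<tau>0 \<xi>0 s) (fst p) (fl (fst p) (snd p) s))"
  unfolding k1_def k2_def case_prod_unfold cbox_interval[symmetric] using t0
  by (intro integral_continuous_on_param;
      auto simp: case_prod_unfold intro!: continuous_on_field continuous_intros continuous_on_flI segment_I)+

text \<open>The coefficients in \<open>fl_diff\<close> are jointly continuous and multiply
  \<open>\<tau> - \<tau>0\<close> and \<open>\<xi> - \<xi>0\<close>, which vanish at the base point.
  By \<open>has_derivative_continuous_mult\<close> only their values there survive, and these are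
  \<open>la * qa\<close> and \<open>la\<close>.\<close>

lemma fl_has_derivative:
  assumes t0: "\<tau>0 \<in> I"
  shows "((\<lambda>q. fl (fst (fst q)) (snd (fst q)) (snd q)) has_derivative
    (\<lambda>v. la \<tau>0 \<xi>0 t0 * qa \<tau>0 \<xi>0 t0 * fst (fst v) + la \<tau>0 \<xi>0 t0 * snd (fst v) + \<sigma> \<tau>0 (fl \<tau>0 \<xi>0 t0) * snd v))
    (at ((\<tau>0, \<xi>0), t0))"
proof -
  define K where "K = (\<lambda>p s. k2 \<tau>0 (fl \<tau>0 \<xi>0 s) (fst p) (fl (fst p) (snd p) s))"
  define N where "N = (\<lambda>p s. k1 \<tau>0 (fl \<tau>0 \<xi>0 s) (fst p) (fl (fst p) (snd p) s))"
  let ?S = "(I \<times> UNIV) \<times> (UNIV :: real set)" and ?p0 = "(\<tau>0, \<xi>0)"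
  have cK: "continuous_on ?S (\<lambda>(p, s). K p s)" and cN: "continuous_on ?S (\<lambda>(p, s). N p s)"
    using continuous_on_k[OF t0] unfolding K_def N_def by auto
  define E where "E = (\<lambda>p t. exp (antideriv (K p) t))"
  define L where "L = (\<lambda>p t. antideriv (\<lambda>s. N p s / E p s) t)"
  have cE: "continuous_on ?S (\<lambda>(p, s). E p s)"
    using continuous_on_antideriv[OF cK] unfolding E_def case_prod_unfold by (intro continuous_intros)
  have "continuous_on ?S (\<lambda>(p, s). N p s / E p s)"
    using cE cN unfolding case_prod_unfold by (intro continuous_intros) (auto simp: E_def)
  then have cL: "continuous_on ?S (\<lambda>(p, s). L p s)"
    unfolding L_def by (rule continuous_on_antideriv)
  have sl: "continuous_on UNIV (f p)" if "continuous_on ?S (\<lambda>(p, s). f p s)" "fst p \<in> I" for f :: "real \<times> real \<Rightarrow> real \<Rightarrow> real" and p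
  proof -
    have "continuous_on UNIV (\<lambda>s. case (p, s) of (p, s) \<Rightarrow> f p s)"
      by (rule continuous_on_compose2[OF that(1)]) (use that(2) in \<open>auto intro!: continuous_intros simp: mem_Times_iff\<close>)
    then show ?thesis by simp
  qed
  have eq: "fl (fst p) (snd p) t = (E p t * L p t) * (fst p - \<tau>0) + E p t * (snd p - \<xi>0) + fl \<tau>0 \<xi>0 t"
    if "fst p \<in> I" for p t
    using fl_diff[OF that t0, of \<xi>0 "snd p" t] sl[OF cK that] sl[OF cN that]
    unfolding K_def N_def L_def E_def by (simp add: algebra_simps)
  have op: "open ?S" using I by (simp add: open_Times)
  have ic: "isCont (\<lambda>q. E (fst q) (snd q) * L (fst q) (snd q)) (?p0, t0)" "isCont (\<lambda>q. E (fst q) (snd q)) (?p0, t0)"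
    using cE cL t0 continuous_on_eq_continuous_at[OF op]
    by (auto simp: case_prod_unfold intro!: continuous_intros)
  have K0: "K ?p0 s = s2 \<tau>0 (fl \<tau>0 \<xi>0 s)" and N0: "N ?p0 s = s1 \<tau>0 (fl \<tau>0 \<xi>0 s)" for s
    by (simp_all add: K_def N_def k1_def k2_def)
  have E0: "E ?p0 t = la \<tau>0 \<xi>0 t" for t by (simp add: E_def la_def K0[abs_def])
  have L0: "L ?p0 t = qa \<tau>0 \<xi>0 t" for t by (simp add: L_def qa_def N0[abs_def] E0[abs_def])
  have fs: "((\<lambda>q :: (real \<times> real) \<times> real. fl \<tau>0 \<xi>0 (snd q)) has_derivative (\<lambda>v. \<sigma> \<tau>0 (fl \<tau>0 \<xi>0 t0) * snd v)) (at (?p0, t0))"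
    by (rule has_derivative_compose[where f=snd and f'=snd and g="fl \<tau>0 \<xi>0" and g'="\<lambda>h. \<sigma> \<tau>0 (fl \<tau>0 \<xi>0 t0) * h"])
      (use fl_deriv[OF t0, of \<xi>0 t0] in \<open>auto simp: has_field_derivative_def intro!: derivative_eq_intros\<close>)
  have "((\<lambda>q. (E (fst q) (snd q) * L (fst q) (snd q)) * (fst (fst q) - \<tau>0) + E (fst q) (snd q) * (snd (fst q) - \<xi>0)
      + fl \<tau>0 \<xi>0 (snd q)) has_derivative
      (\<lambda>v. (E ?p0 t0 * L ?p0 t0) * fst (fst v) + E ?p0 t0 * snd (fst v) + \<sigma> \<tau>0 (fl \<tau>0 \<xi>0 t0) * snd v)) (at (?p0, t0))"
  proof (intro has_derivative_add fs)
    let ?T = "at (?p0, t0) :: ((real \<times> real) \<times> real) filter"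
    have g: "((\<lambda>q. fst (fst q) - \<tau>0) has_derivative (\<lambda>v. fst (fst v))) ?T"
      "((\<lambda>q. snd (fst q) - \<xi>0) has_derivative (\<lambda>v. snd (fst v))) ?T"
      by (auto intro!: derivative_eq_intros)
    show "((\<lambda>q. (E (fst q) (snd q) * L (fst q) (snd q)) * (fst (fst q) - \<tau>0)) has_derivative
        (\<lambda>v. (E ?p0 t0 * L ?p0 t0) * fst (fst v))) ?T"
      "((\<lambda>q. E (fst q) (snd q) * (snd (fst q) - \<xi>0)) has_derivative (\<lambda>v. E ?p0 t0 * snd (fst v))) ?T"
      using has_derivative_continuous_mult[OF ic(1) g(1)] has_derivative_continuous_mult[OF ic(2) g(2)] by simp_all
  qed
  then show ?thesis
    unfolding E0 L0
    by (rule has_derivative_transform_within_open[OF _ op]) (use t0 eq in \<open>auto simp: mem_Times_iff\<close>)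
qed

text \<open>Regularity is gained in two rounds: the partial derivatives of \<open>fl\<close> are
  continuous, so \<open>fl\<close> is C1; then \<open>s1\<close> and \<open>s2\<close> along the
  flow are C1, because \<sigma> is C2, and so are the integrals that define \<open>la\<close> and
  \<open>qa\<close>.\<close>

lemma fl_C1: "C1_on ((I \<times> UNIV) \<times> UNIV) (\<lambda>q. fl (fst (fst q)) (snd (fst q)) (snd q))"
  and la_C1: "C1_on ((I \<times> UNIV) \<times> UNIV) (\<lambda>q. la (fst (fst q)) (snd (fst q)) (snd q))"
  and qa_C1: "C1_on ((I \<times> UNIV) \<times> UNIV) (\<lambda>q. qa (fst (fst q)) (snd (fst q)) (snd q))"
proof -
  let ?S = "(I \<times> (UNIV :: real set)) \<times> (UNIV :: real set)"
  have cS: "continuous_on ?S (\<lambda>q. s1 (fst (fst q)) (fl (fst (fst q)) (snd (fst q)) (snd q)))"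
    "continuous_on ?S (\<lambda>q. s2 (fst (fst q)) (fl (fst (fst q)) (snd (fst q)) (snd q)))"
    "continuous_on ?S (\<lambda>q. \<sigma> (fst (fst q)) (fl (fst (fst q)) (snd (fst q)) (snd q)))"
    by (auto intro!: continuous_on_field continuous_on_flI continuous_intros)
  have cla: "continuous_on ?S (\<lambda>q. la (fst (fst q)) (snd (fst q)) (snd q))"
    unfolding la_def using continuous_on_antideriv[of "I \<times> UNIV" "\<lambda>p s. s2 (fst p) (fl (fst p) (snd p) s)"] cS
    by (intro continuous_intros) (simp add: case_prod_unfold)
  have cqa: "continuous_on ?S (\<lambda>q. qa (fst (fst q)) (snd (fst q)) (snd q))"
  proof -
    have "continuous_on ?S (\<lambda>q. s1 (fst (fst q)) (fl (fst (fst q)) (snd (fst q)) (snd q))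
        / la (fst (fst q)) (snd (fst q)) (snd q))"
      by (intro continuous_intros cS cla) (auto simp: la_def)
    then show ?thesis
      unfolding qa_def
      using continuous_on_antideriv[of "I \<times> UNIV" "\<lambda>p s. s1 (fst p) (fl (fst p) (snd p) s) / la (fst p) (snd p) s"]
      by (simp add: case_prod_unfold)
  qed
  show fl1: "C1_on ?S (\<lambda>q. fl (fst (fst q)) (snd (fst q)) (snd q))"
    by (rule C1_onI[OF fl_has_derivative[of "fst (fst q)" "snd (fst q)" "snd q" for q, simplified]])
      (auto intro!: continuous_intros cS cla cqa)
  have ci: "C1_on ?S (\<lambda>q. fst (fst q))"
    by (intro C1_on_bounded_linear bounded_linear_intros)
  have o: "open (I \<times> (UNIV::real set))" "convex (I \<times> (UNIV::real set))"
    using open_strip convex_interval by (auto intro: convex_Times)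
  have s: "C1_on ?S (\<lambda>q. s1 (fst (fst q)) (fl (fst (fst q)) (snd (fst q)) (snd q)))"
    "C1_on ?S (\<lambda>q. s2 (fst (fst q)) (fl (fst (fst q)) (snd (fst q)) (snd q)))"
    using C1_on_compose_pair[OF sigma_derivative(2) _ ci fl1] C1_on_compose_pair[OF sigma_derivative(3) _ ci fl1]
    by auto
  have p: "C1_on ?S (\<lambda>q. antideriv (\<lambda>s. s2 (fst (fst q)) (fl (fst (fst q)) (snd (fst q)) s)) (snd q))"
    using C1_on_antideriv[OF o, of "\<lambda>p s. s2 (fst p) (fl (fst p) (snd p) s)"] s(2) by simp
  then show "C1_on ?S (\<lambda>q. la (fst (fst q)) (snd (fst q)) (snd q))"
    unfolding la_def by (rule C1_on_exp)
  have "C1_on ?S (\<lambda>q. s1 (fst (fst q)) (fl (fst (fst q)) (snd (fst q)) (snd q))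
      * exp ((-1) * antideriv (\<lambda>s. s2 (fst (fst q)) (fl (fst (fst q)) (snd (fst q)) s)) (snd q)))"
    by (intro C1_on_mult s C1_on_exp p C1_on_const)
  then show "C1_on ?S (\<lambda>q. qa (fst (fst q)) (snd (fst q)) (snd q))"
    unfolding qa_def using C1_on_antideriv[OF o, of "\<lambda>p s. s1 (fst p) (fl (fst p) (snd p) s) / la (fst p) (snd p) s"]
    by (simp add: la_def exp_minus divide_inverse)
qed

end

section \<open>Stieltjes integrals\<close>

lemma subdivision:
  fixes u v d :: real
  assumes "u \<le> v" "d > 0"
  obtains N :: nat and p where "p 0 = u" "p N = v" "\<And>i. i < N \<Longrightarrow> p i < p (Suc i)"
    "\<And>i. i < N \<Longrightarrow> p (Suc i) - p i < d" "\<And>i. i \<le> N \<Longrightarrow> u \<le> p i \<and> p i \<le> v"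
proof (cases "u = v")
  case True
  show ?thesis by (rule that[of "\<lambda>_. u" 0]) (use True in auto)
next
  case False
  obtain n :: nat where n: "(v - u) / d < real n" using reals_Archimedean2 by blast
  define N where "N = Suc n"
  have N: "(v - u) / d < real N" "N > 0" using n by (auto simp: N_def)
  define p where "p = (\<lambda>i. u + (v - u) * (real i / real N))"
  have s: "p (Suc i) - p i = (v - u) / real N" for i
    using N by (simp add: p_def field_simps)
  have "(v - u) / real N < d" using N assms by (simp add: field_simps)
  moreover have "(v - u) / real N > 0" using N assms False by simp
  moreover have "u \<le> p i \<and> p i \<le> v" if "i \<le> N" for i
    using mult_left_le[of "real i / real N" "v - u"] that N assms by (auto simp: p_def)
  ultimately show ?thesis
    using s N by (intro that[of p N]) (auto simp: p_def, smt (verit) s)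
qed

lemma sum_telescope_clock: "(\<Sum>i<N. g (p (Suc i)) - g (p i)) = g (p N) - (g (p 0) :: real)"
  by (rule sum_lessThan_telescope)

lemma chain_mono:
  fixes p :: "nat \<Rightarrow> real"
  assumes "\<And>i. i < n \<Longrightarrow> p i \<le> p (Suc i)" "i \<le> j" "j \<le> n"
  shows "p i \<le> p j"
  using assms(2,3)
proof (induction j rule: dec_induct)
  case (step k)
  then show ?case using assms(1)[of k] by simp
qed simp

lemma has_RS_integral_unique:
  assumes "has_RS_integral f g a b J" "has_RS_integral f g a b K" "a \<le> b"
  shows "J = K"
proof (rule ccontr)
  assume "J \<noteq> K"
  then have e: "\<bar>J - K\<bar> / 2 > 0" by simp
  obtain d where d: "d > 0" "\<And>p \<xi> n. tagged_div_fine a b d p \<xi> n \<Longrightarrow> \<bar>RS_sum f g p \<xi> n - J\<bar> < \<bar>J - K\<bar> / 2"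
    using assms(1) e unfolding has_RS_integral_def by blast
  obtain d' where d': "d' > 0" "\<And>p \<xi> n. tagged_div_fine a b d' p \<xi> n \<Longrightarrow> \<bar>RS_sum f g p \<xi> n - K\<bar> < \<bar>J - K\<bar> / 2"
    using assms(2) e unfolding has_RS_integral_def by blast
  obtain N p where p: "p 0 = a" "p N = b" "\<And>i. i < N \<Longrightarrow> p i < p (Suc i)"
    "\<And>i. i < N \<Longrightarrow> p (Suc i) - p i < min d d'"
    using subdivision[OF assms(3), of "min d d'"] d(1) d'(1) by (metis min_less_iff_conj)
  then have "tagged_div_fine a b d p p N" "tagged_div_fine a b d' p p N"
    unfolding tagged_div_fine_def by (auto simp: less_imp_le)
  from d(2)[OF this(1)] d'(2)[OF this(2)] show False by (auto simp: abs_if split: if_splits)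
qed

lemma uniformly_continuous_01:
  fixes f :: "real \<Rightarrow> real"
  assumes "continuous_on {0..1} f" "e > 0"
  obtains d where "d > 0" "\<And>u v. 0 \<le> u \<Longrightarrow> u \<le> v \<Longrightarrow> v \<le> 1 \<Longrightarrow> v - u < d \<Longrightarrow> \<bar>f v - f u\<bar> < e"
proof -
  have "uniformly_continuous_on {0..1} f" using assms(1) by (simp add: compact_uniformly_continuous)
  then obtain d where d: "d > 0" "\<forall>u\<in>{0..1}. \<forall>v\<in>{0..1}. dist v u < d \<longrightarrow> dist (f v) (f u) < e"
    using assms(2) unfolding uniformly_continuous_on_def by blast
  show ?thesis
  proof (rule that[OF d(1)])
    fix u v :: real assume uv: "0 \<le> u" "u \<le> v" "v \<le> 1" "v - u < d"
    then have "u \<in> {0..1}" "v \<in> {0..1}" "dist v u < d" by (auto simp: dist_real_def)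
    with d(2) show "\<bar>f v - f u\<bar> < e" by (auto simp: dist_real_def)
  qed
qed

text \<open>The variation on \<open>[0, v]\<close> is compared with the sums along an almost optimal chain for \<open>[0, 1]\<close>,
  restricted to subintervals by clamping: on a short interval such a clamped sum is small.\<close>

lemma CBV01_dominated:
  assumes "CBV01 f"
  shows "\<exists>V. continuous_on {0..1} V \<and> (\<forall>u v. 0 \<le> u \<longrightarrow> u \<le> v \<longrightarrow> v \<le> 1 \<longrightarrow> \<bar>f v - f u\<bar> \<le> V v - V u)"
proof -
  have cf: "continuous_on {0..1} f" using assms by (simp add: CBV01_def)
  define ch :: "real \<Rightarrow> real \<Rightarrow> (nat \<Rightarrow> real) \<Rightarrow> nat \<Rightarrow> bool"
    where "ch = (\<lambda>a b p n. p 0 = a \<and> p n = b \<and> (\<forall>i<n. p i \<le> p (Suc i)))"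
  define S :: "(nat \<Rightarrow> real) \<Rightarrow> nat \<Rightarrow> real" where "S = (\<lambda>p n. \<Sum>i<n. \<bar>f (p (Suc i)) - f (p i)\<bar>)"
  obtain M where M: "\<And>p n. ch 0 1 p n \<Longrightarrow> S p n \<le> M"
    using assms unfolding CBV01_def bounded_variation_on_def ch_def S_def by blast
  have cat: "\<exists>r k. ch a c r k \<and> S r k = S p n + S q l" if p: "ch a b p n" and q: "ch b c q l" for a b c p q n l
  proof (intro exI conjI)
    define r where "r = (\<lambda>i. if i \<le> n then p i else q (i - n))"
    have rq: "r (n + i) = q i" for i using p q by (auto simp: r_def ch_def)
    have rp: "r i = p i" if "i \<le> n" for i using that by (simp add: r_def)
    have "r i \<le> r (Suc i)" if "i < n + l" for i
    proof (cases "i < n")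
      case True then show ?thesis using p rp by (simp add: ch_def)
    next
      case False
      then obtain j where "i = n + j" "j < l" using \<open>i < n + l\<close> by (metis le_Suc_ex nat_add_left_cancel_less not_less)
      then show ?thesis using q rq[of j] rq[of "Suc j"] by (simp add: ch_def)
    qed
    then show "ch a c r (n + l)" using p q rq[of l] rp[of 0] by (simp add: ch_def)
    have "S r (n + l) = S r n + (\<Sum>i<l. \<bar>f (r (Suc (n + i))) - f (r (n + i))\<bar>)"
      unfolding S_def by (induction l) auto
    also have "S r n = S p n" unfolding S_def using rp by (intro sum.cong) auto
    also have "(\<Sum>i<l. \<bar>f (r (Suc (n + i))) - f (r (n + i))\<bar>) = S q l"
      unfolding S_def using rq[of "Suc _"] rq by (intro sum.cong) auto
    finally show "S r (n + l) = S p n + S q l" .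
  qed
  have one: "ch a b (\<lambda>i. if i = 0 then a else b) 1 \<and> S (\<lambda>i. if i = 0 then a else b) 1 = \<bar>f b - f a\<bar>" if "a \<le> b" for a b
    using that by (simp add: ch_def S_def)
  define V where "V = (\<lambda>t. Sup {S p n |p n. ch 0 t p n})"
  have bd: "S p n \<le> M" if c: "ch 0 t p n" and t: "t \<le> 1" for t p n
  proof -
    obtain r k where "ch 0 1 r k" "S r k = S p n + \<bar>f 1 - f t\<bar>"
      using cat[OF c conjunct1[OF one[OF t]]] one[OF t] by auto
    then show ?thesis using M[of r k] by linarith
  qed
  have up: "S p n \<le> V t" if "ch 0 t p n" "t \<le> 1" for t p n
    unfolding V_def using that bd by (intro cSup_upper bdd_aboveI[of _ M]) auto
  have low: "V t \<le> c" if "0 \<le> t" "\<And>p n. ch 0 t p n \<Longrightarrow> S p n \<le> c" for t c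
    unfolding V_def using one[OF that(1)] that(2) by (intro cSup_least) auto
  have V: "V u + S q l \<le> V v" if "0 \<le> u" "ch u v q l" "v \<le> 1" for u v q l
  proof -
    have "V u \<le> V v - S q l"
    proof (rule low[OF that(1)])
      fix p n assume "ch 0 u p n"
      from cat[OF this that(2)] obtain r k where "ch 0 v r k" "S r k = S p n + S q l" by blast
      then show "S p n \<le> V v - S q l" using up[of v r k] that by linarith
    qed
    then show ?thesis by simp
  qed
  have dom: "\<bar>f v - f u\<bar> \<le> V v - V u" if "0 \<le> u" "u \<le> v" "v \<le> 1" for u v
    using V[OF that(1) conjunct1[OF one[OF that(2)]] that(3)] one[OF that(2)] by linarith
  have "continuous_on {0..1} V"
    unfolding continuous_on_iff
  proof (intro ballI allI impI)
    fix x e :: real assume x: "x \<in> {0..1}" and e: "e > 0"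
    have "\<exists>p n. ch 0 1 p n \<and> S p n > V 1 - e / 3"
      using low[of 1 "V 1 - e / 3"] e by force
    then obtain p n where p: "ch 0 1 p n" "S p n > V 1 - e / 3" by blast
    \<comment> \<open>The almost optimal chain is fixed before \<open>d\<close>: its
      \<open>n\<close> steps, clamped to a short interval, then contribute at most
      \<open>e / 3\<close> in total.\<close>
    have e': "e / 3 / (real n + 1) > 0" using e by simp
    obtain d where d: "d > 0" "\<And>u v. 0 \<le> u \<Longrightarrow> u \<le> v \<Longrightarrow> v \<le> 1 \<Longrightarrow> v - u < d \<Longrightarrow> \<bar>f v - f u\<bar> < e / 3 / (real n + 1)"
      by (rule uniformly_continuous_01[OF cf e'], rule that)
    have key: "V v - V u < e" if uv: "0 \<le> u" "u \<le> v" "v \<le> 1" "v - u < d" for u v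
    proof -
      define c where "c = (\<lambda>a b t :: real. min b (max a t))"
      have pm: "p i \<le> p j" if "i \<le> j" "j \<le> n" for i j
      by (rule chain_mono[OF _ that]) (use p(1) in \<open>auto simp: ch_def\<close>)
      have p01: "0 \<le> p i \<and> p i \<le> 1" if "i \<le> n" for i
        using pm[of 0 i] pm[of i n] that p(1) by (auto simp: ch_def)
      have chc: "ch a b (\<lambda>i. c a b (p i)) n" if "0 \<le> a" "a \<le> b" "b \<le> 1" for a b
        using that p(1) by (auto simp: ch_def c_def)
      \<comment> \<open>Wherever \<open>t\<close> lies, the three clamped points are
        \<open>t\<close>, \<open>u\<close> and \<open>v\<close> in some order, so every increment of
        \<open>f\<close> is the sum of its three clamped increments.\<close>
      have split: "f (c 0 u t) + f (c u v t) + f (c v 1 t) = f t + f u + f v" if "0 \<le> t" "t \<le> 1" for t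
        using that uv by (cases "t \<le> u"; cases "t \<le> v") (auto simp: c_def min_def max_def)
      have "S p n \<le> S (\<lambda>i. c 0 u (p i)) n + S (\<lambda>i. c u v (p i)) n + S (\<lambda>i. c v 1 (p i)) n"
        unfolding S_def sum.distrib[symmetric]
      proof (rule sum_mono)
        fix i assume "i \<in> {..<n}"
        then have "0 \<le> p i" "p i \<le> p (Suc i)" "p (Suc i) \<le> 1" using p01[of i] p01[of "Suc i"] p(1) by (auto simp: ch_def)
        then show "\<bar>f (p (Suc i)) - f (p i)\<bar> \<le> \<bar>f (c 0 u (p (Suc i))) - f (c 0 u (p i))\<bar> +
           \<bar>f (c u v (p (Suc i))) - f (c u v (p i))\<bar> + \<bar>f (c v 1 (p (Suc i))) - f (c v 1 (p i))\<bar>"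
          using split[of "p i"] split[of "p (Suc i)"] by linarith
      qed
      also have "S (\<lambda>i. c 0 u (p i)) n \<le> V u" by (rule up[OF chc]) (use uv in auto)
      also have "S (\<lambda>i. c u v (p i)) n \<le> (\<Sum>i<n. e / 3 / (real n + 1))"
        unfolding S_def
      proof (rule sum_mono, rule less_imp_le, rule d(2))
        fix i assume "i \<in> {..<n}"
        then have "p i \<le> p (Suc i)" using p(1) by (auto simp: ch_def)
        then show "c u v (p i) \<le> c u v (p (Suc i))" "0 \<le> c u v (p i)" "c u v (p (Suc i)) \<le> 1"
          "c u v (p (Suc i)) - c u v (p i) < d"
          using uv by (auto simp: c_def min_def max_def)
      qed
      also have "\<dots> \<le> e / 3" using e by (simp add: field_simps)
      also have "S (\<lambda>i. c v 1 (p i)) n \<le> V 1 - V v"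
        using V[OF _ chc, of v 1] uv by simp
      finally show ?thesis using p(2) e by simp
    qed
    have "dist (V y) (V x) < e" if "y \<in> {0..1}" "dist y x < d" for y
      using key[of x y] key[of y x] dom[of x y] dom[of y x] that x
      by (cases "x \<le> y") (auto simp: dist_real_def abs_if split: if_splits)
    with d(1) show "\<exists>d>0. \<forall>y\<in>{0..1}. dist y x < d \<longrightarrow> dist (V y) (V x) < e" by blast
  qed
  with dom show ?thesis by blast
qed

lemma local_bound_global:
  fixes Z \<mu> :: "real \<Rightarrow> real"
  assumes d: "d > 0" "\<And>a b. u \<le> a \<Longrightarrow> a \<le> b \<Longrightarrow> b \<le> v \<Longrightarrow> b - a < d \<Longrightarrow> \<bar>Z b - Z a\<bar> \<le> \<mu> b - \<mu> a"
    and uv: "u \<le> v"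
  shows "\<bar>Z v - Z u\<bar> \<le> \<mu> v - \<mu> u"
proof -
  obtain N p where p: "p 0 = u" "p N = v" "\<And>i. i < N \<Longrightarrow> p i < p (Suc i)"
    "\<And>i. i < N \<Longrightarrow> p (Suc i) - p i < d" "\<And>i. i \<le> N \<Longrightarrow> u \<le> p i \<and> p i \<le> v"
    by (rule subdivision[OF uv d(1)], rule that)
  have "\<bar>Z v - Z u\<bar> = \<bar>\<Sum>i<N. Z (p (Suc i)) - Z (p i)\<bar>"
    using p by (simp add: sum_telescope_clock)
  also have "\<dots> \<le> (\<Sum>i<N. \<mu> (p (Suc i)) - \<mu> (p i))"
    by (rule order_trans[OF sum_abs]) (intro sum_mono d(2), use p in \<open>auto simp: less_imp_le\<close>)
  also have "\<dots> = \<mu> v - \<mu> u"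
    using p by (simp add: sum_telescope_clock)
  finally show ?thesis .
qed

text \<open>The lower bound by the length makes \<open>m\<close> strictly increasing and lets the
  identity, the integrator of the ds-integral, count as Lipschitz.\<close>

locale clock =
  fixes m :: "real \<Rightarrow> real"
  assumes m_cont: "continuous_on {0..1} m"
    and m_inc: "\<And>u v. 0 \<le> u \<Longrightarrow> u \<le> v \<Longrightarrow> v \<le> 1 \<Longrightarrow> v - u \<le> m v - m u"
begin

definition "lipm g \<longleftrightarrow> (\<exists>C\<ge>0. \<forall>u v. 0 \<le> u \<longrightarrow> u \<le> v \<longrightarrow> v \<le> 1 \<longrightarrow> \<bar>g v - g u\<bar> \<le> C * (m v - m u))"

text \<open>\<open>dZ = f dg\<close> locally, up to errors that are small against the clock.\<close>

definition "stdiff Z f g \<longleftrightarrow> (\<forall>e>0. \<exists>d>0. \<forall>u v. 0 \<le> u \<longrightarrow> u \<le> v \<longrightarrow> v \<le> 1 \<longrightarrow> v - u < d \<longrightarrow>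
    \<bar>Z v - Z u - f u * (g v - g u)\<bar> \<le> e * (m v - m u))"

lemma m_mono: "0 \<le> u \<Longrightarrow> u \<le> v \<Longrightarrow> v \<le> 1 \<Longrightarrow> m u \<le> m v"
  using m_inc[of u v] by linarith

lemma lipmI: "0 \<le> C \<Longrightarrow> (\<And>u v. 0 \<le> u \<Longrightarrow> u \<le> v \<Longrightarrow> v \<le> 1 \<Longrightarrow> \<bar>g v - g u\<bar> \<le> C * (m v - m u)) \<Longrightarrow> lipm g"
  unfolding lipm_def by blast

lemma lipmE:
  assumes "lipm g"
  obtains C where "C \<ge> 0" "\<And>u v. 0 \<le> u \<Longrightarrow> u \<le> v \<Longrightarrow> v \<le> 1 \<Longrightarrow> \<bar>g v - g u\<bar> \<le> C * (m v - m u)"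
  using assms unfolding lipm_def by blast

lemma lipm_const: "lipm (\<lambda>_. c)" by (rule lipmI[of 0]) auto

lemma lipm_id: "lipm (\<lambda>t. t)" by (rule lipmI[of 1]) (use m_inc in auto)

lemma lipm_add:
  assumes "lipm f" "lipm g" shows "lipm (\<lambda>t. f t + g t)"
proof -
  obtain C where C: "C \<ge> 0" "\<And>u v. 0 \<le> u \<Longrightarrow> u \<le> v \<Longrightarrow> v \<le> 1 \<Longrightarrow> \<bar>f v - f u\<bar> \<le> C * (m v - m u)" by (rule lipmE[OF assms(1)], rule that)
  obtain D where D: "D \<ge> 0" "\<And>u v. 0 \<le> u \<Longrightarrow> u \<le> v \<Longrightarrow> v \<le> 1 \<Longrightarrow> \<bar>g v - g u\<bar> \<le> D * (m v - m u)" by (rule lipmE[OF assms(2)], rule that)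
  show ?thesis
  proof (rule lipmI)
    fix u v :: real assume "0 \<le> u" "u \<le> v" "v \<le> 1"
    then show "\<bar>f v + g v - (f u + g u)\<bar> \<le> (C + D) * (m v - m u)" using C(2)[of u v] D(2)[of u v] by (simp add: algebra_simps)
  qed (use C D in auto)
qed

lemma lipm_cmult:
  assumes "lipm f" shows "lipm (\<lambda>t. c * f t)"
proof -
  obtain C where C: "C \<ge> 0" "\<And>u v. 0 \<le> u \<Longrightarrow> u \<le> v \<Longrightarrow> v \<le> 1 \<Longrightarrow> \<bar>f v - f u\<bar> \<le> C * (m v - m u)" by (rule lipmE[OF assms(1)], rule that)
  show ?thesis
    by (rule lipmI[of "\<bar>c\<bar> * C"]) (use C in \<open>auto simp: abs_mult mult.assoc mult_left_mono simp flip: right_diff_distrib\<close>)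
qed

lemma lipm_diff: "lipm f \<Longrightarrow> lipm g \<Longrightarrow> lipm (\<lambda>t. f t - g t)"
  using lipm_add[OF _ lipm_cmult[of g "-1"]] by simp

lemma m_uniform:
  assumes "e > 0"
  obtains d where "d > 0" "\<And>u v. 0 \<le> u \<Longrightarrow> u \<le> v \<Longrightarrow> v \<le> 1 \<Longrightarrow> v - u < d \<Longrightarrow> m v - m u < e"
proof -
  obtain d where d: "d > 0" "\<And>u v. 0 \<le> u \<Longrightarrow> u \<le> v \<Longrightarrow> v \<le> 1 \<Longrightarrow> v - u < d \<Longrightarrow> \<bar>m v - m u\<bar> < e"
    by (rule uniformly_continuous_01[OF m_cont assms], rule that)
  show ?thesis by (rule that[OF d(1)]) (use d(2) in \<open>force simp: abs_less_iff\<close>)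
qed

lemma lipm_continuous_on:
  assumes "lipm g" shows "continuous_on {0..1} g"
proof -
  obtain C where C: "C \<ge> 0" "\<And>u v. 0 \<le> u \<Longrightarrow> u \<le> v \<Longrightarrow> v \<le> 1 \<Longrightarrow> \<bar>g v - g u\<bar> \<le> C * (m v - m u)" by (rule lipmE[OF assms(1)], rule that)
  show ?thesis
    unfolding continuous_on_iff
  proof (intro ballI allI impI)
    fix x e :: real assume x: "x \<in> {0..1}" and e: "e > 0"
    obtain d where d: "d > 0" "\<And>u v. 0 \<le> u \<Longrightarrow> u \<le> v \<Longrightarrow> v \<le> 1 \<Longrightarrow> v - u < d \<Longrightarrow> m v - m u < e / (C + 1)"
      using m_uniform[of "e / (C + 1)"] e C(1) by auto
    have k: "\<bar>g v - g u\<bar> < e" if uv: "0 \<le> u" "u \<le> v" "v \<le> 1" "v - u < d" for u v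
    proof -
      have "C * (m v - m u) \<le> (C + 1) * (m v - m u)" using m_mono[of u v] uv by (intro mult_right_mono) auto
      also have "\<dots> < e" using d(2)[OF uv] C(1) by (simp add: pos_less_divide_eq mult.commute)
      finally show ?thesis using C(2)[OF uv(1-3)] by linarith
    qed
    have "dist (g y) (g x) < e" if "y \<in> {0..1}" "dist y x < d" for y
      using k[of x y] k[of y x] that x by (cases "x \<le> y") (auto simp: dist_real_def abs_minus_commute)
    with d(1) show "\<exists>d>0. \<forall>y\<in>{0..1}. dist y x < d \<longrightarrow> dist (g y) (g x) < e" by blast
  qed
qed

lemma lipm_CBV01:
  assumes "lipm g" shows "CBV01 g"
proof -
  obtain C where C: "C \<ge> 0" "\<And>u v. 0 \<le> u \<Longrightarrow> u \<le> v \<Longrightarrow> v \<le> 1 \<Longrightarrow> \<bar>g v - g u\<bar> \<le> C * (m v - m u)" by (rule lipmE[OF assms(1)], rule that)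
  have "(\<Sum>i<n. \<bar>g (p (Suc i)) - g (p i)\<bar>) \<le> C * (m 1 - m 0)"
    if p: "p 0 = 0" "p n = 1" "\<forall>i<n. p i \<le> p (Suc i)" for p n
  proof -
    have pm: "p i \<le> p j" if "i \<le> j" "j \<le> n" for i j
      by (rule chain_mono[OF _ that]) (use p in auto)
    have "(\<Sum>i<n. \<bar>g (p (Suc i)) - g (p i)\<bar>) \<le> (\<Sum>i<n. C * (m (p (Suc i)) - m (p i)))"
    proof (intro sum_mono C(2))
      fix i assume "i \<in> {..<n}"
      then show "0 \<le> p i" "p i \<le> p (Suc i)" "p (Suc i) \<le> 1"
        using pm[of 0 i] pm[of "Suc i" n] p by auto
    qed
    also have "\<dots> = C * (m 1 - m 0)"
      using sum_telescope_clock[of m p n] p by (simp flip: sum_distrib_left)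
    finally show ?thesis .
  qed
  then show ?thesis
    unfolding CBV01_def bounded_variation_on_def using lipm_continuous_on[OF assms] by blast
qed

text \<open>Increments that are o(clock) on short intervals add up to at most \<open>e\<close> times
  the increase of the clock on the whole interval, for every \<open>e\<close>.\<close>

lemma local_null_const:
  assumes d: "\<And>e. e > 0 \<Longrightarrow> \<exists>d>0. \<forall>a b. u \<le> a \<longrightarrow> a \<le> b \<longrightarrow> b \<le> v \<longrightarrow> b - a < d \<longrightarrow> \<bar>Z b - Z a\<bar> \<le> e * (m b - m a)"
    and uv: "0 \<le> u" "u \<le> v" "v \<le> 1"
  shows "Z v = Z u"
proof -
  have "\<bar>Z v - Z u\<bar> \<le> e" if "e > 0" for e
  proof -
    have "e / (m v - m u + 1) > 0" using that m_mono[OF uv] by simp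
    from d[OF this] obtain d where "d > 0" "\<And>a b. u \<le> a \<Longrightarrow> a \<le> b \<Longrightarrow> b \<le> v \<Longrightarrow> b - a < d \<Longrightarrow>
        \<bar>Z b - Z a\<bar> \<le> e / (m v - m u + 1) * (m b - m a)" by blast
    from local_bound_global[of d u v Z "\<lambda>t. e / (m v - m u + 1) * m t", OF this[unfolded right_diff_distrib] uv(2)]
    have "\<bar>Z v - Z u\<bar> \<le> e / (m v - m u + 1) * m v - e / (m v - m u + 1) * m u" .
    then have "\<bar>Z v - Z u\<bar> \<le> e / (m v - m u + 1) * (m v - m u)" by (simp only: right_diff_distrib)
    also have "\<dots> \<le> e" using that m_mono[OF uv] by (simp add: field_simps)
    finally show ?thesis .
  qed
  then have "\<bar>Z v - Z u\<bar> \<le> 0" by (rule field_le_epsilon[where y=0, simplified])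
  then show ?thesis by simp
qed

lemma stdiffD:
  assumes "stdiff Z f g" "e > 0"
  obtains d where "d > 0" "\<And>u v. 0 \<le> u \<Longrightarrow> u \<le> v \<Longrightarrow> v \<le> 1 \<Longrightarrow> v - u < d \<Longrightarrow>
    \<bar>Z v - Z u - f u * (g v - g u)\<bar> \<le> e * (m v - m u)"
  using assms unfolding stdiff_def by blast

lemma stdiffI:
  assumes "\<And>e. e > 0 \<Longrightarrow> \<exists>d>0. \<forall>u v. 0 \<le> u \<longrightarrow> u \<le> v \<longrightarrow> v \<le> 1 \<longrightarrow> v - u < d \<longrightarrow>
    \<bar>Z v - Z u - f u * (g v - g u)\<bar> \<le> e * (m v - m u)"
  shows "stdiff Z f g"
  using assms unfolding stdiff_def by blast

lemma stdiff_add: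
  assumes "stdiff Z f g" "stdiff Y h k" "\<And>u v. 0 \<le> u \<Longrightarrow> u \<le> v \<Longrightarrow> v \<le> 1 \<Longrightarrow> F u * (G v - G u) = f u * (g v - g u) + h u * (k v - k u)"
  shows "stdiff (\<lambda>t. Z t + Y t) F G"
proof (rule stdiffI)
  fix e :: real assume "e > 0"
  then have e: "e / 2 > 0" by simp
  obtain d1 where d1: "d1 > 0" "\<And>u v. 0 \<le> u \<Longrightarrow> u \<le> v \<Longrightarrow> v \<le> 1 \<Longrightarrow> v - u < d1 \<Longrightarrow>
    \<bar>Z v - Z u - f u * (g v - g u)\<bar> \<le> e / 2 * (m v - m u)" using stdiffD[OF assms(1) e] by blast
  obtain d2 where d2: "d2 > 0" "\<And>u v. 0 \<le> u \<Longrightarrow> u \<le> v \<Longrightarrow> v \<le> 1 \<Longrightarrow> v - u < d2 \<Longrightarrow>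
    \<bar>Y v - Y u - h u * (k v - k u)\<bar> \<le> e / 2 * (m v - m u)" using stdiffD[OF assms(2) e] by blast
  show "\<exists>d>0. \<forall>u v. 0 \<le> u \<longrightarrow> u \<le> v \<longrightarrow> v \<le> 1 \<longrightarrow> v - u < d \<longrightarrow>
      \<bar>Z v + Y v - (Z u + Y u) - F u * (G v - G u)\<bar> \<le> e * (m v - m u)"
  proof (intro exI[of _ "min d1 d2"] conjI allI impI)
    fix u v :: real assume uv: "0 \<le> u" "u \<le> v" "v \<le> 1" "v - u < min d1 d2"
    have uv': "v - u < d1" "v - u < d2" using uv(4) by auto
    have "e / 2 * (m v - m u) + e / 2 * (m v - m u) = e * (m v - m u)" by (simp add: field_simps)
    then show "\<bar>Z v + Y v - (Z u + Y u) - F u * (G v - G u)\<bar> \<le> e * (m v - m u)"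
      using d1(2)[OF uv(1-3) uv'(1)] d2(2)[OF uv(1-3) uv'(2)] assms(3)[OF uv(1-3)] by linarith
  qed (use d1 d2 in auto)
qed

lemma stdiff_cmult:
  assumes "stdiff Z f g" shows "stdiff (\<lambda>t. c * Z t) (\<lambda>t. c * f t) g"
proof (rule stdiffI)
  fix e :: real assume "e > 0"
  then have e: "e / (\<bar>c\<bar> + 1) > 0" by simp
  obtain d where d: "d > 0" "\<And>u v. 0 \<le> u \<Longrightarrow> u \<le> v \<Longrightarrow> v \<le> 1 \<Longrightarrow> v - u < d \<Longrightarrow>
    \<bar>Z v - Z u - f u * (g v - g u)\<bar> \<le> e / (\<bar>c\<bar> + 1) * (m v - m u)" using stdiffD[OF assms(1) e] by blast
  show "\<exists>d>0. \<forall>u v. 0 \<le> u \<longrightarrow> u \<le> v \<longrightarrow> v \<le> 1 \<longrightarrow> v - u < d \<longrightarrow>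
      \<bar>c * Z v - c * Z u - c * f u * (g v - g u)\<bar> \<le> e * (m v - m u)"
  proof (intro exI[of _ d] conjI allI impI)
    fix u v :: real assume uv: "0 \<le> u" "u \<le> v" "v \<le> 1" "v - u < d"
    have "\<bar>c * Z v - c * Z u - c * f u * (g v - g u)\<bar> = \<bar>c\<bar> * \<bar>Z v - Z u - f u * (g v - g u)\<bar>"
      by (simp add: algebra_simps flip: abs_mult)
    also have "\<dots> \<le> (\<bar>c\<bar> + 1) * (e / (\<bar>c\<bar> + 1) * (m v - m u))"
      using d(2)[OF uv] by (intro mult_mono) auto
    finally show "\<bar>c * Z v - c * Z u - c * f u * (g v - g u)\<bar> \<le> e * (m v - m u)" by simp
  qed (use d in auto)
qed

lemma stdiff_diff: "stdiff Z f g \<Longrightarrow> stdiff Y f k \<Longrightarrow> stdiff (\<lambda>t. Z t - Y t) f (\<lambda>t. g t - k t)"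
  by (drule stdiff_cmult[of Y f k "-1"], drule (1) stdiff_add[of Z f g _ _ k f "\<lambda>t. g t - k t"])
    (auto simp: algebra_simps)

lemma stdiff_trans:
  assumes Z: "stdiff Z f g" and g: "stdiff g h k" and f: "\<And>t. 0 \<le> t \<Longrightarrow> t \<le> 1 \<Longrightarrow> \<bar>f t\<bar> \<le> K"
  shows "stdiff Z (\<lambda>t. f t * h t) k"
proof (rule stdiffI)
  fix e :: real assume "e > 0"
  then have e: "e / 2 > 0" "e / (2 * (\<bar>K\<bar> + 1)) > 0" by auto
  obtain d1 where d1: "d1 > 0" "\<And>u v. 0 \<le> u \<Longrightarrow> u \<le> v \<Longrightarrow> v \<le> 1 \<Longrightarrow> v - u < d1 \<Longrightarrow>
    \<bar>Z v - Z u - f u * (g v - g u)\<bar> \<le> e / 2 * (m v - m u)" using stdiffD[OF Z e(1)] by blast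
  obtain d2 where d2: "d2 > 0" "\<And>u v. 0 \<le> u \<Longrightarrow> u \<le> v \<Longrightarrow> v \<le> 1 \<Longrightarrow> v - u < d2 \<Longrightarrow>
    \<bar>g v - g u - h u * (k v - k u)\<bar> \<le> e / (2 * (\<bar>K\<bar> + 1)) * (m v - m u)" using stdiffD[OF g e(2)] by blast
  show "\<exists>d>0. \<forall>u v. 0 \<le> u \<longrightarrow> u \<le> v \<longrightarrow> v \<le> 1 \<longrightarrow> v - u < d \<longrightarrow>
      \<bar>Z v - Z u - f u * h u * (k v - k u)\<bar> \<le> e * (m v - m u)"
  proof (intro exI[of _ "min d1 d2"] conjI allI impI)
    fix u v :: real assume uv: "0 \<le> u" "u \<le> v" "v \<le> 1" "v - u < min d1 d2"
    have "\<bar>f u\<bar> * \<bar>g v - g u - h u * (k v - k u)\<bar> \<le> (\<bar>K\<bar> + 1) * (e / (2 * (\<bar>K\<bar> + 1)) * (m v - m u))"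
      using d2(2)[of u v] f[of u] uv by (intro mult_mono) auto
    also have "\<dots> = e / 2 * (m v - m u)" by (simp add: field_simps)
    finally have "\<bar>f u * (g v - g u) - f u * h u * (k v - k u)\<bar> \<le> e / 2 * (m v - m u)"
      by (simp add: algebra_simps flip: abs_mult)
    moreover have "e / 2 * (m v - m u) + e / 2 * (m v - m u) = e * (m v - m u)" by (simp add: field_simps)
    ultimately show "\<bar>Z v - Z u - f u * h u * (k v - k u)\<bar> \<le> e * (m v - m u)"
      using d1(2)[OF uv(1-3)] uv(4) unfolding min_less_iff_conj by linarith
  qed (use d1 d2 in auto)
qed

lemma stdiff_unique:
  assumes "stdiff Z f g" "stdiff Y f g" "0 \<le> u" "u \<le> v" "v \<le> 1"
  shows "Z v - Z u = Y v - Y u"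
proof -
  have s: "stdiff (\<lambda>t. Z t - Y t) f (\<lambda>t. g t - g t)" using stdiff_diff assms by blast
  have "Z v - Y v = Z u - Y u"
  proof (rule local_null_const[OF _ assms(3-5)])
    fix e :: real assume "e > 0"
    from stdiffD[OF s this] obtain d where d: "d > 0" "\<And>u v. 0 \<le> u \<Longrightarrow> u \<le> v \<Longrightarrow> v \<le> 1 \<Longrightarrow> v - u < d \<Longrightarrow>
      \<bar>Z v - Y v - (Z u - Y u) - f u * (g v - g v - (g u - g u))\<bar> \<le> e * (m v - m u)" by blast
    show "\<exists>d>0. \<forall>a b. u \<le> a \<longrightarrow> a \<le> b \<longrightarrow> b \<le> v \<longrightarrow> b - a < d \<longrightarrow> \<bar>Z b - Y b - (Z a - Y a)\<bar> \<le> e * (m b - m a)"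
    proof (intro exI[of _ d] conjI allI impI)
      fix a b assume "u \<le> a" "a \<le> b" "b \<le> v" "b - a < d"
      then show "\<bar>Z b - Y b - (Z a - Y a)\<bar> \<le> e * (m b - m a)" using d(2)[of a b] assms(3-5) by simp
    qed (rule d(1))
  qed
  then show ?thesis by simp
qed

lemma bounded_on_01:
  fixes f :: "real \<Rightarrow> real"
  assumes "continuous_on {0..1} f"
  obtains K where "K \<ge> 0" "\<And>t. 0 \<le> t \<Longrightarrow> t \<le> 1 \<Longrightarrow> \<bar>f t\<bar> \<le> K"
proof -
  have "bounded (f ` {0..1})" using assms by (simp add: compact_continuous_image compact_imp_bounded)
  then obtain K where "K > 0" "\<forall>y\<in>f ` {0..1}. norm y \<le> K" using bounded_pos by blast
  then show ?thesis by (intro that[of K]) auto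
qed

lemma stdiff_bound:
  assumes Z: "stdiff Z f g" and f: "\<And>t. 0 \<le> t \<Longrightarrow> t \<le> 1 \<Longrightarrow> \<bar>f t\<bar> \<le> K"
    and g: "C \<ge> 0" "\<And>u v. 0 \<le> u \<Longrightarrow> u \<le> v \<Longrightarrow> v \<le> 1 \<Longrightarrow> \<bar>g v - g u\<bar> \<le> C * (m v - m u)"
    and uv: "0 \<le> u" "u \<le> v" "v \<le> 1"
  shows "\<bar>Z v - Z u\<bar> \<le> (K * C + 1) * (m v - m u)"
proof -
  obtain d where d: "d > 0" "\<And>u v. 0 \<le> u \<Longrightarrow> u \<le> v \<Longrightarrow> v \<le> 1 \<Longrightarrow> v - u < d \<Longrightarrow>
    \<bar>Z v - Z u - f u * (g v - g u)\<bar> \<le> 1 * (m v - m u)" by (rule stdiffD[OF Z zero_less_one], rule that)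
  have "\<bar>Z v - Z u\<bar> \<le> (K * C + 1) * m v - (K * C + 1) * m u"
  proof (rule local_bound_global[OF d(1) _ uv(2)])
    fix a b assume ab: "u \<le> a" "a \<le> b" "b \<le> v" "b - a < d"
    have K: "K \<ge> 0" using f[of 0] by simp
    have "\<bar>f a * (g b - g a)\<bar> \<le> K * (C * (m b - m a))"
      unfolding abs_mult using f[of a] g(2)[of a b] ab uv K by (intro mult_mono) auto
    moreover have "\<bar>Z b - Z a - f a * (g b - g a)\<bar> \<le> 1 * (m b - m a)"
      by (rule d(2)) (use ab uv in auto)
    moreover have "(K * C + 1) * m b - (K * C + 1) * m a = K * (C * (m b - m a)) + 1 * (m b - m a)"
      by (simp add: algebra_simps)
    ultimately show "\<bar>Z b - Z a\<bar> \<le> (K * C + 1) * m b - (K * C + 1) * m a"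
      by linarith
  qed
  then show ?thesis by (simp only: right_diff_distrib)
qed

lemma stdiff_lipm:
  assumes "stdiff Z f g" "continuous_on {0..1} f" "lipm g" shows "lipm Z"
proof -
  obtain K where K: "K \<ge> 0" "\<And>t. 0 \<le> t \<Longrightarrow> t \<le> 1 \<Longrightarrow> \<bar>f t\<bar> \<le> K" using bounded_on_01[OF assms(2)] by blast
  obtain C where C: "C \<ge> 0" "\<And>u v. 0 \<le> u \<Longrightarrow> u \<le> v \<Longrightarrow> v \<le> 1 \<Longrightarrow> \<bar>g v - g u\<bar> \<le> C * (m v - m u)" by (rule lipmE[OF assms(3)], rule that)
  show ?thesis by (rule lipmI[of "K * C + 1"]) (use stdiff_bound[OF assms(1) K(2) C] K C in auto)
qed

text \<open>The substitution \<open>y = G t\<close> turns the Stieltjes integral into an ordinary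
  integral of \<open>f\<close> composed with the inverse of \<open>G\<close>, which is continuous;
  no limit of Stieltjes sums has to be constructed.\<close>

lemma stdiff_exists_increasing:
  assumes f: "continuous_on {0..1} f" and G: "continuous_on {0..1} G"
    and inc: "\<And>u v. 0 \<le> u \<Longrightarrow> u < v \<Longrightarrow> v \<le> 1 \<Longrightarrow> G u < G v"
    and C: "C > 0" "\<And>u v. 0 \<le> u \<Longrightarrow> u \<le> v \<Longrightarrow> v \<le> 1 \<Longrightarrow> G v - G u \<le> C * (m v - m u)"
  shows "\<exists>Z. stdiff Z f G"
proof -
  have mono: "G u \<le> G v" if "0 \<le> u" "u \<le> v" "v \<le> 1" for u v
    using inc[of u v] that by (cases "u = v") auto
  have inj: "inj_on G {0..1}"
    by (intro linorder_inj_onI) (use inc in \<open>force simp: less_imp_neq\<close>)+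
  define h where "h = inv_into {0..1} G"
  have hG: "h (G t) = t" if "t \<in> {0..1}" for t unfolding h_def using inj that by simp
  have im: "G ` {0..1} = {G 0..G 1}"
  proof
    show "G ` {0..1} \<subseteq> {G 0..G 1}" using mono by auto
    show "{G 0..G 1} \<subseteq> G ` {0..1}"
      using IVT'[of G 0 _ 1] G by (force simp: image_iff)
  qed
  have "continuous_on (G ` {0..1}) h"
    by (rule continuous_on_inv[OF G]) (auto simp: hG)
  moreover have "h ` G ` {0..1} \<subseteq> {0..1}" using hG by auto
  ultimately have cfh: "continuous_on {G 0..G 1} (\<lambda>y. f (h y))"
    using continuous_on_compose2[OF f] im by auto
  define Z where "Z = (\<lambda>t. integral {G 0..G t} (\<lambda>y. f (h y)))"
  have "stdiff Z f G"
  proof (rule stdiffI)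
    fix e :: real assume "e > 0"
    then have e: "e / C > 0" using C by simp
    obtain d where d: "d > 0" "\<And>u v. 0 \<le> u \<Longrightarrow> u \<le> v \<Longrightarrow> v \<le> 1 \<Longrightarrow> v - u < d \<Longrightarrow> \<bar>f v - f u\<bar> < e / C"
      by (rule uniformly_continuous_01[OF f e], rule that)
    show "\<exists>d>0. \<forall>u v. 0 \<le> u \<longrightarrow> u \<le> v \<longrightarrow> v \<le> 1 \<longrightarrow> v - u < d \<longrightarrow>
        \<bar>Z v - Z u - f u * (G v - G u)\<bar> \<le> e * (m v - m u)"
    proof (intro exI[of _ d] conjI allI impI)
      fix u v :: real assume uv: "0 \<le> u" "u \<le> v" "v \<le> 1" "v - u < d"
      have sub: "{G u..G v} \<subseteq> {G 0..G 1}" using mono[of 0 u] mono[of v 1] uv by auto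
      have int: "(\<lambda>y. f (h y)) integrable_on {G 0..G v}"
        by (rule integrable_continuous_real, rule continuous_on_subset[OF cfh]) (use mono[of v 1] uv in auto)
      have Zd: "Z v = Z u + integral {G u..G v} (\<lambda>y. f (h y))"
        unfolding Z_def by (rule Henstock_Kurzweil_Integration.integral_combine[symmetric])
          (use int mono[of 0 u] mono[of u v] uv in auto)
      have ii: "((\<lambda>y. f (h y) - f u) has_integral (Z v - Z u - f u * (G v - G u))) {G u..G v}"
      proof -
        have "(\<lambda>y. f (h y)) integrable_on {G u..G v}"
          by (rule integrable_continuous_real, rule continuous_on_subset[OF cfh sub])
        then have "((\<lambda>y. f (h y)) has_integral (Z v - Z u)) {G u..G v}" using Zd by (simp add: has_integral_integral)
        moreover have "((\<lambda>y. f u) has_integral (G v - G u) *\<^sub>R f u) {G u..G v}"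
          using has_integral_const_real[of "f u" "G u" "G v"] mono[OF uv(1-3)] by simp
        ultimately have "((\<lambda>y. f (h y) - f u) has_integral (Z v - Z u - (G v - G u) *\<^sub>R f u)) {G u..G v}"
          by (rule has_integral_diff)
        then show ?thesis by (simp add: mult.commute)
      qed
      have "norm (Z v - Z u - f u * (G v - G u)) \<le> e / C * Henstock_Kurzweil_Integration.content {G u..G v}"
      proof (rule has_integral_bound_real[OF _ finite.emptyI ii])
        fix y assume "y \<in> {G u..G v} - {}"
        then have y: "y \<in> {G u..G v}" by simp
        then obtain t where t: "t \<in> {0..1}" "y = G t" using sub unfolding im[symmetric] by (auto dest!: subsetD)
        then have "u \<le> t" "t \<le> v" using y inc[of t u] inc[of v t] uv by force+
        then show "norm (f (h y) - f u) \<le> e / C" using d(2)[of u t] t hG[OF t(1)] uv by (auto simp: less_imp_le)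
      qed (use e in auto)
      also have "\<dots> = e / C * (G v - G u)" using mono[OF uv(1-3)] by simp
      also have "\<dots> \<le> e / C * (C * (m v - m u))" using C(2)[OF uv(1-3)] e by (intro mult_left_mono) auto
      finally show "\<bar>Z v - Z u - f u * (G v - G u)\<bar> \<le> e * (m v - m u)" using C by simp
    qed (use d in auto)
  qed
  then show ?thesis by blast
qed

lemma stdiff_exists:
  assumes f: "continuous_on {0..1} f" and g: "lipm g"
  shows "\<exists>Z. stdiff Z f g \<and> Z 0 = 0"
proof -
  obtain C where C: "C \<ge> 0" "\<And>u v. 0 \<le> u \<Longrightarrow> u \<le> v \<Longrightarrow> v \<le> 1 \<Longrightarrow> \<bar>g v - g u\<bar> \<le> C * (m v - m u)" by (rule lipmE[OF g], rule that)
  \<comment> \<open>\<open>g\<close> is the difference of \<open>g + k\<close> and \<open>k\<close>,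
    both strictly increasing: the increments of \<open>g\<close> are at most \<open>C\<close> times
    those of \<open>m\<close>, so adding \<open>(C + 1) * m\<close> outweighs any decrease.\<close>
  define k where "k = (\<lambda>t. (C + 1) * m t)"
  have pos: "m u < m v" if "0 \<le> u" "u < v" "v \<le> 1" for u v using m_inc[of u v] that by linarith
  obtain Z1 where Z1: "stdiff Z1 f (\<lambda>t. g t + k t)"
  proof (atomize_elim, rule stdiff_exists_increasing[OF f, where C="2 * C + 1"])
    show "continuous_on {0..1} (\<lambda>t. g t + k t)"
      unfolding k_def by (intro continuous_intros lipm_continuous_on[OF g] m_cont)
    fix u v :: real assume "0 \<le> u" "v \<le> 1"
    { assume "u < v"
      then show "g u + k u < g v + k v" using C(2)[of u v] pos[of u v] \<open>0 \<le> u\<close> \<open>v \<le> 1\<close>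
        by (simp add: k_def algebra_simps) }
    { assume "u \<le> v"
      then show "g v + k v - (g u + k u) \<le> (2 * C + 1) * (m v - m u)" using C(2)[of u v] \<open>0 \<le> u\<close> \<open>v \<le> 1\<close>
        by (simp add: k_def algebra_simps) }
  qed (use C in auto)
  obtain Z2 where Z2: "stdiff Z2 f k"
  proof (atomize_elim, rule stdiff_exists_increasing[OF f, where C="C + 1"])
    show "continuous_on {0..1} k" unfolding k_def by (intro continuous_intros m_cont)
    show "k u < k v" if "0 \<le> u" "u < v" "v \<le> 1" for u v using pos[OF that] C(1) by (simp add: k_def)
    show "k v - k u \<le> (C + 1) * (m v - m u)" for u v by (simp add: k_def algebra_simps)
  qed (use C in auto)
  have "stdiff (\<lambda>t. Z1 t - Z2 t) f g" using stdiff_diff[OF Z1 Z2] by simp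
  then show ?thesis
    by (intro exI[of _ "\<lambda>t. Z1 t - Z2 t - (Z1 0 - Z2 0)"]) (simp add: stdiff_def algebra_simps)
qed

text \<open>The indefinite Stieltjes integral of \<open>f\<close> against \<open>g\<close>, fixed by
  its local behaviour and its value at 0. Only its values on [0, 1] are determined.\<close>

definition "SI f g = (SOME Z. stdiff Z f g \<and> Z 0 = 0)"

lemma SI:
  assumes "continuous_on {0..1} f" "lipm g"
  shows stdiff_SI: "stdiff (SI f g) f g" and SI_0: "SI f g 0 = 0"
  using someI_ex[OF stdiff_exists[OF assms]] unfolding SI_def by auto

text \<open>Left-point sums are controlled by \<open>stdiff\<close>; moving a tag inside its
  interval changes \<open>f\<close> by less than \<epsilon> and the sum by at most \<epsilon> times
  \<open>C\<close> times the increase of the clock. The summand 1 in \<open>m t - m 0 + 1\<close>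
  keeps \<epsilon> well defined at \<open>t = 0\<close>.\<close>

lemma stdiff_has_RS:
  assumes Z: "stdiff Z f g" and f: "continuous_on {0..1} f" and g: "lipm g" and t: "0 \<le> t" "t \<le> 1"
  shows "has_RS_integral f g 0 t (Z t - Z 0)"
  unfolding has_RS_integral_def
proof (intro allI impI)
  fix e :: real assume e: "e > 0"
  obtain C where C: "C \<ge> 0" "\<And>u v. 0 \<le> u \<Longrightarrow> u \<le> v \<Longrightarrow> v \<le> 1 \<Longrightarrow> \<bar>g v - g u\<bar> \<le> C * (m v - m u)" by (rule lipmE[OF g], rule that)
  define \<epsilon> where "\<epsilon> = e / ((C + 1) * (m t - m 0 + 1))"
  have m0: "m 0 \<le> m t" using m_mono t by auto
  then have \<epsilon>: "\<epsilon> > 0" using e C by (simp add: \<epsilon>_def)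
  obtain d1 where d1: "d1 > 0" "\<And>u v. 0 \<le> u \<Longrightarrow> u \<le> v \<Longrightarrow> v \<le> 1 \<Longrightarrow> v - u < d1 \<Longrightarrow>
    \<bar>Z v - Z u - f u * (g v - g u)\<bar> \<le> \<epsilon> * (m v - m u)" using stdiffD[OF Z \<epsilon>] by blast
  obtain d2 where d2: "d2 > 0" "\<And>u v. 0 \<le> u \<Longrightarrow> u \<le> v \<Longrightarrow> v \<le> 1 \<Longrightarrow> v - u < d2 \<Longrightarrow> \<bar>f v - f u\<bar> < \<epsilon>"
    by (rule uniformly_continuous_01[OF f \<epsilon>], rule that)
  show "\<exists>d>0. \<forall>p \<xi> n. tagged_div_fine 0 t d p \<xi> n \<longrightarrow> \<bar>RS_sum f g p \<xi> n - (Z t - Z 0)\<bar> < e"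
  proof (intro exI[of _ "min d1 d2"] conjI allI impI)
    fix p \<xi> n assume "tagged_div_fine 0 t (min d1 d2) p \<xi> n"
    then have p: "p 0 = 0" "p n = t" "\<And>i. i < n \<Longrightarrow> p i < p (Suc i)" "\<And>i. i < n \<Longrightarrow> p i \<le> \<xi> i"
      "\<And>i. i < n \<Longrightarrow> \<xi> i \<le> p (Suc i)" "\<And>i. i < n \<Longrightarrow> p (Suc i) - p i < min d1 d2"
      unfolding tagged_div_fine_def by auto
    have pm: "p i \<le> p j" if "i \<le> j" "j \<le> n" for i j
      by (rule chain_mono[OF _ that]) (use p(3) in \<open>auto simp: less_imp_le\<close>)
    have "\<bar>RS_sum f g p \<xi> n - (Z t - Z 0)\<bar> = \<bar>\<Sum>i<n. f (\<xi> i) * (g (p (Suc i)) - g (p i)) - (Z (p (Suc i)) - Z (p i))\<bar>"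
      using p sum_telescope_clock[of Z p n] by (simp add: RS_sum_def sum_subtractf)
    also have "\<dots> \<le> (\<Sum>i<n. \<epsilon> * (C + 1) * (m (p (Suc i)) - m (p i)))"
    proof (rule order_trans[OF sum_abs], rule sum_mono)
      fix i assume "i \<in> {..<n}"
      then have i: "i < n" by simp
      have r: "0 \<le> p i" "p i \<le> p (Suc i)" "p (Suc i) \<le> 1"
        using pm[of 0 i] pm[of "Suc i" n] pm[of i "Suc i"] i p t by auto
      have "\<bar>f (\<xi> i) - f (p i)\<bar> < \<epsilon>"
        using d2(2)[of "p i" "\<xi> i"] p(4,5,6)[OF i] r by auto
      then have "\<bar>f (\<xi> i) - f (p i)\<bar> * \<bar>g (p (Suc i)) - g (p i)\<bar> \<le> \<epsilon> * (C * (m (p (Suc i)) - m (p i)))"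
        using C(2)[OF r] \<epsilon> by (intro mult_mono) auto
      moreover have "\<bar>Z (p (Suc i)) - Z (p i) - f (p i) * (g (p (Suc i)) - g (p i))\<bar> \<le> \<epsilon> * (m (p (Suc i)) - m (p i))"
        using d1(2)[OF r] p(6)[OF i] by simp
      moreover have "f (\<xi> i) * (g (p (Suc i)) - g (p i)) - (Z (p (Suc i)) - Z (p i)) =
          (f (\<xi> i) - f (p i)) * (g (p (Suc i)) - g (p i)) - (Z (p (Suc i)) - Z (p i) - f (p i) * (g (p (Suc i)) - g (p i)))"
        by (simp add: algebra_simps)
      moreover have "\<epsilon> * (C * (m (p (Suc i)) - m (p i))) + \<epsilon> * (m (p (Suc i)) - m (p i)) = \<epsilon> * (C + 1) * (m (p (Suc i)) - m (p i))"
        by (simp add: algebra_simps)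
      ultimately show "\<bar>f (\<xi> i) * (g (p (Suc i)) - g (p i)) - (Z (p (Suc i)) - Z (p i))\<bar> \<le> \<epsilon> * (C + 1) * (m (p (Suc i)) - m (p i))"
        using abs_triangle_ineq4[of "(f (\<xi> i) - f (p i)) * (g (p (Suc i)) - g (p i))" "Z (p (Suc i)) - Z (p i) - f (p i) * (g (p (Suc i)) - g (p i))"]
        by (simp only: abs_mult)
    qed
    also have "\<dots> = \<epsilon> * (C + 1) * (m t - m 0)"
      using p by (simp add: sum_telescope_clock flip: sum_distrib_left)
    also have "\<dots> < \<epsilon> * (C + 1) * (m t - m 0 + 1)" using \<epsilon> C by simp
    also have "\<dots> = e" unfolding \<epsilon>_def using C m0 by simp
    finally show "\<bar>RS_sum f g p \<xi> n - (Z t - Z 0)\<bar> < e" .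
  qed (use d1 d2 in auto)
qed

text \<open>The bridge between the limit of tagged sums, in which the equations are stated, and
  \<open>SI\<close>, with which they are computed.\<close>

lemma has_RS_SI:
  assumes "continuous_on {0..1} f" "lipm g" "0 \<le> t" "t \<le> 1"
  shows "has_RS_integral f g 0 t J \<longleftrightarrow> J = SI f g t"
  using stdiff_has_RS[OF stdiff_SI[OF assms(1,2)] assms] has_RS_integral_unique assms SI_0[OF assms(1,2)]
  by auto

end

section \<open>Sums along refining partitions\<close>

context
  fixes P assumes P: "is_partition01 P"
begin

lemma succ_pt:
  assumes "s \<in> P"
  shows succ_pt_mem: "succ_pt P s \<in> P" and succ_pt_ge: "s \<le> succ_pt P s"
    and succ_pt_le1: "succ_pt P s \<le> 1" and succ_pt_mesh: "succ_pt P s - s \<le> mesh P"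
    and succ_pt_least: "r \<in> P \<Longrightarrow> s < r \<Longrightarrow> succ_pt P s \<le> r"
    and succ_pt_gt: "s < 1 \<Longrightarrow> s < succ_pt P s"
proof -
  have fin: "finite P" "1 \<in> P" "P \<subseteq> {0..1}" using P by (auto simp: is_partition01_def)
  have s1: "s \<le> 1" using assms fin by auto
  have M: "Min {u \<in> P. s < u} \<in> {u \<in> P. s < u}" if "s < 1"
    using that fin by (intro Min_in) auto
  show "succ_pt P s \<in> P" "s \<le> succ_pt P s" using M s1 fin by (auto simp: succ_pt_def less_imp_le)
  then show "succ_pt P s \<le> 1" using fin by auto
  show "succ_pt P s - s \<le> mesh P" unfolding mesh_def using fin assms by (intro Max_ge) auto
  show "succ_pt P s \<le> r" if "r \<in> P" "s < r"
    using that fin s1 unfolding succ_pt_def by (auto intro: Min_le)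
  show "s < succ_pt P s" if "s < 1" using M[OF that] that by (auto simp: succ_pt_def)
qed

definition "last_pt t = Max {s \<in> P. s \<le> t}"

lemma last_pt:
  assumes "0 \<le> t"
  shows "last_pt t \<in> P" "last_pt t \<le> t" "s \<in> P \<Longrightarrow> s \<le> t \<Longrightarrow> s \<le> last_pt t"
proof -
  have fin: "finite {s \<in> P. s \<le> t}" "0 \<in> {s \<in> P. s \<le> t}" using P assms by (auto simp: is_partition01_def)
  then have "last_pt t \<in> {s \<in> P. s \<le> t}" unfolding last_pt_def by (intro Max_in) auto
  then show "last_pt t \<in> P" "last_pt t \<le> t" by auto
  show "s \<le> last_pt t" if "s \<in> P" "s \<le> t" unfolding last_pt_def using that fin by (intro Max_ge) auto
qed

lemma succ_last_pt:
  assumes "0 \<le> t" "t \<le> 1"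
  shows "t \<le> succ_pt P (last_pt t)" "succ_pt P (last_pt t) \<le> 1" "succ_pt P (last_pt t) - t \<le> mesh P"
proof -
  note l = last_pt[OF assms(1)]
  show "t \<le> succ_pt P (last_pt t)"
  proof (rule ccontr)
    assume a: "\<not> t \<le> succ_pt P (last_pt t)"
    then have "last_pt t < 1" using succ_pt_ge[OF l(1)] assms by linarith
    then show False using l(3)[OF succ_pt_mem[OF l(1)]] succ_pt_gt[OF l(1)] a by linarith
  qed
  show "succ_pt P (last_pt t) \<le> 1" "succ_pt P (last_pt t) - t \<le> mesh P"
    using succ_pt_le1[OF l(1)] succ_pt_mesh[OF l(1)] l(2) by linarith+
qed

text \<open>The sum runs over left end points, so it stops at the successor of the last point up to
  \<open>t\<close>, possibly beyond \<open>t\<close>; at \<open>t = 1\<close> the convention that 1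
  is its own successor makes the last term 0. The proof is an induction on the number of partition
  points up to \<open>t\<close>.\<close>

lemma telescope_succ_pt:
  fixes G :: "real \<Rightarrow> real"
  assumes "0 \<le> t" "t \<le> 1"
  shows "(\<Sum>s\<in>{s \<in> P. s \<le> t}. G (succ_pt P s) - G s) = G (succ_pt P (last_pt t)) - G 0"
  using assms
proof (induction "card {s \<in> P. s \<le> t}" arbitrary: t rule: less_induct)
  case less
  have fin: "finite P" "0 \<in> P" "P \<subseteq> {0..1}" using P by (auto simp: is_partition01_def)
  define M where "M = last_pt t"
  have M: "M \<in> P" "M \<le> t" "\<And>s. s \<in> P \<Longrightarrow> s \<le> t \<Longrightarrow> s \<le> M"
    using last_pt[OF less.prems(1)] by (auto simp: M_def)
  show ?case
  proof (cases "M = 0")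
    case True
    then have "{s \<in> P. s \<le> t} = {0}" using M fin less.prems(1) by force
    then show ?thesis using True by (simp add: M_def)
  next
    case False
    then have M0: "0 < M" using M(1) fin by force
    define t' where "t' = Max {s \<in> P. s < M}"
    have ne: "finite {s \<in> P. s < M}" "{s \<in> P. s < M} \<noteq> {}" using fin M0 by auto
    have t': "t' \<in> P" "t' < M" "\<And>s. s \<in> P \<Longrightarrow> s < M \<Longrightarrow> s \<le> t'"
      using Max_in[OF ne] Max_ge[OF ne(1)] by (auto simp: t'_def)
    have t01: "0 \<le> t'" "t' \<le> 1" using t'(1) fin by auto
    have l': "last_pt t' = t'" using last_pt[OF t01(1)] t'(1) by force
    have s': "succ_pt P t' = M"
      using succ_pt_least[OF t'(1) M(1) t'(2)] succ_pt_gt[OF t'(1)] t'(2,3) succ_pt_mem[OF t'(1)] M(2) less.prems(2)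
      by (force simp: not_less)
    have eq: "{s \<in> P. s \<le> t} = insert M {s \<in> P. s \<le> t'}" using M t' by force
    have nin: "M \<notin> {s \<in> P. s \<le> t'}" using t' by auto
    have "card {s \<in> P. s \<le> t'} < card {s \<in> P. s \<le> t}" unfolding eq using nin fin by simp
    from less.hyps[OF this t01] show ?thesis
      unfolding eq using nin fin by (simp add: l' s' M_def[symmetric])
  qed
qed

end

locale partition_clock = clock +
  fixes T :: "nat \<Rightarrow> real set" and x :: "real \<Rightarrow> real"
  assumes T: "refining_sequence T" and x_cont: "continuous_on {0..1} x"
    and x_qv: "has_cont_quadvar T x" and qv_lipm: "lipm (quadvar T x)"
begin

abbreviation "q \<equiv> quadvar T x"

lemma part: "is_partition01 (T n)" using T by (simp add: refining_sequence_def)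

lemma T01: "s \<in> T n \<Longrightarrow> 0 \<le> s" "s \<in> T n \<Longrightarrow> s \<le> 1" "finite (T n)" "0 \<in> T n"
  using part[of n] by (auto simp: is_partition01_def)

lemmas suc = succ_pt_ge[OF part] succ_pt_le1[OF part] succ_pt_mesh[OF part]

lemma mesh_small: "d > 0 \<Longrightarrow> \<forall>\<^sub>F n in sequentially. mesh (T n) < d"
  using T order_tendstoD(2) unfolding refining_sequence_def by blast

text \<open>The overshoot past \<open>t\<close> is at most the mesh, and \<open>G\<close> is
  uniformly continuous.\<close>

lemma telescope_limit:
  fixes G :: "real \<Rightarrow> real"
  assumes "continuous_on {0..1} G" "0 \<le> t" "t \<le> 1"
  shows "(\<lambda>n. \<Sum>s\<in>{s \<in> T n. s \<le> t}. G (succ_pt (T n) s) - G s) \<longlonglongrightarrow> G t - G 0"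
proof -
  have "(\<lambda>n. G (succ_pt (T n) (last_pt (T n) t))) \<longlonglongrightarrow> G t"
  proof (rule LIMSEQ_I)
    fix e :: real assume e: "e > 0"
    obtain d where d: "d > 0" "\<And>u v. 0 \<le> u \<Longrightarrow> u \<le> v \<Longrightarrow> v \<le> 1 \<Longrightarrow> v - u < d \<Longrightarrow> \<bar>G v - G u\<bar> < e"
      by (rule uniformly_continuous_01[OF assms(1) e], rule that)
    from mesh_small[OF d(1)] obtain N where N: "\<And>n. n \<ge> N \<Longrightarrow> mesh (T n) < d"
      unfolding eventually_sequentially by blast
    show "\<exists>N. \<forall>n\<ge>N. norm (G (succ_pt (T n) (last_pt (T n) t)) - G t) < e"
    proof (intro exI allI impI)
      fix n assume "n \<ge> N"
      then show "norm (G (succ_pt (T n) (last_pt (T n) t)) - G t) < e"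
        using N[of n] succ_last_pt[OF part[of n] assms(2,3)] d(2)[of t "succ_pt (T n) (last_pt (T n) t)"] assms(2) by auto
    qed
  qed
  then have "(\<lambda>n. G (succ_pt (T n) (last_pt (T n) t)) - G 0) \<longlonglongrightarrow> G t - G 0"
    by (intro tendsto_diff tendsto_const)
  then show ?thesis using telescope_succ_pt[OF part assms(2,3)] by simp
qed

lemma qv_limit: "0 \<le> t \<Longrightarrow> t \<le> 1 \<Longrightarrow> (\<lambda>n. qv_sum (T n) x t) \<longlonglongrightarrow> q t"
  using x_qv unfolding has_cont_quadvar_def quadvar_def convergent_LIMSEQ_iff by auto

lemma sum_split: "0 \<le> u \<Longrightarrow> u \<le> v \<Longrightarrow> (\<Sum>s\<in>{s \<in> T n. s \<le> v}. f s) - (\<Sum>s\<in>{s \<in> T n. s \<le> u}. f s) = (\<Sum>s\<in>{s \<in> T n. u < s \<and> s \<le> v}. (f s :: real))"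
proof -
  assume uv: "0 \<le> u" "u \<le> v"
  have "{s \<in> T n. s \<le> v} = {s \<in> T n. s \<le> u} \<union> {s \<in> T n. u < s \<and> s \<le> v}" using uv by auto
  moreover have "sum f ({s \<in> T n. s \<le> u} \<union> {s \<in> T n. u < s \<and> s \<le> v}) = sum f {s \<in> T n. s \<le> u} + sum f {s \<in> T n. u < s \<and> s \<le> v}"
    using T01(3) by (intro sum.union_disjoint) auto
  ultimately show ?thesis by simp
qed

text \<open>The order of choices matters: \<open>e\<close> fixes \<open>d\<close> and with it the
  number \<open>N\<close> of pieces, and only then is \<open>r\<close> taken of order 1/N. The index
  from which a local bound holds may depend on the piece, since there are finitely many
  pieces.\<close>

lemma local_limit:
  assumes loc: "\<And>e. e > 0 \<Longrightarrow> \<exists>d>0. \<forall>u v. u0 \<le> u \<longrightarrow> u \<le> v \<longrightarrow> v \<le> v0 \<longrightarrow> v - u < d \<longrightarrow>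
      (\<forall>r>0. \<forall>\<^sub>F n in sequentially. \<bar>D n v - D n u\<bar> \<le> e * (m v - m u) + r)"
    and uv: "0 \<le> u0" "u0 \<le> v0" "v0 \<le> 1"
  shows "(\<lambda>n. D n v0 - D n u0 :: real) \<longlonglongrightarrow> 0"
proof (rule LIMSEQ_I)
  fix \<epsilon> :: real assume \<epsilon>: "\<epsilon> > 0"
  have half_cancel: "c \<noteq> 0 \<Longrightarrow> \<epsilon> / (2 * c) * c = \<epsilon> / 2" for c :: real by simp
  have mm: "m u0 \<le> m v0" using m_mono[OF uv] .
  define e where "e = \<epsilon> / (2 * (m v0 - m u0 + 1))"
  have e: "e > 0" using \<epsilon> mm by (simp add: e_def)
  from loc[OF this] obtain d where d: "d > 0" "\<And>u v r. u0 \<le> u \<Longrightarrow> u \<le> v \<Longrightarrow> v \<le> v0 \<Longrightarrow> v - u < d \<Longrightarrow> r > 0 \<Longrightarrow>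
      \<forall>\<^sub>F n in sequentially. \<bar>D n v - D n u\<bar> \<le> e * (m v - m u) + r" by blast
  obtain N p where p: "p 0 = u0" "p N = v0" "\<And>i. i < N \<Longrightarrow> p i < p (Suc i)"
    "\<And>i. i < N \<Longrightarrow> p (Suc i) - p i < d" "\<And>i. i \<le> N \<Longrightarrow> u0 \<le> p i \<and> p i \<le> v0"
    by (rule subdivision[OF uv(2) d(1)], rule that)
  define r where "r = \<epsilon> / (2 * (real N + 1))"
  have r: "r > 0" using \<epsilon> by (simp add: r_def)
  have "\<forall>\<^sub>F n in sequentially. \<forall>i\<in>{..<N}. \<bar>D n (p (Suc i)) - D n (p i)\<bar> \<le> e * (m (p (Suc i)) - m (p i)) + r"
  proof (rule eventually_ball_finite)
    show "\<forall>i\<in>{..<N}. \<forall>\<^sub>F n in sequentially. \<bar>D n (p (Suc i)) - D n (p i)\<bar> \<le> e * (m (p (Suc i)) - m (p i)) + r"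
    proof
      fix i assume "i \<in> {..<N}"
      then show "\<forall>\<^sub>F n in sequentially. \<bar>D n (p (Suc i)) - D n (p i)\<bar> \<le> e * (m (p (Suc i)) - m (p i)) + r"
        using p(3,4)[of i] p(5)[of i] p(5)[of "Suc i"] r by (intro d(2)) auto
    qed
  qed simp
  then obtain n0 where n0: "\<And>n i. n \<ge> n0 \<Longrightarrow> i < N \<Longrightarrow> \<bar>D n (p (Suc i)) - D n (p i)\<bar> \<le> e * (m (p (Suc i)) - m (p i)) + r"
    unfolding eventually_sequentially by blast
  show "\<exists>n0. \<forall>n\<ge>n0. norm (D n v0 - D n u0 - 0) < \<epsilon>"
  proof (intro exI allI impI)
    fix n assume n: "n \<ge> n0"
    have "\<bar>D n v0 - D n u0\<bar> = \<bar>\<Sum>i<N. D n (p (Suc i)) - D n (p i)\<bar>"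
      using p sum_telescope_clock[of "D n" p N] by simp
    also have "\<dots> \<le> (\<Sum>i<N. e * (m (p (Suc i)) - m (p i)) + r)"
      by (rule order_trans[OF sum_abs]) (intro sum_mono n0[OF n], simp)
    also have "\<dots> = e * (m v0 - m u0) + real N * r"
      using p sum_telescope_clock[of m p N] by (simp add: sum.distrib flip: sum_distrib_left)
    also have "\<dots> < e * (m v0 - m u0 + 1) + (real N + 1) * r" using e r by (intro add_strict_mono mult_strict_left_mono mult_strict_right_mono) auto
    also have "e * (m v0 - m u0 + 1) = \<epsilon> / 2" unfolding e_def by (rule half_cancel) (use mm in simp)
    also have "(real N + 1) * r = \<epsilon> / 2" unfolding r_def mult.commute[of "real N + 1"] by (rule half_cancel) simp
    also have "\<epsilon> / 2 + \<epsilon> / 2 = \<epsilon>" by simp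
    finally show "norm (D n v0 - D n u0 - 0) < \<epsilon>" by simp
  qed
qed

text \<open>On a short interval \<open>w\<close> is nearly constant, so the weighted sum increases
  by about \<open>w u\<close> times the increase of the unweighted sum, whose limit is known;
  \<open>SI w q\<close> has the same local behaviour.\<close>

lemma weighted_qv_limit:
  assumes w: "continuous_on {0..1} w" and t: "0 \<le> t" "t \<le> 1"
  shows "(\<lambda>n. \<Sum>s\<in>{s \<in> T n. s \<le> t}. w s * (x (succ_pt (T n) s) - x s)\<^sup>2) \<longlonglongrightarrow> SI w q t"
proof -
  define X where "X = (\<lambda>n s. (x (succ_pt (T n) s) - x s)\<^sup>2)"
  define S where "S = (\<lambda>n t. \<Sum>s\<in>{s \<in> T n. s \<le> t}. w s * X n s)"
  define Q where "Q = (\<lambda>n t. \<Sum>s\<in>{s \<in> T n. s \<le> t}. X n s)"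
  have Q: "(\<lambda>n. Q n t) \<longlonglongrightarrow> q t" if "0 \<le> t" "t \<le> 1" for t
    using qv_limit[OF that] by (simp add: Q_def X_def qv_sum_def)
  note Z = stdiff_SI[OF w qv_lipm] and Z0 = SI_0[OF w qv_lipm]
  obtain K where K: "K \<ge> 0" "\<And>t. 0 \<le> t \<Longrightarrow> t \<le> 1 \<Longrightarrow> \<bar>w t\<bar> \<le> K" by (rule bounded_on_01[OF w], rule that)
  obtain C where C: "C \<ge> 0" "\<And>u v. 0 \<le> u \<Longrightarrow> u \<le> v \<Longrightarrow> v \<le> 1 \<Longrightarrow> \<bar>q v - q u\<bar> \<le> C * (m v - m u)"
    by (rule lipmE[OF qv_lipm], rule that)
  define D where "D = (\<lambda>n t. S n t - SI w q t)"
  have "(\<lambda>n. D n t - D n 0) \<longlonglongrightarrow> 0"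
  proof (rule local_limit[OF _ order_refl t])
    fix e :: real assume e: "e > 0"
    define \<eta> where "\<eta> = e / (C + 1)"
    have \<eta>: "\<eta> > 0" "\<eta> * (C + 1) = e" using e C by (auto simp: \<eta>_def)
    obtain d1 where d1: "d1 > 0" "\<And>u v. 0 \<le> u \<Longrightarrow> u \<le> v \<Longrightarrow> v \<le> 1 \<Longrightarrow> v - u < d1 \<Longrightarrow> \<bar>w v - w u\<bar> < \<eta>"
      by (rule uniformly_continuous_01[OF w \<eta>(1)], rule that)
    obtain d2 where d2: "d2 > 0" "\<And>u v. 0 \<le> u \<Longrightarrow> u \<le> v \<Longrightarrow> v \<le> 1 \<Longrightarrow> v - u < d2 \<Longrightarrow>
        \<bar>SI w q v - SI w q u - w u * (q v - q u)\<bar> \<le> \<eta> * (m v - m u)"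
      by (rule stdiffD[OF Z \<eta>(1)], rule that)
    show "\<exists>d>0. \<forall>u v. 0 \<le> u \<longrightarrow> u \<le> v \<longrightarrow> v \<le> t \<longrightarrow> v - u < d \<longrightarrow>
      (\<forall>r>0. \<forall>\<^sub>F n in sequentially. \<bar>D n v - D n u\<bar> \<le> e * (m v - m u) + r)"
    proof (intro exI[of _ "min d1 d2"] conjI allI impI)
      fix u v r :: real assume uv: "0 \<le> u" "u \<le> v" "v \<le> t" "v - u < min d1 d2" and r: "r > 0"
      have uv1: "v \<le> 1" "v - u < d1" "v - u < d2" "u \<le> 1" using uv t by auto
      define r' where "r' = r / (K + \<eta> + 1)"
      have r': "r' > 0" using r K \<eta> by (simp add: r'_def)
      have "(\<lambda>n. Q n v - Q n u) \<longlonglongrightarrow> q v - q u" using Q uv uv1 by (intro tendsto_diff) auto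
      from tendstoD[OF this r'] show "\<forall>\<^sub>F n in sequentially. \<bar>D n v - D n u\<bar> \<le> e * (m v - m u) + r"
      proof eventually_elim
        case (elim n)
        then have qn: "\<bar>Q n v - Q n u - (q v - q u)\<bar> < r'" by (simp add: dist_real_def)
        have Sd: "S n v - S n u = (\<Sum>s\<in>{s \<in> T n. u < s \<and> s \<le> v}. w s * X n s)"
          and Qd: "Q n v - Q n u = (\<Sum>s\<in>{s \<in> T n. u < s \<and> s \<le> v}. X n s)"
          unfolding S_def Q_def using sum_split[OF uv(1,2)] by auto
        have "S n v - S n u - w u * (Q n v - Q n u) = (\<Sum>s\<in>{s \<in> T n. u < s \<and> s \<le> v}. (w s - w u) * X n s)"
          unfolding Sd Qd by (simp add: sum_distrib_left left_diff_distrib sum_subtractf)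
        also have "\<bar>\<dots>\<bar> \<le> (\<Sum>s\<in>{s \<in> T n. u < s \<and> s \<le> v}. \<eta> * X n s)"
        proof (rule order_trans[OF sum_abs], rule sum_mono)
          fix s assume "s \<in> {s \<in> T n. u < s \<and> s \<le> v}"
          then have "\<bar>w s - w u\<bar> < \<eta>" using d1(2)[of u s] uv uv1 by auto
          then show "\<bar>(w s - w u) * X n s\<bar> \<le> \<eta> * X n s"
            unfolding abs_mult by (intro mult_mono) (auto simp: X_def)
        qed
        also have "\<dots> = \<eta> * (Q n v - Q n u)" unfolding Qd by (simp add: sum_distrib_left)
        also have "\<dots> \<le> \<eta> * (C * (m v - m u) + r')"
          using qn C(2)[OF uv(1,2) uv1(1)] \<eta> by (intro mult_left_mono) auto
        finally have 1: "\<bar>S n v - S n u - w u * (Q n v - Q n u)\<bar> \<le> \<eta> * (C * (m v - m u) + r')" .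
        have 2: "\<bar>w u * (Q n v - Q n u) - w u * (q v - q u)\<bar> \<le> K * r'"
          unfolding right_diff_distrib[symmetric] abs_mult using K(2)[of u] uv(1) uv1(4) qn K(1) by (intro mult_mono) auto
        have 3: "\<bar>SI w q v - SI w q u - w u * (q v - q u)\<bar> \<le> \<eta> * (m v - m u)"
          by (rule d2(2)) (use uv uv1 in auto)
        have "\<bar>D n v - D n u\<bar> \<le> \<eta> * (C * (m v - m u) + r') + K * r' + \<eta> * (m v - m u)"
          using 1 2 3 unfolding D_def by linarith
        also have "\<dots> = \<eta> * (C + 1) * (m v - m u) + (K + \<eta>) * r'" by (simp add: algebra_simps)
        also have "\<dots> \<le> e * (m v - m u) + (K + \<eta> + 1) * r'" unfolding \<eta>(2) using r' by (simp add: algebra_simps)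
        also have "(K + \<eta> + 1) * r' = r" using K \<eta> by (simp add: r'_def)
        finally show ?case .
      qed
    qed (use d1 d2 in auto)
  qed
  \<comment> \<open>\<open>local_limit\<close> sees only the terms with \<open>s > 0\<close>. The
    remaining one belongs to \<open>s = 0\<close> and is a multiple of the square of one increment
    of \<open>x\<close> over a cell of vanishing length.\<close>
  moreover have "(\<lambda>n. D n 0) \<longlonglongrightarrow> 0"
  proof -
    have "{s \<in> T n. s \<le> 0} = {0}" for n using T01 by force
    then have D0: "D n 0 = w 0 * (\<Sum>s\<in>{s \<in> T n. s \<le> 0}. x (succ_pt (T n) s) - x s)\<^sup>2" for n
      by (simp add: D_def S_def X_def Z0)
    have "(\<lambda>n. \<Sum>s\<in>{s \<in> T n. s \<le> 0}. x (succ_pt (T n) s) - x s) \<longlonglongrightarrow> x 0 - x 0"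
      by (rule telescope_limit[OF x_cont]) auto
    then have "(\<lambda>n. w 0 * (\<Sum>s\<in>{s \<in> T n. s \<le> 0}. x (succ_pt (T n) s) - x s)\<^sup>2) \<longlonglongrightarrow> w 0 * (x 0 - x 0)\<^sup>2"
      by (intro tendsto_intros)
    then show ?thesis by (simp add: D0)
  qed
  ultimately have "(\<lambda>n. (D n t - D n 0) + D n 0 + SI w q t) \<longlonglongrightarrow> 0 + 0 + SI w q t"
    by (intro tendsto_intros)
  then show ?thesis by (simp add: D_def S_def X_def)
qed

text \<open>The clock increments telescope and the squared increments of \<open>x\<close> converge
  to \<open>q\<close>, so their total stays bounded and any error that is small against it
  disappears in the limit.\<close>

lemma small_error_limit:
  assumes r: "\<And>e. e > 0 \<Longrightarrow> \<forall>\<^sub>F n in sequentially. \<forall>s\<in>T n.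
      \<bar>r n s\<bar> \<le> e * ((m (succ_pt (T n) s) - m s) + (x (succ_pt (T n) s) - x s)\<^sup>2)"
    and t: "0 \<le> t" "t \<le> 1"
  shows "(\<lambda>n. \<Sum>s\<in>{s \<in> T n. s \<le> t}. r n s :: real) \<longlonglongrightarrow> 0"
proof (rule LIMSEQ_I)
  fix \<epsilon> :: real assume \<epsilon>: "\<epsilon> > 0"
  define Y where "Y = (\<lambda>n. \<Sum>s\<in>{s \<in> T n. s \<le> t}. (m (succ_pt (T n) s) - m s) + (x (succ_pt (T n) s) - x s)\<^sup>2)"
  define y where "y = m t - m 0 + q t"
  have "Y \<longlonglongrightarrow> y"
    unfolding Y_def sum.distrib y_def using qv_limit[OF t]
    by (intro tendsto_add telescope_limit m_cont t) (simp add: qv_sum_def)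
  then have "\<forall>\<^sub>F n in sequentially. dist (Y n) y < 1" by (rule tendstoD) simp
  moreover have "\<forall>\<^sub>F n in sequentially. \<forall>s\<in>T n.
      \<bar>r n s\<bar> \<le> (\<epsilon> / (\<bar>y\<bar> + 2)) * ((m (succ_pt (T n) s) - m s) + (x (succ_pt (T n) s) - x s)\<^sup>2)"
    by (rule r) (use \<epsilon> in auto)
  ultimately have "\<forall>\<^sub>F n in sequentially. norm ((\<Sum>s\<in>{s \<in> T n. s \<le> t}. r n s) - 0) < \<epsilon>"
  proof eventually_elim
    case (elim n)
    have "\<bar>\<Sum>s\<in>{s \<in> T n. s \<le> t}. r n s\<bar> \<le> (\<Sum>s\<in>{s \<in> T n. s \<le> t}. (\<epsilon> / (\<bar>y\<bar> + 2)) * ((m (succ_pt (T n) s) - m s) + (x (succ_pt (T n) s) - x s)\<^sup>2))"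
      by (rule order_trans[OF sum_abs]) (rule sum_mono, use elim in auto)
    also have "\<dots> = (\<epsilon> / (\<bar>y\<bar> + 2)) * Y n" by (simp only: Y_def sum_distrib_left)
    also have "\<dots> \<le> (\<epsilon> / (\<bar>y\<bar> + 2)) * (\<bar>y\<bar> + 1)"
      using elim(1) \<epsilon> by (intro mult_left_mono) (auto simp: dist_real_def)
    also have "\<dots> < \<epsilon>" using \<epsilon> by (simp add: field_simps)
    finally show ?case by simp
  qed
  then show "\<exists>n0. \<forall>n\<ge>n0. norm ((\<Sum>s\<in>{s \<in> T n. s \<le> t}. r n s) - 0) < \<epsilon>"
    unfolding eventually_sequentially .
qed

end

section \<open>Volterra equations\<close>

context clock
begin

text \<open>Convexity of \<open>exp\<close> gives \<open>exp (l * m a) * (l * (m b - m a)) \<le> exp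
  (l * m b) - exp (l * m a)\<close>: integrating a function of size \<open>exp (l * m)\<close>
  against the clock gains a factor 1/l, as small as desired for large \<open>l\<close>.\<close>

lemma SI_weighted_bound:
  assumes Z: "stdiff Z f g" "Z 0 = 0" and C: "C \<ge> 0" "\<And>u v. 0 \<le> u \<Longrightarrow> u \<le> v \<Longrightarrow> v \<le> 1 \<Longrightarrow> \<bar>g v - g u\<bar> \<le> C * (m v - m u)"
    and l: "l > 0" and c: "c \<ge> 0" and f: "\<And>s. 0 \<le> s \<Longrightarrow> s \<le> 1 \<Longrightarrow> \<bar>f s\<bar> \<le> c * exp (l * m s)"
    and t: "0 \<le> t" "t \<le> 1"
  shows "\<bar>Z t\<bar> \<le> C * c / l * exp (l * m t)"
proof -
  have "\<bar>Z t\<bar> \<le> C * c / l * exp (l * m t) + \<epsilon>" if \<epsilon>: "\<epsilon> > 0" for \<epsilon>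
  proof -
    define e where "e = \<epsilon> / (m t - m 0 + 1)"
    have mt: "m 0 \<le> m t" using m_mono[of 0 t] t by simp
    then have e: "e > 0" using \<epsilon> by (simp add: e_def)
    obtain d where d: "d > 0" "\<And>u v. 0 \<le> u \<Longrightarrow> u \<le> v \<Longrightarrow> v \<le> 1 \<Longrightarrow> v - u < d \<Longrightarrow>
      \<bar>Z v - Z u - f u * (g v - g u)\<bar> \<le> e * (m v - m u)" by (rule stdiffD[OF Z(1) e], rule that)
    define \<mu> where "\<mu> = (\<lambda>t. C * c / l * exp (l * m t) + e * m t)"
    have "\<bar>Z t - Z 0\<bar> \<le> \<mu> t - \<mu> 0"
    proof (rule local_bound_global[OF d(1) _ t(1)])
      fix a b assume ab: "0 \<le> a" "a \<le> b" "b \<le> t" "b - a < d"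
      have "\<bar>f a * (g b - g a)\<bar> \<le> (c * exp (l * m a)) * (C * (m b - m a))"
        unfolding abs_mult using f[of a] C(2)[of a b] ab t c by (intro mult_mono) auto
      also have "\<dots> = C * c / l * (exp (l * m a) * (l * (m b - m a)))" using l by simp
      also have "\<dots> \<le> C * c / l * (exp (l * m b) - exp (l * m a))"
      proof (intro mult_left_mono)
        have "exp (l * m a) * (1 + l * (m b - m a)) \<le> exp (l * m a) * exp (l * (m b - m a))"
          by (intro mult_left_mono exp_ge_add_one_self) auto
        also have "\<dots> = exp (l * m b)" by (simp add: right_diff_distrib flip: exp_add)
        finally show "exp (l * m a) * (l * (m b - m a)) \<le> exp (l * m b) - exp (l * m a)"
          by (simp add: distrib_left)
      qed (use C c l in auto)
      finally have 1: "\<bar>f a * (g b - g a)\<bar> \<le> C * c / l * exp (l * m b) - C * c / l * exp (l * m a)"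
        by (simp only: right_diff_distrib)
      have 2: "\<bar>Z b - Z a - f a * (g b - g a)\<bar> \<le> e * m b - e * m a"
        using d(2)[of a b] ab t by (simp add: right_diff_distrib)
      show "\<bar>Z b - Z a\<bar> \<le> \<mu> b - \<mu> a" using 1 2 unfolding \<mu>_def by linarith
    qed
    moreover have "e * m t - e * m 0 \<le> \<epsilon>"
    proof -
      have "e * (m t - m 0) \<le> e * (m t - m 0 + 1)" using e by simp
      also have "\<dots> = \<epsilon>" using mt by (simp add: e_def)
      finally show ?thesis by (simp only: right_diff_distrib)
    qed
    moreover have "0 \<le> C * c / l * exp (l * m 0)" using C c l by simp
    ultimately show ?thesis using Z(2) unfolding \<mu>_def by linarith
  qed
  then show ?thesis by (rule field_le_epsilon)
qed

end

text \<open>\<open>k\<close> integrands against Lipschitz integrators; the operator below is the right-hand side of the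
  integral equation for \<open>B\<close>.\<close>

locale volterra = clock +
  fixes F :: "nat \<Rightarrow> real \<Rightarrow> real \<Rightarrow> real" and g :: "nat \<Rightarrow> real \<Rightarrow> real" and k :: nat
  assumes g: "j < k \<Longrightarrow> lipm (g j)"
    and F_cont: "j < k \<Longrightarrow> continuous_on ({0..1} \<times> UNIV) (\<lambda>p. F j (fst p) (snd p))"
begin

lemma F_cont': "j < k \<Longrightarrow> continuous_on {0..1} B \<Longrightarrow> continuous_on {0..1} (\<lambda>s. F j s (B s))"
proof -
  assume "j < k" "continuous_on {0..1} B"
  then have "continuous_on {0..1} (\<lambda>s. (\<lambda>p. F j (fst p) (snd p)) (s, B s))"
    by (intro continuous_on_compose2[OF F_cont]) (auto intro!: continuous_intros)
  then show ?thesis by simp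
qed

definition "volt z0 B t = z0 + (\<Sum>j<k. SI (\<lambda>s. F j s (B s)) (g j) t)"

lemma continuous_on_volt: "continuous_on {0..1} B \<Longrightarrow> continuous_on {0..1} (volt z0 B)"
proof -
  assume B: "continuous_on {0..1} B"
  have "continuous_on {0..1} (SI (\<lambda>s. F j s (B s)) (g j))" if j: "j < k" for j
    using F_cont'[OF j B] g[OF j] by (intro lipm_continuous_on) (rule stdiff_lipm[OF stdiff_SI])
  then show ?thesis unfolding volt_def by (intro continuous_intros) auto
qed

lemma g_const: obtains C where "C \<ge> 0" "\<And>j u v. j < k \<Longrightarrow> 0 \<le> u \<Longrightarrow> u \<le> v \<Longrightarrow> v \<le> 1 \<Longrightarrow> \<bar>g j v - g j u\<bar> \<le> C * (m v - m u)"
proof -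
  have "\<exists>C. C \<ge> 0 \<and> (\<forall>j<n. \<forall>u v. 0 \<le> u \<longrightarrow> u \<le> v \<longrightarrow> v \<le> 1 \<longrightarrow> \<bar>g j v - g j u\<bar> \<le> C * (m v - m u))" if "n \<le> k" for n
    using that
  proof (induction n)
    case (Suc n)
    then obtain C where C: "C \<ge> 0" "\<forall>j<n. \<forall>u v. 0 \<le> u \<longrightarrow> u \<le> v \<longrightarrow> v \<le> 1 \<longrightarrow> \<bar>g j v - g j u\<bar> \<le> C * (m v - m u)" by auto
    obtain D where D: "D \<ge> 0" "\<And>u v. 0 \<le> u \<Longrightarrow> u \<le> v \<Longrightarrow> v \<le> 1 \<Longrightarrow> \<bar>g n v - g n u\<bar> \<le> D * (m v - m u)"
      by (rule lipmE[OF g[of n]]) (use Suc.prems in auto)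
    show ?case
    proof (intro exI[of _ "max C D"] conjI allI impI)
      fix j u v assume j: "j < Suc n" and uv: "0 \<le> u" "u \<le> v" "v \<le> (1::real)"
      have "C * (m v - m u) \<le> max C D * (m v - m u)" "D * (m v - m u) \<le> max C D * (m v - m u)"
        using m_mono[OF uv] by (auto intro!: mult_right_mono)
      then show "\<bar>g j v - g j u\<bar> \<le> max C D * (m v - m u)"
        using C(2)[rule_format, of j u v] D(2)[OF uv] j uv by (cases "j = n") (auto simp: less_Suc_eq intro: order_trans)
    qed (use C in auto)
  qed auto
  from this[OF order_refl] obtain C where "C \<ge> 0" "\<forall>j<k. \<forall>u v. 0 \<le> u \<longrightarrow> u \<le> v \<longrightarrow> v \<le> 1 \<longrightarrow> \<bar>g j v - g j u\<bar> \<le> C * (m v - m u)" by blast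
  then show ?thesis by (intro that[of C]) auto
qed

text \<open>The \<open>k\<close> integrators with Lipschitz constant \<open>C\<close> produce the
  factor \<open>k * C / l\<close>; the choice of \<open>l\<close> against
  \<open>2 * k * C * K\<close> makes it at most \<open>1 / (2 * K)\<close>.\<close>

lemma volt_bound:
  assumes C: "C \<ge> 0" "\<And>j u v. j < k \<Longrightarrow> 0 \<le> u \<Longrightarrow> u \<le> v \<Longrightarrow> v \<le> 1 \<Longrightarrow> \<bar>g j v - g j u\<bar> \<le> C * (m v - m u)"
    and Z: "\<And>j. j < k \<Longrightarrow> stdiff (Z j) (f j) (g j)" "\<And>j. j < k \<Longrightarrow> Z j 0 = 0"
    and c: "c \<ge> 0" and f: "\<And>j s. j < k \<Longrightarrow> 0 \<le> s \<Longrightarrow> s \<le> 1 \<Longrightarrow> \<bar>f j s\<bar> \<le> c * exp (l * m s)"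
    and l: "l > 0" "l \<ge> 2 * real k * C * K" and K: "K > 0" and t: "0 \<le> t" "t \<le> 1"
  shows "\<bar>\<Sum>j<k. Z j t\<bar> \<le> c / K / 2 * exp (l * m t)"
proof -
  have "\<bar>\<Sum>j<k. Z j t\<bar> \<le> (\<Sum>j<k. C * c / l * exp (l * m t))"
    by (rule order_trans[OF sum_abs], rule sum_mono, rule SI_weighted_bound[where f="f _" and g="g _"])
      (use assms in auto)
  also have "\<dots> = (real k * C / l) * (c * exp (l * m t))" by simp
  also have "\<dots> \<le> 1 / K / 2 * (c * exp (l * m t))"
  proof (rule mult_right_mono)
    show "real k * C / l \<le> 1 / K / 2" using l K by (simp add: field_simps)
  qed (use c in auto)
  finally show ?thesis by simp
qed

lemma volt_diff_bound:
  assumes B: "continuous_on {0..1} B" "continuous_on {0..1} B'"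
    and L: "L > 0" "\<And>j s. j < k \<Longrightarrow> 0 \<le> s \<Longrightarrow> s \<le> 1 \<Longrightarrow> \<bar>F j s (B s) - F j s (B' s)\<bar> \<le> L * \<bar>B s - B' s\<bar>"
    and C: "C \<ge> 0" "\<And>j u v. j < k \<Longrightarrow> 0 \<le> u \<Longrightarrow> u \<le> v \<Longrightarrow> v \<le> 1 \<Longrightarrow> \<bar>g j v - g j u\<bar> \<le> C * (m v - m u)"
    and l: "l > 0" "l \<ge> 2 * real k * C * L"
    and c: "\<And>t. t \<in> {0..1} \<Longrightarrow> \<bar>B t - B' t\<bar> \<le> c * exp (l * m t)" and t: "t \<in> {0..1}"
  shows "\<bar>volt z0 B t - volt z0 B' t\<bar> \<le> c / 2 * exp (l * m t)"
proof -
  have c0: "c \<ge> 0" using c[of 0] by (auto intro: mult_nonneg_nonneg simp: zero_le_mult_iff dest: order_trans[OF abs_ge_zero])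
  let ?Z = "\<lambda>j t. SI (\<lambda>s. F j s (B s)) (g j) t - SI (\<lambda>s. F j s (B' s)) (g j) t"
  have "\<bar>\<Sum>j<k. ?Z j t\<bar> \<le> (L * c) / L / 2 * exp (l * m t)"
  proof (rule volt_bound[OF C, where f="\<lambda>j s. F j s (B s) - F j s (B' s)"])
    fix j assume j: "j < k"
    show "stdiff (?Z j) (\<lambda>s. F j s (B s) - F j s (B' s)) (g j)"
      using stdiff_add[OF stdiff_SI[OF F_cont'[OF j B(1)] g[OF j]] stdiff_cmult[OF stdiff_SI[OF F_cont'[OF j B(2)] g[OF j]], of "-1"],
        of "\<lambda>s. F j s (B s) - F j s (B' s)" "g j"] by (simp add: left_diff_distrib)
    show "?Z j 0 = 0" using SI_0 F_cont' g j B by simp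
    show "\<bar>F j s (B s) - F j s (B' s)\<bar> \<le> L * c * exp (l * m s)" if "0 \<le> s" "s \<le> 1" for s
      using order_trans[OF L(2)[OF j that] mult_left_mono[OF c[of s], of L]] L(1) that by (simp add: mult.assoc)
  qed (use L c0 l t in auto)
  then show ?thesis using L by (simp add: volt_def sum_subtractf)
qed

text \<open>Both solutions are given and bounded, so a single local Lipschitz constant serves. The
  half-contraction in the weighted norm, applied repeatedly to the same pair, forces their distance
  below \<open>c / 2 ^ n\<close> for every \<open>n\<close>.\<close>

lemma volt_unique:
  assumes B: "continuous_on {0..1} B" "\<And>t. t \<in> {0..1} \<Longrightarrow> volt z0 B t = B t"
    and B': "continuous_on {0..1} B'" "\<And>t. t \<in> {0..1} \<Longrightarrow> volt z0 B' t = B' t"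
    and lip: "\<And>R. \<exists>L. \<forall>j<k. \<forall>s\<in>{0..1}. \<forall>y y'. \<bar>y\<bar> \<le> R \<longrightarrow> \<bar>y'\<bar> \<le> R \<longrightarrow> \<bar>F j s y - F j s y'\<bar> \<le> L * \<bar>y - y'\<bar>"
    and t: "t \<in> {0..1}"
  shows "B t = B' t"
proof -
  obtain R1 where R1: "R1 \<ge> 0" "\<And>t. 0 \<le> t \<Longrightarrow> t \<le> 1 \<Longrightarrow> \<bar>B t\<bar> \<le> R1" by (rule bounded_on_01[OF B(1)], rule that)
  obtain R2 where R2: "R2 \<ge> 0" "\<And>t. 0 \<le> t \<Longrightarrow> t \<le> 1 \<Longrightarrow> \<bar>B' t\<bar> \<le> R2" by (rule bounded_on_01[OF B'(1)], rule that)
  obtain L0 where L0: "\<forall>j<k. \<forall>s\<in>{0..1}. \<forall>y y'. \<bar>y\<bar> \<le> R1 + R2 \<longrightarrow> \<bar>y'\<bar> \<le> R1 + R2 \<longrightarrow> \<bar>F j s y - F j s y'\<bar> \<le> L0 * \<bar>y - y'\<bar>"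
    using lip[of "R1 + R2"] by blast
  define L where "L = \<bar>L0\<bar> + 1"
  have L: "L > 0" "\<bar>F j s (B s) - F j s (B' s)\<bar> \<le> L * \<bar>B s - B' s\<bar>" if "j < k" "0 \<le> s" "s \<le> 1" for j s
  proof -
    have "\<bar>F j s (B s) - F j s (B' s)\<bar> \<le> L0 * \<bar>B s - B' s\<bar>"
      using L0[rule_format, of j s "B s" "B' s"] that R1(2)[of s] R2(2)[of s] R1(1) R2(1) by simp
    also have "\<dots> \<le> L * \<bar>B s - B' s\<bar>" by (intro mult_right_mono) (auto simp: L_def)
    finally show "\<bar>F j s (B s) - F j s (B' s)\<bar> \<le> L * \<bar>B s - B' s\<bar>" .
  qed (simp add: L_def)
  have L': "L > 0" by (simp add: L_def)
  obtain C where C: "C \<ge> 0" "\<And>j u v. j < k \<Longrightarrow> 0 \<le> u \<Longrightarrow> u \<le> v \<Longrightarrow> v \<le> 1 \<Longrightarrow> \<bar>g j v - g j u\<bar> \<le> C * (m v - m u)"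
    by (rule g_const, rule that)
  define l where "l = 2 * real k * C * L + 1"
  have l: "l > 0" "l \<ge> 2 * real k * C * L" using C L' by (auto simp: l_def add_nonneg_pos)
  have cb: "continuous_on {0..1} (\<lambda>t. (B t - B' t) / exp (l * m t))"
    by (intro continuous_intros B B' m_cont) auto
  obtain c where c: "c \<ge> 0" "\<And>t. 0 \<le> t \<Longrightarrow> t \<le> 1 \<Longrightarrow> \<bar>(B t - B' t) / exp (l * m t)\<bar> \<le> c"
    by (rule bounded_on_01[OF cb], rule that)
  have c': "\<bar>B t - B' t\<bar> \<le> c * exp (l * m t)" if "t \<in> {0..1}" for t
    using c(2)[of t] that by (simp add: abs_divide divide_le_eq)
  have "\<bar>B t - B' t\<bar> \<le> c / 2 ^ n * exp (l * m t)" if "t \<in> {0..1}" for n t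
    using that
  proof (induction n arbitrary: t)
    case (Suc n)
    then show ?case
      using volt_diff_bound[OF B(1) B'(1) L' L(2) C l Suc.IH Suc.prems, of z0] B(2) B'(2) by (simp add: mult.commute)
  qed (use c' in auto)
  from this[OF t] have le: "\<bar>B t - B' t\<bar> \<le> c * exp (l * m t) * (1/2) ^ n" for n
    by (simp add: power_divide)
  have "(\<lambda>n. c * exp (l * m t) * (1/2) ^ n) \<longlonglongrightarrow> c * exp (l * m t) * 0"
    by (rule tendsto_mult_left, rule LIMSEQ_realpow_zero) auto
  then have "\<bar>B t - B' t\<bar> \<le> c * exp (l * m t) * 0"
    by (rule LIMSEQ_le_const) (use le in auto)
  then show ?thesis by simp
qed

lemma volt_exists_global:
  assumes lip: "\<And>j s y y'. j < k \<Longrightarrow> s \<in> {0..1} \<Longrightarrow> \<bar>F j s y - F j s y'\<bar> \<le> L * \<bar>y - y'\<bar>"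
  shows "\<exists>B. continuous_on {0..1} B \<and> (\<forall>t\<in>{0..1}. volt z0 B t = B t)"
proof -
  define L' where "L' = \<bar>L\<bar> + 1"
  have L': "L' > 0" "\<And>j s y y'. j < k \<Longrightarrow> s \<in> {0..1} \<Longrightarrow> \<bar>F j s y - F j s y'\<bar> \<le> L' * \<bar>y - y'\<bar>"
    by (simp add: L'_def, rule order_trans[OF lip mult_right_mono]) (auto simp: L'_def)
  obtain C where C: "C \<ge> 0" "\<And>j u v. j < k \<Longrightarrow> 0 \<le> u \<Longrightarrow> u \<le> v \<Longrightarrow> v \<le> 1 \<Longrightarrow> \<bar>g j v - g j u\<bar> \<le> C * (m v - m u)"
    by (rule g_const, rule that)
  define l where "l = 2 * real k * C * L' + 1"
  have l: "l > 0" "l \<ge> 2 * real k * C * L'" using C L'(1) by (auto simp: l_def add_nonneg_pos)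
  have cb: "continuous_on {0..1} (\<lambda>t. (volt z0 (\<lambda>_. z0) t - z0) / exp (l * m t))"
    by (intro continuous_intros continuous_on_volt m_cont) auto
  obtain c where c: "c \<ge> 0" "\<And>t. 0 \<le> t \<Longrightarrow> t \<le> 1 \<Longrightarrow> \<bar>(volt z0 (\<lambda>_. z0) t - z0) / exp (l * m t)\<bar> \<le> c"
    by (rule bounded_on_01[OF cb], rule that)
  show ?thesis
  proof (rule weighted_contraction_exists[where W="\<lambda>t. exp (l * m t)" and ?y0.0="\<lambda>_. z0" and ?C0.0=c])
    show "\<bar>volt z0 (\<lambda>_. z0) t - z0\<bar> \<le> c * exp (l * m t)" if "t \<in> {0..1}" for t
      using c(2)[of t] that by (simp add: abs_divide divide_le_eq)
    show "\<bar>volt z0 y t - volt z0 z t\<bar> \<le> c / 2 * exp (l * m t)"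
      if "continuous_on {0..1} y" "continuous_on {0..1} z" "\<And>t. t \<in> {0..1} \<Longrightarrow> \<bar>y t - z t\<bar> \<le> c * exp (l * m t)" "t \<in> {0..1}" for y z c t
      by (rule volt_diff_bound[OF that(1,2) L'(1) _ C l that(3,4)]) (use L'(2) in auto)
  qed (auto intro!: continuous_intros m_cont continuous_on_volt)
qed

end

context volterra
begin

text \<open>At the maximum \<open>N\<close> of \<open>|B| / exp (l * m)\<close> the equation yields
  \<open>N \<le> |z0| / W0 + (1 / W0 + N) / 2\<close> with \<open>W0 = exp (l * m 0)\<close>, which
  can be solved for \<open>N\<close>. The integrands \<open>f\<close> are kept apart from
  \<open>F\<close> so that the bound also applies to a truncated equation.\<close>

lemma volt_apriori:
  assumes B: "continuous_on {0..1} B" and eq: "\<And>t. t \<in> {0..1} \<Longrightarrow> B t = z0 + (\<Sum>j<k. Z j t)"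
    and Z: "\<And>j. j < k \<Longrightarrow> stdiff (Z j) (f j) (g j)" "\<And>j. j < k \<Longrightarrow> Z j 0 = 0"
    and C: "C \<ge> 0" "\<And>j u v. j < k \<Longrightarrow> 0 \<le> u \<Longrightarrow> u \<le> v \<Longrightarrow> v \<le> 1 \<Longrightarrow> \<bar>g j v - g j u\<bar> \<le> C * (m v - m u)"
    and K: "K > 0" "\<And>j s. j < k \<Longrightarrow> 0 \<le> s \<Longrightarrow> s \<le> 1 \<Longrightarrow> \<bar>f j s\<bar> \<le> K * (1 + \<bar>B s\<bar>)"
    and l: "l > 0" "l \<ge> 2 * real k * C * K" and t: "t \<in> {0..1}"
  shows "\<bar>B t\<bar> \<le> (2 * \<bar>z0\<bar> + 1) * exp (l * m 1 - l * m 0)"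
proof -
  let ?W = "\<lambda>t. exp (l * m t)"
  have W: "?W 0 \<le> ?W t" "?W t \<le> ?W 1" if "t \<in> {0..1}" for t using m_mono[of 0 t] m_mono[of t 1] that l by auto
  have "\<exists>s\<in>{0..1}. \<forall>t\<in>{0..1}. \<bar>B t\<bar> / ?W t \<le> \<bar>B s\<bar> / ?W s"
    by (rule continuous_attains_sup) (auto intro!: continuous_intros B m_cont)
  then obtain s where s: "s \<in> {0..1}" "\<And>t. t \<in> {0..1} \<Longrightarrow> \<bar>B t\<bar> / ?W t \<le> \<bar>B s\<bar> / ?W s" by blast
  define N where "N = \<bar>B s\<bar> / ?W s"
  have N: "\<bar>B t\<bar> \<le> N * ?W t" if "t \<in> {0..1}" for t
    using s(2)[OF that] by (simp only: N_def[symmetric] pos_divide_le_eq exp_gt_zero)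
  have N0: "N \<ge> 0" by (simp add: N_def)
  define c where "c = 1 / ?W 0 + N"
  have "\<bar>\<Sum>j<k. Z j s\<bar> \<le> (K * c) / K / 2 * ?W s"
  proof (rule volt_bound[OF C Z])
    show "\<bar>f j r\<bar> \<le> K * c * ?W r" if "j < k" "0 \<le> r" "r \<le> 1" for j r
    proof -
      have "1 + \<bar>B r\<bar> \<le> ?W r / ?W 0 + N * ?W r" using W(1)[of r] N[of r] that by (intro add_mono) auto
      also have "\<dots> = c * ?W r" by (simp add: c_def distrib_right)
      finally show ?thesis using order_trans[OF K(2)[OF that] mult_left_mono[of _ _ K]] K(1) by (simp add: mult.assoc)
    qed
  qed (use K l s N0 in \<open>auto simp: c_def\<close>)
  then have "\<bar>B s\<bar> \<le> \<bar>z0\<bar> + c / 2 * ?W s" using eq[OF s(1)] K(1) by simp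
  moreover have "\<bar>B s\<bar> = N * ?W s" by (simp add: N_def)
  moreover have "\<bar>z0\<bar> \<le> \<bar>z0\<bar> / ?W 0 * ?W s" using W(1)[OF s(1)] by (simp add: field_simps mult_left_mono)
  ultimately have "N * ?W s \<le> (\<bar>z0\<bar> / ?W 0 + c / 2) * ?W s" by (simp only: distrib_right)
  then have "N \<le> \<bar>z0\<bar> / ?W 0 + c / 2" by (rule mult_right_le_imp_le) simp
  then have N': "N \<le> (2 * \<bar>z0\<bar> + 1) / ?W 0" by (simp add: c_def add_divide_distrib)
  have "\<bar>B t\<bar> \<le> (2 * \<bar>z0\<bar> + 1) / ?W 0 * ?W 1"
    by (rule order_trans[OF N[OF t]], rule mult_mono[OF N' W(2)[OF t]]) auto
  then show ?thesis by (simp add: exp_diff)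
qed

theorem volt_exists:
  assumes lip: "\<And>R. \<exists>L. \<forall>j<k. \<forall>s\<in>{0..1}. \<forall>y y'. \<bar>y\<bar> \<le> R \<longrightarrow> \<bar>y'\<bar> \<le> R \<longrightarrow> \<bar>F j s y - F j s y'\<bar> \<le> L * \<bar>y - y'\<bar>"
    and K: "K > 0" "\<And>j s y. j < k \<Longrightarrow> s \<in> {0..1} \<Longrightarrow> \<bar>F j s y\<bar> \<le> K * (1 + \<bar>y\<bar>)"
  shows "\<exists>B. continuous_on {0..1} B \<and> (\<forall>t\<in>{0..1}. volt z0 B t = B t)"
proof -
  obtain C where C: "C \<ge> 0" "\<And>j u v. j < k \<Longrightarrow> 0 \<le> u \<Longrightarrow> u \<le> v \<Longrightarrow> v \<le> 1 \<Longrightarrow> \<bar>g j v - g j u\<bar> \<le> C * (m v - m u)"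
    by (rule g_const, rule that)
  define l where "l = 2 * real k * C * K + 1"
  have l: "l > 0" "l \<ge> 2 * real k * C * K" using C K(1) by (auto simp: l_def add_nonneg_pos)
  define R where "R = (2 * \<bar>z0\<bar> + 1) * exp (l * m 1 - l * m 0)"
  have R: "R > 0" by (simp add: R_def add_nonneg_pos)
  \<comment> \<open>Truncation at the a priori radius. Because of \<open>|c y| \<le> |y|\<close> the
    linear growth survives with the same \<open>K\<close>, so the solution of the truncated equation
    obeys the same bound and never meets the truncation.\<close>
  define c where "c = (\<lambda>y. max (- R) (min R y))"
  have c: "\<bar>c y\<bar> \<le> R" "\<bar>c y\<bar> \<le> \<bar>y\<bar>" "\<bar>c y - c y'\<bar> \<le> \<bar>y - y'\<bar>" "\<bar>y\<bar> \<le> R \<Longrightarrow> c y = y" for y y'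
    using R by (auto simp: c_def min_def max_def)
  have cc: "continuous_on UNIV c" unfolding c_def by (intro continuous_intros)
  interpret tr: volterra m "\<lambda>j s y. F j s (c y)" g k
  proof
    fix j assume j: "j < k"
    have "continuous_on ({0..1} \<times> UNIV) (\<lambda>p. (\<lambda>p. F j (fst p) (snd p)) (fst p, c (snd p)))"
      by (rule continuous_on_compose2[OF F_cont[OF j]])
        (auto intro!: continuous_intros continuous_on_compose2[OF cc])
    then show "continuous_on ({0..1} \<times> UNIV) (\<lambda>p. F j (fst p) (c (snd p)))" by simp
  qed (use g in auto)
  obtain L where L: "\<And>j s y y'. j < k \<Longrightarrow> s \<in> {0..1} \<Longrightarrow> \<bar>y\<bar> \<le> R \<Longrightarrow> \<bar>y'\<bar> \<le> R \<Longrightarrow> \<bar>F j s y - F j s y'\<bar> \<le> L * \<bar>y - y'\<bar>"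
    using lip[of R] by blast
  have "\<exists>B. continuous_on {0..1} B \<and> (\<forall>t\<in>{0..1}. tr.volt z0 B t = B t)"
  proof (rule tr.volt_exists_global)
    fix j s y y' assume js: "j < k" "s \<in> {0..1::real}"
    have "\<bar>F j s (c y) - F j s (c y')\<bar> \<le> L * \<bar>c y - c y'\<bar>" by (rule L[OF js c(1) c(1)])
    also have "\<dots> \<le> \<bar>L\<bar> * \<bar>y - y'\<bar>" by (rule mult_mono) (use c in auto)
    finally show "\<bar>F j s (c y) - F j s (c y')\<bar> \<le> \<bar>L\<bar> * \<bar>y - y'\<bar>" .
  qed
  then obtain B where B: "continuous_on {0..1} B" "\<And>t. t \<in> {0..1} \<Longrightarrow> tr.volt z0 B t = B t" by blast
  have bd: "\<bar>B t\<bar> \<le> R" if "t \<in> {0..1}" for t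
    unfolding R_def
  proof (rule volt_apriori[OF B(1) _ _ _ C K(1) _ l that, where f="\<lambda>j s. F j s (c (B s))" and Z="\<lambda>j. SI (\<lambda>s. F j s (c (B s))) (g j)"])
    show "B t = z0 + (\<Sum>j<k. SI (\<lambda>s. F j s (c (B s))) (g j) t)" if "t \<in> {0..1}" for t
      using B(2)[OF that] by (simp add: tr.volt_def)
    fix j assume j: "j < k"
    show "stdiff (SI (\<lambda>s. F j s (c (B s))) (g j)) (\<lambda>s. F j s (c (B s))) (g j)" "SI (\<lambda>s. F j s (c (B s))) (g j) 0 = 0"
      using SI[OF tr.F_cont'[OF j B(1)] g[OF j]] by auto
    show "\<bar>F j s (c (B s))\<bar> \<le> K * (1 + \<bar>B s\<bar>)" if "0 \<le> s" "s \<le> 1" for s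
      using order_trans[OF K(2)[OF j, of s "c (B s)"] mult_left_mono[of "1 + \<bar>c (B s)\<bar>" "1 + \<bar>B s\<bar>" K]] that c(2) K(1) by auto
  qed
  have "volt z0 B t = tr.volt z0 B t" if "t \<in> {0..1}" for t
  proof -
    have "SI (\<lambda>s. F j s (B s)) (g j) t = SI (\<lambda>s. F j s (c (B s))) (g j) t" if j: "j < k" for j
    proof -
      note s = stdiff_SI[OF tr.F_cont'[OF j B(1)] g[OF j]]
      have "stdiff (SI (\<lambda>s. F j s (c (B s))) (g j)) (\<lambda>s. F j s (B s)) (g j)"
        using s bd c(4) unfolding stdiff_def by auto
      from stdiff_unique[OF this stdiff_SI[OF F_cont'[OF j B(1)] g[OF j]], of 0 t] \<open>t \<in> {0..1}\<close>
      show ?thesis by (simp add: SI_0[OF tr.F_cont'[OF j B(1)] g[OF j]] SI_0[OF F_cont'[OF j B(1)] g[OF j]])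
    qed
    then show ?thesis by (simp add: volt_def tr.volt_def)
  qed
  with B show ?thesis by auto
qed

end

section \<open>Ito's formula along the flow\<close>

lemma uniformly_continuous_flow:
  fixes h :: "real \<Rightarrow> real \<Rightarrow> real \<Rightarrow> real"
  assumes h: "continuous_on (({0..1} \<times> UNIV) \<times> UNIV) (\<lambda>q. h (fst (fst q)) (snd (fst q)) (snd q))" and e: "e > 0"
  obtains d where "d > 0" "\<And>\<tau> \<tau>' \<xi> \<xi>' t t'. \<tau> \<in> {0..1} \<Longrightarrow> \<tau>' \<in> {0..1} \<Longrightarrow> \<bar>\<xi>\<bar> \<le> R \<Longrightarrow> \<bar>\<xi>'\<bar> \<le> R \<Longrightarrow> \<bar>t\<bar> \<le> R \<Longrightarrow> \<bar>t'\<bar> \<le> R \<Longrightarrow>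
    \<bar>\<tau> - \<tau>'\<bar> < d \<Longrightarrow> \<bar>\<xi> - \<xi>'\<bar> < d \<Longrightarrow> \<bar>t - t'\<bar> < d \<Longrightarrow> \<bar>h \<tau> \<xi> t - h \<tau>' \<xi>' t'\<bar> < e"
proof -
  let ?K = "({0..1::real} \<times> {-R..R}) \<times> {-R..R}" and ?h = "\<lambda>q. h (fst (fst q)) (snd (fst q)) (snd q)"
  have "compact ?K" by (intro compact_Times compact_Icc)
  moreover have "continuous_on ?K ?h" by (rule continuous_on_subset[OF h]) auto
  ultimately have "uniformly_continuous_on ?K ?h" by (rule compact_uniformly_continuous[rotated])
  then obtain d where d: "d > 0" "\<forall>p\<in>?K. \<forall>p'\<in>?K. dist p' p < d \<longrightarrow> dist (?h p') (?h p) < e"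
    using e unfolding uniformly_continuous_on_def by blast
  show ?thesis
  proof (rule that)
    show "d / 3 > 0" using d by simp
    fix \<tau> \<tau>' \<xi> \<xi>' t t' :: real
    assume *: "\<tau> \<in> {0..1}" "\<tau>' \<in> {0..1}" "\<bar>\<xi>\<bar> \<le> R" "\<bar>\<xi>'\<bar> \<le> R" "\<bar>t\<bar> \<le> R" "\<bar>t'\<bar> \<le> R"
      "\<bar>\<tau> - \<tau>'\<bar> < d / 3" "\<bar>\<xi> - \<xi>'\<bar> < d / 3" "\<bar>t - t'\<bar> < d / 3"
    have "dist ((\<tau>, \<xi>), t) ((\<tau>', \<xi>'), t') \<le> dist (\<tau>, \<xi>) (\<tau>', \<xi>') + dist t t'"
      unfolding dist_Pair_Pair by (rule sqrt_sum_squares_le_sum) auto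
    also have "dist (\<tau>, \<xi>) (\<tau>', \<xi>') \<le> dist \<tau> \<tau>' + dist \<xi> \<xi>'"
      unfolding dist_Pair_Pair by (rule sqrt_sum_squares_le_sum) auto
    finally have "dist ((\<tau>, \<xi>), t) ((\<tau>', \<xi>'), t') < d" using * by (simp add: dist_real_def)
    then show "\<bar>h \<tau> \<xi> t - h \<tau>' \<xi>' t'\<bar> < e"
      using d(2)[rule_format, of "((\<tau>', \<xi>'), t')" "((\<tau>, \<xi>), t)"] * by (auto simp: dist_real_def abs_le_iff)
  qed
qed

context flow_field
begin

definition "flt \<tau> \<xi> t = la \<tau> \<xi> t * qa \<tau> \<xi> t"
definition "ftt \<tau> \<xi> t = s2 \<tau> (fl \<tau> \<xi> t) * \<sigma> \<tau> (fl \<tau> \<xi> t)"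

lemma la_pos: "la \<tau> \<xi> t > 0" by (simp add: la_def)

lemma continuous_on_flow:
  assumes "continuous_on S f" "continuous_on S g" "continuous_on S h" "\<And>p. p \<in> S \<Longrightarrow> f p \<in> I"
  shows "continuous_on S (\<lambda>p. la (f p) (g p) (h p))" "continuous_on S (\<lambda>p. qa (f p) (g p) (h p))"
    "continuous_on S (\<lambda>p. flt (f p) (g p) (h p))" "continuous_on S (\<lambda>p. ftt (f p) (g p) (h p))"
    "continuous_on S (\<lambda>p. \<sigma> (f p) (fl (f p) (g p) (h p)))"
proof -
  have c: "continuous_on S (\<lambda>p. ((f p, g p), h p))" using assms by (intro continuous_intros)
  have sub: "(\<lambda>p. ((f p, g p), h p)) ` S \<subseteq> (I \<times> UNIV) \<times> UNIV" using assms(4) by auto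
  show 1: "continuous_on S (\<lambda>p. la (f p) (g p) (h p))" "continuous_on S (\<lambda>p. qa (f p) (g p) (h p))"
    using continuous_on_compose2[OF C1_on_imp_continuous_on[OF la_C1] c sub]
      continuous_on_compose2[OF C1_on_imp_continuous_on[OF qa_C1] c sub] by simp_all
  show "continuous_on S (\<lambda>p. flt (f p) (g p) (h p))" unfolding flt_def by (intro continuous_intros 1)
  have 2: "continuous_on S (\<lambda>p. fl (f p) (g p) (h p))" using assms by (rule continuous_on_flI)
  show "continuous_on S (\<lambda>p. \<sigma> (f p) (fl (f p) (g p) (h p)))" "continuous_on S (\<lambda>p. ftt (f p) (g p) (h p))"
    using continuous_on_field[OF assms(1) 2 assms(4)] unfolding ftt_def by (simp_all add: continuous_on_mult)
qed

lemma sigma_fl_deriv: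
  assumes "\<tau> \<in> I" shows "((\<lambda>t. \<sigma> \<tau> (fl \<tau> \<xi> t)) has_real_derivative ftt \<tau> \<xi> t) (at t)"
proof -
  have "((\<lambda>p. \<sigma> (fst p) (snd p)) has_derivative (\<lambda>v. s1 (fst (\<tau>, y)) (snd (\<tau>, y)) * fst v + s2 (fst (\<tau>, y)) (snd (\<tau>, y)) * snd v)) (at (\<tau>, y))" for y
    by (rule sigma_derivative(1)) (use assms in auto)
  from has_real_derivative_slice(2)[OF this] have "(\<sigma> \<tau> has_real_derivative s2 \<tau> y) (at y)" for y by simp
  from DERIV_chain'[OF fl_deriv[OF assms] this] show ?thesis by (simp add: ftt_def mult.commute)
qed

lemma fl_taylor:
  assumes "\<tau> \<in> I"
  shows "\<exists>c. \<bar>c - t\<bar> \<le> \<bar>t' - t\<bar> \<and> min t t' \<le> c \<and> c \<le> max t t' \<and>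
    fl \<tau> \<xi> t' - fl \<tau> \<xi> t = \<sigma> \<tau> (fl \<tau> \<xi> t) * (t' - t) + ftt \<tau> \<xi> c / 2 * (t' - t)\<^sup>2"
proof (cases "t' = t")
  case False
  define D where "D = (\<lambda>k::nat. if k = 0 then fl \<tau> \<xi> else if k = 1 then (\<lambda>t. \<sigma> \<tau> (fl \<tau> \<xi> t)) else ftt \<tau> \<xi>)"
  have "\<exists>c. (if t' < t then t' < c \<and> c < t else t < c \<and> c < t') \<and>
      fl \<tau> \<xi> t' = (\<Sum>k<2. D k t / fact k * (t' - t) ^ k) + D 2 c / fact 2 * (t' - t) ^ 2"
  proof (rule Taylor[where a="min t t'" and b="max t t'"])
    show "\<forall>k s. k < 2 \<and> min t t' \<le> s \<and> s \<le> max t t' \<longrightarrow> (D k has_real_derivative D (Suc k) s) (at s)"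
      using fl_deriv[OF assms] sigma_fl_deriv[OF assms] by (auto simp: D_def less_2_cases_iff)
  qed (use False in \<open>auto simp: D_def\<close>)
  then obtain c where c: "if t' < t then t' < c \<and> c < t else t < c \<and> c < t'"
    "fl \<tau> \<xi> t' = (\<Sum>k<2. D k t / fact k * (t' - t) ^ k) + D 2 c / fact 2 * (t' - t) ^ 2" by blast
  then show ?thesis
    by (intro exI[of _ c]) (auto simp: D_def numeral_2_eq_2 split: if_splits)
qed (auto intro!: exI[of _ t])

lemma fl_mvt:
  assumes u: "u \<in> I" "v \<in> I"
  shows "\<exists>\<theta>. 0 \<le> \<theta> \<and> \<theta> \<le> 1 \<and> fl v \<zeta> t - fl u \<xi> t
    = flt (u + \<theta> * (v - u)) (\<xi> + \<theta> * (\<zeta> - \<xi>)) t * (v - u) + la (u + \<theta> * (v - u)) (\<xi> + \<theta> * (\<zeta> - \<xi>)) t * (\<zeta> - \<xi>)"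
proof -
  let ?a = "\<lambda>\<theta>. u + \<theta> * (v - u)" and ?b = "\<lambda>\<theta>. \<xi> + \<theta> * (\<zeta> - \<xi>)"
  have d: "((\<lambda>\<theta>. fl (?a \<theta>) (?b \<theta>) t) has_real_derivative flt (?a \<theta>) (?b \<theta>) t * (v - u) + la (?a \<theta>) (?b \<theta>) t * (\<zeta> - \<xi>)) (at \<theta>)"
    if "0 \<le> \<theta>" "\<theta> \<le> 1" for \<theta>
  proof -
    have "((\<lambda>\<theta>. ((?a \<theta>, ?b \<theta>), t)) has_derivative (\<lambda>h. ((h * (v - u), h * (\<zeta> - \<xi>)), 0))) (at \<theta>)"
      by (auto intro!: derivative_eq_intros)
    from has_derivative_compose[OF this fl_has_derivative[OF segment_I[OF u(2,1) that]]]
    have "((\<lambda>\<theta>. fl (?a \<theta>) (?b \<theta>) t) has_derivative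
      (\<lambda>h. la (?a \<theta>) (?b \<theta>) t * qa (?a \<theta>) (?b \<theta>) t * (h * (v - u)) + la (?a \<theta>) (?b \<theta>) t * (h * (\<zeta> - \<xi>)))) (at \<theta>)" by simp
    then show ?thesis
      unfolding has_field_derivative_def flt_def by (rule has_derivative_eq_rhs) (simp add: fun_eq_iff algebra_simps)
  qed
  from MVT2[OF zero_less_one d] obtain \<theta> where "0 < \<theta>" "\<theta> < 1"
    "fl (?a 1) (?b 1) t - fl (?a 0) (?b 0) t = (1 - 0) * (flt (?a \<theta>) (?b \<theta>) t * (v - u) + la (?a \<theta>) (?b \<theta>) t * (\<zeta> - \<xi>))"
    by blast
  then show ?thesis by (intro exI[of _ \<theta>]) auto
qed

end

locale ito_flow = flow_field \<sigma> I M + partition_clock m T x for \<sigma> I M m T x +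
  assumes I01: "{0..1} \<subseteq> I"
begin

lemma continuous_on_flow01:
  assumes "continuous_on {0..1} \<beta>"
  shows "continuous_on {0..1} (\<lambda>t. fl t (\<beta> t) (x t))" "continuous_on {0..1} (\<lambda>t. la t (\<beta> t) (x t))"
    "continuous_on {0..1} (\<lambda>t. flt t (\<beta> t) (x t))" "continuous_on {0..1} (\<lambda>t. ftt t (\<beta> t) (x t))"
    "continuous_on {0..1} (\<lambda>t. qa t (\<beta> t) (x t))"
  using I01 by (auto intro!: continuous_on_flI continuous_on_flow assms x_cont continuous_intros)

lemma ito_local:
  assumes \<beta>: "lipm \<beta>" and e: "e > 0"
  shows "\<exists>d>0. \<forall>u v. 0 \<le> u \<longrightarrow> u \<le> v \<longrightarrow> v \<le> 1 \<longrightarrow> v - u < d \<longrightarrow>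
    \<bar>fl v (\<beta> v) (x v) - fl u (\<beta> u) (x u) - \<sigma> u (fl u (\<beta> u) (x u)) * (x v - x u) - flt u (\<beta> u) (x u) * (v - u)
      - la u (\<beta> u) (x u) * (\<beta> v - \<beta> u) - ftt u (\<beta> u) (x u) / 2 * (x v - x u)\<^sup>2\<bar> \<le> e * ((m v - m u) + (x v - x u)\<^sup>2)"
proof -
  have c\<beta>: "continuous_on {0..1} \<beta>" by (rule lipm_continuous_on[OF \<beta>])
  obtain C where C: "C \<ge> 0" "\<And>u v. 0 \<le> u \<Longrightarrow> u \<le> v \<Longrightarrow> v \<le> 1 \<Longrightarrow> \<bar>\<beta> v - \<beta> u\<bar> \<le> C * (m v - m u)" by (rule lipmE[OF \<beta>], rule that)
  obtain R1 where R1: "R1 \<ge> 0" "\<And>t. 0 \<le> t \<Longrightarrow> t \<le> 1 \<Longrightarrow> \<bar>\<beta> t\<bar> \<le> R1" by (rule bounded_on_01[OF c\<beta>], rule that)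
  obtain R2 where R2: "R2 \<ge> 0" "\<And>t. 0 \<le> t \<Longrightarrow> t \<le> 1 \<Longrightarrow> \<bar>x t\<bar> \<le> R2" by (rule bounded_on_01[OF x_cont], rule that)
  define R where "R = max R1 R2"
  have R: "\<bar>\<beta> t\<bar> \<le> R" "\<bar>x t\<bar> \<le> R" if "0 \<le> t" "t \<le> 1" for t using R1(2)[OF that] R2(2)[OF that] by (auto simp: R_def)
  \<comment> \<open>In \<open>\<eta> * (C + 1) = e\<close> the share 1 pays for the increment of
    time and the share \<open>C\<close> for that of \<beta>, both measured by the clock.\<close>
  define \<eta> where "\<eta> = e / (C + 1)"
  have \<eta>: "\<eta> > 0" "\<eta> * (C + 1) = e" using e C by (auto simp: \<eta>_def)
  have cont: "continuous_on (({0..1} \<times> UNIV) \<times> UNIV) (\<lambda>q. la (fst (fst q)) (snd (fst q)) (snd q))"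
    "continuous_on (({0..1} \<times> UNIV) \<times> UNIV) (\<lambda>q. flt (fst (fst q)) (snd (fst q)) (snd q))"
    "continuous_on (({0..1} \<times> UNIV) \<times> UNIV) (\<lambda>q. ftt (fst (fst q)) (snd (fst q)) (snd q))"
    using I01 by (auto intro!: continuous_on_flow continuous_intros)
  obtain d1 where d1: "d1 > 0" "\<And>\<tau> \<tau>' \<xi> \<xi>' t t'. \<tau> \<in> {0..1} \<Longrightarrow> \<tau>' \<in> {0..1} \<Longrightarrow> \<bar>\<xi>\<bar> \<le> R \<Longrightarrow> \<bar>\<xi>'\<bar> \<le> R \<Longrightarrow> \<bar>t\<bar> \<le> R \<Longrightarrow> \<bar>t'\<bar> \<le> R \<Longrightarrow>
    \<bar>\<tau> - \<tau>'\<bar> < d1 \<Longrightarrow> \<bar>\<xi> - \<xi>'\<bar> < d1 \<Longrightarrow> \<bar>t - t'\<bar> < d1 \<Longrightarrow> \<bar>la \<tau> \<xi> t - la \<tau>' \<xi>' t'\<bar> < \<eta>"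
    by (rule uniformly_continuous_flow[OF cont(1) \<eta>(1)], rule that)
  obtain d2 where d2: "d2 > 0" "\<And>\<tau> \<tau>' \<xi> \<xi>' t t'. \<tau> \<in> {0..1} \<Longrightarrow> \<tau>' \<in> {0..1} \<Longrightarrow> \<bar>\<xi>\<bar> \<le> R \<Longrightarrow> \<bar>\<xi>'\<bar> \<le> R \<Longrightarrow> \<bar>t\<bar> \<le> R \<Longrightarrow> \<bar>t'\<bar> \<le> R \<Longrightarrow>
    \<bar>\<tau> - \<tau>'\<bar> < d2 \<Longrightarrow> \<bar>\<xi> - \<xi>'\<bar> < d2 \<Longrightarrow> \<bar>t - t'\<bar> < d2 \<Longrightarrow> \<bar>flt \<tau> \<xi> t - flt \<tau>' \<xi>' t'\<bar> < \<eta>"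
    by (rule uniformly_continuous_flow[OF cont(2) \<eta>(1)], rule that)
  obtain d3 where d3: "d3 > 0" "\<And>\<tau> \<tau>' \<xi> \<xi>' t t'. \<tau> \<in> {0..1} \<Longrightarrow> \<tau>' \<in> {0..1} \<Longrightarrow> \<bar>\<xi>\<bar> \<le> R \<Longrightarrow> \<bar>\<xi>'\<bar> \<le> R \<Longrightarrow> \<bar>t\<bar> \<le> R \<Longrightarrow> \<bar>t'\<bar> \<le> R \<Longrightarrow>
    \<bar>\<tau> - \<tau>'\<bar> < d3 \<Longrightarrow> \<bar>\<xi> - \<xi>'\<bar> < d3 \<Longrightarrow> \<bar>t - t'\<bar> < d3 \<Longrightarrow> \<bar>ftt \<tau> \<xi> t - ftt \<tau>' \<xi>' t'\<bar> < e"
    by (rule uniformly_continuous_flow[OF cont(3) e], rule that)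
  define d where "d = min d1 (min d2 d3)"
  have d: "d > 0" "d \<le> d1" "d \<le> d2" "d \<le> d3" using d1(1) d2(1) d3(1) by (auto simp: d_def)
  obtain \<delta>1 where \<delta>1: "\<delta>1 > 0" "\<And>u v. 0 \<le> u \<Longrightarrow> u \<le> v \<Longrightarrow> v \<le> 1 \<Longrightarrow> v - u < \<delta>1 \<Longrightarrow> \<bar>\<beta> v - \<beta> u\<bar> < d"
    by (rule uniformly_continuous_01[OF c\<beta> d(1)], rule that)
  obtain \<delta>2 where \<delta>2: "\<delta>2 > 0" "\<And>u v. 0 \<le> u \<Longrightarrow> u \<le> v \<Longrightarrow> v \<le> 1 \<Longrightarrow> v - u < \<delta>2 \<Longrightarrow> \<bar>x v - x u\<bar> < d"
    by (rule uniformly_continuous_01[OF x_cont d(1)], rule that)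
  show ?thesis
  proof (intro exI[of _ "min d (min \<delta>1 \<delta>2)"] conjI allI impI)
    fix u v :: real assume uv: "0 \<le> u" "u \<le> v" "v \<le> 1" and "v - u < min d (min \<delta>1 \<delta>2)"
    then have s: "v - u < d" "\<bar>\<beta> v - \<beta> u\<bar> < d" "\<bar>x v - x u\<bar> < d" using \<delta>1(2)[OF uv] \<delta>2(2)[OF uv] by auto
    have uvI: "u \<in> I" "v \<in> I" using I01 uv by auto
    have Ru: "\<bar>\<beta> u\<bar> \<le> R" "\<bar>x u\<bar> \<le> R" "\<bar>\<beta> v\<bar> \<le> R" "\<bar>x v\<bar> \<le> R" using R uv by auto
    obtain \<theta> where \<theta>: "0 \<le> \<theta>" "\<theta> \<le> 1" and eq1: "fl v (\<beta> v) (x v) - fl u (\<beta> u) (x v)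
      = flt (u + \<theta> * (v - u)) (\<beta> u + \<theta> * (\<beta> v - \<beta> u)) (x v) * (v - u) + la (u + \<theta> * (v - u)) (\<beta> u + \<theta> * (\<beta> v - \<beta> u)) (x v) * (\<beta> v - \<beta> u)"
      using fl_mvt[OF uvI, of "\<beta> v" "x v" "\<beta> u"] by blast
    obtain c where c: "\<bar>c - x u\<bar> \<le> \<bar>x v - x u\<bar>" "min (x u) (x v) \<le> c" "c \<le> max (x u) (x v)" and eq2:
      "fl u (\<beta> u) (x v) - fl u (\<beta> u) (x u) = \<sigma> u (fl u (\<beta> u) (x u)) * (x v - x u) + ftt u (\<beta> u) c / 2 * (x v - x u)\<^sup>2"
      using fl_taylor[OF uvI(1), of "x u" "x v" "\<beta> u"] by blast
    define a where "a = u + \<theta> * (v - u)"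
    define b where "b = \<beta> u + \<theta> * (\<beta> v - \<beta> u)"
    have \<theta>m: "\<bar>\<theta> * y\<bar> \<le> \<bar>y\<bar>" for y using \<theta> by (simp add: abs_mult mult_left_le_one_le)
    have "\<theta> * (v - u) \<le> v - u" "0 \<le> \<theta> * (v - u)" using \<theta> uv by (auto simp: mult_left_le_one_le)
    then have a: "a \<in> {0..1}" "\<bar>a - u\<bar> < d" using uv s(1) by (auto simp: a_def)
    have b: "\<bar>b - \<beta> u\<bar> < d" using \<theta>m[of "\<beta> v - \<beta> u"] s by (simp add: b_def)
    have bR: "\<bar>b\<bar> \<le> R"
    proof -
      have "b = (1 - \<theta>) * \<beta> u + \<theta> * \<beta> v" by (simp add: b_def algebra_simps)
      also have "\<bar>\<dots>\<bar> \<le> (1 - \<theta>) * R + \<theta> * R"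
        using Ru \<theta> by (intro order_trans[OF abs_triangle_ineq] add_mono) (auto simp: abs_mult mult_left_mono)
      finally show ?thesis by (simp add: algebra_simps)
    qed
    have cR: "\<bar>c\<bar> \<le> R" using c Ru by linarith
    have u01: "u \<in> {0..1}" using uv by auto
    have L: "\<bar>la a b (x v) - la u (\<beta> u) (x u)\<bar> < \<eta>"
      using a(2) b s(3) d by (intro d1(2) a(1) u01 bR Ru) linarith+
    have Fl: "\<bar>flt a b (x v) - flt u (\<beta> u) (x u)\<bar> < \<eta>"
      using a(2) b s(3) d by (intro d2(2) a(1) u01 bR Ru) linarith+
    have Ft: "\<bar>ftt u (\<beta> u) c - ftt u (\<beta> u) (x u)\<bar> < e"
      using c(1) s(3) d by (intro d3(2) u01 cR Ru) linarith+
    have m1: "\<bar>(flt a b (x v) - flt u (\<beta> u) (x u)) * (v - u)\<bar> \<le> \<eta> * (m v - m u)"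
      unfolding abs_mult using Fl m_inc[OF uv] uv \<eta> by (intro mult_mono) auto
    have m2: "\<bar>(la a b (x v) - la u (\<beta> u) (x u)) * (\<beta> v - \<beta> u)\<bar> \<le> \<eta> * (C * (m v - m u))"
      unfolding abs_mult using L C(2)[OF uv] \<eta> by (intro mult_mono) auto
    have m3: "\<bar>(ftt u (\<beta> u) c - ftt u (\<beta> u) (x u)) / 2 * (x v - x u)\<^sup>2\<bar> \<le> e * (x v - x u)\<^sup>2"
      unfolding abs_mult using Ft e by (intro mult_mono) auto
    have "fl v (\<beta> v) (x v) - fl u (\<beta> u) (x u) - \<sigma> u (fl u (\<beta> u) (x u)) * (x v - x u) - flt u (\<beta> u) (x u) * (v - u)
      - la u (\<beta> u) (x u) * (\<beta> v - \<beta> u) - ftt u (\<beta> u) (x u) / 2 * (x v - x u)\<^sup>2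
      = (flt a b (x v) - flt u (\<beta> u) (x u)) * (v - u) + (la a b (x v) - la u (\<beta> u) (x u)) * (\<beta> v - \<beta> u)
       + (ftt u (\<beta> u) c - ftt u (\<beta> u) (x u)) / 2 * (x v - x u)\<^sup>2"
      using eq1 eq2 unfolding a_def[symmetric] b_def[symmetric] left_diff_distrib diff_divide_distrib by linarith
    moreover have "\<eta> * (m v - m u) + \<eta> * (C * (m v - m u)) = e * (m v - m u)"
      unfolding \<eta>(2)[symmetric] by (simp add: algebra_simps)
    moreover have "e * ((m v - m u) + (x v - x u)\<^sup>2) = e * (m v - m u) + e * (x v - x u)\<^sup>2" by (rule distrib_left)
    ultimately show "\<bar>fl v (\<beta> v) (x v) - fl u (\<beta> u) (x u) - \<sigma> u (fl u (\<beta> u) (x u)) * (x v - x u) - flt u (\<beta> u) (x u) * (v - u)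
      - la u (\<beta> u) (x u) * (\<beta> v - \<beta> u) - ftt u (\<beta> u) (x u) / 2 * (x v - x u)\<^sup>2\<bar> \<le> e * ((m v - m u) + (x v - x u)\<^sup>2)"
      using m1 m2 m3 by linarith
  qed (use d \<delta>1 \<delta>2 in auto)
qed

lemma small_error_from_local:
  assumes loc: "\<And>e. e > 0 \<Longrightarrow> \<exists>d>0. \<forall>u v. 0 \<le> u \<longrightarrow> u \<le> v \<longrightarrow> v \<le> 1 \<longrightarrow> v - u < d \<longrightarrow>
      \<bar>r u v\<bar> \<le> e * ((m v - m u) + (x v - x u)\<^sup>2)" and t: "0 \<le> t" "t \<le> 1"
  shows "(\<lambda>n. \<Sum>s\<in>{s \<in> T n. s \<le> t}. r s (succ_pt (T n) s) :: real) \<longlonglongrightarrow> 0"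
proof (rule small_error_limit[OF _ t])
  fix e :: real assume "e > 0"
  from loc[OF this] obtain d where d: "d > 0" "\<And>u v. 0 \<le> u \<Longrightarrow> u \<le> v \<Longrightarrow> v \<le> 1 \<Longrightarrow> v - u < d \<Longrightarrow>
      \<bar>r u v\<bar> \<le> e * ((m v - m u) + (x v - x u)\<^sup>2)" by blast
  show "\<forall>\<^sub>F n in sequentially. \<forall>s\<in>T n. \<bar>r s (succ_pt (T n) s)\<bar> \<le> e * ((m (succ_pt (T n) s) - m s) + (x (succ_pt (T n) s) - x s)\<^sup>2)"
    using mesh_small[OF d(1)]
  proof eventually_elim
    case (elim n)
    show ?case
    proof
      fix s assume s: "s \<in> T n"
      show "\<bar>r s (succ_pt (T n) s)\<bar> \<le> e * ((m (succ_pt (T n) s) - m s) + (x (succ_pt (T n) s) - x s)\<^sup>2)"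
        by (rule d(2)) (use suc[OF s] T01(1)[OF s] elim in auto)
    qed
  qed
qed

theorem ito_formula:
  assumes \<beta>: "lipm \<beta>" and t: "0 \<le> t" "t \<le> 1"
  defines "z \<equiv> \<lambda>t. fl t (\<beta> t) (x t)"
  shows "(\<lambda>n. foellmer_sum (T n) (\<lambda>s. \<sigma> s (z s)) x t) \<longlonglongrightarrow> z t - z 0 -
    (SI (\<lambda>s. flt s (\<beta> s) (x s)) (\<lambda>s. s) t + SI (\<lambda>s. la s (\<beta> s) (x s)) \<beta> t + SI (\<lambda>s. ftt s (\<beta> s) (x s) / 2) q t)"
proof -
  have c\<beta>: "continuous_on {0..1} \<beta>" by (rule lipm_continuous_on[OF \<beta>])
  note c = continuous_on_flow01[OF c\<beta>]
  define Y where "Y = (\<lambda>t. SI (\<lambda>s. flt s (\<beta> s) (x s)) (\<lambda>s. s) t + SI (\<lambda>s. la s (\<beta> s) (x s)) \<beta> t)"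
  note s1 = stdiff_SI[OF c(3) lipm_id] and s2 = stdiff_SI[OF c(2) \<beta>]
  have cY: "continuous_on {0..1} Y"
    unfolding Y_def by (intro lipm_continuous_on lipm_add stdiff_lipm[OF s1] stdiff_lipm[OF s2] c lipm_id \<beta>)
  have c2: "continuous_on {0..1} (\<lambda>s. ftt s (\<beta> s) (x s) / 2)" by (intro continuous_intros c) auto
  \<comment> \<open>\<open>r\<close> is the remainder of \<open>ito_local\<close> and
    \<open>r2\<close> the left-point error of the Stieltjes integrals. Solving their definitions for
    the dx-term expresses the Foellmer sum through telescoping sums, a weighted quadratic variation
    and two sums that vanish in the limit.\<close>
  define r where "r = (\<lambda>u v. z v - z u - \<sigma> u (z u) * (x v - x u) - flt u (\<beta> u) (x u) * (v - u)
      - la u (\<beta> u) (x u) * (\<beta> v - \<beta> u) - ftt u (\<beta> u) (x u) / 2 * (x v - x u)\<^sup>2)"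
  define r2 where "r2 = (\<lambda>u v. Y v - Y u - (flt u (\<beta> u) (x u) * (v - u) + la u (\<beta> u) (x u) * (\<beta> v - \<beta> u)))"
  have 1: "(\<lambda>n. \<Sum>s\<in>{s \<in> T n. s \<le> t}. r s (succ_pt (T n) s)) \<longlonglongrightarrow> 0"
    by (rule small_error_from_local[OF _ t]) (use ito_local[OF \<beta>] in \<open>simp only: r_def z_def\<close>)
  have 2: "(\<lambda>n. \<Sum>s\<in>{s \<in> T n. s \<le> t}. r2 s (succ_pt (T n) s)) \<longlonglongrightarrow> 0"
  proof (rule small_error_from_local[OF _ t])
    fix e :: real assume e: "e > 0"
    then have e2: "e / 2 > 0" by simp
    obtain d1 where d1: "d1 > 0" "\<And>u v. 0 \<le> u \<Longrightarrow> u \<le> v \<Longrightarrow> v \<le> 1 \<Longrightarrow> v - u < d1 \<Longrightarrow>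
      \<bar>SI (\<lambda>s. flt s (\<beta> s) (x s)) (\<lambda>s. s) v - SI (\<lambda>s. flt s (\<beta> s) (x s)) (\<lambda>s. s) u - flt u (\<beta> u) (x u) * (v - u)\<bar> \<le> e / 2 * (m v - m u)"
      by (rule stdiffD[OF s1 e2], rule that)
    obtain d2 where d2: "d2 > 0" "\<And>u v. 0 \<le> u \<Longrightarrow> u \<le> v \<Longrightarrow> v \<le> 1 \<Longrightarrow> v - u < d2 \<Longrightarrow>
      \<bar>SI (\<lambda>s. la s (\<beta> s) (x s)) \<beta> v - SI (\<lambda>s. la s (\<beta> s) (x s)) \<beta> u - la u (\<beta> u) (x u) * (\<beta> v - \<beta> u)\<bar> \<le> e / 2 * (m v - m u)"
      by (rule stdiffD[OF s2 e2], rule that)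
    show "\<exists>d>0. \<forall>u v. 0 \<le> u \<longrightarrow> u \<le> v \<longrightarrow> v \<le> 1 \<longrightarrow> v - u < d \<longrightarrow> \<bar>r2 u v\<bar> \<le> e * ((m v - m u) + (x v - x u)\<^sup>2)"
    proof (intro exI[of _ "min d1 d2"] conjI allI impI)
      fix u v :: real assume uv: "0 \<le> u" "u \<le> v" "v \<le> 1" "v - u < min d1 d2"
      then have uv': "v - u < d1" "v - u < d2" by auto
      have "e * ((m v - m u) + (x v - x u)\<^sup>2) = e / 2 * (m v - m u) + e / 2 * (m v - m u) + e * (x v - x u)\<^sup>2"
        by (simp add: field_simps)
      moreover have "e * (x v - x u)\<^sup>2 \<ge> 0" using e by simp
      ultimately show "\<bar>r2 u v\<bar> \<le> e * ((m v - m u) + (x v - x u)\<^sup>2)"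
        using d1(2)[OF uv(1-3) uv'(1)] d2(2)[OF uv(1-3) uv'(2)] unfolding r2_def Y_def by linarith
    qed (use d1 d2 in auto)
  qed
  have 3: "(\<lambda>n. \<Sum>s\<in>{s \<in> T n. s \<le> t}. z (succ_pt (T n) s) - z s) \<longlonglongrightarrow> z t - z 0"
    using c(1) t by (intro telescope_limit) (simp_all add: z_def)
  have 4: "(\<lambda>n. \<Sum>s\<in>{s \<in> T n. s \<le> t}. Y (succ_pt (T n) s) - Y s) \<longlonglongrightarrow> Y t - Y 0"
    by (intro telescope_limit cY t)
  note 5 = weighted_qv_limit[OF c2 t]
  have Y0: "Y 0 = 0" by (simp add: Y_def SI_0[OF c(3) lipm_id] SI_0[OF c(2) \<beta>])
  have "(\<lambda>n. (\<Sum>s\<in>{s \<in> T n. s \<le> t}. z (succ_pt (T n) s) - z s) - (\<Sum>s\<in>{s \<in> T n. s \<le> t}. r s (succ_pt (T n) s))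
      - (\<Sum>s\<in>{s \<in> T n. s \<le> t}. Y (succ_pt (T n) s) - Y s) + (\<Sum>s\<in>{s \<in> T n. s \<le> t}. r2 s (succ_pt (T n) s))
      - (\<Sum>s\<in>{s \<in> T n. s \<le> t}. ftt s (\<beta> s) (x s) / 2 * (x (succ_pt (T n) s) - x s)\<^sup>2))
    \<longlonglongrightarrow> (z t - z 0) - 0 - (Y t - Y 0) + 0 - SI (\<lambda>s. ftt s (\<beta> s) (x s) / 2) q t"
    by (intro tendsto_intros 1 2 3 4 5)
  also have "(\<lambda>n. (\<Sum>s\<in>{s \<in> T n. s \<le> t}. z (succ_pt (T n) s) - z s) - (\<Sum>s\<in>{s \<in> T n. s \<le> t}. r s (succ_pt (T n) s))
      - (\<Sum>s\<in>{s \<in> T n. s \<le> t}. Y (succ_pt (T n) s) - Y s) + (\<Sum>s\<in>{s \<in> T n. s \<le> t}. r2 s (succ_pt (T n) s))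
      - (\<Sum>s\<in>{s \<in> T n. s \<le> t}. ftt s (\<beta> s) (x s) / 2 * (x (succ_pt (T n) s) - x s)\<^sup>2))
    = (\<lambda>n. foellmer_sum (T n) (\<lambda>s. \<sigma> s (z s)) x t)"
    unfolding foellmer_sum_def sum_subtractf[symmetric] sum.distrib[symmetric]
    by (intro ext sum.cong) (auto simp: r_def r2_def)
  finally have "(\<lambda>n. foellmer_sum (T n) (\<lambda>s. \<sigma> s (z s)) x t) \<longlonglongrightarrow>
    (z t - z 0) - 0 - (Y t - Y 0) + 0 - SI (\<lambda>s. ftt s (\<beta> s) (x s) / 2) q t" .
  moreover have "(z t - z 0) - 0 - (Y t - Y 0) + 0 - SI (\<lambda>s. ftt s (\<beta> s) (x s) / 2) q t = z t - z 0 -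
    (SI (\<lambda>s. flt s (\<beta> s) (x s)) (\<lambda>s. s) t + SI (\<lambda>s. la s (\<beta> s) (x s)) \<beta> t + SI (\<lambda>s. ftt s (\<beta> s) (x s) / 2) q t)"
    unfolding Y0 by (simp add: Y_def)
  ultimately show ?thesis by (simp only:)
qed

end

section \<open>The Stieltjes equation\<close>

lemma C1_on_inverse:
  assumes "C1_on S f" "\<And>p. p \<in> S \<Longrightarrow> f p \<noteq> 0" shows "C1_on S (\<lambda>p. inverse (f p))"
proof -
  obtain F where F: "\<And>p. p \<in> S \<Longrightarrow> (f has_derivative blinfun_apply (F p)) (at p)" "continuous_on S F"
    by (rule C1_onE[OF assms(1)], rule that)
  show ?thesis
    by (rule C1_onI[where f'="\<lambda>p v. - (inverse (f p) * F p v * inverse (f p))"])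
      (auto intro!: Deriv.has_derivative_inverse F continuous_intros assms C1_on_imp_continuous_on[OF assms(1)])
qed

lemma antideriv_bound:
  assumes f: "continuous_on UNIV f" and c: "\<And>s. \<bar>s\<bar> \<le> \<bar>t\<bar> \<Longrightarrow> \<bar>f s\<bar> \<le> c"
  shows "\<bar>antideriv f t\<bar> \<le> \<bar>t\<bar> * c"
proof -
  have c0: "c \<ge> 0" using c[of 0] by simp
  have "continuous_on {0..1} (\<lambda>\<theta>. f (t * \<theta>))"
    by (rule continuous_on_compose2[OF f]) (auto intro!: continuous_intros)
  then have "((\<lambda>\<theta>. f (t * \<theta>)) has_integral integral {0..1} (\<lambda>\<theta>. f (t * \<theta>))) {0..1}"
    by (intro integrable_integral integrable_continuous_real)
  from has_integral_bound_real[OF c0 finite.emptyI this]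
  have "\<bar>integral {0..1} (\<lambda>\<theta>. f (t * \<theta>))\<bar> \<le> c"
    using c by (auto simp: abs_mult mult_left_le)
  then show ?thesis by (simp add: antideriv_def abs_mult mult_left_mono)
qed

context clock
begin

lemma SI_eqI: "stdiff Z f g \<Longrightarrow> Z 0 = 0 \<Longrightarrow> continuous_on {0..1} f \<Longrightarrow> lipm g \<Longrightarrow> 0 \<le> t \<Longrightarrow> t \<le> 1 \<Longrightarrow> SI f g t = Z t"
  using stdiff_unique[OF stdiff_SI, of f g Z 0 t] SI_0[of f g] by simp

lemma SI_cmult:
  assumes "continuous_on {0..1} f" "lipm g" "0 \<le> t" "t \<le> 1"
  shows "SI (\<lambda>s. c * f s) g t = c * SI f g t"
  using assms by (intro SI_eqI stdiff_cmult stdiff_SI) (auto simp: SI_0 intro!: continuous_intros)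

lemma SI_SI:
  assumes "continuous_on {0..1} f" "continuous_on {0..1} h" "lipm g" "0 \<le> t" "t \<le> 1"
  shows "SI f (SI h g) t = SI (\<lambda>s. f s * h s) g t"
proof -
  obtain K where K: "K \<ge> 0" "\<And>t. 0 \<le> t \<Longrightarrow> t \<le> 1 \<Longrightarrow> \<bar>f t\<bar> \<le> K" by (rule bounded_on_01[OF assms(1)], rule that)
  have l: "lipm (SI h g)" by (rule stdiff_lipm[OF stdiff_SI]) (use assms in auto)
  have "stdiff (SI f (SI h g)) (\<lambda>s. f s * h s) g"
    by (rule stdiff_trans[OF stdiff_SI stdiff_SI K(2)]) (use assms l in auto)
  from SI_eqI[OF this SI_0[OF assms(1) l]] show ?thesis
    using assms by (simp add: continuous_on_mult)
qed

lemma SI_add_integrator: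
  assumes "continuous_on {0..1} f" "lipm g" "lipm h" "0 \<le> t" "t \<le> 1"
  shows "SI f (\<lambda>s. g s + h s) t = SI f g t + SI f h t"
  using assms by (intro SI_eqI stdiff_add[OF stdiff_SI stdiff_SI]) (auto simp: SI_0 algebra_simps intro!: lipm_add)

end

section \<open>Bounds and smoothness of the coefficients of the Stieltjes equation\<close>

context flow_field
begin

text \<open>\<open>la\<close> is the exponential of an integral of \<open>s2\<close>, which is at
  most \<open>M\<close> in absolute value. Together with the bound on \<open>s1\<close> this also
  bounds \<open>qa\<close>, the quotient of \<open>\<phi>\<^sub>\<tau>\<close> by
  \<open>\<phi>\<^sub>\<xi>\<close>, uniformly in \<xi>.\<close>

lemma la_inverse_bound:
  assumes "\<tau> \<in> I" shows "1 / la \<tau> \<xi> t \<le> exp (M * \<bar>t\<bar>)"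
proof -
  have "continuous_on UNIV (\<lambda>s. s2 \<tau> (fl \<tau> \<xi> s))"
    by (intro continuous_on_field continuous_on_flI continuous_intros) (use assms in auto)
  from antideriv_bound[OF this, of t M] have "\<bar>antideriv (\<lambda>s. s2 \<tau> (fl \<tau> \<xi> s)) t\<bar> \<le> \<bar>t\<bar> * M"
    using M(3)[OF assms] by (simp add: s2_def)
  then have "- antideriv (\<lambda>s. s2 \<tau> (fl \<tau> \<xi> s)) t \<le> M * \<bar>t\<bar>" by (simp add: mult.commute)
  then have "exp (- antideriv (\<lambda>s. s2 \<tau> (fl \<tau> \<xi> s)) t) \<le> exp (M * \<bar>t\<bar>)" by simp
  then show ?thesis by (simp add: la_def exp_minus inverse_eq_divide)
qed

lemma qa_bound:
  assumes "\<tau> \<in> I" shows "\<bar>qa \<tau> \<xi> t\<bar> \<le> \<bar>t\<bar> * (M * exp (M * \<bar>t\<bar>))"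
  unfolding qa_def
proof (rule antideriv_bound)
  show "continuous_on UNIV (\<lambda>s. s1 \<tau> (fl \<tau> \<xi> s) / la \<tau> \<xi> s)"
    using la_pos[of \<tau> \<xi>] assms
    by (intro continuous_on_divide continuous_on_field(2) continuous_on_flow(1) continuous_on_flI continuous_intros)
      (auto simp: less_imp_neq[symmetric])
  fix s assume s: "\<bar>s\<bar> \<le> \<bar>t\<bar>"
  have "\<bar>s1 \<tau> (fl \<tau> \<xi> s) / la \<tau> \<xi> s\<bar> = \<bar>s1 \<tau> (fl \<tau> \<xi> s)\<bar> * (1 / la \<tau> \<xi> s)"
    using la_pos[of \<tau> \<xi> s] by (simp add: abs_divide)
  also have "\<dots> \<le> M * exp (M * \<bar>t\<bar>)"
  proof (rule mult_mono)
    show "1 / la \<tau> \<xi> s \<le> exp (M * \<bar>t\<bar>)"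
      by (rule order_trans[OF la_inverse_bound[OF assms]]) (use s M(1) in \<open>simp add: mult_left_mono\<close>)
  qed (use M(1,2) assms la_pos[of \<tau> \<xi> s] in \<open>auto simp: s1_def less_imp_le\<close>)
  finally show "\<bar>s1 \<tau> (fl \<tau> \<xi> s) / la \<tau> \<xi> s\<bar> \<le> M * exp (M * \<bar>t\<bar>)" .
qed

lemma fl_lipschitz:
  assumes "\<tau> \<in> I" shows "\<bar>fl \<tau> \<xi> t - fl \<tau> \<zeta> t\<bar> \<le> \<bar>\<xi> - \<zeta>\<bar> * exp (2 * M * \<bar>t\<bar>)"
proof (rule power2_le_imp_le)
  have "3 * M * \<bar>t\<bar> \<le> 2 * M * \<bar>t\<bar> + 2 * M * \<bar>t\<bar>" using M(1) by (simp flip: distrib_right)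
  then have "exp (3 * M * \<bar>t\<bar>) \<le> exp (2 * M * \<bar>t\<bar>) * exp (2 * M * \<bar>t\<bar>)" by (simp flip: exp_add)
  then have "(\<xi> - \<zeta>)\<^sup>2 * exp (3 * M * \<bar>t\<bar>) \<le> (\<xi> - \<zeta>)\<^sup>2 * (exp (2 * M * \<bar>t\<bar>))\<^sup>2"
    by (intro mult_left_mono) (auto simp: power2_eq_square)
  then show "\<bar>fl \<tau> \<xi> t - fl \<tau> \<zeta> t\<bar>\<^sup>2 \<le> (\<bar>\<xi> - \<zeta>\<bar> * exp (2 * M * \<bar>t\<bar>))\<^sup>2"
    using fl_gronwall[OF assms assms, of \<xi> t \<zeta>] by (simp add: power_mult_distrib)
qed simp

lemma C1_local_lipschitz:
  fixes h :: "real \<Rightarrow> real \<Rightarrow> real \<Rightarrow> real"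
  assumes h: "C1_on ((I \<times> UNIV) \<times> UNIV) (\<lambda>q. h (fst (fst q)) (snd (fst q)) (snd q))" and I01: "{0..1} \<subseteq> I"
  shows "\<exists>L\<ge>0. \<forall>s\<in>{0..1}. \<forall>y y' t. \<bar>y\<bar> \<le> R \<longrightarrow> \<bar>y'\<bar> \<le> R \<longrightarrow> \<bar>t\<bar> \<le> R \<longrightarrow> \<bar>h s y t - h s y' t\<bar> \<le> L * \<bar>y - y'\<bar>"
    and "\<exists>P\<ge>0. \<forall>s\<in>{0..1}. \<forall>y t. \<bar>y\<bar> \<le> R \<longrightarrow> \<bar>t\<bar> \<le> R \<longrightarrow> \<bar>h s y t\<bar> \<le> P"
proof -
  let ?h = "\<lambda>q. h (fst (fst q)) (snd (fst q)) (snd q)" and ?K = "({0..1::real} \<times> {-R..R}) \<times> {-R..R}"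
  have sub: "?K \<subseteq> (I \<times> UNIV) \<times> UNIV" using I01 by auto
  have K: "compact ?K" "convex ?K" by (auto intro!: compact_Times convex_Times)
  obtain D where D: "\<And>p. p \<in> (I \<times> UNIV) \<times> UNIV \<Longrightarrow> (?h has_derivative blinfun_apply (D p)) (at p)"
    "continuous_on ((I \<times> UNIV) \<times> UNIV) D"
    by (rule C1_onE[OF h], rule that)
  have "bounded (D ` ?K)"
    by (intro compact_imp_bounded compact_continuous_image K continuous_on_subset[OF D(2) sub])
  then obtain L where L: "L > 0" "\<forall>d\<in>D ` ?K. norm d \<le> L" using bounded_pos by blast
  show "\<exists>L\<ge>0. \<forall>s\<in>{0..1}. \<forall>y y' t. \<bar>y\<bar> \<le> R \<longrightarrow> \<bar>y'\<bar> \<le> R \<longrightarrow> \<bar>t\<bar> \<le> R \<longrightarrow> \<bar>h s y t - h s y' t\<bar> \<le> L * \<bar>y - y'\<bar>"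
  proof (intro exI[of _ L] conjI ballI allI impI)
    fix s y y' t :: real assume *: "s \<in> {0..1}" "\<bar>y\<bar> \<le> R" "\<bar>y'\<bar> \<le> R" "\<bar>t\<bar> \<le> R"
    have "norm (?h ((s, y), t) - ?h ((s, y'), t)) \<le> L * norm (((s, y), t) - ((s, y'), t))"
    proof (rule differentiable_bound[OF K(2)])
      fix p assume p: "p \<in> ?K"
      then show "(?h has_derivative blinfun_apply (D p)) (at p within ?K)"
        using D(1)[of p] sub by (blast intro: has_derivative_at_withinI)
      show "onorm (blinfun_apply (D p)) \<le> L" using L(2)[rule_format, OF imageI[OF p]] by (simp add: norm_blinfun.rep_eq[symmetric])
    qed (use * in auto)
    then show "\<bar>h s y t - h s y' t\<bar> \<le> L * \<bar>y - y'\<bar>" by (simp add: norm_Pair)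
  qed (use L in auto)
  have "bounded (?h ` ?K)"
    by (intro compact_imp_bounded compact_continuous_image K continuous_on_subset[OF C1_on_imp_continuous_on[OF h] sub])
  then obtain P where P: "P > 0" "\<forall>d\<in>?h ` ?K. norm d \<le> P" using bounded_pos by blast
  show "\<exists>P\<ge>0. \<forall>s\<in>{0..1}. \<forall>y t. \<bar>y\<bar> \<le> R \<longrightarrow> \<bar>t\<bar> \<le> R \<longrightarrow> \<bar>h s y t\<bar> \<le> P"
  proof (intro exI[of _ P] conjI ballI allI impI)
    fix s y t :: real assume "s \<in> {0..1}" "\<bar>y\<bar> \<le> R" "\<bar>t\<bar> \<le> R"
    then have "((s, y), t) \<in> ?K" by auto
    from P(2)[rule_format, OF imageI[OF this]] show "\<bar>h s y t\<bar> \<le> P" by simp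
  qed (use P in auto)
qed

lemma coefficients_C1:
  "C1_on ((I \<times> UNIV) \<times> UNIV) (\<lambda>q. inverse (la (fst (fst q)) (snd (fst q)) (snd q)))"
  "C1_on ((I \<times> UNIV) \<times> UNIV) (\<lambda>q. \<sigma> (fst (fst q)) (fl (fst (fst q)) (snd (fst q)) (snd q)))"
  "C1_on ((I \<times> UNIV) \<times> UNIV) (\<lambda>q. ftt (fst (fst q)) (snd (fst q)) (snd q))"
proof -
  let ?S = "(I \<times> (UNIV :: real set)) \<times> (UNIV :: real set)"
  show "C1_on ?S (\<lambda>q. inverse (la (fst (fst q)) (snd (fst q)) (snd q)))"
    by (rule C1_on_inverse[OF la_C1]) (simp add: less_imp_neq[OF la_pos, symmetric])
  have ci: "C1_on ?S (\<lambda>q. fst (fst q))"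
    by (intro C1_on_bounded_linear bounded_linear_intros)
  have "C1_on ?S (\<lambda>q. s2 (fst (fst q)) (fl (fst (fst q)) (snd (fst q)) (snd q)))"
    using C1_on_compose_pair[OF sigma_derivative(3) _ ci fl_C1] by auto
  moreover show "C1_on ?S (\<lambda>q. \<sigma> (fst (fst q)) (fl (fst (fst q)) (snd (fst q)) (snd q)))"
    using C1_on_compose_pair[OF C1_sigma _ ci fl_C1] by auto
  ultimately show "C1_on ?S (\<lambda>q. ftt (fst (fst q)) (snd (fst q)) (snd q))"
    unfolding ftt_def by (rule C1_on_mult)
qed

lemma fl_partial_derivs:
  assumes "\<tau> \<in> I"
  shows "deriv (\<lambda>\<xi>. fl \<tau> \<xi> t) \<xi> = la \<tau> \<xi> t" "deriv (\<lambda>\<tau>. fl \<tau> \<xi> t) \<tau> = flt \<tau> \<xi> t"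
    "deriv (fl \<tau> \<xi>) t = \<sigma> \<tau> (fl \<tau> \<xi> t)" "deriv (deriv (fl \<tau> \<xi>)) t = ftt \<tau> \<xi> t"
proof -
  have "((\<lambda>p. fl (fst p) (snd p) t) has_derivative (\<lambda>v. flt \<tau> \<xi> t * fst v + la \<tau> \<xi> t * snd v)) (at (\<tau>, \<xi>))"
  proof -
    have "((\<lambda>p. (p, t)) has_derivative (\<lambda>v. (v, 0))) (at (\<tau>, \<xi>))" by (auto intro!: derivative_eq_intros)
    from has_derivative_compose[OF this fl_has_derivative[OF assms]] show ?thesis by (simp add: flt_def)
  qed
  from has_real_derivative_slice[OF this, THEN DERIV_imp_deriv]
  show "deriv (\<lambda>\<xi>. fl \<tau> \<xi> t) \<xi> = la \<tau> \<xi> t" "deriv (\<lambda>\<tau>. fl \<tau> \<xi> t) \<tau> = flt \<tau> \<xi> t" by simp_all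
  have d: "deriv (fl \<tau> \<xi>) = (\<lambda>t. \<sigma> \<tau> (fl \<tau> \<xi> t))" using DERIV_imp_deriv[OF fl_deriv[OF assms]] by blast
  then show "deriv (fl \<tau> \<xi>) t = \<sigma> \<tau> (fl \<tau> \<xi> t)" by simp
  show "deriv (deriv (fl \<tau> \<xi>)) t = ftt \<tau> \<xi> t" unfolding d by (rule DERIV_imp_deriv[OF sigma_fl_deriv[OF assms]])
qed

end

locale ito_equation = ito_flow \<sigma> I M m T x for \<sigma> I M m T x +
  fixes A :: "real \<Rightarrow> real" and b :: "real \<Rightarrow> real \<Rightarrow> real" and cb :: real
  assumes A_lipm: "lipm A" and b_cont: "continuous_on ({0..1} \<times> UNIV) (\<lambda>p. b (fst p) (snd p))"
    and b_lip: "\<And>p. p > 0 \<Longrightarrow> \<exists>L\<ge>0. \<forall>t\<in>{0..1}. \<forall>\<xi> \<zeta>. \<bar>\<xi>\<bar> \<le> p \<longrightarrow> \<bar>\<zeta>\<bar> \<le> p \<longrightarrow> \<bar>b t \<xi> - b t \<zeta>\<bar> \<le> L * \<bar>\<xi> - \<zeta>\<bar>"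
    and b_growth: "cb \<ge> 0" "\<And>t \<xi>. t \<in> {0..1} \<Longrightarrow> \<bar>b t \<xi>\<bar> \<le> cb * (1 + \<bar>\<xi>\<bar>)"
begin

text \<open>The integrands of the three integrals with their signs. The quotient of
  \<open>\<phi>\<^sub>\<tau>\<close> by \<open>\<phi>\<^sub>\<xi>\<close> appears as
  \<open>qa\<close>, because \<open>flt = la * qa\<close>; dividing by \<open>la\<close> is written
  as a product with the inverse so that product estimates apply.\<close>

definition "F j s y = (if j = 0 then b s (fl s y (x s)) * inverse (la s y (x s)) else if j = 1 then (-1) * qa s y (x s)
  else (- 1 / 2) * (ftt s y (x s) * inverse (la s y (x s))))" for j :: nat

definition "g j = (if j = 0 then A else if j = 1 then (\<lambda>s. s) else q)" for j :: nat

lemma continuous_on_b: "continuous_on S f \<Longrightarrow> continuous_on S h \<Longrightarrow> (\<And>p. p \<in> S \<Longrightarrow> f p \<in> {0..1}) \<Longrightarrow> continuous_on S (\<lambda>p. b (f p) (h p))"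
proof -
  assume "continuous_on S f" "continuous_on S h" and sub: "\<And>p. p \<in> S \<Longrightarrow> f p \<in> {0..1}"
  then have "continuous_on S (\<lambda>p. (f p, h p))" by (intro continuous_on_Pair)
  moreover have "(\<lambda>p. (f p, h p)) ` S \<subseteq> {0..1} \<times> UNIV" using sub by blast
  ultimately show ?thesis using continuous_on_compose2[OF b_cont, of S "\<lambda>p. (f p, h p)"] by simp
qed

lemma x_bound: obtains X where "X > 0" "\<And>t. 0 \<le> t \<Longrightarrow> t \<le> 1 \<Longrightarrow> \<bar>x t\<bar> \<le> X"
proof -
  obtain X where "X \<ge> 0" "\<And>t. 0 \<le> t \<Longrightarrow> t \<le> 1 \<Longrightarrow> \<bar>x t\<bar> \<le> X" by (rule bounded_on_01[OF x_cont], rule that)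
  then show ?thesis by (intro that[of "X + 1"]) force+
qed

sublocale vo: volterra m F g 3
proof
  show "lipm (g j)" if "j < 3" for j using A_lipm lipm_id qv_lipm by (simp add: g_def)
  have x': "continuous_on ({0..1} \<times> UNIV) (\<lambda>p :: real \<times> real. x (fst p))"
    by (rule continuous_on_compose2[OF x_cont]) (auto intro!: continuous_intros)
  have "\<And>p. p \<in> {0..1} \<times> (UNIV :: real set) \<Longrightarrow> fst p \<in> I" using I01 by auto
  note c = continuous_on_flow[OF continuous_on_fst[OF continuous_on_id] continuous_on_snd[OF continuous_on_id] x' this]
    continuous_on_flI[OF continuous_on_fst[OF continuous_on_id] continuous_on_snd[OF continuous_on_id] x' this]
  have "continuous_on ({0..1} \<times> UNIV) (\<lambda>p. b (fst p) (fl (fst p) (snd p) (x (fst p))))"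
    by (rule continuous_on_b) (use c in \<open>auto intro!: continuous_intros\<close>)
  moreover have "continuous_on ({0..1} \<times> UNIV) (\<lambda>p. inverse (la (fst p) (snd p) (x (fst p))))"
    by (rule continuous_on_inverse) (use c(1) la_pos in \<open>auto simp: less_imp_neq[symmetric]\<close>)
  ultimately show "continuous_on ({0..1} \<times> UNIV) (\<lambda>p. F j (fst p) (snd p))" for j
    using c(2,4) unfolding F_def by (cases "j = 0"; cases "j = 1") (simp_all add: continuous_on_mult continuous_on_minus continuous_on_divide)
qed

lemma product_lipschitz:
  fixes a a' c c' :: real
  assumes "\<bar>a - a'\<bar> \<le> La * d" "\<bar>c - c'\<bar> \<le> Lc * d" "\<bar>a'\<bar> \<le> Pa" "\<bar>c\<bar> \<le> Pc"
  shows "\<bar>a * c - a' * c'\<bar> \<le> (La * Pc + Pa * Lc) * d"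
proof -
  have "a * c - a' * c' = (a - a') * c + a' * (c - c')" by (simp add: algebra_simps)
  also have "\<bar>\<dots>\<bar> \<le> (La * d) * Pc + Pa * (Lc * d)"
    using assms by (intro order_trans[OF abs_triangle_ineq] add_mono) (auto simp: abs_mult intro!: mult_mono order_trans[OF abs_ge_zero])
  finally show ?thesis by (simp add: algebra_simps)
qed

lemma F_lipschitz:
  "\<exists>L. \<forall>j<3. \<forall>s\<in>{0..1}. \<forall>y y'. \<bar>y\<bar> \<le> R \<longrightarrow> \<bar>y'\<bar> \<le> R \<longrightarrow> \<bar>F j s y - F j s y'\<bar> \<le> L * \<bar>y - y'\<bar>"
proof -
  obtain X where X: "X > 0" "\<And>t. 0 \<le> t \<Longrightarrow> t \<le> 1 \<Longrightarrow> \<bar>x t\<bar> \<le> X" by (rule x_bound, rule that)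
  define R' where "R' = max R X"
  have R': "R \<le> R'" "\<And>s. s \<in> {0..1} \<Longrightarrow> \<bar>x s\<bar> \<le> R'" using X by (auto simp: R'_def intro: max.coboundedI2)
  note lip = C1_local_lipschitz(1)[OF _ I01, of _ R'] and bd = C1_local_lipschitz(2)[OF _ I01, of _ R']
  obtain L1 where L1: "L1 \<ge> 0" "\<And>s y y' t. s \<in> {0..1} \<Longrightarrow> \<bar>y\<bar> \<le> R' \<Longrightarrow> \<bar>y'\<bar> \<le> R' \<Longrightarrow> \<bar>t\<bar> \<le> R' \<Longrightarrow> \<bar>fl s y t - fl s y' t\<bar> \<le> L1 * \<bar>y - y'\<bar>"
    using lip[OF fl_C1] by blast
  obtain P1 where P1: "P1 \<ge> 0" "\<And>s y t. s \<in> {0..1} \<Longrightarrow> \<bar>y\<bar> \<le> R' \<Longrightarrow> \<bar>t\<bar> \<le> R' \<Longrightarrow> \<bar>fl s y t\<bar> \<le> P1"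
    using bd[OF fl_C1] by blast
  obtain L2 where L2: "L2 \<ge> 0" "\<And>s y y' t. s \<in> {0..1} \<Longrightarrow> \<bar>y\<bar> \<le> R' \<Longrightarrow> \<bar>y'\<bar> \<le> R' \<Longrightarrow> \<bar>t\<bar> \<le> R' \<Longrightarrow> \<bar>inverse (la s y t) - inverse (la s y' t)\<bar> \<le> L2 * \<bar>y - y'\<bar>"
    using lip[OF coefficients_C1(1)] by blast
  obtain P2 where P2: "P2 \<ge> 0" "\<And>s y t. s \<in> {0..1} \<Longrightarrow> \<bar>y\<bar> \<le> R' \<Longrightarrow> \<bar>t\<bar> \<le> R' \<Longrightarrow> \<bar>inverse (la s y t)\<bar> \<le> P2"
    using bd[OF coefficients_C1(1)] by blast
  obtain L3 where L3: "L3 \<ge> 0" "\<And>s y y' t. s \<in> {0..1} \<Longrightarrow> \<bar>y\<bar> \<le> R' \<Longrightarrow> \<bar>y'\<bar> \<le> R' \<Longrightarrow> \<bar>t\<bar> \<le> R' \<Longrightarrow> \<bar>ftt s y t - ftt s y' t\<bar> \<le> L3 * \<bar>y - y'\<bar>"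
    using lip[OF coefficients_C1(3)] by blast
  obtain P3 where P3: "P3 \<ge> 0" "\<And>s y t. s \<in> {0..1} \<Longrightarrow> \<bar>y\<bar> \<le> R' \<Longrightarrow> \<bar>t\<bar> \<le> R' \<Longrightarrow> \<bar>ftt s y t\<bar> \<le> P3"
    using bd[OF coefficients_C1(3)] by blast
  obtain L4 where L4: "L4 \<ge> 0" "\<And>s y y' t. s \<in> {0..1} \<Longrightarrow> \<bar>y\<bar> \<le> R' \<Longrightarrow> \<bar>y'\<bar> \<le> R' \<Longrightarrow> \<bar>t\<bar> \<le> R' \<Longrightarrow> \<bar>qa s y t - qa s y' t\<bar> \<le> L4 * \<bar>y - y'\<bar>"
    using lip[OF qa_C1] by blast
  \<comment> \<open>\<open>b_lip\<close> asks for a positive radius while \<open>P1\<close> may be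
    0, hence \<open>P1 + 1\<close>.\<close>
  obtain Lb where Lb: "Lb \<ge> 0" "\<And>t \<xi> \<zeta>. t \<in> {0..1} \<Longrightarrow> \<bar>\<xi>\<bar> \<le> P1 + 1 \<Longrightarrow> \<bar>\<zeta>\<bar> \<le> P1 + 1 \<Longrightarrow> \<bar>b t \<xi> - b t \<zeta>\<bar> \<le> Lb * \<bar>\<xi> - \<zeta>\<bar>"
    using b_lip[of "P1 + 1"] P1(1) by auto
  define L where "L = (Lb * L1 * P2 + cb * (1 + P1) * L2) + L4 + (L3 * P2 + P3 * L2)"
  have nn: "0 \<le> Lb * L1 * P2 + cb * (1 + P1) * L2" "0 \<le> L3 * P2 + P3 * L2"
    using Lb L1 P2 b_growth P1 L2 L3 P3 by auto
  have "\<bar>F j s y - F j s y'\<bar> \<le> L * \<bar>y - y'\<bar>" if j: "j < 3" and s: "s \<in> {0..1}" and y: "\<bar>y\<bar> \<le> R" "\<bar>y'\<bar> \<le> R" for j s y y'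
  proof -
    have a: "\<bar>y\<bar> \<le> R'" "\<bar>y'\<bar> \<le> R'" "\<bar>x s\<bar> \<le> R'" using y R' s by auto
    let ?d = "\<bar>y - y'\<bar>"
    have fb: "\<bar>fl s y (x s)\<bar> \<le> P1" "\<bar>fl s y' (x s)\<bar> \<le> P1" using P1(2) s a by auto
    have "\<bar>b s (fl s y (x s)) - b s (fl s y' (x s))\<bar> \<le> Lb * \<bar>fl s y (x s) - fl s y' (x s)\<bar>"
      using Lb(2)[OF s] fb by simp
    also have "\<dots> \<le> Lb * (L1 * ?d)" by (intro mult_left_mono L1 Lb s a)
    finally have 1: "\<bar>b s (fl s y (x s)) - b s (fl s y' (x s))\<bar> \<le> (Lb * L1) * ?d" by simp
    have 2: "\<bar>b s (fl s y' (x s))\<bar> \<le> cb * (1 + P1)"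
      by (rule order_trans[OF b_growth(2)[OF s]]) (use fb b_growth(1) in \<open>auto intro!: mult_left_mono\<close>)
    note p1 = product_lipschitz[OF 1 L2(2)[OF s a] 2 P2(2)[OF s a(1,3)]]
    note p3 = product_lipschitz[OF L3(2)[OF s a] L2(2)[OF s a] P3(2)[OF s a(2,3)] P2(2)[OF s a(1,3)]]
    have le: "c * ?d \<le> L * ?d" if "c \<le> L" for c using that by (rule mult_right_mono) simp
    consider "j = 0" | "j = 1" | "j = 2" using j by linarith
    then show ?thesis
    proof cases
      case 1
      then show ?thesis using order_trans[OF p1 le] nn L4(1) by (simp add: F_def L_def)
    next
      case 2
      then have "\<bar>F j s y - F j s y'\<bar> = \<bar>qa s y (x s) - qa s y' (x s)\<bar>" by (simp add: F_def abs_minus_commute)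
      then show ?thesis using order_trans[OF L4(2)[OF s a] le] nn by (simp add: L_def)
    next
      case 3
      then have "\<bar>F j s y - F j s y'\<bar> = \<bar>ftt s y (x s) * inverse (la s y (x s)) - ftt s y' (x s) * inverse (la s y' (x s))\<bar> / 2"
        by (simp add: F_def abs_minus_commute flip: diff_divide_distrib)
      also have "\<dots> \<le> \<bar>ftt s y (x s) * inverse (la s y (x s)) - ftt s y' (x s) * inverse (la s y' (x s))\<bar>" by simp
      finally show ?thesis using order_trans[OF p3 le] nn L4(1) by (simp add: L_def)
    qed
  qed
  then show ?thesis by blast
qed

text \<open>As \<open>x\<close> is bounded, the flow at time \<open>x s\<close> grows at most
  linearly in \<open>y\<close>; \<sigma> grows linearly because it is Lipschitz, and the inverse of
  \<open>la\<close> is bounded by \<open>E\<close>. In the quadratic variation term the bound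
  \<open>M\<close> on \<open>s2\<close> reduces \<open>ftt\<close> to a multiple of
  \<sigma>.\<close>

lemma F_growth: "\<exists>K>0. \<forall>j<3. \<forall>s\<in>{0..1}. \<forall>y. \<bar>F j s y\<bar> \<le> K * (1 + \<bar>y\<bar>)"
proof -
  obtain X where X: "X > 0" "\<And>t. 0 \<le> t \<Longrightarrow> t \<le> 1 \<Longrightarrow> \<bar>x t\<bar> \<le> X" by (rule x_bound, rule that)
  obtain P where P: "P \<ge> 0" "\<And>s y t. s \<in> {0..1} \<Longrightarrow> \<bar>y\<bar> \<le> X \<Longrightarrow> \<bar>t\<bar> \<le> X \<Longrightarrow> \<bar>fl s y t\<bar> \<le> P"
    using C1_local_lipschitz(2)[OF fl_C1 I01, of X] by blast
  have "continuous_on {0..1} (\<lambda>s. \<sigma> s 0)" using I01 by (intro continuous_on_field continuous_intros) auto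
  then obtain S where S: "S \<ge> 0" "\<And>s. 0 \<le> s \<Longrightarrow> s \<le> 1 \<Longrightarrow> \<bar>\<sigma> s 0\<bar> \<le> S" using bounded_on_01 by blast
  define E where "E = exp (2 * M * X)"
  have E: "E \<ge> 1" using M(1) X(1) by (simp add: E_def)
  define D where "D = P + E"
  define K where "K = cb * (1 + D) * E + X * (M * E) + M * (S + M * D) * E + 1"
  have D: "D \<ge> 0" using P E by (simp add: D_def)
  have nn: "0 \<le> cb * (1 + D) * E" "0 \<le> X * (M * E)" "0 \<le> M * (S + M * D) * E"
    using b_growth(1) D E X M(1) S by auto
  have K: "K > 0" using nn by (simp add: K_def)
  have "\<bar>F j s y\<bar> \<le> K * (1 + \<bar>y\<bar>)" if j: "j < 3" and s: "s \<in> {0..1}" for j s y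
  proof -
    have sI: "s \<in> I" and xs: "\<bar>x s\<bar> \<le> X" using s I01 X(2) by auto
    have e: "exp (M * \<bar>x s\<bar>) \<le> E" "exp (2 * M * \<bar>x s\<bar>) \<le> E"
    proof -
      have "0 \<le> M * X" using M(1) X(1) by simp
      then show "exp (M * \<bar>x s\<bar>) \<le> E" "exp (2 * M * \<bar>x s\<bar>) \<le> E"
        using mult_left_mono[OF xs M(1)] by (simp_all add: E_def)
    qed
    have inv: "inverse (la s y (x s)) \<le> E" "inverse (la s y (x s)) > 0"
      using la_inverse_bound[OF sI, of y "x s"] e(1) la_pos[of s y "x s"] by (auto simp: inverse_eq_divide)
    have "\<bar>fl s y (x s)\<bar> \<le> P + \<bar>y\<bar> * E"
    proof -
      have "\<bar>fl s y (x s) - fl s 0 (x s)\<bar> \<le> \<bar>y\<bar> * E"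
        using order_trans[OF fl_lipschitz[OF sI, of y "x s" 0] mult_left_mono[OF e(2)]] by simp
      moreover have "\<bar>fl s 0 (x s)\<bar> \<le> P" by (rule P(2)[OF s]) (use xs X(1) in auto)
      ultimately show ?thesis by linarith
    qed
    also have "\<dots> \<le> D * (1 + \<bar>y\<bar>)" using P(1) E by (simp add: D_def algebra_simps)
    finally have f: "\<bar>fl s y (x s)\<bar> \<le> D * (1 + \<bar>y\<bar>)" .
    have y1: "1 \<le> 1 + \<bar>y\<bar>" by simp
    have le: "c * (1 + \<bar>y\<bar>) \<le> K * (1 + \<bar>y\<bar>)" if "c \<le> K" for c using that by (intro mult_right_mono) auto
    consider "j = 0" | "j = 1" | "j = 2" using j by linarith
    then show ?thesis
    proof cases
      case 1
      have "\<bar>b s (fl s y (x s))\<bar> \<le> cb * (1 + \<bar>fl s y (x s)\<bar>)" by (rule b_growth(2)[OF s])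
      also have "\<dots> \<le> cb * ((1 + D) * (1 + \<bar>y\<bar>))" using f y1 b_growth(1) by (intro mult_left_mono) (auto simp: algebra_simps)
      finally have "\<bar>b s (fl s y (x s))\<bar> * inverse (la s y (x s)) \<le> (cb * ((1 + D) * (1 + \<bar>y\<bar>))) * E"
        using inv b_growth(1) D by (intro mult_mono) auto
      then have "\<bar>F j s y\<bar> \<le> (cb * (1 + D) * E) * (1 + \<bar>y\<bar>)" using 1 inv(2) by (simp add: F_def abs_mult mult_ac)
      also have "\<dots> \<le> K * (1 + \<bar>y\<bar>)" by (rule le) (use nn in \<open>simp add: K_def\<close>)
      finally show ?thesis .
    next
      case 2
      have "\<bar>F j s y\<bar> \<le> X * (M * E)"
        using 2 by (simp add: F_def, intro order_trans[OF qa_bound[OF sI]] mult_mono mult_left_mono)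
          (use xs e M(1) X(1) E in auto)
      also have "\<dots> \<le> (X * (M * E)) * (1 + \<bar>y\<bar>)" using mult_left_mono[OF y1 nn(2)] by simp
      also have "\<dots> \<le> K * (1 + \<bar>y\<bar>)" by (rule le) (use nn in \<open>simp add: K_def\<close>)
      finally show ?thesis .
    next
      case 3
      have "\<bar>\<sigma> s (fl s y (x s))\<bar> \<le> S + M * \<bar>fl s y (x s)\<bar>"
        using sigma_lipschitz[OF sI, of "fl s y (x s)" 0] S(2)[of s] s by simp
      also have "\<dots> \<le> S * (1 + \<bar>y\<bar>) + M * (D * (1 + \<bar>y\<bar>))"
        using mult_left_mono[OF f M(1)] mult_left_mono[OF y1 S(1)] by simp
      finally have "\<bar>\<sigma> s (fl s y (x s))\<bar> \<le> (S + M * D) * (1 + \<bar>y\<bar>)" by (simp add: algebra_simps)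
      then have "\<bar>ftt s y (x s)\<bar> \<le> M * ((S + M * D) * (1 + \<bar>y\<bar>))"
        unfolding ftt_def abs_mult using M(1,3) sI by (intro mult_mono) (auto simp: s2_def)
      then have "\<bar>ftt s y (x s)\<bar> * inverse (la s y (x s)) \<le> M * ((S + M * D) * (1 + \<bar>y\<bar>)) * E"
        using inv M(1) S D by (intro mult_mono) auto
      moreover have "\<bar>F j s y\<bar> \<le> \<bar>ftt s y (x s)\<bar> * inverse (la s y (x s))" using 3 inv(2) by (simp add: F_def abs_mult)
      ultimately have "\<bar>F j s y\<bar> \<le> (M * (S + M * D) * E) * (1 + \<bar>y\<bar>)" by (simp add: mult_ac)
      also have "\<dots> \<le> K * (1 + \<bar>y\<bar>)" by (rule le) (use nn in \<open>simp add: K_def\<close>)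
      finally show ?thesis .
    qed
  qed
  with K show ?thesis by blast
qed

end

lemma has_RS_integral_cong:
  assumes "\<And>s. 0 \<le> s \<Longrightarrow> s \<le> t \<Longrightarrow> f s = h s"
  shows "has_RS_integral f g 0 t J \<longleftrightarrow> has_RS_integral h g 0 t J"
proof -
  have "RS_sum f g p \<xi> n = RS_sum h g p \<xi> n" if p: "tagged_div_fine 0 t d p \<xi> n" for d p \<xi> n
    unfolding RS_sum_def
  proof (rule sum.cong[OF refl])
    fix i assume "i \<in> {..<n}"
    then have i: "i < n" by simp
    have le: "p i \<le> p j" if "i \<le> j" "j \<le> n" for i j
      by (rule chain_mono[OF _ that]) (use p in \<open>auto simp: tagged_div_fine_def less_imp_le\<close>)
    have "0 \<le> p i" "p (Suc i) \<le> t" "p i \<le> \<xi> i" "\<xi> i \<le> p (Suc i)"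
      using le[of 0 i] le[of "Suc i" n] p i by (auto simp: tagged_div_fine_def)
    then have "0 \<le> \<xi> i" "\<xi> i \<le> t" by linarith+
    then show "f (\<xi> i) * (g (p (Suc i)) - g (p i)) = h (\<xi> i) * (g (p (Suc i)) - g (p i))" using assms by simp
  qed
  then show ?thesis unfolding has_RS_integral_def by (intro all_cong1 imp_cong ex_cong1 conj_cong refl) simp
qed

context clock
begin

lemma lipm_cong: "lipm f \<Longrightarrow> (\<And>t. 0 \<le> t \<Longrightarrow> t \<le> 1 \<Longrightarrow> f t = h t) \<Longrightarrow> lipm h"
proof -
  assume f: "lipm f" and eq: "\<And>t. 0 \<le> t \<Longrightarrow> t \<le> 1 \<Longrightarrow> f t = h t"
  obtain C where C: "C \<ge> 0" "\<And>u v. 0 \<le> u \<Longrightarrow> u \<le> v \<Longrightarrow> v \<le> 1 \<Longrightarrow> \<bar>f v - f u\<bar> \<le> C * (m v - m u)"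
    by (rule lipmE[OF f], rule that)
  show "lipm h"
    by (rule lipmI[OF C(1)]) (use C(2) eq in simp)
qed

lemma SI_constant_integrator:
  assumes "continuous_on {0..1} f" "\<And>t. 0 \<le> t \<Longrightarrow> t \<le> 1 \<Longrightarrow> g t = c" "0 \<le> t" "t \<le> 1"
  shows "SI f g t = 0"
proof (rule SI_eqI[of "\<lambda>_. 0"])
  show "stdiff (\<lambda>_. 0) f g"
  proof (rule stdiffI)
    fix e :: real assume e: "e > 0"
    show "\<exists>d>0. \<forall>u v. 0 \<le> u \<longrightarrow> u \<le> v \<longrightarrow> v \<le> 1 \<longrightarrow> v - u < d \<longrightarrow> \<bar>0 - 0 - f u * (g v - g u)\<bar> \<le> e * (m v - m u)"
      using assms(2) m_mono e by (intro exI[of _ 1]) auto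
  qed
  show "lipm g" by (rule lipm_cong[OF lipm_const[of c]]) (use assms(2) in simp)
qed (use assms in auto)

end

context ito_equation
begin

lemma F_lipm: "continuous_on {0..1} B \<Longrightarrow> j < 3 \<Longrightarrow> lipm (SI (\<lambda>s. F j s (B s)) (g j))"
  using vo.F_cont' vo.g by (intro stdiff_lipm[OF stdiff_SI]) auto

lemma volt_expand: "vo.volt z0 B t = z0 + (SI (\<lambda>s. F 0 s (B s)) A t + (SI (\<lambda>s. F 1 s (B s)) (\<lambda>s. s) t + SI (\<lambda>s. F 2 s (B s)) q t))"
proof -
  have "{..<3 :: nat} = {0, 1, 2}" by auto
  then show ?thesis unfolding vo.volt_def by (simp add: g_def)
qed

lemma volt_lipm: "continuous_on {0..1} B \<Longrightarrow> lipm (vo.volt z0 B)"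
  unfolding volt_expand[abs_def] using F_lipm[of B 0] F_lipm[of B 1] F_lipm[of B 2]
  by (intro lipm_add lipm_const) (auto simp: g_def)

lemma volt_0: "continuous_on {0..1} B \<Longrightarrow> vo.volt z0 B 0 = z0"
  using SI_0[OF vo.F_cont' vo.g] by (simp add: vo.volt_def)

lemma continuous_on_bz: "continuous_on {0..1} B \<Longrightarrow> continuous_on {0..1} (\<lambda>s. b s (fl s (B s) (x s)))"
  using continuous_on_flow01(1) by (intro continuous_on_b) (auto intro: continuous_intros)

text \<open>The partial derivatives written with \<open>deriv\<close> are replaced on [0, t] by
  \<open>la\<close>, \<open>flt\<close> and \<open>ftt\<close>, and each Riemann-Stieltjes integral
  by \<open>SI\<close>; what remains is the fixed point equation of \<open>volt\<close>.\<close>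

lemma B_equation_iff:
  "B_equation T x A b fl z0 B \<longleftrightarrow> continuous_on {0..1} B \<and> (\<forall>t\<in>{0..1}. vo.volt z0 B t = B t)"
proof (cases "continuous_on {0..1} B")
  case cB: True
  note c = continuous_on_flow01[OF cB]
  have ci: "continuous_on {0..1} (\<lambda>s. inverse (la s (B s) (x s)))"
    by (rule continuous_on_inverse) (use c(2) la_pos in \<open>auto simp: less_imp_neq[symmetric]\<close>)
  have c0: "continuous_on {0..1} (\<lambda>s. b s (fl s (B s) (x s)) * inverse (la s (B s) (x s)))"
    and c2: "continuous_on {0..1} (\<lambda>s. ftt s (B s) (x s) * inverse (la s (B s) (x s)))"
    by (intro continuous_on_mult ci c continuous_on_bz cB)+
  have "(\<exists>I1 I2 I3.
      has_RS_integral (\<lambda>s. b s (fl s (B s) (x s)) / deriv (\<lambda>\<xi>. fl s \<xi> (x s)) (B s)) A 0 t I1 \<and>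
      has_RS_integral (\<lambda>s. deriv (\<lambda>\<tau>. fl \<tau> (B s) (x s)) s / deriv (\<lambda>\<xi>. fl s \<xi> (x s)) (B s)) (\<lambda>s. s) 0 t I2 \<and>
      has_RS_integral (\<lambda>s. deriv (deriv (fl s (B s))) (x s) / deriv (\<lambda>\<xi>. fl s \<xi> (x s)) (B s)) q 0 t I3 \<and>
      B t = z0 + I1 - I2 - I3 / 2) \<longleftrightarrow> vo.volt z0 B t = B t" if t: "t \<in> {0..1}" for t
  proof -
    have sI: "s \<in> I" if "0 \<le> s" "s \<le> t" for s using that t I01 by auto
    have t01: "0 \<le> t" "t \<le> 1" using t by auto
    have "has_RS_integral (\<lambda>s. b s (fl s (B s) (x s)) / deriv (\<lambda>\<xi>. fl s \<xi> (x s)) (B s)) A 0 t J \<longleftrightarrow>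
        has_RS_integral (\<lambda>s. b s (fl s (B s) (x s)) * inverse (la s (B s) (x s))) A 0 t J" for J
      by (rule has_RS_integral_cong) (simp add: fl_partial_derivs sI divide_inverse)
    then have 1: "has_RS_integral (\<lambda>s. b s (fl s (B s) (x s)) / deriv (\<lambda>\<xi>. fl s \<xi> (x s)) (B s)) A 0 t J \<longleftrightarrow>
        J = SI (\<lambda>s. b s (fl s (B s) (x s)) * inverse (la s (B s) (x s))) A t" for J
      using has_RS_SI[OF c0 A_lipm t01] by simp
    have "has_RS_integral (\<lambda>s. deriv (\<lambda>\<tau>. fl \<tau> (B s) (x s)) s / deriv (\<lambda>\<xi>. fl s \<xi> (x s)) (B s)) (\<lambda>s. s) 0 t J \<longleftrightarrow>
        has_RS_integral (\<lambda>s. qa s (B s) (x s)) (\<lambda>s. s) 0 t J" for J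
      by (rule has_RS_integral_cong) (simp add: fl_partial_derivs sI flt_def less_imp_neq[OF la_pos, symmetric])
    then have 2: "has_RS_integral (\<lambda>s. deriv (\<lambda>\<tau>. fl \<tau> (B s) (x s)) s / deriv (\<lambda>\<xi>. fl s \<xi> (x s)) (B s)) (\<lambda>s. s) 0 t J \<longleftrightarrow>
        J = SI (\<lambda>s. qa s (B s) (x s)) (\<lambda>s. s) t" for J
      using has_RS_SI[OF c(5) lipm_id t01] by simp
    have "has_RS_integral (\<lambda>s. deriv (deriv (fl s (B s))) (x s) / deriv (\<lambda>\<xi>. fl s \<xi> (x s)) (B s)) q 0 t J \<longleftrightarrow>
        has_RS_integral (\<lambda>s. ftt s (B s) (x s) * inverse (la s (B s) (x s))) q 0 t J" for J
      by (rule has_RS_integral_cong) (simp add: fl_partial_derivs sI divide_inverse)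
    then have 3: "has_RS_integral (\<lambda>s. deriv (deriv (fl s (B s))) (x s) / deriv (\<lambda>\<xi>. fl s \<xi> (x s)) (B s)) q 0 t J \<longleftrightarrow>
        J = SI (\<lambda>s. ftt s (B s) (x s) * inverse (la s (B s) (x s))) q t" for J
      using has_RS_SI[OF c2 qv_lipm t01] by simp
    have V: "vo.volt z0 B t = z0 + SI (\<lambda>s. b s (fl s (B s) (x s)) * inverse (la s (B s) (x s))) A t
        - SI (\<lambda>s. qa s (B s) (x s)) (\<lambda>s. s) t - SI (\<lambda>s. ftt s (B s) (x s) * inverse (la s (B s) (x s))) q t / 2"
      unfolding volt_expand F_def using SI_cmult[OF c(5) lipm_id t01, of "-1"] SI_cmult[OF c2 qv_lipm t01, of "-1/2"] by simp
    show ?thesis unfolding 1 2 3 V by auto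
  qed
  then show ?thesis unfolding B_equation_def using cB by simp
qed (simp add: B_equation_def)

theorem B_equation_exists_unique:
  "\<exists>B. B_equation T x A b fl z0 B"
  "B_equation T x A b fl z0 B \<Longrightarrow> B_equation T x A b fl z0 B' \<Longrightarrow> t \<in> {0..1} \<Longrightarrow> B' t = B t"
proof -
  obtain K where "K > 0" "\<forall>j<3. \<forall>s\<in>{0..1}. \<forall>y. \<bar>F j s y\<bar> \<le> K * (1 + \<bar>y\<bar>)" using F_growth by blast
  then show "\<exists>B. B_equation T x A b fl z0 B"
    unfolding B_equation_iff by (intro vo.volt_exists[OF F_lipschitz, of K]) auto
  show "B' t = B t" if "B_equation T x A b fl z0 B" "B_equation T x A b fl z0 B'" "t \<in> {0..1}"
    by (rule vo.volt_unique[OF _ _ _ _ F_lipschitz that(3)]) (use that in \<open>auto simp: B_equation_iff\<close>)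
qed

text \<open>Multiplying \<open>d volt\<close> by \<open>la\<close> gives
  \<open>b dA - flt ds - ftt / 2 dq\<close>, so Ito's formula becomes
  \<open>dz = \<sigma> dx + b dA + la d(\<beta> - volt \<beta>)\<close> for an arbitrary Lipschitz
  \<beta>. Read in one direction it shows that a solution of the Stieltjes equation yields a
  solution \<open>z\<close>; read in the other, that \<open>\<beta> - volt \<beta>\<close> is
  constant as soon as \<open>z\<close> is a solution.\<close>

theorem foellmer_limit:
  assumes \<beta>: "lipm \<beta>" and t: "0 \<le> t" "t \<le> 1"
  defines "z \<equiv> \<lambda>t. fl t (\<beta> t) (x t)"
  shows "(\<lambda>n. foellmer_sum (T n) (\<lambda>s. \<sigma> s (z s)) x t) \<longlonglongrightarrow>
    z t - z 0 - SI (\<lambda>s. b s (z s)) A t - SI (\<lambda>s. la s (\<beta> s) (x s)) (\<lambda>s. \<beta> s - vo.volt z0 \<beta> s) t"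
proof -
  have c\<beta>: "continuous_on {0..1} \<beta>" by (rule lipm_continuous_on[OF \<beta>])
  note c = continuous_on_flow01[OF c\<beta>]
  let ?l = "\<lambda>s. la s (\<beta> s) (x s)"
  let ?S = "\<lambda>j. SI (\<lambda>s. F j s (\<beta> s)) (g j)"
  have l: "lipm (?S 0)" "lipm (?S 1)" "lipm (?S 2)" using F_lipm[OF c\<beta>] by auto
  have S: "SI ?l (?S j) t = SI (\<lambda>s. ?l s * F j s (\<beta> s)) (g j) t" if "j < 3" for j
    by (rule SI_SI[OF c(2) vo.F_cont'[OF that c\<beta>] vo.g[OF that] t])
  have ne: "la s \<xi> t \<noteq> 0" for s \<xi> t using la_pos[of s \<xi> t] by simp
  have cz2: "continuous_on {0..1} (\<lambda>s. ftt s (\<beta> s) (x s) / 2)" by (intro continuous_intros c) auto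
  have "SI ?l (vo.volt z0 \<beta>) t = SI ?l (\<lambda>s. z0) t + (SI ?l (?S 0) t + (SI ?l (?S 1) t + SI ?l (?S 2) t))"
  proof -
    have "vo.volt z0 \<beta> = (\<lambda>s. z0 + (?S 0 s + (?S 1 s + ?S 2 s)))" by (simp add: volt_expand g_def fun_eq_iff)
    then show ?thesis using l
      by (simp add: SI_add_integrator[OF c(2) _ _ t] lipm_const lipm_add)
  qed
  also have "SI ?l (\<lambda>s. z0) t = 0" by (rule SI_constant_integrator[OF c(2) _ t]) simp
  also have "SI ?l (?S 0) t = SI (\<lambda>s. b s (z s)) A t"
  proof -
    have "(\<lambda>s. ?l s * F 0 s (\<beta> s)) = (\<lambda>s. b s (z s))" by (simp add: F_def z_def ne fun_eq_iff field_simps)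
    then show ?thesis using S[of 0] by (simp add: g_def)
  qed
  also have "SI ?l (?S 1) t = - SI (\<lambda>s. flt s (\<beta> s) (x s)) (\<lambda>s. s) t"
    using S[of 1] SI_cmult[OF c(3) lipm_id t, of "-1"] by (simp add: F_def g_def flt_def)
  also have "SI ?l (?S 2) t = - SI (\<lambda>s. ftt s (\<beta> s) (x s) / 2) q t"
  proof -
    have "(\<lambda>s. ?l s * F 2 s (\<beta> s)) = (\<lambda>s. (-1) * (ftt s (\<beta> s) (x s) / 2))" by (simp add: F_def ne fun_eq_iff field_simps)
    then show ?thesis using S[of 2] SI_cmult[OF cz2 qv_lipm t, of "-1"] by (simp add: g_def)
  qed
  finally have V: "SI ?l (vo.volt z0 \<beta>) t = SI (\<lambda>s. b s (z s)) A t - SI (\<lambda>s. flt s (\<beta> s) (x s)) (\<lambda>s. s) t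
      - SI (\<lambda>s. ftt s (\<beta> s) (x s) / 2) q t" by simp
  have "SI ?l \<beta> t = SI ?l (\<lambda>s. \<beta> s - vo.volt z0 \<beta> s) t + SI ?l (vo.volt z0 \<beta>) t"
    using SI_add_integrator[OF c(2) lipm_diff[OF \<beta> volt_lipm[OF c\<beta>]] volt_lipm[OF c\<beta>] t, of z0 z0] by simp
  with V have "z t - z 0 - (SI (\<lambda>s. flt s (\<beta> s) (x s)) (\<lambda>s. s) t + SI ?l \<beta> t + SI (\<lambda>s. ftt s (\<beta> s) (x s) / 2) q t)
      = z t - z 0 - SI (\<lambda>s. b s (z s)) A t - SI ?l (\<lambda>s. \<beta> s - vo.volt z0 \<beta> s) t" by linarith
  with ito_formula[OF \<beta> t] show ?thesis by (simp only: z_def)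
qed

text \<open>The flow itself is the witness, with the two parameters \<open>t\<close> and
  \<open>B t\<close> of bounded variation: its derivative in the last variable is \<sigma> along the
  flow. This accounts for the dimension 2.\<close>

lemma admissible_fl:
  assumes "lipm B"
  shows "admissible_integrand TYPE(2) x (\<lambda>t. \<sigma> t (fl t (B t) (x t)))"
  unfolding admissible_integrand_def
proof (intro exI conjI)
  let ?A = "\<lambda>t. vector [t, B t] :: real^2" and ?U = "{p :: (real^2) \<times> real. fst p $ 1 \<in> I}"
    and ?f = "\<lambda>p :: (real^2) \<times> real. fl (fst p $ 1) (fst p $ 2) (snd p)"
  show cbv: "\<forall>i. CBV01 (\<lambda>t. ?A t $ i)"
    using lipm_CBV01[OF assms] lipm_CBV01[OF lipm_id] by (simp add: forall_2)
  have "continuous_on {0..1} (\<lambda>t. \<chi> i. ?A t $ i)"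
    using cbv by (intro continuous_on_vec_lambda) (auto simp: CBV01_def)
  then show "continuous_on {0..1} ?A" by simp
  have "?U = (\<lambda>p. fst p $ 1) -` I" by auto
  then show "open ?U" using I(1) by (auto intro!: open_vimage continuous_intros)
  show "\<forall>t\<in>{0..1}. (?A t, x t) \<in> ?U" using I01 by auto
  show "C1_on ?U ?f"
  proof -
    have "C1_on ?U (\<lambda>p. (\<lambda>q. fl (fst (fst q)) (snd (fst q)) (snd q)) ((fst p $ 1, fst p $ 2), snd p))"
    proof (rule C1_on_compose[OF fl_C1])
      show "((\<lambda>p :: (real^2) \<times> real. ((fst p $ 1, fst p $ 2), snd p)) has_derivative (\<lambda>v. ((fst v $ 1, fst v $ 2), snd v))) (at p)" for p
        by (intro bounded_linear_imp_has_derivative bounded_linear_Pair bounded_linear_snd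
            bounded_linear_compose[OF bounded_linear_vec_nth bounded_linear_fst])
    qed auto
    then show ?thesis by simp
  qed
  show "\<forall>a\<in>fst ` ?U. C2_on {\<xi>. (a, \<xi>) \<in> ?U} (\<lambda>\<xi>. ?f (a, \<xi>))"
  proof
    fix a :: "real^2" assume "a \<in> fst ` ?U"
    then have a: "a $ 1 \<in> I" by auto
    have C: "C1_on UNIV (\<lambda>\<xi>. \<sigma> (a $ 1) (fl (a $ 1) (a $ 2) \<xi>) * v)" for v
      by (rule C1_onI[where f'="\<lambda>\<xi> w. ftt (a $ 1) (a $ 2) \<xi> * v * w"])
        (use sigma_fl_deriv[OF a] a in \<open>auto simp: has_field_derivative_def[symmetric] intro!: derivative_eq_intros continuous_intros continuous_on_flow\<close>)
    have "C2_on UNIV (\<lambda>\<xi>. fl (a $ 1) (a $ 2) \<xi>)"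
      using fl_deriv[OF a] C[of 1] by (intro C2_onI[where f'="\<lambda>\<xi> v. \<sigma> (a $ 1) (fl (a $ 1) (a $ 2) \<xi>) * v"])
        (auto simp: has_field_derivative_def)
    then show "C2_on {\<xi>. (a, \<xi>) \<in> ?U} (\<lambda>\<xi>. ?f (a, \<xi>))" using a by simp
  qed
  show "\<forall>t\<in>{0..1}. \<sigma> t (fl t (B t) (x t)) = deriv (\<lambda>\<xi>. ?f (?A t, \<xi>)) (x t)"
    using fl_partial_derivs(3) I01 by auto
qed

theorem is_solution_fl:
  assumes x0: "x 0 = 0" and B: "B_equation T x A b fl z0 B"
  shows "is_solution TYPE(2) T x A \<sigma> b z0 (\<lambda>t. fl t (B t) (x t))"
proof -
  have cB: "continuous_on {0..1} B" and V: "\<And>t. t \<in> {0..1} \<Longrightarrow> vo.volt z0 B t = B t" using B by (auto simp: B_equation_iff)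
  have lB: "lipm B" by (rule lipm_cong[OF volt_lipm[OF cB]]) (use V in auto)
  have "0 \<in> I" using I01 by (rule subsetD) simp
  then have z0: "fl 0 (B 0) (x 0) = z0"
    using V[of 0] volt_0[OF cB, of z0] x0 by (simp add: fl_0)
  show ?thesis
    unfolding is_solution_def
  proof (intro conjI ballI admissible_fl lB continuous_on_flow01(1) cB)
    fix t :: real assume "t \<in> {0..1}"
    then have t: "0 \<le> t" "t \<le> 1" by auto
    let ?z = "\<lambda>t. fl t (B t) (x t)"
    have "SI (\<lambda>s. la s (B s) (x s)) (\<lambda>s. B s - vo.volt z0 B s) t = 0"
      by (rule SI_constant_integrator[OF continuous_on_flow01(2)[OF cB] _ t, of _ 0]) (use V in auto)
    with foellmer_limit[OF lB t, of z0]
    have "(\<lambda>n. foellmer_sum (T n) (\<lambda>s. \<sigma> s (?z s)) x t) \<longlonglongrightarrow> ?z t - z0 - SI (\<lambda>s. b s (?z s)) A t"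
      by (simp add: z0)
    moreover have "has_RS_integral (\<lambda>s. b s (?z s)) A 0 t (SI (\<lambda>s. b s (?z s)) A t)"
      using has_RS_SI[OF continuous_on_bz[OF cB] A_lipm t] by simp
    ultimately show "\<exists>I J. (\<lambda>n. foellmer_sum (T n) (\<lambda>s. \<sigma> s (?z s)) x t) \<longlonglongrightarrow> I \<and>
        has_RS_integral (\<lambda>s. b s (?z s)) A 0 t J \<and> ?z t = z0 + I + J"
      by (intro exI[of _ "?z t - z0 - SI (\<lambda>s. b s (?z s)) A t"] exI[of _ "SI (\<lambda>s. b s (?z s)) A t"]) auto
  qed
qed

end

section \<open>Uniqueness of the solution\<close>

text \<open>If \<open>\<kappa>\<close> moves by \<open>o(\<bar>\<Delta>x\<bar>)\<close> up to a Lipschitz part, then the first term disappears: cut \<open>[u, v]\<close> at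
  successive levels of \<open>x\<close>, so that the increments of \<open>x\<close> add up to \<open>x v - x u\<close> instead of its variation.\<close>

lemma level_chain:
  fixes \<kappa> x \<mu> :: "real \<Rightarrow> real"
  assumes x: "continuous_on {u..v} x"
    and loc: "\<And>\<epsilon>. \<epsilon> > 0 \<Longrightarrow> \<exists>\<delta>>0. \<forall>a b. u \<le> a \<longrightarrow> a \<le> b \<longrightarrow> b \<le> v \<longrightarrow> \<bar>x b - x a\<bar> \<le> \<delta> \<longrightarrow>
      \<bar>\<kappa> b - \<kappa> a\<bar> \<le> (\<mu> b - \<mu> a) + \<epsilon> * \<bar>x b - x a\<bar>"
    and uv: "u \<le> v"
  shows "\<bar>\<kappa> v - \<kappa> u\<bar> \<le> \<mu> v - \<mu> u"
proof -
  have "\<bar>\<kappa> v - \<kappa> u\<bar> \<le> (\<mu> v - \<mu> u) + \<epsilon> * \<bar>x v - x u\<bar>" if "\<epsilon> > 0" for \<epsilon>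
  proof -
    from loc[OF that] obtain \<delta> where \<delta>: "\<delta> > 0" "\<And>a b. u \<le> a \<Longrightarrow> a \<le> b \<Longrightarrow> b \<le> v \<Longrightarrow> \<bar>x b - x a\<bar> \<le> \<delta> \<Longrightarrow>
      \<bar>\<kappa> b - \<kappa> a\<bar> \<le> (\<mu> b - \<mu> a) + \<epsilon> * \<bar>x b - x a\<bar>" by blast
    \<comment> \<open>The induction counts the levels of height \<delta> between \<open>x a\<close>
      and \<open>x v\<close>.\<close>
    have step: "\<bar>\<kappa> v - \<kappa> a\<bar> \<le> (\<mu> v - \<mu> a) + \<epsilon> * \<bar>x v - x a\<bar>"
      if "\<bar>x v - x a\<bar> \<le> real n * \<delta>" "u \<le> a" "a \<le> v" for n a
      using that
    proof (induction n arbitrary: a)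
      case 0
      then show ?case using \<delta>(2)[of a v] \<delta>(1) by simp
    next
      case (Suc n)
      show ?case
      proof (cases "\<bar>x v - x a\<bar> \<le> \<delta>")
        case True
        then show ?thesis using \<delta>(2)[of a v] Suc.prems by simp
      next
        case False
        \<comment> \<open>The next level towards \<open>x v\<close>, at distance exactly \<delta>.
          As it lies between \<open>x a\<close> and \<open>x v\<close>, the distances add up without
          cancellation.\<close>
        define y where "y = (if x a \<le> x v then x a + \<delta> else x a - \<delta>)"
        have cx: "continuous_on {a..v} x" using x Suc.prems by (rule_tac continuous_on_subset) auto
        have "\<exists>w. a \<le> w \<and> w \<le> v \<and> x w = y"
        proof (cases "x a \<le> x v")
          case True
          then show ?thesis using IVT'[of x a y v] cx False Suc.prems \<delta>(1) by (auto simp: y_def)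
        next
          case f: False
          then show ?thesis using IVT2'[of x v y a] cx False Suc.prems \<delta>(1) by (auto simp: y_def)
        qed
        then obtain w where w: "a \<le> w" "w \<le> v" "x w = y" by blast
        have d: "\<bar>x w - x a\<bar> = \<delta>" "\<bar>x v - x a\<bar> = \<bar>x w - x a\<bar> + \<bar>x v - x w\<bar>"
          using w(3) False \<delta>(1) by (auto simp: y_def)
        have 1: "\<bar>\<kappa> w - \<kappa> a\<bar> \<le> (\<mu> w - \<mu> a) + \<epsilon> * \<bar>x w - x a\<bar>" using \<delta>(2)[of a w] d w Suc.prems by simp
        have 2: "\<bar>\<kappa> v - \<kappa> w\<bar> \<le> (\<mu> v - \<mu> w) + \<epsilon> * \<bar>x v - x w\<bar>"
          by (rule Suc.IH) (use d w Suc.prems in \<open>auto simp: algebra_simps\<close>)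
        have "\<epsilon> * \<bar>x v - x a\<bar> = \<epsilon> * \<bar>x w - x a\<bar> + \<epsilon> * \<bar>x v - x w\<bar>" unfolding d(2) by (rule distrib_left)
        with 1 2 show ?thesis by linarith
      qed
    qed
    obtain n where "\<bar>x v - x u\<bar> / \<delta> \<le> real n" using real_arch_simple by blast
    then have "\<bar>x v - x u\<bar> \<le> real n * \<delta>" using \<delta>(1) by (simp add: pos_divide_le_eq)
    from step[OF this order_refl uv] show ?thesis .
  qed
  then have le: "\<bar>\<kappa> v - \<kappa> u\<bar> - (\<mu> v - \<mu> u) \<le> \<epsilon> * \<bar>x v - x u\<bar>" if "\<epsilon> > 0" for \<epsilon> using that by (simp add: algebra_simps)
  have "\<bar>\<kappa> v - \<kappa> u\<bar> - (\<mu> v - \<mu> u) \<le> e" if e: "e > 0" for e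
  proof -
    define w where "w = \<bar>x v - x u\<bar>"
    have w: "w \<ge> 0" by (simp add: w_def)
    have "e / (w + 1) > 0" using e w by simp
    from le[OF this] have "\<bar>\<kappa> v - \<kappa> u\<bar> - (\<mu> v - \<mu> u) \<le> e / (w + 1) * w" by (simp only: w_def)
    also have "\<dots> = e * (w / (w + 1))" by simp
    also have "\<dots> \<le> e * 1" using e w by (intro mult_left_mono) auto
    also have "\<dots> = e" by simp
    finally show ?thesis .
  qed
  from field_le_epsilon[of "\<bar>\<kappa> v - \<kappa> u\<bar> - (\<mu> v - \<mu> u)" 0, unfolded add_0_left, OF this]
  show ?thesis by simp
qed

lemma (in clock) SI_local:
  assumes f: "continuous_on {0..1} f" "continuous_on {0..1} h" "lipm g" and uv: "0 \<le> u" "u \<le> v" "v \<le> 1"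
    and eq: "\<And>t. u \<le> t \<Longrightarrow> t \<le> v \<Longrightarrow> f t = h t"
  shows "SI f g v - SI f g u = SI h g v - SI h g u"
proof -
  have "SI f g v - SI h g v = SI f g u - SI h g u"
  proof (rule local_null_const[OF _ uv])
    fix e :: real assume "e > 0"
    then have e: "e / 2 > 0" by simp
    obtain d1 where d1: "d1 > 0" "\<And>u v. 0 \<le> u \<Longrightarrow> u \<le> v \<Longrightarrow> v \<le> 1 \<Longrightarrow> v - u < d1 \<Longrightarrow>
        \<bar>SI f g v - SI f g u - f u * (g v - g u)\<bar> \<le> e / 2 * (m v - m u)"
      by (rule stdiffD[OF stdiff_SI[OF f(1,3)] e], rule that)
    obtain d2 where d2: "d2 > 0" "\<And>u v. 0 \<le> u \<Longrightarrow> u \<le> v \<Longrightarrow> v \<le> 1 \<Longrightarrow> v - u < d2 \<Longrightarrow>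
        \<bar>SI h g v - SI h g u - h u * (g v - g u)\<bar> \<le> e / 2 * (m v - m u)"
      by (rule stdiffD[OF stdiff_SI[OF f(2,3)] e], rule that)
    show "\<exists>d>0. \<forall>a b. u \<le> a \<longrightarrow> a \<le> b \<longrightarrow> b \<le> v \<longrightarrow> b - a < d \<longrightarrow> \<bar>SI f g b - SI h g b - (SI f g a - SI h g a)\<bar> \<le> e * (m b - m a)"
    proof (intro exI[of _ "min d1 d2"] conjI allI impI)
      fix a b assume ab: "u \<le> a" "a \<le> b" "b \<le> v" "b - a < min d1 d2"
      have "\<bar>SI f g b - SI f g a - f a * (g b - g a)\<bar> \<le> e / 2 * (m b - m a)"
        by (rule d1(2)) (use ab uv in auto)
      moreover have "\<bar>SI h g b - SI h g a - f a * (g b - g a)\<bar> \<le> e / 2 * (m b - m a)"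
        using d2(2)[of a b] ab uv eq[of a] by auto
      moreover have "e / 2 * (m b - m a) + e / 2 * (m b - m a) = e * (m b - m a)" by (simp add: field_simps)
      ultimately show "\<bar>SI f g b - SI h g b - (SI f g a - SI h g a)\<bar> \<le> e * (m b - m a)" by linarith
    qed (use d1 d2 in auto)
  qed
  then show ?thesis by simp
qed

text \<open>\<open>gg t\<close> and \<open>gx t\<close> stand for \<open>f(\<^bold>A(t), \<cdot>)\<close> and its derivative, where \<open>f\<close> and \<open>\<^bold>A\<close> witness that
  \<open>\<sigma>(t, z(t))\<close> is admissible; the clock \<open>m\<close> is chosen after \<open>\<^bold>A\<close>.\<close>

locale second_solution = ito_equation \<sigma> I M m T x A b cb for \<sigma> I M m T x A b cb +
  fixes z :: "real \<Rightarrow> real" and gg gx :: "real \<Rightarrow> real \<Rightarrow> real" and r Cg z0 :: real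
  assumes x0: "x 0 = 0" and z_cont: "continuous_on {0..1} z" and r: "r > 0" and Cg: "Cg \<ge> 0"
    and g_deriv: "\<And>t \<xi>. t \<in> {0..1} \<Longrightarrow> \<bar>\<xi> - x t\<bar> < r \<Longrightarrow> (gg t has_real_derivative gx t \<xi>) (at \<xi>)"
    and g_time: "\<And>u v \<xi>. 0 \<le> u \<Longrightarrow> u \<le> v \<Longrightarrow> v \<le> 1 \<Longrightarrow> v - u < r \<Longrightarrow> \<bar>\<xi> - x u\<bar> < r \<Longrightarrow> \<bar>\<xi> - x v\<bar> < r \<Longrightarrow>
        \<bar>gg v \<xi> - gg u \<xi>\<bar> \<le> Cg * (m v - m u)"
    and gx_cont: "\<And>\<epsilon>. \<epsilon> > 0 \<Longrightarrow> \<exists>\<delta>>0. \<forall>u v \<xi> \<xi>'. u \<in> {0..1} \<longrightarrow> v \<in> {0..1} \<longrightarrow> \<bar>\<xi> - x u\<bar> < r \<longrightarrow> \<bar>\<xi>' - x v\<bar> < r \<longrightarrow>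
        \<bar>u - v\<bar> < \<delta> \<longrightarrow> \<bar>\<xi> - \<xi>'\<bar> < \<delta> \<longrightarrow> \<bar>gx u \<xi> - gx v \<xi>'\<bar> < \<epsilon>"
    and gx_lip: "\<And>t. t \<in> {0..1} \<Longrightarrow> \<exists>K. \<forall>\<xi> \<xi>'. \<bar>\<xi> - x t\<bar> < r \<longrightarrow> \<bar>\<xi>' - x t\<bar> < r \<longrightarrow> \<bar>gx t \<xi> - gx t \<xi>'\<bar> \<le> K * \<bar>\<xi> - \<xi>'\<bar>"
    and eta: "\<And>t. t \<in> {0..1} \<Longrightarrow> gx t (x t) = \<sigma> t (z t)"
    and Ff_cont: "continuous_on {0..1} (\<lambda>t. gg t (x t))"
    and sol: "\<And>t. t \<in> {0..1} \<Longrightarrow> (\<lambda>n. foellmer_sum (T n) (\<lambda>s. \<sigma> s (z s)) x t) \<longlonglongrightarrow> z t - z0 - SI (\<lambda>s. b s (z s)) A t"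
begin

section \<open>The pulled-back solution and its defect in the Stieltjes equation\<close>

definition "Bt t = fl t (z t) (- x t)"
definition "Y = vo.volt z0 Bt"
definition "D t = Bt t - Y t"

lemma Bt_cont: "continuous_on {0..1} Bt"
  unfolding Bt_def using I01 by (intro continuous_on_flI continuous_intros z_cont x_cont) auto

lemma fl_Bt: "t \<in> {0..1} \<Longrightarrow> fl t (Bt t) (x t) = z t"
  unfolding Bt_def using I01 by (intro fl_inverse(2)) auto

lemma Y_lipm: "lipm Y" unfolding Y_def by (rule volt_lipm[OF Bt_cont])

lemma D_cont: "continuous_on {0..1} D"
  unfolding D_def by (intro continuous_intros Bt_cont lipm_continuous_on[OF Y_lipm])

lemma bz_cont: "continuous_on {0..1} (\<lambda>s. b s (z s))"
  by (rule continuous_on_b) (auto intro!: z_cont continuous_intros)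

text \<open>At time 0 the Foellmer sum consists of the single term for \<open>s = 0\<close>, which
  tends to 0 by continuity of \<open>x\<close>; the equation itself thus forces the initial
  value.\<close>

lemma z_0: "z 0 = z0"
proof -
  have eq: "foellmer_sum (T n) (\<lambda>s. \<sigma> s (z s)) x 0 = \<sigma> 0 (z 0) * (\<Sum>s\<in>{s \<in> T n. s \<le> 0}. x (succ_pt (T n) s) - x s)" for n
  proof -
    have "{s \<in> T n. s \<le> 0} = {0}" using T01 by force
    then show ?thesis by (simp add: foellmer_sum_def)
  qed
  have "(\<lambda>n. \<sigma> 0 (z 0) * (\<Sum>s\<in>{s \<in> T n. s \<le> 0}. x (succ_pt (T n) s) - x s)) \<longlonglongrightarrow> \<sigma> 0 (z 0) * (x 0 - x 0)"
    by (intro tendsto_mult_left telescope_limit x_cont) auto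
  with sol[of 0] have "\<sigma> 0 (z 0) * (x 0 - x 0) = z 0 - z0 - SI (\<lambda>s. b s (z s)) A 0"
    unfolding eq by (intro LIMSEQ_unique) auto
  then show ?thesis using SI_0[OF bz_cont A_lipm] by simp
qed

lemma D_0: "D 0 = 0"
  using volt_0[OF Bt_cont, of z0] I01 by (simp add: D_def Y_def Bt_def x0 z_0 fl_0 subset_iff)

text \<open>Outside [u, v] \<open>Bt\<close> need not be Lipschitz, so it is frozen there at its end
  values; the resulting \<beta> is Lipschitz on [0, 1] and \<open>foellmer_limit\<close> applies to
  it. Inside [u, v] it reproduces \<open>z\<close>, whose Foellmer sums have a known limit, and the
  comparison leaves \<open>la d(\<beta> - volt \<beta>) = 0\<close>.\<close>

lemma D_constant_if_lipschitz:
  assumes uv: "0 \<le> u" "u \<le> v" "v \<le> 1" and C: "C \<ge> 0"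
    and Bt: "\<And>a b. u \<le> a \<Longrightarrow> a \<le> b \<Longrightarrow> b \<le> v \<Longrightarrow> \<bar>Bt b - Bt a\<bar> \<le> C * (m b - m a)"
  shows "D v = D u"
proof -
  define cl where "cl = (\<lambda>t. max u (min v t))"
  define \<beta> where "\<beta> = (\<lambda>t. Bt (cl t))"
  have \<beta>eq: "\<beta> t = Bt t" if "u \<le> t" "t \<le> v" for t using that by (simp add: \<beta>_def cl_def)
  have \<beta>: "lipm \<beta>"
  proof (rule lipmI[OF C])
    fix s t :: real assume st: "0 \<le> s" "s \<le> t" "t \<le> 1"
    have 1: "u \<le> cl s" "cl s \<le> cl t" "cl t \<le> v" using uv st by (auto simp: cl_def)
    have "m (cl t) - m (cl s) \<le> m t - m s"
    proof -
      consider "t \<le> u" | "v \<le> s" | "s \<le> cl s" "cl t \<le> t" "u \<le> t" "s \<le> v" using st uv by (force simp: cl_def)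
      then show ?thesis
      proof cases
        case 1 then show ?thesis using st uv m_mono[of s t] by (simp add: cl_def)
      next
        case 2 then show ?thesis using st uv m_mono[of s t] by (simp add: cl_def)
      next
        case 3
        then have "m s \<le> m (cl s)" "m (cl t) \<le> m t" using st uv by (auto intro!: m_mono simp: cl_def)
        then show ?thesis by simp
      qed
    qed
    then have "C * (m (cl t) - m (cl s)) \<le> C * (m t - m s)" using C by (rule mult_left_mono)
    with Bt[OF 1] show "\<bar>\<beta> t - \<beta> s\<bar> \<le> C * (m t - m s)" unfolding \<beta>_def by linarith
  qed
  have c\<beta>: "continuous_on {0..1} \<beta>" by (rule lipm_continuous_on[OF \<beta>])
  define z\<beta> where "z\<beta> = (\<lambda>t. fl t (\<beta> t) (x t))"
  have z\<beta>: "z\<beta> t = z t" if "u \<le> t" "t \<le> v" for t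
    using that uv fl_Bt[of t] by (simp add: z\<beta>_def \<beta>eq)
  let ?l = "\<lambda>s. la s (\<beta> s) (x s)"
  define V where "V = vo.volt z0 \<beta>"
  have Vl: "lipm (\<lambda>s. \<beta> s - V s)" unfolding V_def by (intro lipm_diff \<beta> volt_lipm[OF c\<beta>])
  define G where "G = SI ?l (\<lambda>s. \<beta> s - V s)"
  have cz\<beta>: "continuous_on {0..1} (\<lambda>s. b s (z\<beta> s))" unfolding z\<beta>_def by (rule continuous_on_bz[OF c\<beta>])
  have Gc: "G c = G a" if ac: "u \<le> a" "a \<le> c" "c \<le> v" for a c
  proof -
    have a01: "0 \<le> a" "a \<le> 1" "0 \<le> c" "c \<le> 1" using ac uv by auto
    have "(\<lambda>n. foellmer_sum (T n) (\<lambda>s. \<sigma> s (z\<beta> s)) x c - foellmer_sum (T n) (\<lambda>s. \<sigma> s (z\<beta> s)) x a) \<longlonglongrightarrow>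
       (z\<beta> c - z\<beta> 0 - SI (\<lambda>s. b s (z\<beta> s)) A c - G c) - (z\<beta> a - z\<beta> 0 - SI (\<lambda>s. b s (z\<beta> s)) A a - G a)"
      unfolding z\<beta>_def G_def V_def by (intro tendsto_diff foellmer_limit \<beta> a01)
    moreover have "(\<lambda>n. foellmer_sum (T n) (\<lambda>s. \<sigma> s (z s)) x c - foellmer_sum (T n) (\<lambda>s. \<sigma> s (z s)) x a) \<longlonglongrightarrow>
       (z c - z0 - SI (\<lambda>s. b s (z s)) A c) - (z a - z0 - SI (\<lambda>s. b s (z s)) A a)"
      by (intro tendsto_diff sol) (use a01 in auto)
    \<comment> \<open>Both differences are sums over \<open>a < s \<le> c\<close> and evaluate the
      integrand only at such points, where \<open>z\<beta>\<close> and \<open>z\<close>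
      agree.\<close>
    moreover have "foellmer_sum (T n) (\<lambda>s. \<sigma> s (z\<beta> s)) x c - foellmer_sum (T n) (\<lambda>s. \<sigma> s (z\<beta> s)) x a
      = foellmer_sum (T n) (\<lambda>s. \<sigma> s (z s)) x c - foellmer_sum (T n) (\<lambda>s. \<sigma> s (z s)) x a" for n
      unfolding foellmer_sum_def sum_split[OF a01(1) ac(2)] by (rule sum.cong) (use ac z\<beta> in auto)
    ultimately have "(z\<beta> c - z\<beta> 0 - SI (\<lambda>s. b s (z\<beta> s)) A c - G c) - (z\<beta> a - z\<beta> 0 - SI (\<lambda>s. b s (z\<beta> s)) A a - G a)
      = (z c - z0 - SI (\<lambda>s. b s (z s)) A c) - (z a - z0 - SI (\<lambda>s. b s (z s)) A a)"
      by (intro LIMSEQ_unique) auto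
    moreover have "SI (\<lambda>s. b s (z\<beta> s)) A c - SI (\<lambda>s. b s (z\<beta> s)) A a = SI (\<lambda>s. b s (z s)) A c - SI (\<lambda>s. b s (z s)) A a"
      by (rule SI_local[OF cz\<beta> bz_cont A_lipm]) (use ac a01 z\<beta> in auto)
    ultimately show ?thesis using z\<beta>[of a] z\<beta>[of c] ac by simp
  qed
  have cl: "continuous_on {0..1} ?l" by (rule continuous_on_flow01(2)[OF c\<beta>])
  have "\<exists>t0\<in>{0..1}. \<forall>t\<in>{0..1}. ?l t0 \<le> ?l t"
    by (rule continuous_attains_inf[OF compact_Icc _ cl]) simp
  then obtain t0 where t0: "\<forall>t\<in>{0..1}. ?l t0 \<le> ?l t" by blast
  \<comment> \<open>\<open>la\<close> is bounded away from 0 along \<beta>, so it can be divided out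
    of the vanishing differential.\<close>
  define l0 where "l0 = ?l t0"
  have l0: "l0 > 0" by (simp add: l0_def la_pos)
  have sG: "stdiff G ?l (\<lambda>s. \<beta> s - V s)" unfolding G_def by (rule stdiff_SI[OF cl Vl])
  have "\<beta> v - V v = \<beta> u - V u"
  proof (rule local_null_const[OF _ uv])
    fix e :: real assume "e > 0"
    then have e: "e * l0 > 0" using l0 by simp
    obtain d where d: "d > 0" "\<And>a c. 0 \<le> a \<Longrightarrow> a \<le> c \<Longrightarrow> c \<le> 1 \<Longrightarrow> c - a < d \<Longrightarrow>
        \<bar>G c - G a - ?l a * (\<beta> c - V c - (\<beta> a - V a))\<bar> \<le> e * l0 * (m c - m a)"
      by (rule stdiffD[OF sG e], rule that)
    show "\<exists>d>0. \<forall>a c. u \<le> a \<longrightarrow> a \<le> c \<longrightarrow> c \<le> v \<longrightarrow> c - a < d \<longrightarrow> \<bar>\<beta> c - V c - (\<beta> a - V a)\<bar> \<le> e * (m c - m a)"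
    proof (intro exI[of _ d] conjI allI impI)
      fix a c assume ac: "u \<le> a" "a \<le> c" "c \<le> v" "c - a < d"
      have "l0 * \<bar>\<beta> c - V c - (\<beta> a - V a)\<bar> \<le> ?l a * \<bar>\<beta> c - V c - (\<beta> a - V a)\<bar>"
        using t0 ac uv by (intro mult_right_mono) (auto simp: l0_def)
      also have "\<dots> \<le> e * l0 * (m c - m a)"
        using d(2)[of a c] ac uv Gc[of a c] la_pos[of a "\<beta> a" "x a"] by (simp add: abs_mult)
      also have "\<dots> = l0 * (e * (m c - m a))" by simp
      finally show "\<bar>\<beta> c - V c - (\<beta> a - V a)\<bar> \<le> e * (m c - m a)" using l0 by simp
    qed (rule d(1))
  qed
  moreover have "V v - V u = Y v - Y u"
  proof -
    have "SI (\<lambda>s. F j s (\<beta> s)) (g j) v - SI (\<lambda>s. F j s (\<beta> s)) (g j) u = SI (\<lambda>s. F j s (Bt s)) (g j) v - SI (\<lambda>s. F j s (Bt s)) (g j) u"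
      if "j < 3" for j
      by (rule SI_local[OF vo.F_cont'[OF that c\<beta>] vo.F_cont'[OF that Bt_cont] vo.g[OF that] uv]) (simp add: \<beta>eq)
    then show ?thesis unfolding V_def Y_def vo.volt_def by (simp add: sum_subtractf[symmetric])
  qed
  ultimately show ?thesis using \<beta>eq[of u] \<beta>eq[of v] uv by (simp add: D_def)
qed

text \<open>The neighbourhood is taken in the real line and only \<open>a\<close> and
  \<open>c\<close> are confined to [0, 1]; so \<open>good\<close> is open in the line and the end
  points need no separate treatment.\<close>

definition "good = {t. \<exists>\<epsilon>>0. \<forall>a c. 0 \<le> a \<longrightarrow> a \<le> c \<longrightarrow> c \<le> 1 \<longrightarrow> t - \<epsilon> < a \<longrightarrow> c < t + \<epsilon> \<longrightarrow> D c = D a}"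
definition "bad = {0..1} - good"

lemma open_good: "open good"
  unfolding open_contains_ball
proof
  fix t assume "t \<in> good"
  then obtain \<epsilon> where \<epsilon>: "\<epsilon> > 0" "\<And>a c. 0 \<le> a \<Longrightarrow> a \<le> c \<Longrightarrow> c \<le> 1 \<Longrightarrow> t - \<epsilon> < a \<Longrightarrow> c < t + \<epsilon> \<Longrightarrow> D c = D a"
    unfolding good_def by blast
  have "ball t (\<epsilon> / 2) \<subseteq> good"
  proof
    fix s assume "s \<in> ball t (\<epsilon> / 2)"
    then have s: "\<bar>s - t\<bar> < \<epsilon> / 2" by (simp add: dist_real_def abs_minus_commute)
    show "s \<in> good"
      unfolding good_def
    proof (intro CollectI exI[of _ "\<epsilon> / 2"] conjI allI impI)
      fix a c assume "0 \<le> a" "a \<le> c" "c \<le> 1" "s - \<epsilon> / 2 < a" "c < s + \<epsilon> / 2"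
      then show "D c = D a" using s by (intro \<epsilon>(2)) linarith+
    qed (use \<epsilon>(1) in simp)
  qed
  then show "\<exists>e>0. ball t e \<subseteq> good" using \<epsilon>(1) by (intro exI[of _ "\<epsilon> / 2"]) auto
qed

lemma closed_bad: "closed bad" unfolding bad_def using open_good by (intro closed_Diff) auto

lemma D_constant_good:
  assumes uv: "0 \<le> u" "u \<le> v" "v \<le> 1" and g: "{u..v} \<subseteq> good"
  shows "D v = D u"
proof -
  have "D constant_on {u..v}"
  proof (rule locally_constant_imp_constant)
    fix t assume t: "t \<in> {u..v}"
    then obtain \<epsilon> where \<epsilon>: "\<epsilon> > 0" "\<And>a c. 0 \<le> a \<Longrightarrow> a \<le> c \<Longrightarrow> c \<le> 1 \<Longrightarrow> t - \<epsilon> < a \<Longrightarrow> c < t + \<epsilon> \<Longrightarrow> D c = D a"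
      using g unfolding good_def by blast
    show "\<exists>T. openin (top_of_set {u..v}) T \<and> t \<in> T \<and> (\<forall>s\<in>T. D s = D t)"
    proof (intro exI[of _ "{u..v} \<inter> ball t \<epsilon>"] conjI ballI)
      show "openin (top_of_set {u..v}) ({u..v} \<inter> ball t \<epsilon>)" by (rule openin_open_Int) simp
      fix s assume s: "s \<in> {u..v} \<inter> ball t \<epsilon>"
      then show "D s = D t" using \<epsilon>(2)[of s t] \<epsilon>(2)[of t s] \<epsilon>(1) t uv
        by (cases "s \<le> t") (auto simp: dist_real_def abs_less_iff)
    qed (use t \<epsilon>(1) in auto)
  qed auto
  then show ?thesis using uv unfolding constant_on_def by force
qed

text \<open>Inside the gap connectedness gives a single constant; continuity of \<open>D\<close>
  extends it to the end points, which may be bad.\<close>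

lemma D_constant_gap:
  assumes uv: "0 \<le> u" "u \<le> v" "v \<le> 1" and g: "{u<..<v} \<inter> bad = {}" and ac: "u \<le> a" "a \<le> c" "c \<le> v"
  shows "D c = D a"
proof (cases "u < v")
  case True
  have gd: "{u<..<v} \<subseteq> good" using g uv by (auto simp: bad_def)
  define w where "w = (u + v) / 2"
  have w: "u < w" "w < v" using True by (auto simp: w_def)
  have in': "D t = D w" if "t \<in> {u<..<v}" for t
  proof (cases "t \<le> w")
    case True
    have "D w = D t" by (rule D_constant_good) (use True that w uv gd in \<open>auto simp: subset_iff\<close>)
    then show ?thesis by simp
  next
    case False
    show ?thesis by (rule D_constant_good) (use False that w uv gd in \<open>auto simp: subset_iff\<close>)
  qed
  have cl: "closure {u<..<v} = {u..v}" using True by (rule closure_greaterThanLessThan)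
  have "D t = D w" if "t \<in> {u..v}" for t
  proof (rule continuous_constant_on_closure[where S="{u<..<v}" and f=D and a="D w"])
    show "continuous_on (closure {u<..<v}) D" unfolding cl by (rule continuous_on_subset[OF D_cont]) (use uv in auto)
  qed (use in' that cl in auto)
  then show ?thesis using ac by simp
next
  case False
  then have "a = c" using uv ac by linarith
  then show ?thesis by simp
qed

end

lemma mvt_between:
  fixes h h' :: "real \<Rightarrow> real"
  assumes "\<And>\<xi>. min a b \<le> \<xi> \<Longrightarrow> \<xi> \<le> max a b \<Longrightarrow> (h has_real_derivative h' \<xi>) (at \<xi>)"
  shows "\<exists>c. min a b \<le> c \<and> c \<le> max a b \<and> h b - h a = h' c * (b - a)"
proof -
  consider "a = b" | "a < b" | "b < a" by linarith
  then show ?thesis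
  proof cases
    case 1 then show ?thesis by (intro exI[of _ a]) auto
  next
    case 2
    obtain c where "a < c" "c < b" "h b - h a = (b - a) * h' c"
      using MVT2[OF 2, of h h'] assms 2 by auto
    then show ?thesis by (intro exI[of _ c]) auto
  next
    case 3
    obtain c where "b < c" "c < a" "h a - h b = (a - b) * h' c"
      using MVT2[OF 3, of h h'] assms 3 by auto
    then show ?thesis by (intro exI[of _ c]) (auto simp: algebra_simps)
  qed
qed

text \<open>\<open>[c0, c1]\<close> surrounds the portion of \<open>bad\<close> from Baire's theorem; \<open>K\<close> is its Lipschitz constant.\<close>

locale region = second_solution \<sigma> I M m T x A b cb z gg gx r Cg z0
  for \<sigma> I M m T x A b cb z gg gx r Cg z0 +
  fixes c0 c1 K R L S Cq CY Cb :: real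
  assumes c01: "0 \<le> c0" "c1 \<le> 1" "c1 - c0 < r"
    and osc: "\<And>u v. c0 \<le> u \<Longrightarrow> u \<le> c1 \<Longrightarrow> c0 \<le> v \<Longrightarrow> v \<le> c1 \<Longrightarrow> \<bar>x u - x v\<bar> < r"
    and K: "K \<ge> 0" "\<And>t \<xi> \<xi>'. t \<in> bad \<Longrightarrow> c0 \<le> t \<Longrightarrow> t \<le> c1 \<Longrightarrow> \<bar>\<xi> - x t\<bar> < r \<Longrightarrow> \<bar>\<xi>' - x t\<bar> < r \<Longrightarrow> \<bar>gx t \<xi> - gx t \<xi>'\<bar> \<le> K * \<bar>\<xi> - \<xi>'\<bar>"
    and R: "\<And>t. t \<in> {0..1} \<Longrightarrow> \<bar>x t\<bar> \<le> R" "\<And>t. t \<in> {0..1} \<Longrightarrow> \<bar>Bt t\<bar> \<le> R"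
    and L: "L \<ge> 0" "\<And>\<tau> \<tau>' \<xi> \<xi>' t. \<tau> \<in> {0..1} \<Longrightarrow> \<tau>' \<in> {0..1} \<Longrightarrow> \<bar>t\<bar> \<le> R \<Longrightarrow> \<bar>fl \<tau> \<xi> t - fl \<tau>' \<xi>' t\<bar> \<le> L * (\<bar>\<tau> - \<tau>'\<bar> + \<bar>\<xi> - \<xi>'\<bar>)"
    and S: "S \<ge> 0" "\<And>\<tau> \<xi> t. \<tau> \<in> {0..1} \<Longrightarrow> \<bar>\<xi>\<bar> \<le> R \<Longrightarrow> \<bar>t\<bar> \<le> R \<Longrightarrow> \<bar>\<sigma> \<tau> (fl \<tau> \<xi> t)\<bar> \<le> S"
      "\<And>\<tau> \<xi> t. \<tau> \<in> {0..1} \<Longrightarrow> \<bar>\<xi>\<bar> \<le> R \<Longrightarrow> \<bar>t\<bar> \<le> R \<Longrightarrow> \<bar>ftt \<tau> \<xi> t\<bar> \<le> S"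
    and Cq: "Cq \<ge> 0" "\<And>u v. 0 \<le> u \<Longrightarrow> u \<le> v \<Longrightarrow> v \<le> 1 \<Longrightarrow> \<bar>q v - q u\<bar> \<le> Cq * (m v - m u)"
    and CY: "CY \<ge> 0" "\<And>u v. 0 \<le> u \<Longrightarrow> u \<le> v \<Longrightarrow> v \<le> 1 \<Longrightarrow> \<bar>Y v - Y u\<bar> \<le> CY * (m v - m u)"
    and Cb: "Cb \<ge> 0" "\<And>u v. 0 \<le> u \<Longrightarrow> u \<le> v \<Longrightarrow> v \<le> 1 \<Longrightarrow> \<bar>SI (\<lambda>s. b s (z s)) A v - SI (\<lambda>s. b s (z s)) A u\<bar> \<le> Cb * (m v - m u)"
begin

definition "Ff t = gg t (x t)"
text \<open>Both terms have the same dx-part, with integrand \<sigma> at \<open>z\<close>, so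
  \<kappa> should be Lipschitz in the clock. This is proved on gaps of \<open>bad\<close> before it
  is known across bad points.\<close>

definition "\<kappa> t = Ff t - z t"
text \<open>The constants of successive estimates: \<open>C2\<close> for \<kappa> on a gap,
  \<open>K'\<close> for the Lipschitz bound of the slope difference \<open>h'\<close>,
  \<open>C4\<close> for its value at the bad point, \<open>C5\<close> for its value at the starting
  point, \<open>C3\<close> for the increments of \<open>Ff\<close>, \<open>C6\<close> for \<kappa>
  across bad points and \<open>C7\<close> for the increments of \<open>Bt\<close>.\<close>

definition "C2 = Cg + L * (1 + CY)"
definition "K' = K + M * S"
definition "C4 = M + M * (L * (1 + CY))"
definition "C5 = 3 * C2 + K' + C4 * sqrt (m 1 - m 0)"
definition "C3 = C2 + L * (1 + CY) + S + 2 * Cg + K + C5"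
definition "C6 = C3 * (1 + Cq) + Cb"
definition "C7 = L * (1 + (C3 + C6) + S)"

lemma const_nonneg: "C2 \<ge> 0" "K' \<ge> 0" "C4 \<ge> 0" "C5 \<ge> 0" "C3 \<ge> 0" "C6 \<ge> 0" "C7 \<ge> 0" "0 \<le> L * (1 + CY)"
proof -
  show l: "0 \<le> L * (1 + CY)" using L CY by simp
  show c2: "C2 \<ge> 0" using l Cg by (simp add: C2_def)
  show k: "K' \<ge> 0" using K M(1) S by (simp add: K'_def)
  show c4: "C4 \<ge> 0" using M(1) l by (simp add: C4_def)
  show c5: "C5 \<ge> 0" using c2 k c4 m_mono[of 0 1] by (simp add: C5_def)
  show c3: "C3 \<ge> 0" using c2 l S(1) Cg K(1) c5 by (simp add: C3_def)
  show c6: "C6 \<ge> 0" using c3 Cq(1) Cb(1) by (simp add: C6_def)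
  show "C7 \<ge> 0" using c3 c6 S(1) L(1) by (simp add: C7_def)
qed

lemma in01: "c0 \<le> t \<Longrightarrow> t \<le> c1 \<Longrightarrow> t \<in> {0..1}" using c01 by auto

lemma between:
  assumes "c0 \<le> u" "u \<le> c1" "c0 \<le> v" "v \<le> c1" "min (x u) (x v) \<le> \<xi>" "\<xi> \<le> max (x u) (x v)"
  shows "\<bar>\<xi>\<bar> \<le> R" "c0 \<le> t \<Longrightarrow> t \<le> c1 \<Longrightarrow> \<bar>\<xi> - x t\<bar> < r"
  using osc[of u t] osc[of v t] R(1)[OF in01[of u]] R(1)[OF in01[of v]] assms by (auto simp: min_def max_def split: if_splits)

text \<open>\<open>D\<close> is constant there, so \<open>Bt\<close> moves exactly as the Lipschitz
  function \<open>Y\<close>.\<close>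

lemma Bt_gap:
  assumes "c0 \<le> u" "u \<le> v" "v \<le> c1" "{u<..<v} \<inter> bad = {}" "u \<le> a" "a \<le> c" "c \<le> v"
  shows "\<bar>Bt c - Bt a\<bar> \<le> CY * (m c - m a)"
proof -
  have "D c = D a" by (rule D_constant_gap[of u v]) (use assms c01 in auto)
  moreover have "\<bar>Y c - Y a\<bar> \<le> CY * (m c - m a)" by (rule CY(2)) (use assms c01 in auto)
  ultimately show ?thesis by (simp add: D_def algebra_simps)
qed

lemma fl_gap:
  assumes "c0 \<le> u" "u \<le> v" "v \<le> c1" "{u<..<v} \<inter> bad = {}" "u \<le> a" "a \<le> c" "c \<le> v" and t: "\<bar>t\<bar> \<le> R"
  shows "\<bar>fl c (Bt c) t - fl a (Bt a) t\<bar> \<le> L * (1 + CY) * (m c - m a)"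
proof -
  have i: "c \<in> {0..1}" "a \<in> {0..1}" using in01 assms by auto
  have "\<bar>fl c (Bt c) t - fl a (Bt a) t\<bar> \<le> L * (\<bar>c - a\<bar> + \<bar>Bt c - Bt a\<bar>)" by (rule L(2)[OF i t])
  also have "\<dots> \<le> L * ((m c - m a) + CY * (m c - m a))"
    using m_inc[of a c] i assms Bt_gap[OF assms(1-7)] by (intro mult_left_mono add_mono L) auto
  also have "\<dots> = L * (1 + CY) * (m c - m a)" by (simp add: algebra_simps)
  finally show ?thesis .
qed

lemma gg_time:
  assumes "c0 \<le> u" "u \<le> v" "v \<le> c1" "\<bar>\<xi> - x u\<bar> < r" "\<bar>\<xi> - x v\<bar> < r"
  shows "\<bar>gg v \<xi> - gg u \<xi>\<bar> \<le> Cg * (m v - m u)"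
  by (rule g_time) (use assms c01 in auto)

lemma sigma_fl_lip:
  assumes "\<tau> \<in> {0..1}" "\<bar>\<xi>\<bar> \<le> R" "\<bar>s\<bar> \<le> R" "\<bar>t\<bar> \<le> R"
  shows "\<bar>\<sigma> \<tau> (fl \<tau> \<xi> s) - \<sigma> \<tau> (fl \<tau> \<xi> t)\<bar> \<le> M * S * \<bar>s - t\<bar>"
proof -
  have \<tau>: "\<tau> \<in> I" using assms I01 by auto
  obtain c where c: "min t s \<le> c" "c \<le> max t s" "fl \<tau> \<xi> s - fl \<tau> \<xi> t = \<sigma> \<tau> (fl \<tau> \<xi> c) * (s - t)"
    using mvt_between[of t s "fl \<tau> \<xi>" "\<lambda>t. \<sigma> \<tau> (fl \<tau> \<xi> t)"] fl_deriv[OF \<tau>] by blast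
  have cR: "\<bar>c\<bar> \<le> R" using c assms by (auto simp: min_def max_def split: if_splits)
  have "\<bar>\<sigma> \<tau> (fl \<tau> \<xi> s) - \<sigma> \<tau> (fl \<tau> \<xi> t)\<bar> \<le> M * \<bar>fl \<tau> \<xi> s - fl \<tau> \<xi> t\<bar>" by (rule sigma_lipschitz[OF \<tau>])
  also have "\<dots> \<le> M * (S * \<bar>s - t\<bar>)"
    unfolding c(3) abs_mult using S(2)[OF assms(1,2) cR] by (intro mult_left_mono mult_right_mono M) auto
  finally show ?thesis by simp
qed

text \<open>The function \<open>\<lambda>\<xi>. gg a' \<xi> - fl a' (Bt a') \<xi>\<close> has zero
  derivative at \<open>x a'\<close>, since both slopes are \<sigma> at \<open>z a'\<close>. Moving
  the level to \<open>x c'\<close> therefore changes it by o(|x c' - x a'|), which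
  \<open>level_chain\<close> removes; the change of the parameters is Lipschitz on a gap.\<close>

lemma kappa_gap:
  assumes uv: "c0 \<le> u" "u \<le> v" "v \<le> c1" and gap: "{u<..<v} \<inter> bad = {}" and ac: "u \<le> a" "a \<le> c" "c \<le> v"
  shows "\<bar>\<kappa> c - \<kappa> a\<bar> \<le> C2 * (m c - m a)"
proof -
  have "\<bar>\<kappa> c - \<kappa> a\<bar> \<le> C2 * m c - C2 * m a"
  proof (rule level_chain[OF _ _ ac(2), where x=x])
    show "continuous_on {a..c} x" by (rule continuous_on_subset[OF x_cont]) (use uv ac c01 in auto)
    fix \<epsilon> :: real assume \<epsilon>: "\<epsilon> > 0"
    then have "\<epsilon> / 2 > 0" by simp
    from gx_cont[OF this] obtain \<delta>1 where \<delta>1: "\<delta>1 > 0" "\<And>u v \<xi> \<xi>'. u \<in> {0..1} \<Longrightarrow> v \<in> {0..1} \<Longrightarrow> \<bar>\<xi> - x u\<bar> < r \<Longrightarrow> \<bar>\<xi>' - x v\<bar> < r \<Longrightarrow>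
        \<bar>u - v\<bar> < \<delta>1 \<Longrightarrow> \<bar>\<xi> - \<xi>'\<bar> < \<delta>1 \<Longrightarrow> \<bar>gx u \<xi> - gx v \<xi>'\<bar> < \<epsilon> / 2" by blast
    \<comment> \<open>The first bound keeps the variation of \<open>gx\<close> below
      \<open>\<epsilon> / 2\<close>; the second does the same for the slope of the flow line, whose
      Lipschitz constant is \<open>M * S\<close>.\<close>
    define \<delta> where "\<delta> = min (\<delta>1 / 2) (\<epsilon> / (2 * (M * S + 1)))"
    have MS: "M * S \<ge> 0" using M(1) S(1) by simp
    have \<delta>: "\<delta> > 0" "\<delta> < \<delta>1" "M * S * \<delta> \<le> \<epsilon> / 2"
    proof -
      show "\<delta> > 0" "\<delta> < \<delta>1" using \<delta>1(1) \<epsilon> MS by (auto simp: \<delta>_def intro!: divide_pos_pos)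
      have "M * S * \<delta> \<le> (M * S + 1) * \<delta>" using \<open>\<delta> > 0\<close> by simp
      also have "\<dots> \<le> (M * S + 1) * (\<epsilon> / (2 * (M * S + 1)))" using MS by (intro mult_left_mono) (auto simp: \<delta>_def)
      also have "\<dots> = \<epsilon> / 2"
      proof -
        have "e * (\<epsilon> / (2 * e)) = \<epsilon> / 2" if "e \<noteq> 0" for e :: real using that by simp
        then show ?thesis using MS by (metis add_nonneg_pos less_numeral_extra(1) less_numeral_extra(3))
      qed
      finally show "M * S * \<delta> \<le> \<epsilon> / 2" .
    qed
    show "\<exists>\<delta>>0. \<forall>a' c'. a \<le> a' \<longrightarrow> a' \<le> c' \<longrightarrow> c' \<le> c \<longrightarrow> \<bar>x c' - x a'\<bar> \<le> \<delta> \<longrightarrow>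
        \<bar>\<kappa> c' - \<kappa> a'\<bar> \<le> C2 * m c' - C2 * m a' + \<epsilon> * \<bar>x c' - x a'\<bar>"
    proof (intro exI[of _ \<delta>] conjI allI impI \<delta>(1))
      fix a' c' assume "a \<le> a'" "a' \<le> c'" "c' \<le> c" and d: "\<bar>x c' - x a'\<bar> \<le> \<delta>"
      then have ac': "u \<le> a'" "a' \<le> c'" "c' \<le> v" "c0 \<le> a'" "c0 \<le> c'" "a' \<le> c1" "c' \<le> c1" using uv ac by auto
      have i: "a' \<in> {0..1}" "c' \<in> {0..1}" using in01 ac' by auto
      have aI: "a' \<in> I" using i I01 by auto
      have B1: "\<bar>fl c' (Bt c') (x c') - fl a' (Bt a') (x c')\<bar> \<le> L * (1 + CY) * (m c' - m a')"
        by (rule fl_gap[OF uv gap ac'(1-3) R(1)[OF i(2)]])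
      have B2: "\<bar>gg c' (x c') - gg a' (x c')\<bar> \<le> Cg * (m c' - m a')"
        by (rule gg_time) (use ac' osc[of c' a'] r in auto)
      obtain y where y: "min (x a') (x c') \<le> y" "y \<le> max (x a') (x c')"
        "(gg a' (x c') - fl a' (Bt a') (x c')) - (gg a' (x a') - fl a' (Bt a') (x a')) = (gx a' y - \<sigma> a' (fl a' (Bt a') y)) * (x c' - x a')"
      proof (atomize_elim, rule mvt_between[of "x a'" "x c'" "\<lambda>\<xi>. gg a' \<xi> - fl a' (Bt a') \<xi>" "\<lambda>y. gx a' y - \<sigma> a' (fl a' (Bt a') y)"])
        fix \<xi> assume "min (x a') (x c') \<le> \<xi>" "\<xi> \<le> max (x a') (x c')"
        then have "\<bar>\<xi> - x a'\<bar> < r" using between(2)[of a' c' \<xi> a'] ac' by auto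
        then show "((\<lambda>\<xi>. gg a' \<xi> - fl a' (Bt a') \<xi>) has_real_derivative gx a' \<xi> - \<sigma> a' (fl a' (Bt a') \<xi>)) (at \<xi>)"
          by (intro DERIV_diff g_deriv fl_deriv i aI)
      qed
      have yd: "\<bar>y - x a'\<bar> \<le> \<bar>x c' - x a'\<bar>" using y(1,2) by (auto simp: min_def max_def split: if_splits)
      have yr: "\<bar>y\<bar> \<le> R" "\<bar>y - x a'\<bar> < r" using between[of a' c' y] y ac' by auto
      have "\<bar>gx a' y - gx a' (x a')\<bar> < \<epsilon> / 2"
        by (rule \<delta>1(2)) (use i yr r yd d \<delta> \<delta>1(1) in auto)
      moreover have "\<bar>\<sigma> a' (fl a' (Bt a') y) - \<sigma> a' (fl a' (Bt a') (x a'))\<bar> \<le> \<epsilon> / 2"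
      proof -
        have "\<bar>\<sigma> a' (fl a' (Bt a') y) - \<sigma> a' (fl a' (Bt a') (x a'))\<bar> \<le> M * S * \<bar>y - x a'\<bar>"
          by (rule sigma_fl_lip) (use i R yr in auto)
        also have "\<dots> \<le> M * S * \<delta>" using yd d MS by (intro mult_left_mono) auto
        finally show ?thesis using \<delta>(3) by simp
      qed
      moreover have "gx a' (x a') = \<sigma> a' (fl a' (Bt a') (x a'))" using eta[OF i(1)] fl_Bt[OF i(1)] by simp
      ultimately have "\<bar>gx a' y - \<sigma> a' (fl a' (Bt a') y)\<bar> \<le> \<epsilon>" by linarith
      then have B3: "\<bar>(gx a' y - \<sigma> a' (fl a' (Bt a') y)) * (x c' - x a')\<bar> \<le> \<epsilon> * \<bar>x c' - x a'\<bar>"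
        unfolding abs_mult by (rule mult_right_mono) simp
      have "\<kappa> c' - \<kappa> a' = (gg c' (x c') - gg a' (x c')) - (fl c' (Bt c') (x c') - fl a' (Bt a') (x c'))
          + (gx a' y - \<sigma> a' (fl a' (Bt a') y)) * (x c' - x a')"
        unfolding y(3)[symmetric] \<kappa>_def Ff_def by (simp add: fl_Bt[OF i(1)] fl_Bt[OF i(2)])
      moreover have "C2 * m c' - C2 * m a' = Cg * (m c' - m a') + L * (1 + CY) * (m c' - m a')"
        by (simp add: C2_def algebra_simps)
      ultimately show "\<bar>\<kappa> c' - \<kappa> a'\<bar> \<le> C2 * m c' - C2 * m a' + \<epsilon> * \<bar>x c' - x a'\<bar>"
        using B1 B2 B3 by linarith
    qed
  qed
  then show ?thesis by (simp only: right_diff_distrib)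
qed

text \<open>If [u, v] contains no bad point, \<open>kappa_gap\<close> and Taylor's formula for the
  flow suffice. Otherwise the expansion uses the first bad point \<open>d\<close>, where
  \<open>gx d\<close> is Lipschitz with constant \<open>K\<close>. The price is the slope error
  \<open>h' (x u) = gx d (x u) - \<sigma> u (z u)\<close>, which the interpolation inequality bounds
  by \<open>C5 * sqrt (m d - m u)\<close>.\<close>

lemma F_increment:
  assumes uv: "c0 \<le> u" "u \<le> v" "v \<le> c1"
  shows "\<bar>Ff v - Ff u - \<sigma> u (z u) * (x v - x u)\<bar> \<le> C3 * ((m v - m u) + (x v - x u)\<^sup>2)"
proof -
  have i: "u \<in> {0..1}" "v \<in> {0..1}" and uI: "u \<in> I" using in01[of u] in01[of v] uv I01 by auto
  have mm: "0 \<le> m v - m u" using m_mono[of u v] i uv by auto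
  define \<Delta> where "\<Delta> = x v - x u"
  have D2: "\<Delta>\<^sup>2 \<ge> 0" by simp
  have fin: "\<bar>Ff v - Ff u - \<sigma> u (z u) * \<Delta>\<bar> \<le> C3 * ((m v - m u) + \<Delta>\<^sup>2)"
    if "\<bar>Ff v - Ff u - \<sigma> u (z u) * \<Delta>\<bar> \<le> a * (m v - m u) + c * \<Delta>\<^sup>2" "a \<le> C3" "c \<le> C3" for a c
  proof -
    have "a * (m v - m u) + c * \<Delta>\<^sup>2 \<le> C3 * (m v - m u) + C3 * \<Delta>\<^sup>2"
      using that mm by (intro add_mono mult_right_mono) auto
    with that(1) show ?thesis by (simp only: distrib_left)
  qed
  show ?thesis
  proof (cases "bad \<inter> {u..v} = {}")
    case True
    then have gap: "{u<..<v} \<inter> bad = {}" by auto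
    obtain c where c: "min (x u) (x v) \<le> c" "c \<le> max (x u) (x v)" and eq:
      "fl u (Bt u) (x v) - fl u (Bt u) (x u) = \<sigma> u (fl u (Bt u) (x u)) * (x v - x u) + ftt u (Bt u) c / 2 * (x v - x u)\<^sup>2"
      using fl_taylor[OF uI, of "x u" "x v" "Bt u"] by blast
    have "\<bar>ftt u (Bt u) c\<bar> \<le> S" by (rule S(3)) (use i R between(1)[of u v c] c uv in auto)
    then have 1: "\<bar>ftt u (Bt u) c / 2 * \<Delta>\<^sup>2\<bar> \<le> S * \<Delta>\<^sup>2" unfolding abs_mult by (intro mult_mono) auto
    have 2: "\<bar>fl v (Bt v) (x v) - fl u (Bt u) (x v)\<bar> \<le> L * (1 + CY) * (m v - m u)"
      by (rule fl_gap[OF uv gap]) (use uv R i in auto)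
    have 3: "\<bar>\<kappa> v - \<kappa> u\<bar> \<le> C2 * (m v - m u)" by (rule kappa_gap[OF uv gap]) (use uv in auto)
    have e': "fl u (Bt u) (x v) - z u = \<sigma> u (z u) * \<Delta> + ftt u (Bt u) c / 2 * \<Delta>\<^sup>2"
      using eq unfolding fl_Bt[OF i(1)] \<Delta>_def .
    have "(C2 + L * (1 + CY)) * (m v - m u) = C2 * (m v - m u) + L * (1 + CY) * (m v - m u)" by (rule distrib_right)
    then have "\<bar>Ff v - Ff u - \<sigma> u (z u) * \<Delta>\<bar> \<le> (C2 + L * (1 + CY)) * (m v - m u) + S * \<Delta>\<^sup>2"
      using 1 2 3 e' unfolding \<kappa>_def fl_Bt[OF i(2)] by linarith
    then show ?thesis unfolding \<Delta>_def[symmetric]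
      by (rule fin) (use const_nonneg(1,4,8) S(1) Cg K(1) in \<open>simp_all add: C3_def\<close>)
  next
    case False
    have "compact (bad \<inter> {u..v})" using closed_bad by (intro closed_Int_compact) auto
    from compact_attains_inf[OF this False] obtain d where d: "d \<in> bad" "u \<le> d" "d \<le> v"
      and dmin: "\<And>t. t \<in> bad \<Longrightarrow> u \<le> t \<Longrightarrow> t \<le> v \<Longrightarrow> d \<le> t" by auto
    have ud: "c0 \<le> u" "u \<le> d" "d \<le> c1" and dc0: "c0 \<le> d" and uc1: "u \<le> c1" and vc0: "c0 \<le> v" using d uv by auto
    have gap: "{u<..<d} \<inter> bad = {}" using dmin d by force
    have di: "d \<in> {0..1}" using in01[OF dc0 ud(3)] .
    define l where "l = m d - m u"
    have l: "0 \<le> l" "d - u \<le> l" "l \<le> m v - m u" "l \<le> m 1 - m 0"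
      using m_mono[of u d] m_inc[of u d] m_mono[of d v] m_mono[of d 1] m_mono[of 0 u] ud uv i di d by (auto simp: l_def)
    define s where "s = sqrt l"
    have s: "s \<ge> 0" "s * s = l" using l by (auto simp: s_def)
    \<comment> \<open>\<open>h\<close> compares \<open>gg\<close> frozen at \<open>d\<close> with
      the flow line frozen at \<open>u\<close>. At the level \<open>x \<rho>\<close> it differs from
      \<open>\<kappa> \<rho>\<close> by O(l), and on [u, d] the oscillation of \<kappa> is O(l) as
      well.\<close>
    define h where "h = (\<lambda>\<xi>. gg d \<xi> - fl u (Bt u) \<xi>)"
    define h' where "h' = (\<lambda>\<xi>. gx d \<xi> - \<sigma> u (fl u (Bt u) \<xi>))"
    have hd: "(h has_real_derivative h' \<xi>) (at \<xi>)" if "\<bar>\<xi> - x d\<bar> < r" for \<xi>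
      unfolding h_def h'_def by (intro DERIV_diff g_deriv fl_deriv di uI that)
    have hk: "\<bar>h (x \<rho>) - \<kappa> \<rho>\<bar> \<le> C2 * l" if \<rho>: "u \<le> \<rho>" "\<rho> \<le> d" for \<rho>
    proof -
      have \<rho>i: "\<rho> \<in> {0..1}" using \<rho> ud dc0 by (intro in01) auto
      have mr: "m \<rho> - m u \<le> l" "m d - m \<rho> \<le> l" using m_mono[of u \<rho>] m_mono[of \<rho> d] \<rho> \<rho>i di i by (auto simp: l_def)
      have "\<bar>gg d (x \<rho>) - gg \<rho> (x \<rho>)\<bar> \<le> Cg * (m d - m \<rho>)"
        by (rule gg_time) (use \<rho> ud osc[of \<rho> d] r in auto)
      also have "\<dots> \<le> Cg * l" using mr Cg by (intro mult_left_mono)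
      finally have 1: "\<bar>gg d (x \<rho>) - gg \<rho> (x \<rho>)\<bar> \<le> Cg * l" .
      have "\<bar>fl \<rho> (Bt \<rho>) (x \<rho>) - fl u (Bt u) (x \<rho>)\<bar> \<le> L * (1 + CY) * (m \<rho> - m u)"
        by (rule fl_gap[OF ud gap _ _ _ R(1)[OF \<rho>i]]) (use \<rho> in auto)
      also have "\<dots> \<le> L * (1 + CY) * l" using mr const_nonneg(8) by (intro mult_left_mono)
      finally have 2: "\<bar>z \<rho> - fl u (Bt u) (x \<rho>)\<bar> \<le> L * (1 + CY) * l" unfolding fl_Bt[OF \<rho>i] .
      have "C2 * l = Cg * l + L * (1 + CY) * l" by (simp add: C2_def distrib_right)
      then show ?thesis using 1 2 unfolding h_def \<kappa>_def Ff_def by linarith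
    qed
    have hb: "\<bar>h \<xi> - h (x u)\<bar> \<le> 3 * C2 * l" if \<xi>: "min (x u) (x d) \<le> \<xi>" "\<xi> \<le> max (x u) (x d)" for \<xi>
    proof -
      have cx: "continuous_on {u..d} x" by (rule continuous_on_subset[OF x_cont]) (use i di in auto)
      \<comment> \<open>Every level between \<open>x u\<close> and \<open>x d\<close> is taken by
        \<open>x\<close> on [u, d], which transfers the bound from \<kappa> to \<open>h\<close>. The
        3 counts two comparisons of \<open>h\<close> with \<kappa> and one increment of
        \<kappa>.\<close>
      have "\<exists>\<rho>. u \<le> \<rho> \<and> \<rho> \<le> d \<and> x \<rho> = \<xi>"
        using IVT'[of x u \<xi> d] IVT2'[of x d \<xi> u] \<xi> cx ud by (auto simp: min_def max_def split: if_splits)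
      then obtain \<rho> where \<rho>: "u \<le> \<rho>" "\<rho> \<le> d" "x \<rho> = \<xi>" by blast
      have \<rho>i: "\<rho> \<in> {0..1}" using \<rho> ud dc0 by (intro in01) auto
      have "\<bar>\<kappa> \<rho> - \<kappa> u\<bar> \<le> C2 * (m \<rho> - m u)" by (rule kappa_gap[OF ud gap]) (use \<rho> in auto)
      also have "\<dots> \<le> C2 * l" using m_mono[of \<rho> d] \<rho> \<rho>i di const_nonneg(1) by (intro mult_left_mono) (auto simp: l_def)
      finally show ?thesis using hk[of \<rho>] hk[of u] \<rho> ud by auto
    qed
    have hl: "\<bar>h' \<xi> - h' \<xi>'\<bar> \<le> K' * \<bar>\<xi> - \<xi>'\<bar>"
      if "min (x u) (x d) \<le> \<xi>" "\<xi> \<le> max (x u) (x d)" "min (x u) (x d) \<le> \<xi>'" "\<xi>' \<le> max (x u) (x d)" for \<xi> \<xi>'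
    proof -
      note b1 = between[OF ud(1) uc1 dc0 ud(3) that(1,2)] and b2 = between[OF ud(1) uc1 dc0 ud(3) that(3,4)]
      have "\<bar>gx d \<xi> - gx d \<xi>'\<bar> \<le> K * \<bar>\<xi> - \<xi>'\<bar>" by (rule K(2)[OF d(1) dc0 ud(3) b1(2)[OF dc0 ud(3)] b2(2)[OF dc0 ud(3)]])
      moreover have "\<bar>\<sigma> u (fl u (Bt u) \<xi>) - \<sigma> u (fl u (Bt u) \<xi>')\<bar> \<le> M * S * \<bar>\<xi> - \<xi>'\<bar>"
        by (rule sigma_fl_lip[OF i(1) R(2)[OF i(1)] b1(1) b2(1)])
      moreover have "K' * \<bar>\<xi> - \<xi>'\<bar> = K * \<bar>\<xi> - \<xi>'\<bar> + M * S * \<bar>\<xi> - \<xi>'\<bar>" by (simp add: K'_def distrib_right)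
      ultimately show ?thesis unfolding h'_def by linarith
    qed
    \<comment> \<open>At \<open>x d\<close> both slopes are values of \<sigma> at states that differ
      only by the parameter move from \<open>u\<close> to \<open>d\<close>; hence the order
      \<open>l\<close> instead of sqrt l.\<close>
    have hxd: "\<bar>h' (x d)\<bar> \<le> C4 * l"
    proof -
      have dI: "d \<in> I" using di I01 by auto
      have e: "gx d (x d) = \<sigma> d (fl d (Bt d) (x d))" using eta[OF di] fl_Bt[OF di] by simp
      have f: "\<bar>fl d (Bt d) (x d) - fl u (Bt u) (x d)\<bar> \<le> L * (1 + CY) * l"
        unfolding l_def by (rule fl_gap[OF ud gap _ _ _ R(1)[OF di]]) (use ud in auto)
      have "\<bar>h' (x d)\<bar> \<le> \<bar>d - u\<bar> * M + \<bar>fl d (Bt d) (x d) - fl u (Bt u) (x d)\<bar> * M"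
        unfolding h'_def e sigma_diff(1)[OF dI uI]
        by (rule order_trans[OF abs_triangle_ineq], unfold abs_mult, intro add_mono mult_left_mono sigma_diff(2,3)[OF dI uI] abs_ge_zero)
      also have "\<dots> \<le> l * M + (L * (1 + CY) * l) * M"
        using f l(2) ud M(1) by (intro add_mono mult_right_mono) auto
      also have "\<dots> = C4 * l" by (simp add: C4_def algebra_simps)
      finally show ?thesis .
    qed
    have "C4 * l \<le> C4 * sqrt (m 1 - m 0) * s"
    proof -
      have "C4 * l = C4 * (s * s)" using s by simp
      also have "\<dots> \<le> C4 * (sqrt (m 1 - m 0) * s)"
        using l(4) s const_nonneg(3) by (intro mult_left_mono mult_right_mono) (auto simp: s_def)
      finally show ?thesis by simp
    qed
    then have hxd': "\<bar>h' (x d)\<bar> \<le> C4 * sqrt (m 1 - m 0) * s" using hxd by linarith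
    have C5s: "C5 * s = 3 * C2 * s + K' * s + C4 * sqrt (m 1 - m 0) * s" by (simp add: C5_def distrib_right)
    have n: "0 \<le> 3 * C2 * s" "0 \<le> C4 * sqrt (m 1 - m 0) * s" using const_nonneg s m_mono[of 0 1] by auto
    \<comment> \<open>Landau's inequality. If \<open>x u\<close> and \<open>x d\<close> are within
      \<open>s = sqrt l\<close>, the slope is compared with that at \<open>x d\<close>. Otherwise
      the mean slope over a piece of length \<open>s\<close> is at most
      \<open>3 * C2 * l / s = 3 * C2 * s\<close>, and the Lipschitz bound transports it to
      \<open>x u\<close>.\<close>
    have hxu: "\<bar>h' (x u)\<bar> \<le> C5 * s"
    proof (cases "\<bar>x u - x d\<bar> \<le> s")
      case True
      have "\<bar>h' (x u) - h' (x d)\<bar> \<le> K' * \<bar>x u - x d\<bar>" by (rule hl) auto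
      also have "\<dots> \<le> K' * s" using True const_nonneg(2) by (rule mult_left_mono)
      finally show ?thesis using hxd' C5s n by linarith
    next
      case False
      have s0: "s > 0"
      proof (rule ccontr)
        assume "\<not> s > 0"
        then have "l = 0" using s by auto
        then have "d = u" using l(2) ud by simp
        then show False using False s(1) by simp
      qed
      define \<xi> where "\<xi> = (if x u \<le> x d then x u + s else x u - s)"
      have \<xi>: "min (x u) (x d) \<le> \<xi>" "\<xi> \<le> max (x u) (x d)" "\<bar>\<xi> - x u\<bar> = s" using False s0 by (auto simp: \<xi>_def)
      obtain c where c: "min (x u) \<xi> \<le> c" "c \<le> max (x u) \<xi>" "h \<xi> - h (x u) = h' c * (\<xi> - x u)"
      proof (atomize_elim, rule mvt_between)
        fix y assume "min (x u) \<xi> \<le> y" "y \<le> max (x u) \<xi>"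
        then have "min (x u) (x d) \<le> y" "y \<le> max (x u) (x d)" using \<xi> by (auto simp: min_def max_def split: if_splits)
        then show "(h has_real_derivative h' y) (at y)" by (intro hd between(2)[OF ud(1) uc1 dc0 ud(3)] dc0 ud(3))
      qed
      have cb: "min (x u) (x d) \<le> c" "c \<le> max (x u) (x d)" "\<bar>x u - c\<bar> \<le> s"
        using c(1,2) \<xi> by (auto simp: min_def max_def split: if_splits)
      have "\<bar>h' c\<bar> * s \<le> (3 * C2 * s) * s"
        using hb[OF \<xi>(1,2)] unfolding c(3) abs_mult \<xi>(3) s(2)[symmetric] by (simp add: mult.assoc)
      then have "\<bar>h' c\<bar> \<le> 3 * C2 * s" using s0 by (rule mult_right_le_imp_le)
      moreover have "\<bar>h' (x u) - h' c\<bar> \<le> K' * s"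
        by (rule order_trans[OF hl mult_left_mono]) (use cb const_nonneg(2) in auto)
      ultimately show ?thesis using C5s n by linarith
    qed
    have xuv: "\<bar>x u - x d\<bar> < r" "\<bar>x v - x d\<bar> < r" "\<bar>x v - x v\<bar> < r" "\<bar>x u - x u\<bar> < r"
      using osc[of u d] osc[of v d] ud uv d r by auto
    obtain c where c: "min (x u) (x v) \<le> c" "c \<le> max (x u) (x v)" "gg d (x v) - gg d (x u) = gx d c * (x v - x u)"
    proof (atomize_elim, rule mvt_between)
      fix y assume "min (x u) (x v) \<le> y" "y \<le> max (x u) (x v)"
      then have "\<bar>y - x d\<bar> < r" by (rule between(2)[OF ud(1) uc1 vc0 uv(3) _ _ dc0 ud(3)])
      then show "(gg d has_real_derivative gx d y) (at y)" by (rule g_deriv[OF di])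
    qed
    have cr: "\<bar>c - x d\<bar> < r" by (rule between(2)[OF ud(1) uc1 vc0 uv(3) c(1,2) dc0 ud(3)])
    have cd: "\<bar>c - x u\<bar> \<le> \<bar>\<Delta>\<bar>" using c(1,2) by (auto simp: \<Delta>_def min_def max_def split: if_splits)
    have gu: "gx d (x u) = h' (x u) + \<sigma> u (z u)" by (simp add: h'_def fl_Bt[OF i(1)])
    have "\<bar>gx d c - gx d (x u)\<bar> \<le> K * \<bar>\<Delta>\<bar>"
      by (rule order_trans[OF K(2)[OF d(1) dc0 ud(3) cr xuv(1)] mult_left_mono[OF cd K(1)]])
    then have "\<bar>gx d c - \<sigma> u (z u)\<bar> \<le> K * \<bar>\<Delta>\<bar> + C5 * s" using hxu gu by linarith
    then have "\<bar>(gx d c - \<sigma> u (z u)) * \<Delta>\<bar> \<le> (K * \<bar>\<Delta>\<bar> + C5 * s) * \<bar>\<Delta>\<bar>"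
      unfolding abs_mult by (rule mult_right_mono) simp
    also have "\<dots> = K * \<Delta>\<^sup>2 + C5 * (s * \<bar>\<Delta>\<bar>)" by (simp add: algebra_simps power2_eq_square)
    \<comment> \<open>The mixed term obeys \<open>2 * s * |\<Delta>| \<le> s^2 + \<Delta>^2\<close>
      with \<open>s^2 = l\<close>; this is why a slope error of order sqrt l is good enough.\<close>
    also have "\<dots> \<le> K * \<Delta>\<^sup>2 + C5 * (l + \<Delta>\<^sup>2)"
    proof (intro add_left_mono mult_left_mono const_nonneg)
      have "2 * (s * \<bar>\<Delta>\<bar>) \<le> s\<^sup>2 + \<Delta>\<^sup>2" using sum_squares_bound[of s "\<bar>\<Delta>\<bar>"] by simp
      moreover have "0 \<le> s * \<bar>\<Delta>\<bar>" using s(1) by simp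
      moreover have "s\<^sup>2 = l" using s(2) by (simp add: power2_eq_square)
      ultimately show "s * \<bar>\<Delta>\<bar> \<le> l + \<Delta>\<^sup>2" by linarith
    qed
    finally have 1: "\<bar>(gx d c - \<sigma> u (z u)) * \<Delta>\<bar> \<le> K * \<Delta>\<^sup>2 + C5 * (l + \<Delta>\<^sup>2)" .
    have "\<bar>gg v (x v) - gg d (x v)\<bar> \<le> Cg * (m v - m d)"
      by (rule gg_time[OF dc0 d(3) uv(3) xuv(2,3)])
    also have "\<dots> \<le> Cg * (m v - m u)" using l(1) Cg by (intro mult_left_mono) (auto simp: l_def)
    finally have 2: "\<bar>gg v (x v) - gg d (x v)\<bar> \<le> Cg * (m v - m u)" .
    have "\<bar>gg d (x u) - gg u (x u)\<bar> \<le> Cg * l"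
      unfolding l_def by (rule gg_time[OF ud xuv(4,1)])
    also have "\<dots> \<le> Cg * (m v - m u)" using l(3) Cg by (rule mult_left_mono)
    finally have 3: "\<bar>gg d (x u) - gg u (x u)\<bar> \<le> Cg * (m v - m u)" .
    have 4: "C5 * (l + \<Delta>\<^sup>2) \<le> C5 * (m v - m u) + C5 * \<Delta>\<^sup>2"
      unfolding distrib_left using mult_left_mono[OF l(3) const_nonneg(4)] by simp
    have "Ff v - Ff u - \<sigma> u (z u) * \<Delta> = (gg v (x v) - gg d (x v)) + (gx d c - \<sigma> u (z u)) * \<Delta> + (gg d (x u) - gg u (x u))"
      using c(3) unfolding Ff_def \<Delta>_def[symmetric] by (simp add: left_diff_distrib)
    moreover have "(2 * Cg + C5) * (m v - m u) + (K + C5) * \<Delta>\<^sup>2 = Cg * (m v - m u) + Cg * (m v - m u) + C5 * (m v - m u) + K * \<Delta>\<^sup>2 + C5 * \<Delta>\<^sup>2"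
      by (simp add: algebra_simps)
    ultimately have "\<bar>Ff v - Ff u - \<sigma> u (z u) * \<Delta>\<bar> \<le> (2 * Cg + C5) * (m v - m u) + (K + C5) * \<Delta>\<^sup>2"
      using 1 2 3 4 by linarith
    then show ?thesis unfolding \<Delta>_def[symmetric]
      by (rule fin) (use const_nonneg(1,4,8) S(1) Cg K(1) in \<open>simp_all add: C3_def\<close>)
  qed
qed

text \<open>The squared increments of \<open>x\<close> sum to the quadratic variation, itself
  Lipschitz in the clock, so a bound by \<open>\<Delta>m + (\<Delta>x)^2\<close> becomes one by the
  clock alone. The last successor may exceed \<open>c\<close>: with \<open>c < c2\<close> it stays
  in the range of the hypothesis once the mesh is small, and at \<open>c = 1\<close> it cannot
  exceed 1.\<close>

lemma sum_bound_limit: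
  assumes H: "\<And>u v. c0 \<le> u \<Longrightarrow> u \<le> v \<Longrightarrow> v \<le> c2 \<Longrightarrow> \<bar>H u v\<bar> \<le> C * ((m v - m u) + (x v - x u)\<^sup>2)" and C: "C \<ge> 0"
    and ac: "c0 \<le> a" "a \<le> c" "c \<le> c2" "c2 \<le> c1" "c < c2 \<or> c = 1"
    and lim: "(\<lambda>n. \<Sum>s\<in>{s \<in> T n. a < s \<and> s \<le> c}. H s (succ_pt (T n) s)) \<longlonglongrightarrow> \<Lambda>"
  shows "\<bar>\<Lambda>\<bar> \<le> C * (1 + Cq) * (m c - m a)"
proof -
  have ac01: "0 \<le> a" "a \<le> 1" "0 \<le> c" "c \<le> 1" using ac c01 by auto
  have "(\<lambda>n. C * ((\<Sum>s\<in>{s \<in> T n. a < s \<and> s \<le> c}. m (succ_pt (T n) s) - m s) + (\<Sum>s\<in>{s \<in> T n. a < s \<and> s \<le> c}. (x (succ_pt (T n) s) - x s)\<^sup>2)))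
      \<longlonglongrightarrow> C * (((m c - m 0) - (m a - m 0)) + (q c - q a))"
    unfolding sum_split[OF ac01(1) ac(2), symmetric] using qv_limit ac01 unfolding qv_sum_def
    by (intro tendsto_mult_left tendsto_add tendsto_diff telescope_limit m_cont) auto
  moreover have "\<forall>\<^sub>F n in sequentially. \<bar>\<Sum>s\<in>{s \<in> T n. a < s \<and> s \<le> c}. H s (succ_pt (T n) s)\<bar> \<le>
      C * ((\<Sum>s\<in>{s \<in> T n. a < s \<and> s \<le> c}. m (succ_pt (T n) s) - m s) + (\<Sum>s\<in>{s \<in> T n. a < s \<and> s \<le> c}. (x (succ_pt (T n) s) - x s)\<^sup>2))"
  proof -
    have "\<forall>\<^sub>F n in sequentially. \<forall>s\<in>{s \<in> T n. a < s \<and> s \<le> c}. succ_pt (T n) s \<le> c2"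
    proof (cases "c = 1")
      case True
      then have "c2 = 1" using ac c01 by simp
      then show ?thesis using suc(2) by auto
    next
      case False
      then have "c2 - c > 0" using ac by auto
      from mesh_small[OF this] show ?thesis
      proof eventually_elim
        case (elim n)
        show ?case
        proof
          fix s assume "s \<in> {s \<in> T n. a < s \<and> s \<le> c}"
          then show "succ_pt (T n) s \<le> c2" using suc(3)[of s n] elim by auto
        qed
      qed
    qed
    then show ?thesis
    proof eventually_elim
      case (elim n)
      have "\<bar>\<Sum>s\<in>{s \<in> T n. a < s \<and> s \<le> c}. H s (succ_pt (T n) s)\<bar> \<le>
        (\<Sum>s\<in>{s \<in> T n. a < s \<and> s \<le> c}. C * ((m (succ_pt (T n) s) - m s) + (x (succ_pt (T n) s) - x s)\<^sup>2))"
        by (rule order_trans[OF sum_abs], rule sum_mono, rule H) (use elim suc ac in auto)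
      then show ?case by (simp only: sum.distrib flip: sum_distrib_left)
    qed
  qed
  ultimately have "\<bar>\<Lambda>\<bar> \<le> C * (((m c - m 0) - (m a - m 0)) + (q c - q a))"
    using tendsto_rabs[OF lim] by (intro tendsto_le[OF trivial_limit_sequentially])
  also have "\<dots> \<le> C * ((m c - m a) + Cq * (m c - m a))"
    using Cq(2)[OF ac01(1) ac(2) ac01(4)] C by (intro mult_left_mono) auto
  finally show ?thesis by (simp add: algebra_simps)
qed

text \<open>\<open>F_increment\<close> holds across bad points. The increments of \<open>Ff\<close>
  minus the Foellmer sums of \<open>z\<close> therefore have a limit bounded by the clock, and up to
  the integral of \<open>b\<close> this limit is the increment of \<open>Ff - z\<close>.\<close>

lemma kappa_lipschitz:
  assumes ac: "c0 \<le> a" "a \<le> c" "c \<le> c1" "c < c1 \<or> c = 1"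
  shows "\<bar>\<kappa> c - \<kappa> a\<bar> \<le> C6 * (m c - m a)"
proof -
  have ac01: "0 \<le> a" "a \<le> 1" "0 \<le> c" "c \<le> 1" using ac c01 by auto
  let ?W = "SI (\<lambda>s. b s (z s)) A"
  have "(\<lambda>n. ((\<Sum>s\<in>{s \<in> T n. s \<le> c}. Ff (succ_pt (T n) s) - Ff s) - (\<Sum>s\<in>{s \<in> T n. s \<le> a}. Ff (succ_pt (T n) s) - Ff s))
      - (foellmer_sum (T n) (\<lambda>s. \<sigma> s (z s)) x c - foellmer_sum (T n) (\<lambda>s. \<sigma> s (z s)) x a))
    \<longlonglongrightarrow> ((Ff c - Ff 0) - (Ff a - Ff 0)) - ((z c - z0 - ?W c) - (z a - z0 - ?W a))"
    using ac01 Ff_cont by (intro tendsto_diff telescope_limit sol) (auto simp: Ff_def)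
  moreover have "((\<Sum>s\<in>{s \<in> T n. s \<le> c}. Ff (succ_pt (T n) s) - Ff s) - (\<Sum>s\<in>{s \<in> T n. s \<le> a}. Ff (succ_pt (T n) s) - Ff s))
      - (foellmer_sum (T n) (\<lambda>s. \<sigma> s (z s)) x c - foellmer_sum (T n) (\<lambda>s. \<sigma> s (z s)) x a)
    = (\<Sum>s\<in>{s \<in> T n. a < s \<and> s \<le> c}. Ff (succ_pt (T n) s) - Ff s - \<sigma> s (z s) * (x (succ_pt (T n) s) - x s))" for n
    unfolding foellmer_sum_def sum_split[OF ac01(1) ac(2)] by (simp only: sum_subtractf)
  ultimately have lim: "(\<lambda>n. \<Sum>s\<in>{s \<in> T n. a < s \<and> s \<le> c}. Ff (succ_pt (T n) s) - Ff s - \<sigma> s (z s) * (x (succ_pt (T n) s) - x s))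
    \<longlonglongrightarrow> ((Ff c - Ff 0) - (Ff a - Ff 0)) - ((z c - z0 - ?W c) - (z a - z0 - ?W a))"
    by (simp only:)
  have "\<bar>((Ff c - Ff 0) - (Ff a - Ff 0)) - ((z c - z0 - ?W c) - (z a - z0 - ?W a))\<bar> \<le> C3 * (1 + Cq) * (m c - m a)"
    by (rule sum_bound_limit[where H="\<lambda>u v. Ff v - Ff u - \<sigma> u (z u) * (x v - x u)", OF F_increment const_nonneg(5) ac(1-3) order_refl ac(4) lim]) auto
  moreover have "\<bar>?W c - ?W a\<bar> \<le> Cb * (m c - m a)" by (rule Cb(2)) (use ac01 ac in auto)
  moreover have "C6 * (m c - m a) = C3 * (1 + Cq) * (m c - m a) + Cb * (m c - m a)" by (simp add: C6_def distrib_right)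
  ultimately show ?thesis unfolding \<kappa>_def by linarith
qed

text \<open>\<open>w\<close> is the state reached at level \<open>x v\<close> if \<open>Bt\<close>
  stays at \<open>Bt u\<close>; so \<open>Bt u\<close> and \<open>Bt v\<close> are pull-backs by the
  same flow time \<open>- x v\<close>, and the Lipschitz bound of the flow compares them through
  \<open>z v - w\<close>. In that difference the terms linear in \<Delta> cancel.\<close>

lemma Bt_increment:
  assumes uv: "c0 \<le> u" "u \<le> v" "v \<le> c1" "v < c1 \<or> v = 1"
  shows "\<bar>Bt v - Bt u\<bar> \<le> C7 * ((m v - m u) + (x v - x u)\<^sup>2)"
proof -
  have i: "u \<in> {0..1}" "v \<in> {0..1}" and uI: "u \<in> I" using in01[of u] in01[of v] uv I01 by auto
  define \<Delta> where "\<Delta> = x v - x u"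
  define d where "d = m v - m u"
  have d: "0 \<le> d" "v - u \<le> d" using m_inc[of u v] uv i by (auto simp: d_def)
  define w where "w = fl u (Bt u) (x v)"
  obtain c where c: "min (x u) (x v) \<le> c" "c \<le> max (x u) (x v)" and eq:
    "fl u (Bt u) (x v) - fl u (Bt u) (x u) = \<sigma> u (fl u (Bt u) (x u)) * (x v - x u) + ftt u (Bt u) c / 2 * (x v - x u)\<^sup>2"
    using fl_taylor[OF uI, of "x u" "x v" "Bt u"] by blast
  have eq': "w - z u = \<sigma> u (z u) * \<Delta> + ftt u (Bt u) c / 2 * \<Delta>\<^sup>2" using eq unfolding fl_Bt[OF i(1)] \<Delta>_def w_def .
  have "\<bar>ftt u (Bt u) c\<bar> \<le> S" by (rule S(3)) (use i R between(1)[of u v c] c uv in auto)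
  then have "\<bar>ftt u (Bt u) c / 2 * \<Delta>\<^sup>2\<bar> \<le> S * \<Delta>\<^sup>2" unfolding abs_mult by (intro mult_mono) auto
  then have 1: "\<bar>ftt u (Bt u) c / 2 * \<Delta>\<^sup>2\<bar> \<le> S * (d + \<Delta>\<^sup>2)" using mult_left_mono[of "\<Delta>\<^sup>2" "d + \<Delta>\<^sup>2" S] d S(1) by linarith
  have 2: "\<bar>Ff v - Ff u - \<sigma> u (z u) * \<Delta>\<bar> \<le> C3 * (d + \<Delta>\<^sup>2)" unfolding \<Delta>_def d_def by (rule F_increment[OF uv(1-3)])
  have "\<bar>\<kappa> v - \<kappa> u\<bar> \<le> C6 * d" unfolding d_def by (rule kappa_lipschitz[OF uv])
  also have "\<dots> \<le> C6 * (d + \<Delta>\<^sup>2)" using const_nonneg(6) by (intro mult_left_mono) auto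
  finally have 3: "\<bar>\<kappa> v - \<kappa> u\<bar> \<le> C6 * (d + \<Delta>\<^sup>2)" .
  have "z v - w = (Ff v - Ff u - \<sigma> u (z u) * \<Delta>) - (\<kappa> v - \<kappa> u) - ftt u (Bt u) c / 2 * \<Delta>\<^sup>2"
    using eq' unfolding \<kappa>_def by linarith
  then have zw: "\<bar>z v - w\<bar> \<le> C3 * (d + \<Delta>\<^sup>2) + C6 * (d + \<Delta>\<^sup>2) + S * (d + \<Delta>\<^sup>2)" using 1 2 3 by linarith
  have bu: "Bt u = fl u w (- x v)" unfolding w_def using fl_inverse(1)[OF uI] by simp
  have "\<bar>Bt v - Bt u\<bar> \<le> L * (\<bar>v - u\<bar> + \<bar>z v - w\<bar>)"
    unfolding bu unfolding Bt_def by (rule L(2)) (use i R in auto)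
  also have "\<dots> \<le> L * ((d + \<Delta>\<^sup>2) + (C3 * (d + \<Delta>\<^sup>2) + C6 * (d + \<Delta>\<^sup>2) + S * (d + \<Delta>\<^sup>2)))"
    using zw d uv(2) zero_le_power2[of \<Delta>] L(1) by (intro mult_left_mono add_mono) linarith+
  also have "\<dots> = C7 * (d + \<Delta>\<^sup>2)" by (simp add: C7_def algebra_simps)
  finally show ?thesis unfolding d_def \<Delta>_def .
qed

text \<open>Summed along the partitions, the increments make \<open>Bt\<close> Lipschitz. Each of
  the two summations loses a margin at the right end, unless the end is 1: from \<open>c1\<close> to
  \<open>c2\<close> for \<kappa> and from \<open>c2\<close> to \<open>c\<close> for
  \<open>Bt\<close>.\<close>

lemma D_constant_region:
  assumes c2: "c2 < c1 \<or> c2 = 1" "c2 \<le> c1" and ac: "c0 \<le> a" "a \<le> c" "c < c2 \<or> c = 1" "c \<le> c2"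
  shows "D c = D a"
proof (rule D_constant_if_lipschitz)
  show "0 \<le> a" "a \<le> c" "c \<le> 1" "0 \<le> C7 * (1 + Cq)" using ac c01 c2 const_nonneg(7) Cq(1) by auto
  fix a' c' assume a': "a \<le> a'" "a' \<le> c'" "c' \<le> c"
  have ac01: "0 \<le> a'" "a' \<le> 1" "0 \<le> c'" "c' \<le> 1" using ac a' c01 c2 by auto
  have lim: "(\<lambda>n. \<Sum>s\<in>{s \<in> T n. a' < s \<and> s \<le> c'}. Bt (succ_pt (T n) s) - Bt s) \<longlonglongrightarrow> (Bt c' - Bt 0) - (Bt a' - Bt 0)"
    unfolding sum_split[OF ac01(1) a'(2), symmetric] by (intro tendsto_diff telescope_limit Bt_cont ac01)
  have "\<bar>(Bt c' - Bt 0) - (Bt a' - Bt 0)\<bar> \<le> C7 * (1 + Cq) * (m c' - m a')"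
  proof (rule sum_bound_limit[where H="\<lambda>u v. Bt v - Bt u" and ?c2.0=c2, OF _ const_nonneg(7) _ a'(2) _ c2(2) _ lim])
    show "\<bar>Bt v - Bt u\<bar> \<le> C7 * ((m v - m u) + (x v - x u)\<^sup>2)" if "c0 \<le> u" "u \<le> v" "v \<le> c2" for u v
      by (rule Bt_increment) (use that c2 c01 in auto)
  qed (use a' ac c2 c01 in auto)
  then show "\<bar>Bt c' - Bt a'\<bar> \<le> C7 * (1 + Cq) * (m c' - m a')" by simp
qed

end

lemma (in flow_field) fl_lipschitz_parameters:
  assumes "\<tau> \<in> I" "\<tau>' \<in> I"
  shows "\<bar>fl \<tau> \<xi> t - fl \<tau>' \<xi>' t\<bar> \<le> exp (2 * M * \<bar>t\<bar>) * (\<bar>\<tau> - \<tau>'\<bar> + \<bar>\<xi> - \<xi>'\<bar>)"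
proof (rule power2_le_imp_le)
  let ?a = "\<bar>\<tau> - \<tau>'\<bar> + \<bar>\<xi> - \<xi>'\<bar>"
  have "3 * M * \<bar>t\<bar> \<le> 2 * M * \<bar>t\<bar> + 2 * M * \<bar>t\<bar>" using M(1) by (simp flip: distrib_right)
  then have e: "exp (3 * M * \<bar>t\<bar>) \<le> (exp (2 * M * \<bar>t\<bar>))\<^sup>2" by (simp add: power2_eq_square flip: exp_add)
  have "(\<xi> - \<xi>')\<^sup>2 + (\<tau> - \<tau>')\<^sup>2 \<le> ?a\<^sup>2"
    by (simp add: power2_sum)
  then have "((\<xi> - \<xi>')\<^sup>2 + (\<tau> - \<tau>')\<^sup>2) * exp (3 * M * \<bar>t\<bar>) \<le> ?a\<^sup>2 * (exp (2 * M * \<bar>t\<bar>))\<^sup>2"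
    using e by (intro mult_mono) auto
  then show "\<bar>fl \<tau> \<xi> t - fl \<tau>' \<xi>' t\<bar>\<^sup>2 \<le> (exp (2 * M * \<bar>t\<bar>) * ?a)\<^sup>2"
    using fl_gronwall[OF assms, of \<xi> t \<xi>'] by (simp add: power_mult_distrib mult.commute)
qed simp

section \<open>Baire's theorem on the bad set\<close>

context second_solution
begin

definition "lip_bad k = {t \<in> bad. \<forall>\<xi> \<xi>'. \<bar>\<xi> - x t\<bar> < r \<longrightarrow> \<bar>\<xi>' - x t\<bar> < r \<longrightarrow> \<bar>gx t \<xi> - gx t \<xi>'\<bar> \<le> real k * \<bar>\<xi> - \<xi>'\<bar>}"

lemma bad_01: "bad \<subseteq> {0..1}" by (auto simp: bad_def)

lemma bad_cover: "t \<in> bad \<Longrightarrow> \<exists>k. t \<in> lip_bad k"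
proof -
  assume t: "t \<in> bad"
  then have "t \<in> {0..1}" using bad_01 by auto
  from gx_lip[OF this] obtain K where K: "\<forall>\<xi> \<xi>'. \<bar>\<xi> - x t\<bar> < r \<longrightarrow> \<bar>\<xi>' - x t\<bar> < r \<longrightarrow> \<bar>gx t \<xi> - gx t \<xi>'\<bar> \<le> K * \<bar>\<xi> - \<xi>'\<bar>" by blast
  obtain k :: nat where k: "K \<le> real k" using real_arch_simple by blast
  have "t \<in> lip_bad k"
    unfolding lip_bad_def
  proof (intro CollectI conjI t allI impI)
    fix \<xi> \<xi>' assume "\<bar>\<xi> - x t\<bar> < r" "\<bar>\<xi>' - x t\<bar> < r"
    then have "\<bar>gx t \<xi> - gx t \<xi>'\<bar> \<le> K * \<bar>\<xi> - \<xi>'\<bar>" by (rule K[rule_format])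
    also have "\<dots> \<le> real k * \<bar>\<xi> - \<xi>'\<bar>" using k by (rule mult_right_mono) simp
    finally show "\<bar>gx t \<xi> - gx t \<xi>'\<bar> \<le> real k * \<bar>\<xi> - \<xi>'\<bar>" .
  qed
  then show ?thesis ..
qed

text \<open>For a fixed level \<xi> the condition \<open>|\<xi> - x t| < r\<close> is open in
  \<open>t\<close>, so it holds eventually along the sequence, and the joint continuity of
  \<open>gx\<close> carries the Lipschitz inequality to the limit.\<close>

lemma closed_lip_bad: "closed (lip_bad k)"
  unfolding closed_sequential_limits
proof (intro allI impI, elim conjE)
  fix s l assume s: "\<forall>n. s n \<in> lip_bad k" and lim: "s \<longlonglongrightarrow> l"
  have lb: "l \<in> bad" using closed_bad s lim unfolding closed_sequential_limits lip_bad_def by blast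
  have l01: "l \<in> {0..1}" and s01: "s n \<in> {0..1}" for n using bad_01 lb s by (auto simp: lip_bad_def)
  have xs: "(\<lambda>n. x (s n)) \<longlonglongrightarrow> x l"
    using x_cont l01 s01 lim unfolding continuous_on_sequentially comp_def by blast
  have gl: "\<forall>\<^sub>F n in sequentially. \<bar>\<xi> - x (s n)\<bar> < r" if "\<bar>\<xi> - x l\<bar> < r" for \<xi>
  proof -
    have "(\<lambda>n. \<bar>\<xi> - x (s n)\<bar>) \<longlonglongrightarrow> \<bar>\<xi> - x l\<bar>" by (intro tendsto_intros xs)
    from order_tendstoD(2)[OF this that] show ?thesis .
  qed
  have gt: "(\<lambda>n. gx (s n) \<xi>) \<longlonglongrightarrow> gx l \<xi>" if \<xi>: "\<bar>\<xi> - x l\<bar> < r" for \<xi>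
  proof (rule tendstoI)
    fix e :: real assume "e > 0"
    from gx_cont[OF this] obtain \<delta> where \<delta>: "\<delta> > 0" "\<And>u v \<xi> \<xi>'. u \<in> {0..1} \<Longrightarrow> v \<in> {0..1} \<Longrightarrow> \<bar>\<xi> - x u\<bar> < r \<Longrightarrow> \<bar>\<xi>' - x v\<bar> < r \<Longrightarrow>
        \<bar>u - v\<bar> < \<delta> \<Longrightarrow> \<bar>\<xi> - \<xi>'\<bar> < \<delta> \<Longrightarrow> \<bar>gx u \<xi> - gx v \<xi>'\<bar> < e" by blast
    from tendstoD[OF lim \<delta>(1)] gl[OF \<xi>] show "\<forall>\<^sub>F n in sequentially. dist (gx (s n) \<xi>) (gx l \<xi>) < e"
    proof eventually_elim
      case (elim n)
      then show ?case using \<delta>(2)[OF s01 l01 _ \<xi>, of \<xi> n] \<delta>(1) by (simp add: dist_real_def)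
    qed
  qed
  show "l \<in> lip_bad k"
    unfolding lip_bad_def
  proof (intro CollectI conjI lb allI impI)
    fix \<xi> \<xi>' assume r: "\<bar>\<xi> - x l\<bar> < r" "\<bar>\<xi>' - x l\<bar> < r"
    have lm: "(\<lambda>n. \<bar>gx (s n) \<xi> - gx (s n) \<xi>'\<bar>) \<longlonglongrightarrow> \<bar>gx l \<xi> - gx l \<xi>'\<bar>" by (intro tendsto_intros gt r)
    have ev: "\<forall>\<^sub>F n in sequentially. \<bar>gx (s n) \<xi> - gx (s n) \<xi>'\<bar> \<le> real k * \<bar>\<xi> - \<xi>'\<bar>"
      using gl[OF r(1)] gl[OF r(2)]
    proof eventually_elim
      case (elim n)
      then show ?case using s unfolding lip_bad_def by blast
    qed
    show "\<bar>gx l \<xi> - gx l \<xi>'\<bar> \<le> real k * \<bar>\<xi> - \<xi>'\<bar>"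
      by (rule tendsto_upperbound[OF lm ev]) simp
  qed
qed

text \<open>Without such a portion every \<open>bad - lip_bad k\<close> would be relatively open and
  dense in the closed set \<open>bad\<close>. By Baire's theorem their intersection would be dense
  too, yet it is empty because the sets \<open>lip_bad k\<close> cover \<open>bad\<close>.\<close>

lemma bad_portion:
  assumes "bad \<noteq> {}"
  shows "\<exists>k t \<epsilon>. t \<in> bad \<and> \<epsilon> > 0 \<and> (\<forall>s\<in>bad. \<bar>s - t\<bar> < \<epsilon> \<longrightarrow> s \<in> lip_bad k)"
proof (rule ccontr)
  assume a: "\<nexists>k t \<epsilon>. t \<in> bad \<and> \<epsilon> > 0 \<and> (\<forall>s\<in>bad. \<bar>s - t\<bar> < \<epsilon> \<longrightarrow> s \<in> lip_bad k)"
  let ?G = "range (\<lambda>k. bad - lip_bad k)"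
  have cl: "bad \<subseteq> closure (\<Inter>?G)"
  proof (rule Baire[OF closed_bad])
    fix U assume "U \<in> ?G"
    then obtain k where k: "U = bad - lip_bad k" by blast
    have "openin (top_of_set bad) U"
      unfolding k openin_open using closed_lip_bad by (intro exI[of _ "- lip_bad k"]) auto
    moreover have "bad \<subseteq> closure U"
    proof
      fix t assume t: "t \<in> bad"
      show "t \<in> closure U"
        unfolding closure_approachable
      proof (intro allI impI)
        fix e :: real assume "e > 0"
        with a t obtain s where "s \<in> bad" "\<bar>s - t\<bar> < e" "s \<notin> lip_bad k" by blast
        then show "\<exists>y\<in>U. dist y t < e" unfolding k by (auto simp: dist_real_def)
      qed
    qed
    ultimately show "openin (top_of_set bad) U \<and> bad \<subseteq> closure U" by blast
  qed simp
  have "\<Inter>?G = {}" using bad_cover by blast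
  from cl[unfolded this closure_empty] show False using assms by blast
qed

lemma bad_empty: "bad = {}"
proof (rule ccontr)
  assume "bad \<noteq> {}"
  from bad_portion[OF this] obtain k t \<epsilon> where t: "t \<in> bad" and \<epsilon>: "\<epsilon> > 0"
    and pb: "\<And>s. s \<in> bad \<Longrightarrow> \<bar>s - t\<bar> < \<epsilon> \<Longrightarrow> s \<in> lip_bad k" by blast
  have t01: "0 \<le> t" "t \<le> 1" using t bad_01 by auto
  obtain X where X: "X \<ge> 0" "\<And>t. 0 \<le> t \<Longrightarrow> t \<le> 1 \<Longrightarrow> \<bar>x t\<bar> \<le> X" by (rule bounded_on_01[OF x_cont], rule that)
  obtain N where N: "N \<ge> 0" "\<And>t. 0 \<le> t \<Longrightarrow> t \<le> 1 \<Longrightarrow> \<bar>Bt t\<bar> \<le> N" by (rule bounded_on_01[OF Bt_cont], rule that)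
  define R where "R = max X N"
  define L where "L = exp (2 * M * R)"
  obtain S1 where S1: "S1 \<ge> 0" "\<And>s y t. s \<in> {0..1} \<Longrightarrow> \<bar>y\<bar> \<le> R \<Longrightarrow> \<bar>t\<bar> \<le> R \<Longrightarrow> \<bar>\<sigma> s (fl s y t)\<bar> \<le> S1"
    using C1_local_lipschitz(2)[OF coefficients_C1(2) I01, of R] by blast
  obtain S2 where S2: "S2 \<ge> 0" "\<And>s y t. s \<in> {0..1} \<Longrightarrow> \<bar>y\<bar> \<le> R \<Longrightarrow> \<bar>t\<bar> \<le> R \<Longrightarrow> \<bar>ftt s y t\<bar> \<le> S2"
    using C1_local_lipschitz(2)[OF coefficients_C1(3) I01, of R] by blast
  define S where "S = max S1 S2"
  obtain Cq where Cq: "Cq \<ge> 0" "\<And>u v. 0 \<le> u \<Longrightarrow> u \<le> v \<Longrightarrow> v \<le> 1 \<Longrightarrow> \<bar>q v - q u\<bar> \<le> Cq * (m v - m u)" by (rule lipmE[OF qv_lipm], rule that)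
  obtain CY where CY: "CY \<ge> 0" "\<And>u v. 0 \<le> u \<Longrightarrow> u \<le> v \<Longrightarrow> v \<le> 1 \<Longrightarrow> \<bar>Y v - Y u\<bar> \<le> CY * (m v - m u)" by (rule lipmE[OF Y_lipm], rule that)
  obtain Cb where Cb: "Cb \<ge> 0" "\<And>u v. 0 \<le> u \<Longrightarrow> u \<le> v \<Longrightarrow> v \<le> 1 \<Longrightarrow> \<bar>SI (\<lambda>s. b s (z s)) A v - SI (\<lambda>s. b s (z s)) A u\<bar> \<le> Cb * (m v - m u)"
    by (rule lipmE[OF stdiff_lipm[OF stdiff_SI[OF bz_cont A_lipm] bz_cont A_lipm]], rule that)
  obtain \<delta> where \<delta>: "\<delta> > 0" "\<And>u v. 0 \<le> u \<Longrightarrow> u \<le> v \<Longrightarrow> v \<le> 1 \<Longrightarrow> v - u < \<delta> \<Longrightarrow> \<bar>x v - x u\<bar> < r"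
    by (rule uniformly_continuous_01[OF x_cont r], rule that)
  \<comment> \<open>Three demands on the interval of radius \<open>e\<close>: it stays in the
    portion (\<open>e < \<epsilon>\<close>), \<open>x\<close> oscillates on it by less than
    \<open>r\<close> (\<open>2 * e < \<delta>\<close>), and its length is below
    \<open>r\<close>.\<close>
  define e where "e = min \<epsilon> (min \<delta> r) / 4"
  have e: "e > 0" "e < \<epsilon>" "2 * e < \<delta>" "2 * e < r" using \<epsilon> \<delta>(1) r by (auto simp: e_def min_def)
  define c0 where "c0 = max 0 (t - e)"
  define c1 where "c1 = min 1 (t + e)"
  define c2 where "c2 = min 1 (t + e / 2)"
  interpret rg: region \<sigma> I M m T x A b cb z gg gx r Cg z0 c0 c1 "real k" R L S Cq CY Cb
  proof
    show "0 \<le> c0" "c1 \<le> 1" "c1 - c0 < r" using e by (auto simp: c0_def c1_def)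
    show "\<bar>x u - x v\<bar> < r" if "c0 \<le> u" "u \<le> c1" "c0 \<le> v" "v \<le> c1" for u v
    proof -
      have uv: "0 \<le> u" "u \<le> 1" "0 \<le> v" "v \<le> 1" "u - v < \<delta>" "v - u < \<delta>" using that e by (auto simp: c0_def c1_def)
      show ?thesis using \<delta>(2)[of u v] \<delta>(2)[of v u] uv by (cases "u \<le> v") (auto simp: abs_minus_commute)
    qed
    show "\<bar>gx s \<xi> - gx s \<xi>'\<bar> \<le> real k * \<bar>\<xi> - \<xi>'\<bar>" if "s \<in> bad" "c0 \<le> s" "s \<le> c1" "\<bar>\<xi> - x s\<bar> < r" "\<bar>\<xi>' - x s\<bar> < r" for s \<xi> \<xi>'
    proof -
      have "s \<in> lip_bad k" by (rule pb) (use that e in \<open>auto simp: c0_def c1_def\<close>)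
      then show ?thesis using that unfolding lip_bad_def by blast
    qed
    show "\<bar>x s\<bar> \<le> R" "\<bar>Bt s\<bar> \<le> R" if "s \<in> {0..1}" for s using X(2)[of s] N(2)[of s] that by (auto simp: R_def)
    show "\<bar>fl \<tau> \<xi> s - fl \<tau>' \<xi>' s\<bar> \<le> L * (\<bar>\<tau> - \<tau>'\<bar> + \<bar>\<xi> - \<xi>'\<bar>)" if "\<tau> \<in> {0..1}" "\<tau>' \<in> {0..1}" "\<bar>s\<bar> \<le> R" for \<tau> \<tau>' \<xi> \<xi>' s
    proof -
      have "exp (2 * M * \<bar>s\<bar>) \<le> L" using mult_left_mono[OF that(3) M(1)] by (simp add: L_def)
      moreover have "\<tau> \<in> I" "\<tau>' \<in> I" using that I01 by auto
      ultimately show ?thesis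
        using order_trans[OF fl_lipschitz_parameters mult_right_mono[of "exp (2 * M * \<bar>s\<bar>)" L]] by simp
    qed
    show "\<bar>\<sigma> s (fl s y u)\<bar> \<le> S" "\<bar>ftt s y u\<bar> \<le> S" if "s \<in> {0..1}" "\<bar>y\<bar> \<le> R" "\<bar>u\<bar> \<le> R" for s y u
      using S1(2)[OF that] S2(2)[OF that] by (auto simp: S_def)
    show "0 \<le> S" using S1 by (simp add: S_def)
    show "0 \<le> L" by (simp add: L_def)
  qed (use Cq CY Cb in simp_all)
  have "t \<in> good"
    unfolding good_def
  proof (intro CollectI exI[of _ "e / 4"] conjI allI impI)
    fix a c assume ac: "0 \<le> a" "a \<le> c" "c \<le> 1" "t - e / 4 < a" "c < t + e / 4"
    show "D c = D a"
      by (rule rg.D_constant_region[of c2]) (use ac e t01 in \<open>auto simp: c0_def c1_def c2_def min_def max_def\<close>)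
  qed (use e in auto)
  then show False using t by (simp add: bad_def)
qed

theorem Bt_solves: "B_equation T x A b fl z0 Bt"
  unfolding B_equation_iff
proof (intro conjI Bt_cont ballI)
  fix t :: real assume t: "t \<in> {0..1}"
  have "D t = D 0"
    by (rule D_constant_good) (use t bad_empty in \<open>auto simp: bad_def\<close>)
  then show "vo.volt z0 Bt t = Bt t" unfolding D_0 by (simp add: D_def Y_def)
qed

theorem solution_unique:
  assumes "B_equation T x A b fl z0 B" "t \<in> {0..1}"
  shows "z t = fl t (B t) (x t)"
  using B_equation_exists_unique(2)[OF assms(1) Bt_solves assms(2)] fl_Bt[OF assms(2)] by simp

end

section \<open>Regularity of the flow and the choice of the clock\<close>

context flow_field
begin

lemma C1_on_reassoc:
  assumes "C1_on ((I \<times> UNIV) \<times> UNIV) (\<lambda>q. h (fst (fst q)) (snd (fst q)) (snd q :: real))"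
  shows "C1_on (I \<times> UNIV \<times> UNIV) (\<lambda>p. h (fst p) (fst (snd p) :: real) (snd (snd p)))"
proof -
  have "C1_on (I \<times> UNIV \<times> UNIV) (\<lambda>p. (\<lambda>q. h (fst (fst q)) (snd (fst q)) (snd q)) ((fst p, fst (snd p)), snd (snd p)))"
  proof (rule C1_on_compose[OF assms])
    show "((\<lambda>p :: real \<times> real \<times> real. ((fst p, fst (snd p)), snd (snd p))) has_derivative (\<lambda>v. ((fst v, fst (snd v)), snd (snd v)))) (at p)" for p
      by (intro bounded_linear_imp_has_derivative bounded_linear_Pair bounded_linear_fst bounded_linear_snd
          bounded_linear_fst_comp bounded_linear_snd_comp)
  qed auto
  then show ?thesis by simp
qed

lemma fl_has_derivative_triple:
  assumes "p \<in> I \<times> UNIV \<times> UNIV"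
  shows "((\<lambda>p. fl (fst p) (fst (snd p)) (snd (snd p))) has_derivative
    (\<lambda>v. flt (fst p) (fst (snd p)) (snd (snd p)) * fst v + la (fst p) (fst (snd p)) (snd (snd p)) * fst (snd v)
       + \<sigma> (fst p) (fl (fst p) (fst (snd p)) (snd (snd p))) * snd (snd v))) (at p)"
proof -
  let ?h = "\<lambda>p :: real \<times> real \<times> real. ((fst p, fst (snd p)), snd (snd p))"
  have "(?h has_derivative ?h) (at p)"
    by (intro bounded_linear_imp_has_derivative bounded_linear_Pair bounded_linear_fst bounded_linear_snd
          bounded_linear_fst_comp bounded_linear_snd_comp)
  from has_derivative_compose[OF this fl_has_derivative] assms show ?thesis by (auto simp: flt_def)
qed

lemma sigma_fl_has_derivative_triple:
  assumes "p \<in> I \<times> UNIV \<times> UNIV"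
  shows "((\<lambda>p. \<sigma> (fst p) (fl (fst p) (fst (snd p)) (snd (snd p)))) has_derivative
    (\<lambda>v. s1 (fst p) (fl (fst p) (fst (snd p)) (snd (snd p))) * fst v
       + s2 (fst p) (fl (fst p) (fst (snd p)) (snd (snd p))) *
         (flt (fst p) (fst (snd p)) (snd (snd p)) * fst v + la (fst p) (fst (snd p)) (snd (snd p)) * fst (snd v)
           + \<sigma> (fst p) (fl (fst p) (fst (snd p)) (snd (snd p))) * snd (snd v)))) (at p)"
proof -
  let ?y = "fl (fst p) (fst (snd p)) (snd (snd p))"
  have h: "((\<lambda>p. (fst p, fl (fst p) (fst (snd p)) (snd (snd p)))) has_derivative
    (\<lambda>v. (fst v, flt (fst p) (fst (snd p)) (snd (snd p)) * fst v + la (fst p) (fst (snd p)) (snd (snd p)) * fst (snd v)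
       + \<sigma> (fst p) ?y * snd (snd v)))) (at p)"
    by (intro has_derivative_Pair has_derivative_fst has_derivative_ident fl_has_derivative_triple assms)
  have "(fst p, ?y) \<in> I \<times> UNIV" using assms by auto
  from has_derivative_compose[OF h sigma_derivative(1)[OF this]] show ?thesis by simp
qed

text \<open>The first derivatives \<open>flt\<close>, \<open>la\<close> and \<sigma> along the flow
  are C1. For \<open>\<phi>\<^sub>t\<close>, which is \<sigma> along the flow, the chain rule brings
  in \<open>s1\<close> and \<open>s2\<close> along the flow, again C1 because \<sigma> is C2; the
  identity holds on the open set, so derivatives carry over to the version written with
  \<open>deriv\<close>.\<close>

theorem fl_C2: "C2_on (I \<times> UNIV \<times> UNIV) (\<lambda>(\<tau>, \<xi>, t). fl \<tau> \<xi> t)"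
  and deriv_fl_C2: "C2_on (I \<times> UNIV \<times> UNIV) (\<lambda>(\<tau>, \<xi>, t). deriv (fl \<tau> \<xi>) t)"
proof -
  let ?S = "I \<times> (UNIV :: real set) \<times> (UNIV :: real set)"
  have S: "open ?S" using I by (intro open_Times) auto
  have "C1_on ((I \<times> UNIV) \<times> UNIV) (\<lambda>q. flt (fst (fst q)) (snd (fst q)) (snd q))"
    unfolding flt_def by (intro C1_on_mult la_C1 qa_C1)
  note c = C1_on_reassoc[OF fl_C1] C1_on_reassoc[OF la_C1] C1_on_reassoc[OF this]
    C1_on_reassoc[OF coefficients_C1(2)]
  have f: "C1_on ?S (\<lambda>p. fst p)" by (intro C1_on_bounded_linear bounded_linear_fst)
  have s: "C1_on ?S (\<lambda>p. s1 (fst p) (fl (fst p) (fst (snd p)) (snd (snd p))))"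
    "C1_on ?S (\<lambda>p. s2 (fst p) (fl (fst p) (fst (snd p)) (snd (snd p))))"
    using C1_on_compose_pair[OF sigma_derivative(2) _ f c(1)] C1_on_compose_pair[OF sigma_derivative(3) _ f c(1)] by auto
  show "C2_on ?S (\<lambda>(\<tau>, \<xi>, t). fl \<tau> \<xi> t)"
    unfolding case_prod_beta
    by (rule C2_onI[OF fl_has_derivative_triple]) (assumption, intro C1_on_add C1_on_mult C1_on_const c)
  have "C2_on ?S (\<lambda>p. \<sigma> (fst p) (fl (fst p) (fst (snd p)) (snd (snd p))))"
    by (rule C2_onI[OF sigma_fl_has_derivative_triple])
      (assumption, rule C1_on_add[OF C1_on_mult[OF s(1) C1_on_const] C1_on_mult[OF s(2) C1_on_add[OF C1_on_add[OF
        C1_on_mult[OF c(3) C1_on_const] C1_on_mult[OF c(2) C1_on_const]] C1_on_mult[OF c(4) C1_on_const]]]])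
  then obtain D E where D: "\<forall>p\<in>?S. ((\<lambda>p. \<sigma> (fst p) (fl (fst p) (fst (snd p)) (snd (snd p)))) has_derivative blinfun_apply (D p)) (at p) \<and>
      (D has_derivative blinfun_apply (E p)) (at p)" "continuous_on ?S E"
    unfolding C2_on_def by (elim exE conjE) (rule that)
  have "((\<lambda>(\<tau>, \<xi>, t). deriv (fl \<tau> \<xi>) t) has_derivative blinfun_apply (D p)) (at p)" if "p \<in> ?S" for p
    by (rule has_derivative_transform_within_open[OF conjunct1[OF bspec[OF D(1) that]] S that]) (auto simp: fl_partial_derivs(3))
  then show "C2_on ?S (\<lambda>(\<tau>, \<xi>, t). deriv (fl \<tau> \<xi>) t)"
    unfolding C2_on_def by (intro exI[of _ D] exI[of _ E] conjI ballI D(2) conjunct2[OF bspec[OF D(1)]])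
qed

end

lemma quadvar_mono:
  assumes T: "refining_sequence T" and x: "has_cont_quadvar T x" and uv: "0 \<le> u" "u \<le> v" "v \<le> 1"
  shows "quadvar T x u \<le> quadvar T x v"
proof (rule LIMSEQ_le)
  have "finite (T n)" for n using T by (simp add: refining_sequence_def is_partition01_def)
  then show "\<exists>N. \<forall>n\<ge>N. qv_sum (T n) x u \<le> qv_sum (T n) x v"
    using uv unfolding qv_sum_def by (intro exI[of _ 0] allI impI sum_mono2) auto
qed (use x uv in \<open>auto simp: has_cont_quadvar_def quadvar_def convergent_LIMSEQ_iff\<close>)

text \<open>The clock adds time, the quadratic variation and monotone functions dominating
  \<open>A\<close> and the components of \<open>A'\<close>. All summands are nondecreasing, so each
  is dominated by the sum; the l1 norm bounds the Euclidean norm of the increments of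
  \<open>A'\<close>.\<close>

lemma clock_exists:
  fixes A' :: "real \<Rightarrow> real^'n::finite"
  assumes T: "refining_sequence T" and x: "has_cont_quadvar T x" and A: "CBV01 A" and A': "\<And>i. CBV01 (\<lambda>t. A' t $ i)"
  obtains m where "clock m" "clock.lipm m A" "clock.lipm m (quadvar T x)"
    "\<And>u v. 0 \<le> u \<Longrightarrow> u \<le> v \<Longrightarrow> v \<le> 1 \<Longrightarrow> norm (A' v - A' u) \<le> m v - m u"
proof -
  obtain V where V: "continuous_on {0..1} V" "\<And>u v. 0 \<le> u \<Longrightarrow> u \<le> v \<Longrightarrow> v \<le> 1 \<Longrightarrow> \<bar>A v - A u\<bar> \<le> V v - V u"
    using CBV01_dominated[OF A] by blast
  obtain W where W: "\<And>i. continuous_on {0..1} (W i)"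
    "\<And>i u v. 0 \<le> u \<Longrightarrow> u \<le> v \<Longrightarrow> v \<le> 1 \<Longrightarrow> \<bar>A' v $ i - A' u $ i\<bar> \<le> W i v - W i u"
    using CBV01_dominated[OF A'] by metis
  define m where "m t = t + V t + quadvar T x t + (\<Sum>i\<in>UNIV. W i t)" for t
  have inc: "v - u \<le> m v - m u" "\<bar>A v - A u\<bar> \<le> m v - m u" "\<bar>quadvar T x v - quadvar T x u\<bar> \<le> m v - m u"
    "norm (A' v - A' u) \<le> m v - m u" if uv: "0 \<le> u" "u \<le> v" "v \<le> 1" for u v
  proof -
    have "norm (A' v - A' u) \<le> (\<Sum>i\<in>UNIV. \<bar>(A' v - A' u) $ i\<bar>)" by (rule norm_le_l1_cart)
    also have "\<dots> \<le> (\<Sum>i\<in>UNIV. W i v - W i u)" using W(2)[OF uv] by (intro sum_mono) simp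
    finally have n: "norm (A' v - A' u) \<le> (\<Sum>i\<in>UNIV. W i v) - (\<Sum>i\<in>UNIV. W i u)" by (simp add: sum_subtractf)
    have "0 \<le> norm (A' v - A' u)" by simp
    with n V(2)[OF uv] quadvar_mono[OF T x uv] uv
    show "v - u \<le> m v - m u" "\<bar>A v - A u\<bar> \<le> m v - m u" "\<bar>quadvar T x v - quadvar T x u\<bar> \<le> m v - m u"
      "norm (A' v - A' u) \<le> m v - m u"
      unfolding m_def by linarith+
  qed
  have "clock m"
  proof
    show "continuous_on {0..1} m"
      unfolding m_def using V(1) W(1) x by (intro continuous_intros) (auto simp: has_cont_quadvar_def)
  qed (rule inc)
  then show thesis
    by (rule that) (use inc in \<open>auto intro!: clock.lipmI[OF \<open>clock m\<close>, of 1]\<close>)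
qed

context ito_equation
begin

text \<open>The curve \<open>(A' t, x t)\<close> is compact in the open set \<open>U\<close>, so a
  closed tube \<open>N\<close> around it lies in \<open>U\<close>; there \<open>Df\<close> is
  bounded and uniformly continuous, which gives \<open>Cg\<close> and the joint continuity of
  \<open>gx\<close>. Second derivatives in \<xi> exist only for each frozen \<open>A' t\<close>,
  whence a Lipschitz constant that depends on \<open>t\<close>.\<close>

lemma second_solution_exists:
  fixes A' :: "real \<Rightarrow> 'v::euclidean_space" and f :: "'v \<times> real \<Rightarrow> real"
  assumes x0: "x 0 = 0" and z: "continuous_on {0..1} z"
    and A'_cont: "continuous_on {0..1} A'"
    and A': "\<And>u v. 0 \<le> u \<Longrightarrow> u \<le> v \<Longrightarrow> v \<le> 1 \<Longrightarrow> norm (A' v - A' u) \<le> m v - m u"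
    and U: "open U" "\<And>t. t \<in> {0..1} \<Longrightarrow> (A' t, x t) \<in> U"
    and f: "C1_on U f" "\<And>a. a \<in> fst ` U \<Longrightarrow> C2_on {\<xi>. (a, \<xi>) \<in> U} (\<lambda>\<xi>. f (a, \<xi>))"
    and eta: "\<And>t. t \<in> {0..1} \<Longrightarrow> \<sigma> t (z t) = deriv (\<lambda>\<xi>. f (A' t, \<xi>)) (x t)"
    and sol: "\<And>t. t \<in> {0..1} \<Longrightarrow> (\<lambda>n. foellmer_sum (T n) (\<lambda>s. \<sigma> s (z s)) x t) \<longlonglongrightarrow> z t - z0 - SI (\<lambda>s. b s (z s)) A t"
  shows "\<exists>gg gx r Cg. second_solution \<sigma> I M m T x A b cb z gg gx r Cg z0"
proof -
  obtain Df where Df: "\<And>p. p \<in> U \<Longrightarrow> (f has_derivative blinfun_apply (Df p)) (at p)" "continuous_on U Df"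
    using C1_onE[OF f(1)] by metis
  define c where "c t = (A' t, x t)" for t
  have c: "continuous_on {0..1} c" unfolding c_def using A'_cont x_cont by (intro continuous_intros)
  have K: "compact (c ` {0..1})" by (intro compact_continuous_image c compact_Icc)
  have cU: "c ` {0..1} \<subseteq> U" using U(2) by (auto simp: c_def)
  obtain e where e: "e > 0" "(\<Union>p\<in>c ` {0..1}. cball p e) \<subseteq> U"
    by (rule compact_subset_open_imp_cball_epsilon_subset[OF K U(1) cU])
  define N where "N = (\<Union>p\<in>c ` {0..1}. cball p e)"
  have N: "compact N" "N \<subseteq> U" unfolding N_def using e compact_minkowski_sum_cball[OF K] by auto
  have DfN: "continuous_on N Df" by (rule continuous_on_subset[OF Df(2) N(2)])
  obtain Cg where Cg: "Cg > 0" "\<And>p. p \<in> N \<Longrightarrow> norm (Df p) \<le> Cg"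
    using compact_imp_bounded[OF compact_continuous_image[OF DfN N(1)]] unfolding bounded_pos by auto
  have uDf: "uniformly_continuous_on N Df" by (rule compact_uniformly_continuous[OF DfN N(1)])
  have uA': "uniformly_continuous_on {0..1} A'" by (rule compact_uniformly_continuous[OF A'_cont compact_Icc])
  have "e / 2 > 0" using e by simp
  from uA'[unfolded uniformly_continuous_on_def, rule_format, OF this]
  obtain d where d: "d > 0" "\<And>u v. u \<in> {0..1} \<Longrightarrow> v \<in> {0..1} \<Longrightarrow> dist v u < d \<Longrightarrow> dist (A' v) (A' u) < e / 2" by blast
  \<comment> \<open>One half of \<open>e\<close> is left for the level \<xi> and the other for the
    move of \<open>A'\<close> within time \<open>r\<close>. Both points compared in the time
    estimate then lie in one ball of radius \<open>e\<close>, which is convex.\<close>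
  define r where "r = min (e / 2) d"
  have r: "r > 0" "r \<le> e / 2" "r \<le> d" using e d by (auto simp: r_def)
  define gx where "gx t \<xi> = Df (A' t, \<xi>) (0, 1)" for t \<xi>
  have ball: "(A' v, \<xi>) \<in> cball (c u) e" if "u \<in> {0..1}" "v \<in> {0..1}" "\<bar>v - u\<bar> < r" "\<bar>\<xi> - x u\<bar> \<le> r" for u v \<xi>
  proof -
    have "dist (A' v) (A' u) \<le> e / 2" using d(2)[of u v] that r by (simp add: dist_real_def)
    moreover have "dist (c u) (A' v, \<xi>) \<le> dist (A' v) (A' u) + \<bar>\<xi> - x u\<bar>"
      using sqrt_sum_squares_le_sum_abs[of "dist (A' u) (A' v)" "dist (x u) \<xi>"]
      by (simp add: c_def dist_Pair_Pair dist_commute dist_real_def abs_minus_commute)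
    ultimately show ?thesis using that(4) r by simp
  qed
  have inN: "(A' t, \<xi>) \<in> N" if "t \<in> {0..1}" "\<bar>\<xi> - x t\<bar> \<le> r" for t \<xi>
    using ball[of t t \<xi>] that r unfolding N_def by auto
  have g_deriv: "((\<lambda>\<xi>. f (A' t, \<xi>)) has_real_derivative gx t \<xi>) (at \<xi>)" if "(A' t, \<xi>) \<in> U" for t \<xi>
  proof -
    have "blinfun_apply (Df (A' t, \<xi>)) (0, v) = gx t \<xi> * v" for v
      using blinfun.scaleR_right[of "Df (A' t, \<xi>)" v "(0, 1)"] by (simp add: gx_def)
    then show ?thesis
      using has_derivative_slice(2)[OF Df(1)[OF that]] by (simp add: has_field_derivative_def)
  qed
  have "second_solution \<sigma> I M m T x A b cb z (\<lambda>t \<xi>. f (A' t, \<xi>)) gx r Cg z0"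
  proof (rule second_solution.intro[OF ito_equation_axioms], rule second_solution_axioms.intro)
    show "x 0 = 0" "continuous_on {0..1} z" "r > 0" "Cg \<ge> 0" using x0 z r Cg by auto
    show "((\<lambda>\<xi>. f (A' t, \<xi>)) has_real_derivative gx t \<xi>) (at \<xi>)" if "t \<in> {0..1}" "\<bar>\<xi> - x t\<bar> < r" for t \<xi>
      by (rule g_deriv) (use inN[of t \<xi>] that N in auto)
    show "\<bar>f (A' v, \<xi>) - f (A' u, \<xi>)\<bar> \<le> Cg * (m v - m u)"
      if uv: "0 \<le> u" "u \<le> v" "v \<le> 1" "v - u < r" and \<xi>: "\<bar>\<xi> - x u\<bar> < r" "\<bar>\<xi> - x v\<bar> < r" for u v \<xi>
    proof -
      have "c u \<in> c ` {0..1}" using uv by (intro imageI) simp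
      then have sub: "cball (c u) e \<subseteq> N" unfolding N_def by (rule UN_upper)
      have "norm (f (A' v, \<xi>) - f (A' u, \<xi>)) \<le> Cg * norm ((A' v, \<xi>) - (A' u, \<xi>))"
      proof (rule differentiable_bound[OF convex_cball])
        show "(f has_derivative blinfun_apply (Df p)) (at p within cball (c u) e)" if "p \<in> cball (c u) e" for p
          by (rule has_derivative_at_withinI[OF Df(1)[OF subsetD[OF N(2) subsetD[OF sub that]]]])
        show "onorm (blinfun_apply (Df p)) \<le> Cg" if "p \<in> cball (c u) e" for p
          using Cg(2)[OF subsetD[OF sub that]] unfolding norm_blinfun.rep_eq .
        show "(A' v, \<xi>) \<in> cball (c u) e" "(A' u, \<xi>) \<in> cball (c u) e"
          using ball[of u v \<xi>] ball[of u u \<xi>] uv \<xi> r by auto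
      qed
      also have "\<dots> = Cg * norm (A' v - A' u)" by (simp add: norm_Pair)
      also have "\<dots> \<le> Cg * (m v - m u)" using A'[OF uv(1-3)] Cg(1) by (intro mult_left_mono) auto
      finally show ?thesis by simp
    qed
    show "\<exists>\<delta>>0. \<forall>u v \<xi> \<xi>'. u \<in> {0..1} \<longrightarrow> v \<in> {0..1} \<longrightarrow> \<bar>\<xi> - x u\<bar> < r \<longrightarrow> \<bar>\<xi>' - x v\<bar> < r \<longrightarrow>
        \<bar>u - v\<bar> < \<delta> \<longrightarrow> \<bar>\<xi> - \<xi>'\<bar> < \<delta> \<longrightarrow> \<bar>gx u \<xi> - gx v \<xi>'\<bar> < \<epsilon>" if "\<epsilon> > 0" for \<epsilon>
    proof -
      from uDf[unfolded uniformly_continuous_on_def, rule_format, OF that]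
      obtain d1 where d1: "d1 > 0" "\<And>p q. p \<in> N \<Longrightarrow> q \<in> N \<Longrightarrow> dist q p < d1 \<Longrightarrow> dist (Df q) (Df p) < \<epsilon>" by blast
      then have "d1 / 2 > 0" by simp
      from uA'[unfolded uniformly_continuous_on_def, rule_format, OF this]
      obtain d2 where d2: "d2 > 0" "\<And>u v. u \<in> {0..1} \<Longrightarrow> v \<in> {0..1} \<Longrightarrow> dist v u < d2 \<Longrightarrow> dist (A' v) (A' u) < d1 / 2" by blast
      show ?thesis
      proof (intro exI[of _ "min d2 (d1 / 2)"] conjI allI impI)
        fix u v \<xi> \<xi>'
        assume h: "u \<in> {0..1}" "v \<in> {0..1}" "\<bar>\<xi> - x u\<bar> < r" "\<bar>\<xi>' - x v\<bar> < r"
          "\<bar>u - v\<bar> < min d2 (d1 / 2)" "\<bar>\<xi> - \<xi>'\<bar> < min d2 (d1 / 2)"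
        have "dist (A' u) (A' v) < d1 / 2" using d2(2)[of v u] h by (simp add: dist_real_def)
        moreover have "dist (A' u, \<xi>) (A' v, \<xi>') \<le> dist (A' u) (A' v) + \<bar>\<xi> - \<xi>'\<bar>"
          using sqrt_sum_squares_le_sum_abs[of "dist (A' u) (A' v)" "dist \<xi> \<xi>'"] by (simp add: dist_Pair_Pair dist_real_def)
        ultimately have "dist (A' u, \<xi>) (A' v, \<xi>') < d1" using h by simp
        then have "norm (Df (A' u, \<xi>) - Df (A' v, \<xi>')) < \<epsilon>"
          using d1(2)[of "(A' v, \<xi>')" "(A' u, \<xi>)"] inN h by (simp add: dist_norm)
        moreover have "\<bar>gx u \<xi> - gx v \<xi>'\<bar> \<le> norm (Df (A' u, \<xi>) - Df (A' v, \<xi>'))"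
          using norm_blinfun[of "Df (A' u, \<xi>) - Df (A' v, \<xi>')" "(0, 1)"]
          by (simp add: gx_def blinfun.diff_left norm_Pair)
        ultimately show "\<bar>gx u \<xi> - gx v \<xi>'\<bar> < \<epsilon>" by simp
      qed (use d1 d2 in auto)
    qed
    show "\<exists>K. \<forall>\<xi> \<xi>'. \<bar>\<xi> - x t\<bar> < r \<longrightarrow> \<bar>\<xi>' - x t\<bar> < r \<longrightarrow> \<bar>gx t \<xi> - gx t \<xi>'\<bar> \<le> K * \<bar>\<xi> - \<xi>'\<bar>" if t: "t \<in> {0..1}" for t
    proof -
      let ?V = "{\<xi>. (A' t, \<xi>) \<in> U}" and ?B = "cball (x t) r"
      have "A' t \<in> fst ` U" using U(2)[OF t] by force
      from C2_onE[OF f(2)[OF this]] obtain G where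
        G: "\<And>\<xi>. \<xi> \<in> ?V \<Longrightarrow> ((\<lambda>\<xi>. f (A' t, \<xi>)) has_derivative blinfun_apply (G \<xi>)) (at \<xi>)"
          "\<And>v. C1_on ?V (\<lambda>\<xi>. G \<xi> v)" by metis
      obtain H where H: "\<And>\<xi>. \<xi> \<in> ?V \<Longrightarrow> ((\<lambda>\<xi>. G \<xi> 1) has_derivative blinfun_apply (H \<xi>)) (at \<xi>)" "continuous_on ?V H"
        using C1_onE[OF G(2)] by metis
      have BV: "?B \<subseteq> ?V" using inN[OF t] N by (auto simp: dist_real_def abs_minus_commute)
      have gG: "gx t \<xi> = G \<xi> 1" if "\<xi> \<in> ?V" for \<xi>
      proof -
        have "((\<lambda>\<xi>. f (A' t, \<xi>)) has_derivative (*) (gx t \<xi>)) (at \<xi>)"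
          using g_deriv[of t \<xi>] that by (simp add: has_field_derivative_def)
        from has_derivative_unique[OF this G(1)[OF that]] have "gx t \<xi> * 1 = G \<xi> 1" by metis
        then show ?thesis by simp
      qed
      obtain K where K: "\<And>\<xi>. \<xi> \<in> ?B \<Longrightarrow> norm (H \<xi>) \<le> K"
        using compact_imp_bounded[OF compact_continuous_image[OF continuous_on_subset[OF H(2) BV] compact_cball]]
        unfolding bounded_iff by blast
      show ?thesis
      proof (intro exI[of _ K] allI impI)
        fix \<xi> \<xi>' assume h: "\<bar>\<xi> - x t\<bar> < r" "\<bar>\<xi>' - x t\<bar> < r"
        then have B: "\<xi> \<in> ?B" "\<xi>' \<in> ?B" by (auto simp: dist_real_def abs_minus_commute)
        have "norm (G \<xi> 1 - G \<xi>' 1) \<le> K * norm (\<xi> - \<xi>')"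
        proof (rule differentiable_bound[OF convex_cball])
          show "((\<lambda>\<xi>. G \<xi> 1) has_derivative blinfun_apply (H y)) (at y within ?B)" if "y \<in> ?B" for y
            by (rule has_derivative_at_withinI[OF H(1)]) (use BV that in auto)
          show "onorm (blinfun_apply (H y)) \<le> K" if "y \<in> ?B" for y
            using K[OF that] unfolding norm_blinfun.rep_eq .
        qed (rule B)+
        moreover have "gx t \<xi> = G \<xi> 1" "gx t \<xi>' = G \<xi>' 1" using B BV by (auto intro!: gG)
        ultimately show "\<bar>gx t \<xi> - gx t \<xi>'\<bar> \<le> K * \<bar>\<xi> - \<xi>'\<bar>" by simp
      qed
    qed
    show "gx t (x t) = \<sigma> t (z t)" if "t \<in> {0..1}" for t
      using DERIV_imp_deriv[OF g_deriv[OF U(2)[OF that]]] eta[OF that] by simp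
    show "continuous_on {0..1} (\<lambda>t. f (A' t, x t))"
      using continuous_on_compose2[OF C1_on_imp_continuous_on[OF f(1)] c cU] by (simp add: c_def)
    show "(\<lambda>n. foellmer_sum (T n) (\<lambda>s. \<sigma> s (z s)) x t) \<longlonglongrightarrow> z t - z0 - SI (\<lambda>s. b s (z s)) A t" if "t \<in> {0..1}" for t
      by (rule sol[OF that])
  qed
  then show ?thesis by (intro exI)
qed

theorem is_solution_unique:
  fixes A' :: "real \<Rightarrow> real^'n::finite" and f :: "(real^'n) \<times> real \<Rightarrow> real"
  assumes x0: "x 0 = 0" and z: "is_solution TYPE('n) T x A \<sigma> b z0 z" and B: "B_equation T x A b fl z0 B" and t: "t \<in> {0..1}"
    and A': "continuous_on {0..1} A'" "\<And>u v. 0 \<le> u \<Longrightarrow> u \<le> v \<Longrightarrow> v \<le> 1 \<Longrightarrow> norm (A' v - A' u) \<le> m v - m u"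
    and U: "open U" "\<And>t. t \<in> {0..1} \<Longrightarrow> (A' t, x t) \<in> U"
    and f: "C1_on U f" "\<And>a. a \<in> fst ` U \<Longrightarrow> C2_on {\<xi>. (a, \<xi>) \<in> U} (\<lambda>\<xi>. f (a, \<xi>))"
    and eta: "\<And>t. t \<in> {0..1} \<Longrightarrow> \<sigma> t (z t) = deriv (\<lambda>\<xi>. f (A' t, \<xi>)) (x t)"
  shows "z t = fl t (B t) (x t)"
proof -
  have zc: "continuous_on {0..1} z" using z by (simp add: is_solution_def)
  have "continuous_on {0..1} (\<lambda>s. b s (z s))" by (rule continuous_on_b[OF continuous_on_id zc])
  note RS = has_RS_SI[OF this A_lipm]
  have "(\<lambda>n. foellmer_sum (T n) (\<lambda>s. \<sigma> s (z s)) x t) \<longlonglongrightarrow> z t - z0 - SI (\<lambda>s. b s (z s)) A t" if t: "t \<in> {0..1}" for t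
  proof -
    from z t obtain K J where K: "(\<lambda>n. foellmer_sum (T n) (\<lambda>s. \<sigma> s (z s)) x t) \<longlonglongrightarrow> K"
      and J: "has_RS_integral (\<lambda>s. b s (z s)) A 0 t J" "z t = z0 + K + J" unfolding is_solution_def by blast
    have "K = z t - z0 - SI (\<lambda>s. b s (z s)) A t" using RS[of t J] J t by simp
    with K show ?thesis by simp
  qed
  from second_solution_exists[OF x0 zc A' U f eta this] obtain gg gx r Cg
    where "second_solution \<sigma> I M m T x A b cb z gg gx r Cg z0" by auto
  then show ?thesis by (rule second_solution.solution_unique) (rule B t)+
qed

end

theorem theorem2p12:
  fixes T :: "nat \<Rightarrow> real set" and x A :: "real \<Rightarrow> real"
    and b \<sigma> :: "real \<Rightarrow> real \<Rightarrow> real" and I :: "real set"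
  assumes T: "refining_sequence T"
    and x_cont: "continuous_on {0..1} x" and x0: "x 0 = 0"
    and x_qv: "has_cont_quadvar T x"
    and A: "CBV01 A"
    and b_cont: "continuous_on ({0..1} \<times> UNIV) (\<lambda>(t, \<xi>). b t \<xi>)"
    and b_lip: "\<forall>p>0. \<exists>L\<ge>0. \<forall>t\<in>{0..1}. \<forall>\<xi> \<zeta>. \<bar>\<xi>\<bar> \<le> p \<longrightarrow> \<bar>\<zeta>\<bar> \<le> p \<longrightarrow>
                  \<bar>b t \<xi> - b t \<zeta>\<bar> \<le> L * \<bar>\<xi> - \<zeta>\<bar>"
    and b_growth: "\<exists>c\<ge>0. \<forall>t\<in>{0..1}. \<forall>\<xi>. \<bar>b t \<xi>\<bar> \<le> c * (1 + \<bar>\<xi>\<bar>)"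
    and I: "open I" "is_interval I" "{0..1} \<subseteq> I"
    and \<sigma>_C2: "C2_on (I \<times> UNIV) (\<lambda>(t, \<xi>). \<sigma> t \<xi>)"
    and \<sigma>_bdd: "\<exists>M. \<forall>t\<in>I. \<forall>\<xi>. \<bar>deriv (\<lambda>s. \<sigma> s \<xi>) t\<bar> \<le> M \<and> \<bar>deriv (\<sigma> t) \<xi>\<bar> \<le> M"
  shows "\<exists>\<phi> :: real \<Rightarrow> real \<Rightarrow> real \<Rightarrow> real.
     \<comment> \<open>(i) the flow is well defined on I \<times> R \<times> R\<close>
     (\<forall>\<tau>\<in>I. \<forall>\<xi>. \<phi> \<tau> \<xi> 0 = \<xi> \<and>
         (\<forall>t. (\<phi> \<tau> \<xi> has_real_derivative \<sigma> \<tau> (\<phi> \<tau> \<xi> t)) (at t))) \<and>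
     (\<forall>\<tau>\<in>I. \<forall>\<xi>. \<forall>y :: real \<Rightarrow> real. y 0 = \<xi> \<and>
         (\<forall>t. (y has_real_derivative \<sigma> \<tau> (y t)) (at t)) \<longrightarrow> y = \<phi> \<tau> \<xi>) \<and>
     \<comment> \<open>(ii) \<phi> and \<phi>_t are C^2\<close>
     C2_on (I \<times> UNIV \<times> UNIV) (\<lambda>(\<tau>, \<xi>, t). \<phi> \<tau> \<xi> t) \<and>
     C2_on (I \<times> UNIV \<times> UNIV) (\<lambda>(\<tau>, \<xi>, t). deriv (\<phi> \<tau> \<xi>) t) \<and>
     \<comment> \<open>(iii) unique continuous solution of the integral equation\<close>
     (\<forall>z0. \<exists>B. B_equation T x A b \<phi> z0 B \<and>
         (\<forall>B'. B_equation T x A b \<phi> z0 B' \<longrightarrow> (\<forall>t\<in>{0..1}. B' t = B t))) \<and>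
     \<comment> \<open>(iv) z(t) = \<phi>(t, B(t), x(t)) is the unique solution of the Ito equation\<close>
     (\<forall>z0 B. B_equation T x A b \<phi> z0 B \<longrightarrow>
         is_solution TYPE(2) T x A \<sigma> b z0 (\<lambda>t. \<phi> t (B t) (x t)) \<and>
         (\<forall>z'. is_solution TYPE('n::finite) T x A \<sigma> b z0 z' \<longrightarrow>
               (\<forall>t\<in>{0..1}. z' t = \<phi> t (B t) (x t))))"
  proof -
  obtain M where M: "\<forall>t\<in>I. \<forall>\<xi>. \<bar>deriv (\<lambda>s. \<sigma> s \<xi>) t\<bar> \<le> M \<and> \<bar>deriv (\<sigma> t) \<xi>\<bar> \<le> M" using \<sigma>_bdd by blast
  obtain cb where cb: "cb \<ge> 0" "\<forall>t\<in>{0..1}. \<forall>\<xi>. \<bar>b t \<xi>\<bar> \<le> cb * (1 + \<bar>\<xi>\<bar>)" using b_growth by blast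
  have "0 \<in> I" using I(3) by (rule subsetD) simp
  then have "\<bar>deriv (\<sigma> 0) 0\<bar> \<le> M" using M by blast
  then have "0 \<le> M" by linarith
  have field: "flow_field \<sigma> I M"
    by unfold_locales (use I \<sigma>_C2 M \<open>0 \<le> M\<close> in \<open>auto simp: case_prod_unfold\<close>)
  interpret F: flow_field \<sigma> I M by (rule field)
  have eq: "ito_equation \<sigma> I M m T x A b cb"
    if "clock m" "clock.lipm m A" "clock.lipm m (quadvar T x)" for m
    by (intro ito_equation.intro ito_flow.intro partition_clock.intro partition_clock_axioms.intro
        ito_flow_axioms.intro ito_equation_axioms.intro field that T x_cont x_qv I(3))
      (use b_cont b_lip cb in \<open>auto simp: case_prod_unfold\<close>)
  \<comment> \<open>For existence there is no competing solution and hence no parameter curve; the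
    one-dimensional curve with component \<open>A\<close> takes its place in the construction of a
    clock.\<close>
  have "CBV01 (\<lambda>t. (\<chi> i. A t) $ i)" for i :: 1 using A by simp
  from clock_exists[OF T x_qv A this] obtain m0 where "clock m0" "clock.lipm m0 A" "clock.lipm m0 (quadvar T x)" by metis
  then interpret E: ito_equation \<sigma> I M m0 T x A b cb by (rule eq)
  have unique: "z' t = F.fl t (B t) (x t)"
    if B: "B_equation T x A b F.fl z0 B" and z': "is_solution TYPE('n) T x A \<sigma> b z0 z'" and t: "t \<in> {0..1}" for z0 B z' t
  proof -
    have "admissible_integrand TYPE('n) x (\<lambda>t. \<sigma> t (z' t))" using z' by (simp add: is_solution_def)
    then obtain A' :: "real \<Rightarrow> real^'n" and U f where adm: "continuous_on {0..1} A'" "\<forall>i. CBV01 (\<lambda>t. A' t $ i)"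
      "open U" "\<forall>t\<in>{0..1}. (A' t, x t) \<in> U" "C1_on U f"
      "\<forall>a\<in>fst ` U. C2_on {\<xi>. (a, \<xi>) \<in> U} (\<lambda>\<xi>. f (a, \<xi>))"
      "\<forall>t\<in>{0..1}. \<sigma> t (z' t) = deriv (\<lambda>\<xi>. f (A' t, \<xi>)) (x t)"
      unfolding admissible_integrand_def by (elim exE conjE) (rule that)
    \<comment> \<open>A new clock that dominates the parameter curve of this particular
      \<open>z'\<close>. Neither \<open>B_equation\<close> nor the flow mentions a clock, so the
      assumption on \<open>B\<close> carries over unchanged.\<close>
    from clock_exists[OF T x_qv A adm(2)[rule_format]] obtain m where m: "clock m" "clock.lipm m A" "clock.lipm m (quadvar T x)"
      "\<And>u v. 0 \<le> u \<Longrightarrow> u \<le> v \<Longrightarrow> v \<le> 1 \<Longrightarrow> norm (A' v - A' u) \<le> m v - m u" by metis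
    show ?thesis
      by (rule ito_equation.is_solution_unique[OF eq[OF m(1-3)] x0 z' B t adm(1) m(4) adm(3) adm(4)[rule_format] adm(5)
            adm(6)[rule_format] adm(7)[rule_format]])
  qed
  show ?thesis
  proof (intro exI[of _ F.fl] conjI ballI allI impI)
    show "\<exists>B. B_equation T x A b F.fl z0 B \<and> (\<forall>B'. B_equation T x A b F.fl z0 B' \<longrightarrow> (\<forall>t\<in>{0..1}. B' t = B t))" for z0
      using E.B_equation_exists_unique by metis
    show "y = F.fl \<tau> \<xi>" if "\<tau> \<in> I" "y 0 = \<xi> \<and> (\<forall>t. (y has_real_derivative \<sigma> \<tau> (y t)) (at t))" for \<tau> \<xi> y
      using F.fl_unique that by blast
  qed (use F.fl_0 F.fl_deriv F.fl_C2 F.deriv_fl_C2 E.is_solution_fl[OF x0] unique in auto)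
qed

end
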